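(* Let $F$ be a field, let $K$ be a Galois $C_n$-algebra over $F$ of dimension $n$ with ${\rm Aut}_F(K)=\langle\sigma\rangle$, $\sigma$ of order $n$, and let $d\in K^\times$. (i) Every nonassociative cyclic algebra $(K/F,\sigma,d)$ over $F$ is $K$-semiassociative of degree $n$, and thus semiassociative. (ii) Let $d\in K\setminus F$. Then $(K/F,\sigma,d)$ is split if and only if $K=F^n$. (iii) $(K/F,\sigma,d)\otimes_F K$ splits. (iv) Let $K/F$ be a cyclic Galois field extension of degree $n$. Then $(K/F,\sigma,d)$ is a division algebra for all $d\in K\setminus F$ such that $1,d,\dots,d^{n-1}$ are linearly independent over $F$. If $K/F$ has prime degree, then $(K/F,\sigma,d)$ is a division algebra for all $d\in K\setminus F$. (v) Let $K/F$ be a cyclic Galois field extension. Then for all $d\in K\setminus F$, the algebra $A=(K/F,\sigma,d)$ is not semicentral, ${\rm Nuc}(A)/J({\rm Nuc}(A))=K$, and $A$ is not homogeneous.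
   Context: Algebras are unital and not necessarily associative. For an algebra $A$ put $[x,y,z]=(xy)z-x(yz)$; the nucleus ${\rm Nuc}(A)$ is the set of $x\in A$ with $[x,A,A]=[A,x,A]=[A,A,x]=0$. $J(\cdot)$ is the radical of an associative algebra. An algebra $A\neq 0$ is a division algebra if for every nonzero $a\in A$ the left and right multiplications by $a$ are bijective. An étale $F$-algebra is a finite direct product of finite separable field extensions of $F$. A Galois $C_n$-algebra over $F$ is an $n$-dimensional étale $F$-algebra with an action of a cyclic group $C_n$ of $F$-automorphisms whose fixed ring is $F$. In (ii), $K=F^n$ is meant up to isomorphism of $F$-algebras. $K[t;\sigma]$ is the skew polynomial ring with $ta=\sigma(a)t$. For $d\in K^\times$, the nonassociative cyclic algebra $(K/F,\sigma,d)$ is $K[t;\sigma]/K[t;\sigma]f$ with $f=t^n-d$: its underlying additive group is $\{g\in K[t;\sigma]\mid\deg g<n\}$, and the product of $g,h$ is the remainder of $gh$ after right division by $f$ (the unique $r$, $\deg r<n$, with $gh=qf+r$). A finite-dimensional $F$-central nonassociative algebra $A$ is $E$-semiassociative if $E$ is an étale $F$-subalgebra of ${\rm Nuc}(A)$ such that $A$ is cyclic and faithful as an $E\otimes_FE$-module via $(e\otimes e')a=eae'$. $A$ is semiassociative if it is $E$-semiassociative for some $E$; then $\dim_FA$ is a square and its square root is the degree of $A$. A skew set of degree $n$ is a tensor $c=(c_{ijk})$ of scalars; it is reduced if $c_{iij}=c_{jii}=1$ for all $i,j$. For a reduced skew set $c$, the skew matrix algebra $M_n(F;c)$ has basis $e_{ij}$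 ($1\le i,j\le n$) and multiplication $e_{ij}e_{kl}=\delta_{jk}c_{ijl}e_{il}$. A semiassociative algebra is split (or splits) if it is isomorphic to a skew matrix algebra over its base; in (iii), $(K/F,\sigma,d)\otimes_FK$ is regarded over $K$ and skew matrix algebras over $K$ are defined by the same formulas with scalars from $K$. The atoms of a semiassociative $A$ are the simple components of ${\rm Nuc}(A)/J({\rm Nuc}(A))$. $A$ is semicentral if all its atoms are $F$-central, and homogeneous if it is semicentral and all its atoms are Brauer equivalent to each other. *)

theory Defs
  imports
    "HOL-Algebra.Divisibility"
    "HOL-Algebra.UnivPoly"
    "HOL-Algebra.QuotRing"
    "HOL-Algebra.Free_Abelian_Groups"
    "Jordan_Normal_Form.Missing_VectorSpace"
    "HOL-Computational_Algebra.Primes"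
begin

text \<open>
  Algebras over a commutative ring \<open>R\<close> are records of type \<^typ>\<open>('a, 'b) module\<close>.  The library
  locale \<^locale>\<open>algebra\<close> is the commutative associative case; the locale below drops both
  requirements.
\<close>

section \<open>Nonassociative algebras\<close>

locale nonassoc_algebra = module R A for R and A (structure) +
  assumes mult_closed: "\<lbrakk>x \<in> carrier A; y \<in> carrier A\<rbrakk> \<Longrightarrow> x \<otimes> y \<in> carrier A"
    and unit_closed: "\<one> \<in> carrier A"
    and unit_left: "x \<in> carrier A \<Longrightarrow> \<one> \<otimes> x = x"
    and unit_right: "x \<in> carrier A \<Longrightarrow> x \<otimes> \<one> = x"
    and distrib_right:
      "\<lbrakk>x \<in> carrier A; y \<in> carrier A; z \<in> carrier A\<rbrakk> \<Longrightarrow> (x \<oplus> y) \<otimes> z = x \<otimes> z \<oplus> y \<otimes> z"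
    and distrib_left:
      "\<lbrakk>x \<in> carrier A; y \<in> carrier A; z \<in> carrier A\<rbrakk> \<Longrightarrow> z \<otimes> (x \<oplus> y) = z \<otimes> x \<oplus> z \<otimes> y"
    and smult_left:
      "\<lbrakk>a \<in> carrier R; x \<in> carrier A; y \<in> carrier A\<rbrakk> \<Longrightarrow> (a \<odot> x) \<otimes> y = a \<odot> (x \<otimes> y)"
    and smult_right:
      "\<lbrakk>a \<in> carrier R; x \<in> carrier A; y \<in> carrier A\<rbrakk> \<Longrightarrow> x \<otimes> (a \<odot> y) = a \<odot> (x \<otimes> y)"

definition scalars :: "('a, 'm) ring_scheme \<Rightarrow> ('a, 'b, 'p) module_scheme \<Rightarrow> 'b set" where
  "scalars R A = (\<lambda>a. a \<odot>\<^bsub>A\<^esub> \<one>\<^bsub>A\<^esub>) ` carrier R"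

text \<open>\<^const>\<open>ring_iso\<close> does not presuppose associativity of the multiplications.\<close>

definition alg_iso ::
  "('a, 'm) ring_scheme \<Rightarrow> ('a, 'b, 'p) module_scheme \<Rightarrow> ('a, 'c, 'q) module_scheme \<Rightarrow> ('b \<Rightarrow> 'c) set" where
  "alg_iso R A B =
     {h \<in> ring_iso A B. \<forall>a\<in>carrier R. \<forall>x\<in>carrier A. h (a \<odot>\<^bsub>A\<^esub> x) = a \<odot>\<^bsub>B\<^esub> h x}"

definition alg_isomorphic ::
  "('a, 'm) ring_scheme \<Rightarrow> ('a, 'b, 'p) module_scheme \<Rightarrow> ('a, 'c, 'q) module_scheme \<Rightarrow> bool" where
  "alg_isomorphic R A B \<longleftrightarrow> alg_iso R A B \<noteq> {}"

definition associator :: "('b, 'm) ring_scheme \<Rightarrow> 'b \<Rightarrow> 'b \<Rightarrow> 'b \<Rightarrow> 'b" where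
  "associator A x y z = ((x \<otimes>\<^bsub>A\<^esub> y) \<otimes>\<^bsub>A\<^esub> z) \<ominus>\<^bsub>A\<^esub> (x \<otimes>\<^bsub>A\<^esub> (y \<otimes>\<^bsub>A\<^esub> z))"

definition nucleus :: "('b, 'm) ring_scheme \<Rightarrow> 'b set" where
  "nucleus A = {x \<in> carrier A. \<forall>y\<in>carrier A. \<forall>z\<in>carrier A.
     associator A x y z = \<zero>\<^bsub>A\<^esub> \<and> associator A y x z = \<zero>\<^bsub>A\<^esub> \<and> associator A y z x = \<zero>\<^bsub>A\<^esub>}"

definition center :: "('b, 'm) ring_scheme \<Rightarrow> 'b set" where
  "center A = {x \<in> nucleus A. \<forall>y\<in>carrier A. x \<otimes>\<^bsub>A\<^esub> y = y \<otimes>\<^bsub>A\<^esub> x}"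

definition central :: "('a, 'm) ring_scheme \<Rightarrow> ('a, 'b, 'p) module_scheme \<Rightarrow> bool" where
  "central F A \<longleftrightarrow> \<one>\<^bsub>A\<^esub> \<noteq> \<zero>\<^bsub>A\<^esub> \<and> center A = scalars F A"

definition division_algebra :: "('b, 'm) ring_scheme \<Rightarrow> bool" where
  "division_algebra A \<longleftrightarrow> carrier A \<noteq> {\<zero>\<^bsub>A\<^esub>} \<and>
     (\<forall>a\<in>carrier A - {\<zero>\<^bsub>A\<^esub>}.
        bij_betw (\<lambda>x. a \<otimes>\<^bsub>A\<^esub> x) (carrier A) (carrier A) \<and>
        bij_betw (\<lambda>x. x \<otimes>\<^bsub>A\<^esub> a) (carrier A) (carrier A))"


section \<open>Etale algebras and Galois algebras\<close>

definition prod_algebra :: "nat \<Rightarrow> (nat \<Rightarrow> ('a, 'b) module) \<Rightarrow> ('a, nat \<Rightarrow> 'b) module" where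
  "prod_algebra r L =
     \<lparr>carrier = (\<Pi>\<^sub>E i\<in>{..<r}. carrier (L i)),
      monoid.mult = (\<lambda>x y. \<lambda>i\<in>{..<r}. x i \<otimes>\<^bsub>L i\<^esub> y i),
      one = (\<lambda>i\<in>{..<r}. \<one>\<^bsub>L i\<^esub>),
      ring.zero = (\<lambda>i\<in>{..<r}. \<zero>\<^bsub>L i\<^esub>),
      add = (\<lambda>x y. \<lambda>i\<in>{..<r}. x i \<oplus>\<^bsub>L i\<^esub> y i),
      smult = (\<lambda>a x. \<lambda>i\<in>{..<r}. a \<odot>\<^bsub>L i\<^esub> x i)\<rparr>"

definition self_algebra :: "('a, 'm) ring_scheme \<Rightarrow> ('a, 'a) module" where
  "self_algebra R =
     \<lparr>carrier = carrier R, monoid.mult = monoid.mult R, one = one R,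
      ring.zero = ring.zero R, add = add R, smult = monoid.mult R\<rparr>"

definition poly_deriv :: "('a, 'm) ring_scheme \<Rightarrow> (nat \<Rightarrow> 'a) \<Rightarrow> nat \<Rightarrow> 'a" where
  "poly_deriv F p = (\<lambda>i. [Suc i] \<cdot>\<^bsub>F\<^esub> p (Suc i))"

definition separable_poly :: "('a, 'm) ring_scheme \<Rightarrow> (nat \<Rightarrow> 'a) \<Rightarrow> bool" where
  "separable_poly F p \<longleftrightarrow>
     (\<exists>u\<in>carrier (UP F). \<exists>v\<in>carrier (UP F).
        u \<otimes>\<^bsub>UP F\<^esub> p \<oplus>\<^bsub>UP F\<^esub> v \<otimes>\<^bsub>UP F\<^esub> poly_deriv F p = \<one>\<^bsub>UP F\<^esub>)"

text \<open>The polynomial \<open>p\<close> below is the minimal polynomial of \<open>x\<close> over \<open>F\<close>.\<close>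

definition separable_element ::
  "('a, 'm) ring_scheme \<Rightarrow> ('a, 'b, 'p) module_scheme \<Rightarrow> 'b \<Rightarrow> bool" where
  "separable_element F L x \<longleftrightarrow>
     (\<exists>p\<in>carrier (UP F). Divisibility.irreducible (UP F) p \<and> p (deg F p) = \<one>\<^bsub>F\<^esub> \<and>
        UnivPoly.eval F L (\<lambda>a. a \<odot>\<^bsub>L\<^esub> \<one>\<^bsub>L\<^esub>) x p = \<zero>\<^bsub>L\<^esub> \<and> separable_poly F p)"

definition finite_separable_field_extension ::
  "('a, 'm) ring_scheme \<Rightarrow> ('a, 'b, 'p) module_scheme \<Rightarrow> bool" where
  "finite_separable_field_extension F L \<longleftrightarrow>
     algebra F L \<and> field L \<and> vectorspace.fin_dim F L \<and> (\<forall>x\<in>carrier L. separable_element F L x)"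

text \<open>
  Each factor of a finite product embeds into the product, so requiring the factors to live on
  the element type of \<open>E\<close> is no restriction.
\<close>

definition etale_algebra :: "('a, 'm) ring_scheme \<Rightarrow> ('a, 'b, 'p) module_scheme \<Rightarrow> bool" where
  "etale_algebra F E \<longleftrightarrow> algebra F E \<and>
     (\<exists>r (L :: nat \<Rightarrow> ('a, 'b) module).
        (\<forall>i<r. finite_separable_field_extension F (L i)) \<and> alg_isomorphic F E (prod_algebra r L))"

text \<open>
  The group acting on \<open>K\<close> is the cyclic group generated by the automorphism \<open>\<sigma>\<close> of order \<open>n\<close>;
  its fixed ring consists of the fixed points of \<open>\<sigma>\<close>.  It is the full automorphism group of \<open>K\<close>
  when \<open>K\<close> is a field, but in general not when \<open>K\<close> has zero divisors (for example \<open>F\<^sup>n\<close>, \<open>n \<ge> 3\<close>).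
\<close>

definition galois_cyclic_algebra ::
  "('a, 'm) ring_scheme \<Rightarrow> ('a, 'b, 'p) module_scheme \<Rightarrow> ('b \<Rightarrow> 'b) \<Rightarrow> nat \<Rightarrow> bool" where
  "galois_cyclic_algebra F K \<sigma> n \<longleftrightarrow>
     etale_algebra F K \<and> vectorspace.dim F K = n \<and>
     \<sigma> \<in> alg_iso F K K \<and>
     0 < n \<and> (\<forall>x\<in>carrier K. (\<sigma> ^^ n) x = x) \<and>
     (\<forall>m. 0 < m \<and> m < n \<longrightarrow> (\<exists>x\<in>carrier K. (\<sigma> ^^ m) x \<noteq> x)) \<and>
     {x \<in> carrier K. \<sigma> x = x} = scalars F K"


section \<open>Skew polynomials and nonassociative cyclic algebras\<close>

text \<open>
  Coefficients are written on the left, as in \<^const>\<open>UP\<close>: \<open>p\<close> stands for the sum of the \<open>p i t\<^sup>i\<close>,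
  and \<open>t a = \<sigma>(a) t\<close> gives \<open>a t\<^sup>i b t\<^sup>j = a \<sigma>\<^sup>i(b) t\<^sup>i\<^sup>+\<^sup>j\<close>.
\<close>

definition skew_poly_ring :: "('b, 'm) ring_scheme \<Rightarrow> ('b \<Rightarrow> 'b) \<Rightarrow> (nat \<Rightarrow> 'b) ring" where
  "skew_poly_ring K \<sigma> =
     \<lparr>carrier = up K,
      monoid.mult = (\<lambda>p q m. \<Oplus>\<^bsub>K\<^esub>i\<in>{..m}. p i \<otimes>\<^bsub>K\<^esub> (\<sigma> ^^ i) (q (m - i))),
      one = (\<lambda>i. if i = 0 then \<one>\<^bsub>K\<^esub> else \<zero>\<^bsub>K\<^esub>),
      ring.zero = (\<lambda>i. \<zero>\<^bsub>K\<^esub>),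
      add = (\<lambda>p q i. p i \<oplus>\<^bsub>K\<^esub> q i)\<rparr>"

definition skew_monom :: "('b, 'm) ring_scheme \<Rightarrow> 'b \<Rightarrow> nat \<Rightarrow> nat \<Rightarrow> 'b" where
  "skew_monom K a k = (\<lambda>i. if i = k then a else \<zero>\<^bsub>K\<^esub>)"

definition skew_polys_below :: "('b, 'm) ring_scheme \<Rightarrow> nat \<Rightarrow> (nat \<Rightarrow> 'b) set" where
  "skew_polys_below K n = {g \<in> up K. \<forall>i\<ge>n. g i = \<zero>\<^bsub>K\<^esub>}"

definition skew_rem ::
  "('b, 'm) ring_scheme \<Rightarrow> ('b \<Rightarrow> 'b) \<Rightarrow> nat \<Rightarrow> (nat \<Rightarrow> 'b) \<Rightarrow> (nat \<Rightarrow> 'b) \<Rightarrow> nat \<Rightarrow> 'b" where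
  "skew_rem K \<sigma> n f p =
     (THE r. r \<in> skew_polys_below K n \<and>
        (\<exists>q\<in>carrier (skew_poly_ring K \<sigma>).
           p = q \<otimes>\<^bsub>skew_poly_ring K \<sigma>\<^esub> f \<oplus>\<^bsub>skew_poly_ring K \<sigma>\<^esub> r))"

definition nonassoc_cyclic_algebra ::
  "('a, 'b, 'p) module_scheme \<Rightarrow> ('b \<Rightarrow> 'b) \<Rightarrow> nat \<Rightarrow> 'b \<Rightarrow> ('a, nat \<Rightarrow> 'b) module" where
  "nonassoc_cyclic_algebra K \<sigma> n d =
     (let S = skew_poly_ring K \<sigma>;
          f = skew_monom K \<one>\<^bsub>K\<^esub> n \<ominus>\<^bsub>S\<^esub> skew_monom K d 0
      in \<lparr>carrier = skew_polys_below K n,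
          monoid.mult = (\<lambda>g h. skew_rem K \<sigma> n f (g \<otimes>\<^bsub>S\<^esub> h)),
          one = \<one>\<^bsub>S\<^esub>,
          ring.zero = \<zero>\<^bsub>S\<^esub>,
          add = add S,
          smult = (\<lambda>a g i. a \<odot>\<^bsub>K\<^esub> g i)\<rparr>)"

definition const_embed :: "('b, 'm) ring_scheme \<Rightarrow> 'b \<Rightarrow> nat \<Rightarrow> 'b" where
  "const_embed K a = skew_monom K a 0"


section \<open>Tensor products\<close>

text \<open>
  The tensor product of two \<open>F\<close>-modules is the free abelian group on the pairs modulo the
  subgroup generated by the elements expressing biadditivity and \<open>F\<close>-balancedness.
\<close>

definition tensor_relations ::
  "('a, 'm) ring_scheme \<Rightarrow> ('a, 'b, 'p) module_scheme \<Rightarrow> ('a, 'c, 'q) module_scheme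
    \<Rightarrow> ('b \<times> 'c \<Rightarrow>\<^sub>0 int) set" where
  "tensor_relations F M N =
     {frag_of (x \<oplus>\<^bsub>M\<^esub> x', y) - frag_of (x, y) - frag_of (x', y) | x x' y.
        x \<in> carrier M \<and> x' \<in> carrier M \<and> y \<in> carrier N} \<union>
     {frag_of (x, y \<oplus>\<^bsub>N\<^esub> y') - frag_of (x, y) - frag_of (x, y') | x y y'.
        x \<in> carrier M \<and> y \<in> carrier N \<and> y' \<in> carrier N} \<union>
     {frag_of (a \<odot>\<^bsub>M\<^esub> x, y) - frag_of (x, a \<odot>\<^bsub>N\<^esub> y) | a x y.
        a \<in> carrier F \<and> x \<in> carrier M \<and> y \<in> carrier N}"

definition tensor_kernel ::
  "('a, 'm) ring_scheme \<Rightarrow> ('a, 'b, 'p) module_scheme \<Rightarrow> ('a, 'c, 'q) module_scheme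
    \<Rightarrow> ('b \<times> 'c \<Rightarrow>\<^sub>0 int) set" where
  "tensor_kernel F M N =
     generate (free_Abelian_group (carrier M \<times> carrier N)) (tensor_relations F M N)"

definition tensor_group ::
  "('a, 'm) ring_scheme \<Rightarrow> ('a, 'b, 'p) module_scheme \<Rightarrow> ('a, 'c, 'q) module_scheme
    \<Rightarrow> ('b \<times> 'c \<Rightarrow>\<^sub>0 int) set monoid" where
  "tensor_group F M N = free_Abelian_group (carrier M \<times> carrier N) Mod tensor_kernel F M N"

definition tensor_class ::
  "('a, 'm) ring_scheme \<Rightarrow> ('a, 'b, 'p) module_scheme \<Rightarrow> ('a, 'c, 'q) module_scheme
    \<Rightarrow> ('b \<times> 'c \<Rightarrow>\<^sub>0 int) \<Rightarrow> ('b \<times> 'c \<Rightarrow>\<^sub>0 int) set" where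
  "tensor_class F M N x =
     tensor_kernel F M N #>\<^bsub>free_Abelian_group (carrier M \<times> carrier N)\<^esub> x"

text \<open>
  The algebra obtained from the \<open>F\<close>-algebra \<open>A\<close> by extending scalars to \<open>K\<close>: the underlying ring
  is the tensor product of \<open>A\<close> and \<open>K\<close> over \<open>F\<close>, and \<open>K\<close> acts through the second factor.
\<close>

definition base_change ::
  "('a, 'm) ring_scheme \<Rightarrow> ('a, 'b, 'p) module_scheme \<Rightarrow> ('a, 'c, 'q) module_scheme
    \<Rightarrow> ('c, ('b \<times> 'c \<Rightarrow>\<^sub>0 int) set) module" where
  "base_change F A K =
     \<lparr>carrier = carrier (tensor_group F A K),
      monoid.mult = (\<lambda>X Y. \<Union>x\<in>X. \<Union>y\<in>Y. tensor_class F A K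
        (frag_extend (\<lambda>(a, k). frag_extend (\<lambda>(b, l). frag_of (a \<otimes>\<^bsub>A\<^esub> b, k \<otimes>\<^bsub>K\<^esub> l)) y) x)),
      one = tensor_class F A K (frag_of (\<one>\<^bsub>A\<^esub>, \<one>\<^bsub>K\<^esub>)),
      ring.zero = \<one>\<^bsub>tensor_group F A K\<^esub>,
      add = monoid.mult (tensor_group F A K),
      smult = (\<lambda>l X. \<Union>x\<in>X. tensor_class F A K
        (frag_extend (\<lambda>(a, k). frag_of (a, l \<otimes>\<^bsub>K\<^esub> k)) x))\<rparr>"


section \<open>Semiassociative algebras\<close>

text \<open>
  The element of the free abelian group on \<open>E \<times> E\<close> with coefficients \<open>k\<^sub>p\<close>, \<open>p = (e, e')\<close>, sends
  \<open>a\<close> to the sum of the \<open>k\<^sub>p e a e'\<close>.  For \<open>E\<close> in the nucleus this depends only on its class.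
\<close>

definition frag_action :: "('b, 'm) ring_scheme \<Rightarrow> ('b \<times> 'b \<Rightarrow>\<^sub>0 int) \<Rightarrow> 'b \<Rightarrow> 'b" where
  "frag_action A x a =
     (\<Oplus>\<^bsub>A\<^esub>p\<in>Poly_Mapping.keys x.
        [Poly_Mapping.lookup x p] \<cdot>\<^bsub>A\<^esub> ((fst p \<otimes>\<^bsub>A\<^esub> a) \<otimes>\<^bsub>A\<^esub> snd p))"

definition tensor_action :: "('b, 'm) ring_scheme \<Rightarrow> ('b \<times> 'b \<Rightarrow>\<^sub>0 int) set \<Rightarrow> 'b \<Rightarrow> 'b" where
  "tensor_action A X a = the_elem ((\<lambda>x. frag_action A x a) ` X)"

definition E_semiassociative ::
  "('a, 'm) ring_scheme \<Rightarrow> ('a, 'b, 'p) module_scheme \<Rightarrow> 'b set \<Rightarrow> bool" where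
  "E_semiassociative F A E \<longleftrightarrow>
     field F \<and> nonassoc_algebra F A \<and> vectorspace.fin_dim F A \<and> central F A \<and>
     E \<subseteq> nucleus A \<and> etale_algebra F (A\<lparr>carrier := E\<rparr>) \<and>
     (let T = tensor_group F (A\<lparr>carrier := E\<rparr>) (A\<lparr>carrier := E\<rparr>) in
        (\<exists>a\<in>carrier A. carrier A = {tensor_action A X a | X. X \<in> carrier T}) \<and>
        (\<forall>X\<in>carrier T. (\<forall>a\<in>carrier A. tensor_action A X a = \<zero>\<^bsub>A\<^esub>) \<longrightarrow> X = \<one>\<^bsub>T\<^esub>))"

definition semiassociative :: "('a, 'm) ring_scheme \<Rightarrow> ('a, 'b, 'p) module_scheme \<Rightarrow> bool" where
  "semiassociative F A \<longleftrightarrow> (\<exists>E. E_semiassociative F A E)"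

definition algebra_degree :: "('a, 'm) ring_scheme \<Rightarrow> ('a, 'b, 'p) module_scheme \<Rightarrow> nat" where
  "algebra_degree F A = (THE m. m\<^sup>2 = vectorspace.dim F A)"


section \<open>Skew matrix algebras\<close>

definition reduced_skew_set ::
  "('a, 'm) ring_scheme \<Rightarrow> nat \<Rightarrow> (nat \<Rightarrow> nat \<Rightarrow> nat \<Rightarrow> 'a) \<Rightarrow> bool" where
  "reduced_skew_set R n c \<longleftrightarrow>
     (\<forall>i<n. \<forall>j<n. \<forall>k<n. c i j k \<in> carrier R) \<and>
     (\<forall>i<n. \<forall>j<n. c i i j = \<one>\<^bsub>R\<^esub> \<and> c j i i = \<one>\<^bsub>R\<^esub>)"

text \<open>
  An element is given by its coordinates with respect to the basis \<open>e\<^sub>i\<^sub>j\<close>, \<open>i, j < n\<close>; the product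
  is the bilinear extension of \<open>e\<^sub>i\<^sub>j e\<^sub>j\<^sub>l = c\<^sub>i\<^sub>j\<^sub>l e\<^sub>i\<^sub>l\<close> and \<open>e\<^sub>i\<^sub>j e\<^sub>k\<^sub>l = 0\<close> for \<open>j \<noteq> k\<close>.
\<close>

definition skew_matrix_algebra ::
  "('a, 'm) ring_scheme \<Rightarrow> nat \<Rightarrow> (nat \<Rightarrow> nat \<Rightarrow> nat \<Rightarrow> 'a) \<Rightarrow> ('a, nat \<times> nat \<Rightarrow> 'a) module" where
  "skew_matrix_algebra R n c =
     \<lparr>carrier = ({..<n} \<times> {..<n}) \<rightarrow>\<^sub>E carrier R,
      monoid.mult = (\<lambda>x y. \<lambda>(i, l)\<in>{..<n} \<times> {..<n}.
        \<Oplus>\<^bsub>R\<^esub>j\<in>{..<n}. c i j l \<otimes>\<^bsub>R\<^esub> (x (i, j) \<otimes>\<^bsub>R\<^esub> y (j, l))),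
      one = (\<lambda>(i, j)\<in>{..<n} \<times> {..<n}. if i = j then \<one>\<^bsub>R\<^esub> else \<zero>\<^bsub>R\<^esub>),
      ring.zero = (\<lambda>p\<in>{..<n} \<times> {..<n}. \<zero>\<^bsub>R\<^esub>),
      add = (\<lambda>x y. \<lambda>p\<in>{..<n} \<times> {..<n}. x p \<oplus>\<^bsub>R\<^esub> y p),
      smult = (\<lambda>a x. \<lambda>p\<in>{..<n} \<times> {..<n}. a \<otimes>\<^bsub>R\<^esub> x p)\<rparr>"

definition split_algebra :: "('a, 'm) ring_scheme \<Rightarrow> ('a, 'b, 'p) module_scheme \<Rightarrow> bool" where
  "split_algebra R A \<longleftrightarrow>
     (\<exists>m c. 0 < m \<and> reduced_skew_set R m c \<and> alg_isomorphic R A (skew_matrix_algebra R m c))"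


section \<open>Atoms\<close>

definition maximal_left_ideal :: "'b set \<Rightarrow> ('b, 'm) ring_scheme \<Rightarrow> bool" where
  "maximal_left_ideal I R \<longleftrightarrow>
     (let left = (\<lambda>J. additive_subgroup J R \<and> (\<forall>x\<in>carrier R. \<forall>a\<in>J. x \<otimes>\<^bsub>R\<^esub> a \<in> J))
      in left I \<and> I \<noteq> carrier R \<and> (\<forall>J. left J \<and> I \<subseteq> J \<longrightarrow> J = I \<or> J = carrier R))"

definition jacobson_radical :: "('b, 'm) ring_scheme \<Rightarrow> 'b set" where
  "jacobson_radical R = carrier R \<inter> \<Inter> {I. maximal_left_ideal I R}"

definition quotient_algebra ::
  "('a, 'b, 'p) module_scheme \<Rightarrow> 'b set \<Rightarrow> ('a, 'b set) module" where
  "quotient_algebra B I =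
     \<lparr>carrier = carrier (B Quot I), monoid.mult = monoid.mult (B Quot I), one = one (B Quot I),
      ring.zero = ring.zero (B Quot I), add = add (B Quot I),
      smult = (\<lambda>a X. \<Union>x\<in>X. I +>\<^bsub>B\<^esub> (a \<odot>\<^bsub>B\<^esub> x))\<rparr>"

text \<open>
  The simple components of a semisimple algebra are its minimal nonzero two-sided ideals.  Each is
  an algebra whose identity element is a central idempotent of the ambient algebra.
\<close>

definition simple_components :: "('a, 'b) module \<Rightarrow> ('a, 'b) module set" where
  "simple_components S =
     {S\<lparr>carrier := I, one := (THE e. e \<in> I \<and> (\<forall>x\<in>I. e \<otimes>\<^bsub>S\<^esub> x = x \<and> x \<otimes>\<^bsub>S\<^esub> e = x))\<rparr> | I.
        ideal I S \<and> I \<noteq> {\<zero>\<^bsub>S\<^esub>} \<and> (\<forall>J. ideal J S \<and> J \<subseteq> I \<longrightarrow> J = {\<zero>\<^bsub>S\<^esub>} \<or> J = I)}"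

definition nucleus_algebra :: "('a, 'b, 'p) module_scheme \<Rightarrow> ('a, 'b, 'p) module_scheme" where
  "nucleus_algebra A = A\<lparr>carrier := nucleus A\<rparr>"

definition nucleus_mod_radical :: "('a, 'b, 'p) module_scheme \<Rightarrow> ('a, 'b set) module" where
  "nucleus_mod_radical A =
     quotient_algebra (nucleus_algebra A) (jacobson_radical (nucleus_algebra A))"

definition atoms :: "('a, 'b, 'p) module_scheme \<Rightarrow> ('a, 'b set) module set" where
  "atoms A = simple_components (nucleus_mod_radical A)"

definition semicentral :: "('a, 'm) ring_scheme \<Rightarrow> ('a, 'b, 'p) module_scheme \<Rightarrow> bool" where
  "semicentral F A \<longleftrightarrow> (\<forall>B\<in>atoms A. central F B)"

definition matrix_algebra ::
  "nat \<Rightarrow> ('a, 'b, 'p) module_scheme \<Rightarrow> ('a, nat \<times> nat \<Rightarrow> 'b) module" where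
  "matrix_algebra r B =
     \<lparr>carrier = ({..<r} \<times> {..<r}) \<rightarrow>\<^sub>E carrier B,
      monoid.mult = (\<lambda>x y. \<lambda>(i, l)\<in>{..<r} \<times> {..<r}. \<Oplus>\<^bsub>B\<^esub>j\<in>{..<r}. x (i, j) \<otimes>\<^bsub>B\<^esub> y (j, l)),
      one = (\<lambda>(i, j)\<in>{..<r} \<times> {..<r}. if i = j then \<one>\<^bsub>B\<^esub> else \<zero>\<^bsub>B\<^esub>),
      ring.zero = (\<lambda>p\<in>{..<r} \<times> {..<r}. \<zero>\<^bsub>B\<^esub>),
      add = (\<lambda>x y. \<lambda>p\<in>{..<r} \<times> {..<r}. x p \<oplus>\<^bsub>B\<^esub> y p),
      smult = (\<lambda>a x. \<lambda>p\<in>{..<r} \<times> {..<r}. a \<odot>\<^bsub>B\<^esub> x p)\<rparr>"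

definition brauer_equivalent ::
  "('a, 'm) ring_scheme \<Rightarrow> ('a, 'b, 'p) module_scheme \<Rightarrow> ('a, 'c, 'q) module_scheme \<Rightarrow> bool" where
  "brauer_equivalent F B C \<longleftrightarrow>
     (\<exists>r s. 0 < r \<and> 0 < s \<and> alg_isomorphic F (matrix_algebra r B) (matrix_algebra s C))"

definition homogeneous :: "('a, 'm) ring_scheme \<Rightarrow> ('a, 'b, 'p) module_scheme \<Rightarrow> bool" where
  "homogeneous F A \<longleftrightarrow>
     semicentral F A \<and> (\<forall>B\<in>atoms A. \<forall>C\<in>atoms A. brauer_equivalent F B C)"


section \<open>Linear independence of powers\<close>

text \<open>Stated for the family rather than for the set of powers, so that repetitions count.\<close>

definition powers_independent ::
  "('a, 'm) ring_scheme \<Rightarrow> ('a, 'b, 'p) module_scheme \<Rightarrow> 'b \<Rightarrow> nat \<Rightarrow> bool" where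
  "powers_independent F K d n \<longleftrightarrow>
     (\<forall>c\<in>{..<n} \<rightarrow> carrier F.
        (\<Oplus>\<^bsub>K\<^esub>i\<in>{..<n}. c i \<odot>\<^bsub>K\<^esub> (d [^]\<^bsub>K\<^esub> i)) = \<zero>\<^bsub>K\<^esub> \<longrightarrow> (\<forall>i<n. c i = \<zero>\<^bsub>F\<^esub>))"

end

theory Submission
  imports Defs
begin

text \<open>
  Write \<open>A\<close> for \<open>(K/F, \<sigma>, d)\<close>.  Its elements are the polynomials of degree below \<open>n\<close> in \<open>t\<close> with left
  coefficients in \<open>K\<close>, and the product is the skew product in which \<open>t\<^sup>m\<^sup>+\<^sup>n\<close> is replaced by
  \<open>\<sigma>\<^sup>m(d) t\<^sup>m\<close> (\<open>skew_rem_eq\<close>).  The algebra \<open>K\<close> may have zero divisors, but it has no proper nonzero ideals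
  stable under \<open>\<sigma>\<close> (\<open>sigma_simple\<close>).  Since \<open>\<sigma>\<close> has order \<open>n\<close>, this yields finite families \<open>u\<^sub>k, v\<^sub>k\<close> in \<open>K\<close>
  such that \<open>\<Sum>\<^sub>k u\<^sub>k \<sigma>\<^sup>i(v\<^sub>k)\<close> is \<open>1\<close> for \<open>i = 0\<close> and \<open>0\<close> for \<open>0 < i < n\<close> (\<open>dual_families\<close>).  They serve in
  place of bases:
  \<open>a = \<Sum>\<^sub>k tr(v\<^sub>k a) u\<^sub>k\<close> for all \<open>a\<close> in \<open>K\<close> (\<open>dual_expansion\<close>).

  Semiassociativity.  Constants are in the nucleus, and \<open>x \<otimes> y\<close> multiplies the coefficient of \<open>t\<^sup>m\<close> by \<open>x \<sigma>\<^sup>m(y)\<close>.  By means of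
  the dual families, \<open>x \<otimes> y \<mapsto> (x \<sigma>\<^sup>m(y))\<^sub>m\<close> is a bijection from the tensor square of \<open>K\<close> to \<open>K\<^sup>n\<close>, so \<open>A\<close> is
  a free module of rank one, generated by \<open>1 + t + \<dots> + t\<^sup>n\<^sup>-\<^sup>1\<close> (\<open>A_E_semiassociative\<close>).

  Splitting over \<open>K\<close>, and over \<open>F\<close> if \<open>K = F\<^sup>n\<close>.  For a homomorphism \<open>\<pi>\<close> from \<open>K\<close> to a commutative ring \<open>R\<close>, the map sending \<open>g\<close> to
  the matrix with entries \<open>\<pi>(\<sigma>\<^sup>-\<^sup>i(g\<^sub>i\<^sub>-\<^sub>j))\<close>, indices modulo \<open>n\<close>, is multiplicative from \<open>A\<close> to a skew matrix
  algebra over \<open>R\<close> (\<open>Phi_mult\<close>).  For the identity of \<open>K\<close>, its \<open>K\<close>-linear extension is an isomorphism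
  (\<open>base_change_split\<close>).  For an \<open>F\<close>-algebra homomorphism from \<open>K\<close> to \<open>F\<close>, which exists if and only if \<open>K\<close> is
  isomorphic to \<open>F\<^sup>n\<close>, the map itself is an isomorphism (\<open>split_if_K_split\<close>).

  The converse for \<open>d\<close> not in \<open>F\<close>.  If \<open>A\<close> is split, then its nucleus \<open>N\<close> contains idempotents with sum \<open>1\<close> whose
  corners are one-dimensional.  The nucleus is graded, and \<open>x t\<^sup>i\<close> is in \<open>N\<close> for \<open>0 < i < n\<close> only if
  \<open>x \<sigma>\<^sup>i\<^sup>-\<^sup>1(\<sigma>(d) - d) = 0\<close> (\<open>nucleus_coeff\<close>).  For a suitable primitive idempotent \<open>\<epsilon>\<close> of \<open>K\<close>, comparison of
  the center of the corner \<open>\<epsilon> N \<epsilon>\<close> with the given idempotents (\<open>corner_center\<close>) shows that \<open>\<epsilon>\<close> is fixed by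
  no \<open>\<sigma>\<^sup>i\<close> with \<open>0 < i < n\<close>.  Then \<open>a \<mapsto> tr(\<epsilon> a)\<close> is a homomorphism from \<open>K\<close> to \<open>F\<close>
  (\<open>split_imp_character\<close>).

  Division algebras.  Let \<open>K\<close> be a field, and let \<open>x a = 0\<close> with \<open>x\<close> of degree \<open>k\<close>.  Left multiplication by \<open>t\<close> is a semilinear
  map of the left vector space \<open>A\<close> over \<open>K\<close>, and \<open>x a\<close> is a combination of \<open>a, t a, t(t a), \<dots>\<close>.  So
  the first \<open>k\<close> of these span an invariant subspace other than \<open>A\<close>.  The \<open>n\<close>-th power of the map scales the
  coefficient of \<open>t\<^sup>m\<close> by \<open>\<sigma>\<^sup>m(d)\<close>; if these scalars are distinct, then \<open>0\<close> is the only such subspace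
  (\<open>shift_simple\<close>) and \<open>a = 0\<close>.  Either hypothesis on \<open>d\<close> implies that they are distinct.

  Atoms.  If \<open>K\<close> is a field and \<open>\<sigma>(d) \<noteq> d\<close>, then \<open>N = K\<close> by the relation above.  Therefore the only atom is \<open>K\<close>,
  which is not central over \<open>F\<close>, as \<open>d\<close> is not a scalar.
\<close>

section \<open>Finite sums\<close>

context abelian_monoid
begin

lemma finsum_in: "(\<And>x. x \<in> A \<Longrightarrow> f x \<in> carrier G) \<Longrightarrow> finsum G f A \<in> carrier G"
  by (auto intro: finsum_closed)

lemma finsum_single:
  assumes "i \<in> A" "finite A" "f i \<in> carrier G" "\<And>j. \<lbrakk>j \<in> A; j \<noteq> i\<rbrakk> \<Longrightarrow> f j = \<zero>"
  shows "finsum G f A = f i"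
proof -
  have c: "f j \<in> carrier G" if "j \<in> A" for j
    using assms(3) assms(4)[of j] that by (cases "j = i") auto
  have "finsum G f A = (\<Oplus>j\<in>A. if i = j then f j else \<zero>)"
    using assms c by (intro finsum_cong') auto
  also have "\<dots> = f i"
    using assms c by (intro finsum_singleton) auto
  finally show ?thesis .
qed

lemma finsum_swap:
  assumes "finite A" "finite B" "\<And>i j. \<lbrakk>i \<in> A; j \<in> B\<rbrakk> \<Longrightarrow> f i j \<in> carrier G"
  shows "(\<Oplus>i\<in>A. \<Oplus>j\<in>B. f i j) = (\<Oplus>j\<in>B. \<Oplus>i\<in>A. f i j)"
  using assms(1,3)
proof (induction A rule: finite_induct)
  case (insert a A)
  have "(\<Oplus>i\<in>insert a A. \<Oplus>j\<in>B. f i j) = (\<Oplus>j\<in>B. f a j) \<oplus> (\<Oplus>i\<in>A. \<Oplus>j\<in>B. f i j)"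
    using insert by (intro finsum_insert) (auto intro!: finsum_closed)
  also have "\<dots> = (\<Oplus>j\<in>B. f a j) \<oplus> (\<Oplus>j\<in>B. \<Oplus>i\<in>A. f i j)"
    using insert by simp
  also have "\<dots> = (\<Oplus>j\<in>B. f a j \<oplus> (\<Oplus>i\<in>A. f i j))"
    using insert by (intro finsum_addf[symmetric]) (auto intro!: finsum_closed)
  also have "\<dots> = (\<Oplus>j\<in>B. \<Oplus>i\<in>insert a A. f i j)"
    using insert by (intro finsum_cong') (auto intro!: finsum_closed simp: Pi_def)
  finally show ?case .
qed (simp add: finsum_zero)

lemma finsum_bij:
  assumes "bij_betw \<phi> A B" "\<And>x. x \<in> B \<Longrightarrow> f x \<in> carrier G"
  shows "(\<Oplus>x\<in>A. f (\<phi> x)) = (\<Oplus>y\<in>B. f y)"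
  using finsum_reindex[of f \<phi> A] assms by (auto simp: bij_betw_def)

lemma finsum_eqI:
  assumes "\<And>x. x \<in> A \<Longrightarrow> f x = g x" "\<And>x. x \<in> A \<Longrightarrow> g x \<in> carrier G"
  shows "finsum G f A = finsum G g A"
  using assms by (intro finsum_cong') auto

lemma finsum_add:
  assumes "\<And>x. x \<in> A \<Longrightarrow> f x \<in> carrier G" "\<And>x. x \<in> A \<Longrightarrow> g x \<in> carrier G"
  shows "(\<Oplus>x\<in>A. f x \<oplus> g x) = finsum G f A \<oplus> finsum G g A"
  using assms by (intro finsum_addf) auto

lemma finsum_map:
  assumes "abelian_monoid H" "finite A" "\<And>x. x \<in> A \<Longrightarrow> f x \<in> carrier G"
    "\<And>x. x \<in> carrier G \<Longrightarrow> \<phi> x \<in> carrier H"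
    "\<phi> \<zero> = \<zero>\<^bsub>H\<^esub>" "\<And>x y. \<lbrakk>x \<in> carrier G; y \<in> carrier G\<rbrakk> \<Longrightarrow> \<phi> (x \<oplus> y) = \<phi> x \<oplus>\<^bsub>H\<^esub> \<phi> y"
  shows "\<phi> (finsum G f A) = (\<Oplus>\<^bsub>H\<^esub>x\<in>A. \<phi> (f x))"
  using assms(2,3)
proof (induction A rule: finite_induct)
  case (insert a A)
  interpret H: abelian_monoid H by fact
  have c: "finsum G f A \<in> carrier G" using insert by (auto intro!: finsum_in)
  have "\<phi> (finsum G f (insert a A)) = \<phi> (f a \<oplus> finsum G f A)"
    using insert by (simp add: Pi_def)
  also have "\<dots> = \<phi> (f a) \<oplus>\<^bsub>H\<^esub> (\<Oplus>\<^bsub>H\<^esub>x\<in>A. \<phi> (f x))"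
    using insert c assms(6) by simp
  also have "\<dots> = (\<Oplus>\<^bsub>H\<^esub>x\<in>insert a A. \<phi> (f x))"
    using insert assms(4) by (intro H.finsum_insert[symmetric]) auto
  finally show ?case .
next
  case empty
  interpret H: abelian_monoid H by fact
  show ?case using assms by simp
qed

end

lemma (in abelian_group) finsum_uminus:
  assumes "\<And>x. x \<in> A \<Longrightarrow> f x \<in> carrier G" "finite A"
  shows "\<ominus> finsum G f A = (\<Oplus>x\<in>A. \<ominus> f x)"
  using assms by (intro finsum_map) (auto simp: abelian_monoid_axioms minus_add)

section \<open>The multiplication of a nonassociative cyclic algebra\<close>

text \<open>
  A commutative ring \<open>K\<close> with an endomorphism \<open>\<sigma>\<close> such that \<open>\<sigma>\<^sup>n = id\<close>.  The power \<open>\<sigma>\<^sup>i\<close>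
  is written \<open>s i\<close>; in particular \<open>s (n - i)\<close> is the inverse of \<open>s i\<close> for \<open>i \<le> n\<close>.
\<close>

locale twisted =
  K?: cring K for K :: "('a, 'b, 'p) module_scheme" (structure) +
  fixes \<sigma> :: "'b \<Rightarrow> 'b" and n :: nat
  assumes sigma_hom: "\<sigma> \<in> ring_hom K K"
    and n_pos: "0 < n"
    and period: "x \<in> carrier K \<Longrightarrow> (\<sigma> ^^ n) x = x"
begin

abbreviation s :: "nat \<Rightarrow> 'b \<Rightarrow> 'b" where "s i \<equiv> \<sigma> ^^ i"

lemma s_closed [simp, intro]: "x \<in> carrier K \<Longrightarrow> s i x \<in> carrier K"
  by (induction i) (auto intro: ring_hom_closed[OF sigma_hom])

lemma s_add [simp]: "\<lbrakk>x \<in> carrier K; y \<in> carrier K\<rbrakk> \<Longrightarrow> s i (x \<oplus> y) = s i x \<oplus> s i y"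
  by (induction i) (auto simp: ring_hom_add[OF sigma_hom])

lemma s_mult [simp]: "\<lbrakk>x \<in> carrier K; y \<in> carrier K\<rbrakk> \<Longrightarrow> s i (x \<otimes> y) = s i x \<otimes> s i y"
  by (induction i) (auto simp: ring_hom_mult[OF sigma_hom])

lemma s_one [simp]: "s i \<one> = \<one>"
  by (induction i) (auto simp: ring_hom_one[OF sigma_hom])

lemma s_zero [simp]: "s i \<zero> = \<zero>"
  by (induction i) (auto simp: ring_hom_zero[OF sigma_hom K.ring_axioms K.ring_axioms])

lemma s_minus [simp]: "x \<in> carrier K \<Longrightarrow> s i (\<ominus> x) = \<ominus> s i x"
  by (metis K.add.inv_closed K.minus_equality K.r_neg K.a_comm s_add s_closed s_zero)

lemma s_sum:
  assumes "finite A" "\<And>x. x \<in> A \<Longrightarrow> f x \<in> carrier K"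
  shows "s i (\<Oplus>x\<in>A. f x) = (\<Oplus>x\<in>A. s i (f x))"
  using assms by (intro finsum_map) (auto simp: K.abelian_monoid_axioms)

lemma s_s: "s i (s j x) = s (i + j) x"
  by (simp add: funpow_add)

lemma s_period: "x \<in> carrier K \<Longrightarrow> s (n * k) x = x"
proof (induction k)
  case (Suc k)
  then show ?case by (simp add: funpow_add period)
qed simp

lemma s_mod: assumes "x \<in> carrier K" shows "s (i mod n) x = s i x"
proof -
  have "s i x = s (i mod n) (s (n * (i div n)) x)"
    by (simp only: s_s) simp
  then show ?thesis using assms by (simp add: s_period)
qed

lemma s_cong: "\<lbrakk>x \<in> carrier K; i mod n = j mod n\<rbrakk> \<Longrightarrow> s i x = s j x"
  by (metis s_mod)

lemma s_inj: "\<lbrakk>x \<in> carrier K; y \<in> carrier K; s i x = s i y\<rbrakk> \<Longrightarrow> x = y"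
proof -
  assume a: "x \<in> carrier K" "y \<in> carrier K" "s i x = s i y"
  have e: "(n - 1) * i + i = n * i" using n_pos by (cases n) auto
  have "s ((n - 1) * i) (s i z) = z" if "z \<in> carrier K" for z
    unfolding s_s e using that by (rule s_period)
  then show "x = y" using a by metis
qed

lemma s_eq_zero [simp]: "x \<in> carrier K \<Longrightarrow> s i x = \<zero> \<longleftrightarrow> x = \<zero>"
  using s_inj[of x \<zero> i] by auto

lemma s_Units: "x \<in> Units K \<Longrightarrow> s i x \<in> Units K"
proof -
  assume x: "x \<in> Units K"
  then have "s i (inv x \<otimes> x) = \<one>" "s i (x \<otimes> inv x) = \<one>" by simp_all
  then have "s i (inv x) \<otimes> s i x = \<one>" "s i x \<otimes> s i (inv x) = \<one>"
    using x K.Units_closed[OF x] K.Units_inv_closed[OF x] by (simp_all del: K.Units_l_inv K.Units_r_inv)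
  then show ?thesis using K.Units_closed[OF x] K.Units_inv_closed[OF x] unfolding Units_def by blast
qed

lemma mem_below: "g \<in> skew_polys_below K m \<longleftrightarrow> (\<forall>i. g i \<in> carrier K) \<and> (\<forall>i\<ge>m. g i = \<zero>)"
  unfolding skew_polys_below_def up_def bound_def by (auto intro: less_imp_le)

lemma coeff_closed [simp]: "g \<in> skew_polys_below K m \<Longrightarrow> g i \<in> carrier K"
  by (simp add: mem_below)

lemma coeff_zero: "\<lbrakk>g \<in> skew_polys_below K m; m \<le> i\<rbrakk> \<Longrightarrow> g i = \<zero>"
  by (simp add: mem_below)

abbreviation S where "S \<equiv> skew_poly_ring K \<sigma>"

lemma S_abelian_group: "abelian_group S"
proof (rule abelian_groupI)
  fix x assume "x \<in> carrier S"
  then obtain N where x: "\<And>i. x i \<in> carrier K" "\<And>i. N < i \<Longrightarrow> x i = \<zero>"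
    unfolding skew_poly_ring_def up_def bound_def by auto
  show "\<exists>y\<in>carrier S. y \<oplus>\<^bsub>S\<^esub> x = \<zero>\<^bsub>S\<^esub>"
    using x by (intro bexI[of _ "\<lambda>i. \<ominus> x i"])
      (auto simp: skew_poly_ring_def up_def bound_def l_neg)
next
  fix x y assume "x \<in> carrier S" "y \<in> carrier S"
  then obtain N N' where "\<And>i. x i \<in> carrier K" "\<forall>i>N. x i = \<zero>" "\<And>i. y i \<in> carrier K" "\<forall>i>N'. y i = \<zero>"
    unfolding skew_poly_ring_def up_def bound_def by (auto simp: Pi_def)
  then show "x \<oplus>\<^bsub>S\<^esub> y \<in> carrier S"
    by (auto simp: skew_poly_ring_def up_def bound_def intro!: exI[of _ "max N N'"])
qed (auto simp: skew_poly_ring_def up_def bound_def K.a_ac fun_eq_iff Pi_def)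

text \<open>The polynomial \<open>t\<^sup>n - d\<close>.\<close>

definition modulus :: "'b \<Rightarrow> nat \<Rightarrow> 'b" where
  "modulus d = skew_monom K \<one> n \<ominus>\<^bsub>S\<^esub> skew_monom K d 0"

lemma modulus_eq:
  assumes "d \<in> carrier K"
  shows "modulus d = (\<lambda>i. if i = n then \<one> else if i = 0 then \<ominus> d else \<zero>)"
proof -
  interpret S: abelian_group S by (rule S_abelian_group)
  have c: "skew_monom K a k \<in> carrier S" if "a \<in> carrier K" for a k
    using that by (auto simp: skew_poly_ring_def skew_monom_def up_def bound_def intro!: exI[of _ k])
  have "\<ominus>\<^bsub>S\<^esub> skew_monom K d 0 = skew_monom K (\<ominus> d) 0"
    using assms by (intro S.minus_equality c)
      (auto simp: skew_poly_ring_def skew_monom_def l_neg fun_eq_iff)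
  then show ?thesis
    using assms n_pos by (auto simp: modulus_def a_minus_def skew_poly_ring_def skew_monom_def fun_eq_iff)
qed

lemma times_modulus:
  assumes d: "d \<in> carrier K" and q: "q \<in> carrier S"
  shows "(q \<otimes>\<^bsub>S\<^esub> modulus d) m = (if n \<le> m then q (m - n) else \<zero>) \<ominus> q m \<otimes> s m d"
proof -
  have qc: "q i \<in> carrier K" for i using q by (auto simp: skew_poly_ring_def up_def)
  have "(q \<otimes>\<^bsub>S\<^esub> modulus d) m = (\<Oplus>i\<in>{..m}. q i \<otimes> s i (modulus d (m - i)))"
    by (simp add: skew_poly_ring_def)
  also have "\<dots> = (\<Oplus>i\<in>{..m}. (if m - i = n then q i else \<zero>) \<oplus> (if i = m then \<ominus> (q m \<otimes> s m d) else \<zero>))"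
    using d qc n_pos by (intro finsum_eqI) (auto simp: modulus_eq r_minus)
  also have "\<dots> = (\<Oplus>i\<in>{..m}. if m - i = n then q i else \<zero>) \<oplus> (\<Oplus>i\<in>{..m}. if i = m then \<ominus> (q m \<otimes> s m d) else \<zero>)"
    using d qc by (intro finsum_add) auto
  also have "(\<Oplus>i\<in>{..m}. if i = m then \<ominus> (q m \<otimes> s m d) else \<zero>) = \<ominus> (q m \<otimes> s m d)"
    using d qc by (subst finsum_single[of m]) auto
  also have "(\<Oplus>i\<in>{..m}. if m - i = n then q i else \<zero>) = (if n \<le> m then q (m - n) else \<zero>)"
  proof (cases "n \<le> m")
    case True
    then show ?thesis using qc by (subst finsum_single[of "m - n"]) auto
  next
    case False
    then have "(\<Oplus>i\<in>{..m}. if m - i = n then q i else \<zero>) = (\<Oplus>i\<in>{..m}. \<zero>)"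
      by (intro finsum_eqI) auto
    then show ?thesis using False by (simp add: finsum_zero)
  qed
  finally show ?thesis by (simp add: a_minus_def)
qed

text \<open>
  Right division by \<open>t\<^sup>n - d\<close> replaces \<open>a t\<^sup>m\<^sup>+\<^sup>n\<close> by \<open>a \<sigma>\<^sup>m(d) t\<^sup>m\<close>.  Hence the coefficient of \<open>t\<^sup>m\<close> in a
  product \<open>g h\<close> is the sum over \<open>i < n\<close> of \<open>g\<^sub>i \<sigma>\<^sup>i(h\<^sub>j)\<close> with \<open>j\<close> congruent to \<open>m - i\<close> modulo \<open>n\<close>, weighted
  by \<open>1\<close> if \<open>i + j = m\<close> and by \<open>\<sigma>\<^sup>m(d)\<close> if \<open>i + j = m + n\<close>.  The latter case is \<open>i > m\<close>.
\<close>

definition wt :: "'b \<Rightarrow> nat \<Rightarrow> nat \<Rightarrow> 'b" where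
  "wt d i m = (if i \<le> m then \<one> else s m d)"

text \<open>The multiplication of the algebra on coefficients; \<open>m + n - i\<close> avoids truncated subtraction.\<close>

definition cmul :: "'b \<Rightarrow> (nat \<Rightarrow> 'b) \<Rightarrow> (nat \<Rightarrow> 'b) \<Rightarrow> nat \<Rightarrow> 'b" where
  "cmul d g h m = (if m < n then \<Oplus>i\<in>{..<n}. g i \<otimes> s i (h ((m + n - i) mod n)) \<otimes> wt d i m else \<zero>)"

lemma wt_closed [simp]: "d \<in> carrier K \<Longrightarrow> wt d i m \<in> carrier K"
  by (simp add: wt_def)

lemma cmul_closed [simp]:
  assumes "d \<in> carrier K" "g \<in> skew_polys_below K n" "h \<in> skew_polys_below K n"
  shows "cmul d g h \<in> skew_polys_below K n"
  using assms by (auto simp: mem_below cmul_def intro!: finsum_in)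

text \<open>
  The quotient \<open>q\<close> consists of the coefficients of \<open>g h\<close> in degrees at least \<open>n\<close>, since \<open>g h\<close> has degree
  below \<open>2 n\<close>.  Uniqueness holds because the modulus is monic: two quotients agree in all large degrees
  and then, descending by steps of \<open>n\<close>, everywhere.
\<close>

lemma skew_rem_eq:
  assumes d: "d \<in> carrier K" and g: "g \<in> skew_polys_below K n" and h: "h \<in> skew_polys_below K n"
  shows "skew_rem K \<sigma> n (modulus d) (g \<otimes>\<^bsub>S\<^esub> h) = cmul d g h"
proof -
  interpret S: abelian_group S by (rule S_abelian_group)
  define p where "p = g \<otimes>\<^bsub>S\<^esub> h"
  have gc [simp]: "g i \<in> carrier K" and hc [simp]: "h i \<in> carrier K" for i using g h by simp_all
  have p: "p m = (\<Oplus>i\<in>{..m}. g i \<otimes> s i (h (m - i)))" for m by (simp add: p_def skew_poly_ring_def)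
  have pc [simp]: "p m \<in> carrier K" for m by (auto simp: p intro!: finsum_in)
  have p0: "p m = \<zero>" if "2 * n \<le> m" for m
  proof -
    have "g i \<otimes> s i (h (m - i)) = \<zero>" if "i \<le> m" for i
      using that coeff_zero[OF g, of i] coeff_zero[OF h, of "m - i"] \<open>2 * n \<le> m\<close> by (cases "n \<le> i") auto
    then have "p m = (\<Oplus>i\<in>{..m}. \<zero>)" unfolding p by (intro finsum_eqI) auto
    then show ?thesis by (simp add: finsum_zero)
  qed
  have diff_mod: "(m + n - i) mod n = m - i" if "i \<le> m" "m < n" for i m
    using that by (metis Nat.add_diff_assoc2 less_imp_diff_less mod_add_self2 mod_less)
  have p_low: "p m = (\<Oplus>i\<in>{..<n}. if i \<le> m then g i \<otimes> s i (h ((m + n - i) mod n)) else \<zero>)" if "m < n" for m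
    unfolding p using that by (intro add.finprod_mono_neutral_cong_left) (auto simp: Pi_def diff_mod)
  have p_high: "p (m + n) = (\<Oplus>i\<in>{..<n}. if i \<le> m then \<zero> else g i \<otimes> s i (h ((m + n - i) mod n)))"
    if "m < n" for m
  proof -
    have "p (m + n) = (\<Oplus>i\<in>{..<n}. g i \<otimes> s i (h (m + n - i)))"
      unfolding p using that coeff_zero[OF g] by (intro add.finprod_mono_neutral_cong_right) (auto simp: Pi_def)
    also have "\<dots> = (\<Oplus>i\<in>{..<n}. if i \<le> m then \<zero> else g i \<otimes> s i (h ((m + n - i) mod n)))"
      using coeff_zero[OF h] by (intro finsum_eqI) auto
    finally show ?thesis .
  qed
  have key: "cmul d g h m = p m \<oplus> p (m + n) \<otimes> s m d" if m: "m < n" for m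
  proof -
    have "p m \<oplus> p (m + n) \<otimes> s m d =
        (\<Oplus>i\<in>{..<n}. if i \<le> m then g i \<otimes> s i (h ((m + n - i) mod n)) else \<zero>) \<oplus>
        (\<Oplus>i\<in>{..<n}. (if i \<le> m then \<zero> else g i \<otimes> s i (h ((m + n - i) mod n))) \<otimes> s m d)"
      using m d by (simp add: p_low p_high finsum_ldistr Pi_def)
    also have "\<dots> = (\<Oplus>i\<in>{..<n}. (if i \<le> m then g i \<otimes> s i (h ((m + n - i) mod n)) else \<zero>) \<oplus>
        (if i \<le> m then \<zero> else g i \<otimes> s i (h ((m + n - i) mod n))) \<otimes> s m d)"
      using d by (intro finsum_add[symmetric]) auto
    also have "\<dots> = cmul d g h m"
      unfolding cmul_def using m d by (simp only: if_True, intro finsum_eqI) (auto simp: wt_def)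
    finally show ?thesis by simp
  qed
  have S_carrier: "q \<in> carrier S \<longleftrightarrow> (\<forall>i. q i \<in> carrier K) \<and> (\<exists>N. \<forall>i>N. q i = \<zero>)" for q
    by (auto simp: skew_poly_ring_def up_def bound_def Pi_def)
  have below_S: "r \<in> carrier S" if "r \<in> skew_polys_below K n" for r
    using that by (auto simp: skew_poly_ring_def skew_polys_below_def)
  have S_add: "(x \<oplus>\<^bsub>S\<^esub> y) i = x i \<oplus> y i" for x y i by (simp add: skew_poly_ring_def)
  define q where "q = (\<lambda>i. p (i + n))"
  have q: "q \<in> carrier S" unfolding S_carrier using p0 by (auto simp: q_def intro!: exI[of _ "2 * n"])
  have ex: "p = q \<otimes>\<^bsub>S\<^esub> modulus d \<oplus>\<^bsub>S\<^esub> cmul d g h"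
  proof
    fix m
    consider "m < n" | "n \<le> m" "m < 2 * n" | "2 * n \<le> m" by linarith
    then show "p m = (q \<otimes>\<^bsub>S\<^esub> modulus d \<oplus>\<^bsub>S\<^esub> cmul d g h) m"
    proof cases
      case 1
      then show ?thesis using d by (simp add: S_add times_modulus[OF d q] key)
          (simp add: q_def a_minus_def a_lcomm[of "\<ominus> _" "p m"] l_neg)
    next
      case 2
      then show ?thesis using d by (simp add: S_add times_modulus[OF d q] cmul_def) (simp add: q_def p0 a_minus_def)
    next
      case 3
      then show ?thesis using d by (simp add: S_add times_modulus[OF d q] cmul_def) (simp add: q_def p0 a_minus_def)
    qed
  qed
  have uniq: "r = cmul d g h" if r: "r \<in> skew_polys_below K n" and q': "q' \<in> carrier S"
    and eq: "p = q' \<otimes>\<^bsub>S\<^esub> modulus d \<oplus>\<^bsub>S\<^esub> r" for r q'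
  proof -
    have rc [simp]: "r i \<in> carrier K" for i using r by simp
    have q'c [simp]: "q' i \<in> carrier K" for i using q' S_carrier by auto
    have qc [simp]: "q i \<in> carrier K" for i by (simp add: q_def)
    obtain N1 N2 where "\<forall>i>N1. q i = \<zero>" "\<forall>i>N2. q' i = \<zero>"
      using q q' unfolding S_carrier by blast
    then obtain N where N: "\<And>i. N < i \<Longrightarrow> q i = \<zero>" "\<And>i. N < i \<Longrightarrow> q' i = \<zero>"
      using that[of "max N1 N2"] by simp
    have pm: "p m = (if n \<le> m then q' (m - n) else \<zero>) \<ominus> q' m \<otimes> s m d \<oplus> r m" for m
      by (subst eq) (simp add: S_add times_modulus[OF d q'])
    have pm': "p m = (if n \<le> m then q (m - n) else \<zero>) \<ominus> q m \<otimes> s m d \<oplus> cmul d g h m" for m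
      by (subst ex) (simp add: S_add times_modulus[OF d q])
    have step: "q' m = q m" if "q' (m + n) = q (m + n)" for m
    proof -
      have "q' m \<ominus> q (m + n) \<otimes> s (m + n) d = q m \<ominus> q (m + n) \<otimes> s (m + n) d"
        using pm[of "m + n"] pm'[of "m + n"] that d coeff_zero[OF r, of "m + n"] by (simp add: cmul_def)
      then show ?thesis using d by (simp add: a_minus_def)
    qed
    have "q' i = q i" for i
    proof (induction "N - i" arbitrary: i rule: less_induct)
      case less
      show ?case
      proof (cases "N < i")
        case True then show ?thesis using N by simp
      next
        case False
        show ?thesis
        proof (cases "i + n \<le> N")
          case True
          then have "N - (i + n) < N - i" using n_pos by linarith
          then show ?thesis by (rule step[OF less.hyps])
        next
          case False
          then have "q' (i + n) = q (i + n)" using N by simp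
          then show ?thesis by (rule step)
        qed
      qed
    qed
    then have "q' = q" by auto
    show ?thesis
    proof
      fix m
      let ?t = "(if n \<le> m then q (m - n) else \<zero>) \<ominus> q m \<otimes> s m d"
      have "?t \<oplus> r m = ?t \<oplus> cmul d g h m" using pm[of m] pm'[of m] \<open>q' = q\<close> by simp
      moreover have "cmul d g h m \<in> carrier K" using cmul_closed[OF d g h] by simp
      ultimately show "r m = cmul d g h m" using d by simp
    qed
  qed
  show ?thesis
    unfolding skew_rem_def p_def[symmetric]
  proof (rule the_equality)
    show "cmul d g h \<in> skew_polys_below K n \<and>
        (\<exists>q\<in>carrier S. p = q \<otimes>\<^bsub>S\<^esub> modulus d \<oplus>\<^bsub>S\<^esub> cmul d g h)"
      using cmul_closed[OF d g h] q ex by (intro conjI bexI[of _ q])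
  next
    fix r assume "r \<in> skew_polys_below K n \<and> (\<exists>q\<in>carrier S. p = q \<otimes>\<^bsub>S\<^esub> modulus d \<oplus>\<^bsub>S\<^esub> r)"
    then obtain q' where "r \<in> skew_polys_below K n" "q' \<in> carrier S" "p = q' \<otimes>\<^bsub>S\<^esub> modulus d \<oplus>\<^bsub>S\<^esub> r"
      by blast
    then show "r = cmul d g h" by (rule uniq)
  qed
qed

text \<open>The nonassociative cyclic algebra and its carrier, the polynomials of degree below \<open>n\<close>.\<close>

abbreviation A where "A d \<equiv> nonassoc_cyclic_algebra K \<sigma> n d"
abbreviation P where "P \<equiv> skew_polys_below K n"

lemma A_simps [simp]:
  "carrier (A d) = P" "\<zero>\<^bsub>A d\<^esub> = (\<lambda>i. \<zero>)" "\<one>\<^bsub>A d\<^esub> = skew_monom K \<one> 0"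
  "g \<oplus>\<^bsub>A d\<^esub> h = (\<lambda>i. g i \<oplus> h i)" "a \<odot>\<^bsub>A d\<^esub> g = (\<lambda>i. a \<odot> g i)"
  by (simp_all add: nonassoc_cyclic_algebra_def skew_poly_ring_def skew_monom_def Let_def)

lemma A_mult: "\<lbrakk>d \<in> carrier K; g \<in> P; h \<in> P\<rbrakk> \<Longrightarrow> g \<otimes>\<^bsub>A d\<^esub> h = cmul d g h"
  using skew_rem_eq[of d g h] by (simp add: nonassoc_cyclic_algebra_def Let_def modulus_def)

lemma below_ext: "\<lbrakk>g \<in> P; h \<in> P; \<And>m. m < n \<Longrightarrow> g m = h m\<rbrakk> \<Longrightarrow> g = h"
  by (rule ext) (metis coeff_zero not_less)

lemma mon_closed [simp]: "a \<in> carrier K \<Longrightarrow> skew_monom K a i m \<in> carrier K"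
  by (simp add: skew_monom_def)

lemma mon_in [simp]: "\<lbrakk>a \<in> carrier K; i < n\<rbrakk> \<Longrightarrow> skew_monom K a i \<in> P"
  by (auto simp: mem_below skew_monom_def)

lemma const_in [simp]: "a \<in> carrier K \<Longrightarrow> skew_monom K a 0 \<in> P"
  using n_pos by simp

lemma sub_mod: "\<lbrakk>i \<le> m; m < n\<rbrakk> \<Longrightarrow> (m + n - i) mod n = m - i"
  by (metis Nat.add_diff_assoc2 less_imp_diff_less mod_add_self2 mod_less)

lemma add_mod [simp]: "i < n \<Longrightarrow> (i + (m + n - i) mod n) mod n = m mod n"
  by (simp add: mod_add_right_eq)

lemma cmul_mon_left:
  assumes "d \<in> carrier K" "a \<in> carrier K" "i < n" "h \<in> P" "m < n"
  shows "cmul d (skew_monom K a i) h m = a \<otimes> s i (h ((m + n - i) mod n)) \<otimes> wt d i m"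
  unfolding cmul_def using assms
  by (subst if_P, simp, subst finsum_single[of i]) (auto simp: skew_monom_def)

lemma cmul_const_left:
  assumes "d \<in> carrier K" "a \<in> carrier K" "h \<in> P"
  shows "cmul d (skew_monom K a 0) h = (\<lambda>m. a \<otimes> h m)"
proof (rule below_ext)
  show "(\<lambda>m. a \<otimes> h m) \<in> P" using assms by (auto simp: mem_below)
qed (use assms n_pos in \<open>auto simp: cmul_mon_left wt_def\<close>)

lemma cmul_const_right:
  assumes d: "d \<in> carrier K" and a: "a \<in> carrier K" and g: "g \<in> P"
  shows "cmul d g (skew_monom K a 0) = (\<lambda>m. g m \<otimes> s m a)"
proof (rule below_ext)
  show "(\<lambda>m. g m \<otimes> s m a) \<in> P" using assms by (auto simp: mem_below)
next
  fix m assume m: "m < n"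
  have neq: "skew_monom K a 0 ((m + n - j) mod n) = \<zero>" if "j < n" "j \<noteq> m" for j
  proof (cases "j \<le> m")
    case True then show ?thesis using that m by (simp add: sub_mod skew_monom_def)
  qed (use that m in \<open>auto simp: skew_monom_def\<close>)
  have "cmul d g (skew_monom K a 0) m = (\<Oplus>i\<in>{..<n}. g i \<otimes> s i (skew_monom K a 0 ((m + n - i) mod n)) \<otimes> wt d i m)"
    using m by (simp add: cmul_def)
  also have "\<dots> = g m \<otimes> s m (skew_monom K a 0 ((m + n - m) mod n)) \<otimes> wt d m m"
    using assms m neq by (intro finsum_single) auto
  finally show "cmul d g (skew_monom K a 0) m = g m \<otimes> s m a"
    using assms m by (simp add: wt_def skew_monom_def)
qed (use assms in auto)

lemma cmul_scale_left:
  assumes d: "d \<in> carrier K" and a: "a \<in> carrier K" and g: "g \<in> P" and h: "h \<in> P"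
  shows "cmul d (\<lambda>m. a \<otimes> g m) h = (\<lambda>m. a \<otimes> cmul d g h m)"
  using assms by (auto simp: cmul_def fun_eq_iff finsum_rdistr Pi_def m_assoc intro!: finsum_eqI)

lemma cmul_scale_mid:
  assumes d: "d \<in> carrier K" and a: "a \<in> carrier K" and g: "g \<in> P" and h: "h \<in> P"
  shows "cmul d (\<lambda>m. g m \<otimes> s m a) h = cmul d g (\<lambda>m. a \<otimes> h m)"
  using assms by (auto simp: cmul_def fun_eq_iff m_assoc intro!: finsum_eqI)

lemma cmul_scale_right:
  assumes d: "d \<in> carrier K" and a: "a \<in> carrier K" and g: "g \<in> P" and h: "h \<in> P"
  shows "cmul d g (\<lambda>m. h m \<otimes> s m a) = (\<lambda>m. cmul d g h m \<otimes> s m a)"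
proof
  fix m
  show "cmul d g (\<lambda>m. h m \<otimes> s m a) m = cmul d g h m \<otimes> s m a"
  proof (cases "m < n")
    case True
    have e: "s i (s ((m + n - i) mod n) a) = s m a" if "i < n" for i
      using a that True add_mod[of i m] by (metis s_s s_mod)
    have "cmul d g (\<lambda>m. h m \<otimes> s m a) m = (\<Oplus>i\<in>{..<n}. g i \<otimes> s i (h ((m + n - i) mod n) \<otimes> s ((m + n - i) mod n) a) \<otimes> wt d i m)"
      using True by (simp add: cmul_def)
    also have "\<dots> = (\<Oplus>i\<in>{..<n}. (g i \<otimes> s i (h ((m + n - i) mod n)) \<otimes> wt d i m) \<otimes> s m a)"
      using assms by (intro finsum_eqI) (auto simp: e m_ac)
    also have "\<dots> = cmul d g h m \<otimes> s m a"
      using True assms by (simp add: cmul_def finsum_ldistr Pi_def)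
    finally show ?thesis .
  qed (use a in \<open>auto simp: cmul_def\<close>)
qed

lemma cmul_add_left:
  assumes "d \<in> carrier K" "g \<in> P" "g' \<in> P" "h \<in> P"
  shows "cmul d (\<lambda>m. g m \<oplus> g' m) h = (\<lambda>m. cmul d g h m \<oplus> cmul d g' h m)"
proof
  fix m
  show "cmul d (\<lambda>m. g m \<oplus> g' m) h m = cmul d g h m \<oplus> cmul d g' h m"
    using assms unfolding cmul_def
    by (cases "m < n", simp_all only: if_True if_False refl, subst finsum_add[symmetric])
       (auto intro!: finsum_eqI simp: l_distr simp del: add.finprod_multf)
qed

lemma cmul_add_right:
  assumes "d \<in> carrier K" "g \<in> P" "h \<in> P" "h' \<in> P"
  shows "cmul d g (\<lambda>m. h m \<oplus> h' m) = (\<lambda>m. cmul d g h m \<oplus> cmul d g h' m)"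
proof
  fix m
  show "cmul d g (\<lambda>m. h m \<oplus> h' m) m = cmul d g h m \<oplus> cmul d g h' m"
    using assms unfolding cmul_def
    by (cases "m < n", simp_all only: if_True if_False refl, subst finsum_add[symmetric])
       (auto intro!: finsum_eqI simp: l_distr r_distr simp del: add.finprod_multf)
qed

text \<open>
  The product of two monomials is a monomial: \<open>a t\<^sup>i \<cdot> b t\<^sup>j\<close> is \<open>a \<sigma>\<^sup>i(b) t\<^sup>i\<^sup>+\<^sup>j\<close> or
  \<open>a \<sigma>\<^sup>i(b) \<sigma>\<^sup>i\<^sup>+\<^sup>j\<^sup>-\<^sup>n(d) t\<^sup>i\<^sup>+\<^sup>j\<^sup>-\<^sup>n\<close>.
\<close>

lemma cmul_mon_mon:
  assumes "d \<in> carrier K" "a \<in> carrier K" "b \<in> carrier K" "i < n" "j < n"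
  shows "cmul d (skew_monom K a i) (skew_monom K b j) =
         skew_monom K (a \<otimes> s i b \<otimes> wt d i ((i + j) mod n)) ((i + j) mod n)"
proof (rule below_ext)
  fix m assume m: "m < n"
  have "(m + n - i) mod n = j \<longleftrightarrow> m = (i + j) mod n"
  proof
    assume "(m + n - i) mod n = j"
    then show "m = (i + j) mod n" using add_mod[OF assms(4), of m] m by simp
  next
    assume m_eq: "m = (i + j) mod n"
    show "(m + n - i) mod n = j"
    proof (cases "i + j < n")
      case True then show ?thesis using m_eq assms by (simp add: sub_mod)
    next
      case False
      then have "m = i + j - n" using m_eq assms by (simp add: le_mod_geq)
      then show ?thesis using False assms by simp
    qed
  qed
  then show "cmul d (skew_monom K a i) (skew_monom K b j) m =
      skew_monom K (a \<otimes> s i b \<otimes> wt d i ((i + j) mod n)) ((i + j) mod n) m"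
    using assms m by (subst cmul_mon_left[OF _ _ _ mon_in]) (auto simp: skew_monom_def)
qed (use assms in auto)

end

section \<open>The algebra axioms\<close>

text \<open>Now \<open>K\<close> is an algebra over a field \<open>F\<close> and \<open>\<sigma>\<close> is \<open>F\<close>-linear.\<close>

locale cyclic_setup = twisted K \<sigma> n
  for K :: "('a, 'b, 'p) module_scheme" (structure) and \<sigma> n +
  fixes F :: "('a, 'm) ring_scheme"
  assumes field_F: "field F"
    and alg: "algebra F K"
    and sigma_lin: "\<lbrakk>a \<in> carrier F; x \<in> carrier K\<rbrakk> \<Longrightarrow> \<sigma> (a \<odot> x) = a \<odot> \<sigma> x"

begin

sublocale F: field F by (rule field_F)
sublocale KA: algebra F K by (rule alg)

lemma s_lin [simp]: "\<lbrakk>a \<in> carrier F; x \<in> carrier K\<rbrakk> \<Longrightarrow> s i (a \<odot> x) = a \<odot> s i x"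
  by (induction i) (auto simp: sigma_lin)

lemma smult_mult_right: "\<lbrakk>a \<in> carrier F; x \<in> carrier K; y \<in> carrier K\<rbrakk> \<Longrightarrow> x \<otimes> (a \<odot> y) = a \<odot> (x \<otimes> y)"
  by (metis K.m_comm KA.smult_assoc2 KA.smult_closed)

lemma smult_one_mult: "\<lbrakk>a \<in> carrier F; x \<in> carrier K\<rbrakk> \<Longrightarrow> (a \<odot> \<one>) \<otimes> x = a \<odot> x"
  by (simp add: KA.smult_assoc2)

lemma A_abelian_group: "abelian_group (A d)"
proof (rule abelian_groupI)
  fix x assume "x \<in> carrier (A d)"
  then show "\<exists>y\<in>carrier (A d). y \<oplus>\<^bsub>A d\<^esub> x = \<zero>\<^bsub>A d\<^esub>"
    by (intro bexI[of _ "\<lambda>i. \<ominus> x i"]) (auto simp: mem_below l_neg)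
qed (auto simp: mem_below K.a_ac)

lemma A_module: "module F (A d)"
proof (rule moduleI)
qed (auto simp: A_abelian_group F.is_cring mem_below KA.smult_l_distr KA.smult_r_distr KA.smult_assoc1)

lemma A_nonassoc_algebra:
  assumes d: "d \<in> carrier K"
  shows "nonassoc_algebra F (A d)"
proof (intro nonassoc_algebra.intro nonassoc_algebra_axioms.intro A_module)
  fix a x y assume a: "a \<in> carrier F" and "x \<in> carrier (A d)" "y \<in> carrier (A d)"
  then have x: "x \<in> P" and y: "y \<in> P" by auto
  let ?a = "a \<odot> \<one>"
  have a1: "?a \<in> carrier K" using a by simp
  have eq: "a \<odot>\<^bsub>A d\<^esub> g = (\<lambda>m. ?a \<otimes> g m)" "a \<odot>\<^bsub>A d\<^esub> g = (\<lambda>m. g m \<otimes> s m ?a)" if "g \<in> P" for g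
    using a that by (auto simp: smult_one_mult smult_mult_right)
  have in_P: "(\<lambda>m. ?a \<otimes> g m) \<in> P" "(\<lambda>m. g m \<otimes> s m ?a) \<in> P" if "g \<in> P" for g
    using a1 that by (auto simp: mem_below)
  show "(a \<odot>\<^bsub>A d\<^esub> x) \<otimes>\<^bsub>A d\<^esub> y = a \<odot>\<^bsub>A d\<^esub> (x \<otimes>\<^bsub>A d\<^esub> y)"
    using d x y a1 in_P by (simp only: eq(1) A_mult cmul_scale_left cmul_closed)
  show "x \<otimes>\<^bsub>A d\<^esub> (a \<odot>\<^bsub>A d\<^esub> y) = a \<odot>\<^bsub>A d\<^esub> (x \<otimes>\<^bsub>A d\<^esub> y)"
    using d x y a1 in_P by (simp only: eq(2) A_mult cmul_scale_right cmul_closed)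
next
  fix x assume x: "x \<in> carrier (A d)"
  show "\<one>\<^bsub>A d\<^esub> \<otimes>\<^bsub>A d\<^esub> x = x" using x d by (simp add: A_mult cmul_const_left)
  show "x \<otimes>\<^bsub>A d\<^esub> \<one>\<^bsub>A d\<^esub> = x" using x d by (simp add: A_mult cmul_const_right)
next
  fix x y z assume "x \<in> carrier (A d)" "y \<in> carrier (A d)" "z \<in> carrier (A d)"
  then have xyz: "x \<in> P" "y \<in> P" "z \<in> P" by auto
  then have *: "(\<lambda>i. x i \<oplus> y i) \<in> P" by (auto simp: mem_below)
  show "(x \<oplus>\<^bsub>A d\<^esub> y) \<otimes>\<^bsub>A d\<^esub> z = x \<otimes>\<^bsub>A d\<^esub> z \<oplus>\<^bsub>A d\<^esub> y \<otimes>\<^bsub>A d\<^esub> z"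
    using d xyz * by (simp add: A_mult cmul_add_left)
  show "z \<otimes>\<^bsub>A d\<^esub> (x \<oplus>\<^bsub>A d\<^esub> y) = z \<otimes>\<^bsub>A d\<^esub> x \<oplus>\<^bsub>A d\<^esub> z \<otimes>\<^bsub>A d\<^esub> y"
    using d xyz * by (simp add: A_mult cmul_add_right)
qed (use d in \<open>auto simp: A_mult\<close>)

lemma A_finsum:
  assumes "finite X" "\<And>x. x \<in> X \<Longrightarrow> f x \<in> P"
  shows "finsum (A d) f X = (\<lambda>m. \<Oplus>x\<in>X. f x m)"
proof
  fix m
  interpret AG: abelian_group "A d" by (rule A_abelian_group)
  show "finsum (A d) f X m = (\<Oplus>x\<in>X. f x m)"
    using assms by (intro AG.finsum_map) (auto simp: K.abelian_monoid_axioms)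
qed

end

section \<open>The nucleus of a nonassociative algebra\<close>

context nonassoc_algebra
begin

lemma mult_zero_left [simp]: "x \<in> carrier A \<Longrightarrow> \<zero> \<otimes> x = \<zero>"
  by (metis M.add.l_cancel_one' M.zero_closed distrib_right M.l_zero mult_closed)

lemma mult_zero_right [simp]: "x \<in> carrier A \<Longrightarrow> x \<otimes> \<zero> = \<zero>"
  by (metis M.add.l_cancel_one' M.zero_closed distrib_left M.l_zero mult_closed)

lemma mult_minus_left: "\<lbrakk>x \<in> carrier A; y \<in> carrier A\<rbrakk> \<Longrightarrow> (\<ominus> x) \<otimes> y = \<ominus> (x \<otimes> y)"
  by (metis M.add.inv_closed M.l_neg M.minus_equality distrib_right mult_closed mult_zero_left)

lemma mult_minus_right: "\<lbrakk>x \<in> carrier A; y \<in> carrier A\<rbrakk> \<Longrightarrow> x \<otimes> (\<ominus> y) = \<ominus> (x \<otimes> y)"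
  by (metis M.add.inv_closed M.l_neg M.minus_equality distrib_left mult_closed mult_zero_right)

lemma associator_zero_iff:
  "\<lbrakk>x \<in> carrier A; y \<in> carrier A; z \<in> carrier A\<rbrakk> \<Longrightarrow>
    associator A x y z = \<zero> \<longleftrightarrow> (x \<otimes> y) \<otimes> z = x \<otimes> (y \<otimes> z)"
  by (simp add: associator_def mult_closed M.minus_other_side)

lemma mem_nucleus:
  "x \<in> nucleus A \<longleftrightarrow> x \<in> carrier A \<and> (\<forall>y\<in>carrier A. \<forall>z\<in>carrier A.
     (x \<otimes> y) \<otimes> z = x \<otimes> (y \<otimes> z) \<and> (y \<otimes> x) \<otimes> z = y \<otimes> (x \<otimes> z) \<and> (y \<otimes> z) \<otimes> x = y \<otimes> (z \<otimes> x))"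
  by (auto simp: nucleus_def associator_zero_iff)

lemma nucleus_closed: "x \<in> nucleus A \<Longrightarrow> x \<in> carrier A"
  by (simp add: mem_nucleus)

lemma nucleus_assoc:
  assumes "x \<in> carrier A" "y \<in> carrier A" "z \<in> carrier A" "x \<in> nucleus A \<or> y \<in> nucleus A \<or> z \<in> nucleus A"
  shows "(x \<otimes> y) \<otimes> z = x \<otimes> (y \<otimes> z)"
  using assms by (auto simp: mem_nucleus)

lemma nucleus_mult:
  assumes "x \<in> nucleus A" "y \<in> nucleus A"
  shows "x \<otimes> y \<in> nucleus A"
proof -
  have c: "x \<in> carrier A" "y \<in> carrier A" using assms by (auto simp: nucleus_closed)
  have "((x \<otimes> y) \<otimes> u) \<otimes> v = (x \<otimes> y) \<otimes> (u \<otimes> v) \<and> (u \<otimes> (x \<otimes> y)) \<otimes> v = u \<otimes> ((x \<otimes> y) \<otimes> v)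
      \<and> (u \<otimes> v) \<otimes> (x \<otimes> y) = u \<otimes> (v \<otimes> (x \<otimes> y))"
    if u: "u \<in> carrier A" and v: "v \<in> carrier A" for u v
  proof (intro conjI)
    have "((x \<otimes> y) \<otimes> u) \<otimes> v = (x \<otimes> (y \<otimes> u)) \<otimes> v" using c u v assms by (simp add: nucleus_assoc)
    also have "\<dots> = x \<otimes> ((y \<otimes> u) \<otimes> v)" using c u v assms by (intro nucleus_assoc) (auto simp: mult_closed)
    also have "\<dots> = x \<otimes> (y \<otimes> (u \<otimes> v))" using c u v assms by (simp add: nucleus_assoc)
    also have "\<dots> = (x \<otimes> y) \<otimes> (u \<otimes> v)"
      using c u v assms by (intro nucleus_assoc[symmetric]) (auto simp: mult_closed)
    finally show "((x \<otimes> y) \<otimes> u) \<otimes> v = (x \<otimes> y) \<otimes> (u \<otimes> v)" .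
    have "(u \<otimes> (x \<otimes> y)) \<otimes> v = ((u \<otimes> x) \<otimes> y) \<otimes> v" using c u v assms by (simp add: nucleus_assoc)
    also have "\<dots> = (u \<otimes> x) \<otimes> (y \<otimes> v)" using c u v assms by (intro nucleus_assoc) (auto simp: mult_closed)
    also have "\<dots> = u \<otimes> (x \<otimes> (y \<otimes> v))" using c u v assms by (intro nucleus_assoc) (auto simp: mult_closed)
    also have "\<dots> = u \<otimes> ((x \<otimes> y) \<otimes> v)" using c u v assms by (simp add: nucleus_assoc)
    finally show "(u \<otimes> (x \<otimes> y)) \<otimes> v = u \<otimes> ((x \<otimes> y) \<otimes> v)" .
    have "(u \<otimes> v) \<otimes> (x \<otimes> y) = ((u \<otimes> v) \<otimes> x) \<otimes> y"
      using c u v assms by (intro nucleus_assoc[symmetric]) (auto simp: mult_closed)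
    also have "\<dots> = (u \<otimes> (v \<otimes> x)) \<otimes> y" using c u v assms by (simp add: nucleus_assoc)
    also have "\<dots> = u \<otimes> ((v \<otimes> x) \<otimes> y)" using c u v assms by (intro nucleus_assoc) (auto simp: mult_closed)
    also have "\<dots> = u \<otimes> (v \<otimes> (x \<otimes> y))" using c u v assms by (simp add: nucleus_assoc)
    finally show "(u \<otimes> v) \<otimes> (x \<otimes> y) = u \<otimes> (v \<otimes> (x \<otimes> y))" .
  qed
  then show ?thesis unfolding mem_nucleus using c by (simp add: mult_closed)
qed

lemma nucleus_add: "\<lbrakk>x \<in> nucleus A; y \<in> nucleus A\<rbrakk> \<Longrightarrow> x \<oplus> y \<in> nucleus A"
  by (simp add: mem_nucleus distrib_left distrib_right mult_closed)

lemma nucleus_minus: "x \<in> nucleus A \<Longrightarrow> \<ominus> x \<in> nucleus A"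
  by (simp add: mem_nucleus mult_minus_left mult_minus_right mult_closed)

lemma nucleus_zero: "\<zero> \<in> nucleus A"
  by (simp add: mem_nucleus mult_closed)

lemma nucleus_one: "\<one> \<in> nucleus A"
  by (simp add: mem_nucleus mult_closed unit_closed unit_left unit_right)

lemma nucleus_smult: "\<lbrakk>a \<in> carrier R; x \<in> nucleus A\<rbrakk> \<Longrightarrow> a \<odot> x \<in> nucleus A"
  by (simp add: mem_nucleus smult_left smult_right mult_closed)

lemma scalars_subset_center: "scalars R A \<subseteq> center A"
  by (auto simp: scalars_def center_def nucleus_smult nucleus_one smult_left smult_right
      unit_left unit_right unit_closed)

lemma nucleus_algebra_simps [simp]:
  "carrier (nucleus_algebra A) = nucleus A" "monoid.mult (nucleus_algebra A) = monoid.mult A"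
  "one (nucleus_algebra A) = one A" "ring.zero (nucleus_algebra A) = ring.zero A"
  "add (nucleus_algebra A) = add A" "smult (nucleus_algebra A) = smult A"
  by (simp_all add: nucleus_algebra_def)

lemma nucleus_ring: "ring (nucleus_algebra A)"
proof (rule ringI)
  show "abelian_group (nucleus_algebra A)"
  proof (rule abelian_groupI)
    fix x assume "x \<in> carrier (nucleus_algebra A)"
    then show "\<exists>y\<in>carrier (nucleus_algebra A). y \<oplus>\<^bsub>nucleus_algebra A\<^esub> x = \<zero>\<^bsub>nucleus_algebra A\<^esub>"
      by (intro bexI[of _ "\<ominus> x"]) (auto simp: nucleus_minus nucleus_closed M.l_neg)
  qed (auto simp: nucleus_add nucleus_zero nucleus_closed M.a_ac)
  show "monoid (nucleus_algebra A)"
    by (rule monoidI) (auto simp: nucleus_mult nucleus_one nucleus_closed unit_left unit_right nucleus_assoc)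
qed (auto simp: nucleus_closed distrib_left distrib_right)

end

section \<open>Primitive idempotents of etale algebras\<close>

text \<open>
  Of the isomorphism of an etale algebra with a product of \<open>r\<close> fields only the primitive idempotents
  \<open>\<eta>\<^sub>i\<close> are needed later: they are orthogonal, an element is determined by its components \<open>\<eta>\<^sub>i x\<close>, and a
  nonzero component is invertible up to \<open>\<eta>\<^sub>i\<close>.
\<close>

lemma etale_idempotents:
  fixes F :: "('a, 'm) ring_scheme" and K :: "('a, 'b, 'p) module_scheme" (structure)
  assumes et: "etale_algebra F K"
  obtains r :: nat and \<eta> where
    "\<And>i. i < r \<Longrightarrow> \<eta> i \<in> carrier K"
    "\<And>i j. \<lbrakk>i < r; j < r\<rbrakk> \<Longrightarrow> \<eta> i \<otimes> \<eta> j = (if i = j then \<eta> i else \<zero>)"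
    "\<And>x. \<lbrakk>x \<in> carrier K; x \<noteq> \<zero>\<rbrakk> \<Longrightarrow> \<exists>i<r. \<eta> i \<otimes> x \<noteq> \<zero>"
    "\<And>i x. \<lbrakk>i < r; x \<in> carrier K; \<eta> i \<otimes> x \<noteq> \<zero>\<rbrakk> \<Longrightarrow> \<exists>y\<in>carrier K. x \<otimes> y = \<eta> i"
proof -
  interpret K: algebra F K using et by (simp add: etale_algebra_def)
  obtain r and L :: "nat \<Rightarrow> ('a, 'b) module" and h where
    L: "\<And>i. i < r \<Longrightarrow> finite_separable_field_extension F (L i)"
    and h: "h \<in> alg_iso F K (prod_algebra r L)"
    using et by (auto simp: etale_algebra_def alg_isomorphic_def)
  have fld: "field (L i)" if "i < r" for i
    using L[OF that] by (simp add: finite_separable_field_extension_def)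
  have hom: "h \<in> ring_hom K (prod_algebra r L)"
    and bij: "bij_betw h (carrier K) (carrier (prod_algebra r L))"
    using h by (auto simp: alg_iso_def ring_iso_def)
  have c_closed: "h x i \<in> carrier (L i)" if "x \<in> carrier K" "i < r" for x i
    using ring_hom_closed[OF hom that(1)] that(2) by (auto simp: prod_algebra_def)
  have c_add: "h (x \<oplus> y) i = h x i \<oplus>\<^bsub>L i\<^esub> h y i" if "x \<in> carrier K" "y \<in> carrier K" "i < r" for x y i
    using ring_hom_add[OF hom that(1,2)] that(3) by (simp add: prod_algebra_def)
  have c_mult: "h (x \<otimes> y) i = h x i \<otimes>\<^bsub>L i\<^esub> h y i" if "x \<in> carrier K" "y \<in> carrier K" "i < r" for x y i
    using ring_hom_mult[OF hom that(1,2)] that(3) by (simp add: prod_algebra_def)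
  have c_zero: "h \<zero> i = \<zero>\<^bsub>L i\<^esub>" if "i < r" for i
  proof -
    interpret L: field "L i" by (rule fld[OF that])
    have "h \<zero> i \<oplus>\<^bsub>L i\<^esub> h \<zero> i = h \<zero> i" using c_add[of \<zero> \<zero> i] that by simp
    then show ?thesis using c_closed[of \<zero> i] that by (metis L.add.l_cancel_one' K.zero_closed)
  qed
  have eqI: "x = y" if "x \<in> carrier K" "y \<in> carrier K" "\<And>i. i < r \<Longrightarrow> h x i = h y i" for x y
  proof -
    have "h x \<in> carrier (prod_algebra r L)" "h y \<in> carrier (prod_algebra r L)"
      using that ring_hom_closed[OF hom] by auto
    then have "h x = h y" using that(3) by (intro PiE_ext[of "h x" "{..<r}" "\<lambda>i. carrier (L i)"]) (auto simp: prod_algebra_def)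
    then show ?thesis using bij that(1,2) by (auto simp: bij_betw_def inj_on_def)
  qed
  have ex: "\<exists>x\<in>carrier K. \<forall>i<r. h x i = w i" if "\<And>i. i < r \<Longrightarrow> w i \<in> carrier (L i)" for w
  proof -
    have "(\<lambda>i\<in>{..<r}. w i) \<in> carrier (prod_algebra r L)" using that by (auto simp: prod_algebra_def)
    then obtain x where "x \<in> carrier K" "h x = (\<lambda>i\<in>{..<r}. w i)"
      using bij unfolding bij_betw_def by (metis imageE)
    then show ?thesis by (intro bexI[of _ x]) auto
  qed
  have "\<exists>e\<in>carrier K. \<forall>j<r. h e j = (if j = i then \<one>\<^bsub>L j\<^esub> else \<zero>\<^bsub>L j\<^esub>)" for i
  proof (rule ex)
    fix j assume "j < r"
    interpret L: field "L j" by (rule fld[OF \<open>j < r\<close>])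
    show "(if j = i then \<one>\<^bsub>L j\<^esub> else \<zero>\<^bsub>L j\<^esub>) \<in> carrier (L j)"
      using L.one_closed L.zero_closed by presburger
  qed
  then obtain \<eta> where \<eta>: "\<And>i. \<eta> i \<in> carrier K"
    and h\<eta>: "\<And>i j. j < r \<Longrightarrow> h (\<eta> i) j = (if j = i then \<one>\<^bsub>L j\<^esub> else \<zero>\<^bsub>L j\<^esub>)"
    by metis
  have h\<eta>x: "h (\<eta> i \<otimes> x) j = (if j = i then h x j else \<zero>\<^bsub>L j\<^esub>)" if "j < r" "x \<in> carrier K" for i j x
  proof -
    interpret L: field "L j" by (rule fld[OF that(1)])
    show ?thesis using that L.l_one[OF c_closed[OF that(2,1)]] L.l_null[OF c_closed[OF that(2,1)]]
      by (cases "j = i") (simp_all add: c_mult \<eta> h\<eta>)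
  qed
  show thesis
  proof (rule that[of r \<eta>])
    fix i j assume "i < r" "j < r"
    show "\<eta> i \<otimes> \<eta> j = (if i = j then \<eta> i else \<zero>)"
      by (rule eqI) (auto simp: \<eta> h\<eta>x h\<eta> c_zero)
  next
    fix x assume x: "x \<in> carrier K" "x \<noteq> \<zero>"
    then obtain i where i: "i < r" "h x i \<noteq> h \<zero> i" using eqI[of x \<zero>] by auto
    then have "h (\<eta> i \<otimes> x) i \<noteq> h \<zero> i" using x h\<eta>x[OF i(1) x(1), of i] by simp
    then have "\<eta> i \<otimes> x \<noteq> \<zero>" by (intro notI) simp
    then show "\<exists>i<r. \<eta> i \<otimes> x \<noteq> \<zero>" using i(1) by blast
  next
    fix i x assume i: "i < r" and x: "x \<in> carrier K" and ne: "\<eta> i \<otimes> x \<noteq> \<zero>"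
    interpret L: field "L i" by (rule fld[OF i])
    have "h x i \<noteq> \<zero>\<^bsub>L i\<^esub>"
    proof
      assume 0: "h x i = \<zero>\<^bsub>L i\<^esub>"
      have "\<eta> i \<otimes> x = \<zero>" by (rule eqI) (use 0 x \<eta> in \<open>auto simp: h\<eta>x c_zero\<close>)
      then show False using ne by simp
    qed
    then have u: "h x i \<in> Units (L i)" using L.field_Units c_closed[OF x i] by auto
    have "\<exists>y\<in>carrier K. \<forall>j<r. h y j = (if j = i then inv\<^bsub>L j\<^esub> h x j else \<zero>\<^bsub>L j\<^esub>)"
    proof (rule ex)
      fix j assume j: "j < r"
      interpret Lj: field "L j" by (rule fld[OF j])
      show "(if j = i then inv\<^bsub>L j\<^esub> h x j else \<zero>\<^bsub>L j\<^esub>) \<in> carrier (L j)"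
        using u by auto
    qed
    then obtain y where y: "y \<in> carrier K"
      and hy: "\<And>j. j < r \<Longrightarrow> h y j = (if j = i then inv\<^bsub>L j\<^esub> h x j else \<zero>\<^bsub>L j\<^esub>)" by auto
    have "h x j \<otimes>\<^bsub>L j\<^esub> h y j = h (\<eta> i) j" if j: "j < r" for j
    proof -
      interpret Lj: field "L j" by (rule fld[OF j])
      show ?thesis using u j c_closed[OF x j] by (auto simp: hy h\<eta>)
    qed
    then have "x \<otimes> y = \<eta> i" by (intro eqI[of "x \<otimes> y" "\<eta> i"]) (use x y \<eta> in \<open>auto simp: c_mult\<close>)
    then show "\<exists>y\<in>carrier K. x \<otimes> y = \<eta> i" using y by auto
  qed (use \<eta> in auto)
qed

section \<open>Galois algebras\<close>

text \<open>A Galois \<open>C\<^sub>n\<close>-algebra \<open>K\<close> over the field \<open>F\<close>, with generator \<open>\<sigma>\<close> of the group.\<close>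

locale galois = cyclic_setup K \<sigma> n F
  for K :: "('a, 'b, 'p) module_scheme" (structure) and \<sigma> n and F :: "('a, 'm) ring_scheme" +
  assumes etale: "etale_algebra F K"
    and dim: "vectorspace.dim F K = n"
    and order: "\<lbrakk>0 < m; m < n\<rbrakk> \<Longrightarrow> \<exists>x\<in>carrier K. s m x \<noteq> x"
    and fixed: "{x \<in> carrier K. \<sigma> x = x} = scalars F K"
begin

lemma K_vectorspace: "vectorspace F K"
  by (intro vectorspace.intro KA.module field_F)

lemma one_neq_zero: "\<one> \<noteq> \<zero>"
proof
  assume eq: "\<one> = \<zero>"
  interpret V: vectorspace F K by (rule K_vectorspace)
  have "carrier K = {\<zero>}" using eq by (rule K.one_zeroD)
  then have "KA.gen_set {\<zero>}"
    using KA.span_is_subset2[of "{\<zero>}"] KA.in_own_span[of "{\<zero>}"] by auto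
  then show False using V.dim0I dim n_pos by simp
qed

lemma scalar_eq_zero: "a \<in> carrier F \<Longrightarrow> a \<odot> \<one> = \<zero> \<longleftrightarrow> a = \<zero>\<^bsub>F\<^esub>"
proof
  assume a: "a \<in> carrier F" and eq: "a \<odot> \<one> = \<zero>"
  show "a = \<zero>\<^bsub>F\<^esub>"
  proof (rule ccontr)
    assume "a \<noteq> \<zero>\<^bsub>F\<^esub>"
    then have "a \<in> Units F" using a F.field_Units by auto
    then have "\<one> = (inv\<^bsub>F\<^esub> a \<otimes>\<^bsub>F\<^esub> a) \<odot> \<one>" by simp
    also have "\<dots> = inv\<^bsub>F\<^esub> a \<odot> (a \<odot> \<one>)" using a \<open>a \<in> Units F\<close> by (intro KA.smult_assoc1) auto
    also have "\<dots> = \<zero>" using \<open>a \<in> Units F\<close> eq by simp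
    finally show False using one_neq_zero by simp
  qed
qed simp

lemma scalar_inj: "\<lbrakk>a \<in> carrier F; b \<in> carrier F; a \<odot> \<one> = b \<odot> \<one>\<rbrakk> \<Longrightarrow> a = b"
proof -
  assume ab: "a \<in> carrier F" "b \<in> carrier F" "a \<odot> \<one> = b \<odot> \<one>"
  have "(a \<oplus>\<^bsub>F\<^esub> (\<ominus>\<^bsub>F\<^esub> b)) \<odot> \<one> = \<zero>"
    using ab by (simp add: KA.smult_l_distr KA.smult_l_minus r_neg)
  then have "a \<ominus>\<^bsub>F\<^esub> b = \<zero>\<^bsub>F\<^esub>" using ab by (simp add: scalar_eq_zero a_minus_def)
  then show "a = b" using ab by simp
qed

text \<open>
  A nonzero ideal of \<open>K\<close> stable under \<open>\<sigma>\<close> is all of \<open>K\<close>.  The sum \<open>e\<close> of the primitive idempotents in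
  the ideal is its identity element, hence is fixed by \<open>\<sigma>\<close> and therefore a nonzero scalar.
\<close>

lemma sigma_simple:
  assumes "I \<subseteq> carrier K" "x \<in> I" "x \<noteq> \<zero>"
    and add: "\<And>a b. \<lbrakk>a \<in> I; b \<in> I\<rbrakk> \<Longrightarrow> a \<oplus> b \<in> I"
    and mult: "\<And>a b. \<lbrakk>a \<in> carrier K; b \<in> I\<rbrakk> \<Longrightarrow> a \<otimes> b \<in> I"
    and stable: "\<And>a. a \<in> I \<Longrightarrow> \<sigma> a \<in> I"
  shows "\<one> \<in> I"
proof -
  obtain r :: nat and \<eta> where \<eta> [simp]: "\<And>i. i < r \<Longrightarrow> \<eta> i \<in> carrier K"
    and orth: "\<And>i j. \<lbrakk>i < r; j < r\<rbrakk> \<Longrightarrow> \<eta> i \<otimes> \<eta> j = (if i = j then \<eta> i else \<zero>)"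
    and sep: "\<And>x. \<lbrakk>x \<in> carrier K; x \<noteq> \<zero>\<rbrakk> \<Longrightarrow> \<exists>i<r. \<eta> i \<otimes> x \<noteq> \<zero>"
    and inv: "\<And>i x. \<lbrakk>i < r; x \<in> carrier K; \<eta> i \<otimes> x \<noteq> \<zero>\<rbrakk> \<Longrightarrow> \<exists>y\<in>carrier K. x \<otimes> y = \<eta> i"
    using etale_idempotents[OF etale] by blast
  have IK: "a \<in> carrier K" if "a \<in> I" for a using that assms(1) by auto
  have zeroI: "\<zero> \<in> I" using mult[of \<zero> x] assms IK by simp
  have etaI: "\<eta> i \<in> I" if i: "i < r" and a: "a \<in> I" and ne: "\<eta> i \<otimes> a \<noteq> \<zero>" for i a
  proof -
    obtain y where "y \<in> carrier K" "a \<otimes> y = \<eta> i" using inv[OF i IK[OF a] ne] by blast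
    then show ?thesis using mult[of y a] a IK[OF a] by (simp add: m_comm)
  qed
  define T where "T = {i. i < r \<and> \<eta> i \<in> I}"
  have "finite T" unfolding T_def by (rule finite_subset[of _ "{..<r}"]) auto
  then have T: "finite T" "\<And>i. i \<in> T \<Longrightarrow> i < r" "\<And>i. i \<in> T \<Longrightarrow> \<eta> i \<in> I"
    by (auto simp: T_def)
  define e where "e = (\<Oplus>i\<in>T. \<eta> i)"
  have eK [simp]: "e \<in> carrier K" unfolding e_def using T by (intro finsum_in) auto
  have eI: "e \<in> I"
    unfolding e_def using T
  proof (induction T rule: finite_induct)
    case (insert i T)
    then show ?case by (subst finsum_insert) (auto intro!: add)
  qed (simp add: zeroI)
  have \<eta>e: "\<eta> i \<otimes> e = \<eta> i" if "i \<in> T" for i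
  proof -
    have "\<eta> i \<otimes> e = (\<Oplus>j\<in>T. \<eta> i \<otimes> \<eta> j)"
      unfolding e_def using T that by (intro finsum_rdistr) auto
    also have "\<dots> = \<eta> i \<otimes> \<eta> i"
      using T that orth by (intro finsum_single) auto
    finally show ?thesis using orth T that by simp
  qed
  have id: "e \<otimes> a = a" if a: "a \<in> I" for a
  proof (rule ccontr)
    assume ne: "e \<otimes> a \<noteq> a"
    define b where "b = (\<one> \<ominus> e) \<otimes> a"
    have bI: "b \<in> I" unfolding b_def using a by (intro mult) auto
    have b_eq: "b = a \<ominus> e \<otimes> a" unfolding b_def using a IK by (simp add: l_distr a_minus_def l_minus)
    have "b \<noteq> \<zero>" using ne a IK unfolding b_eq by simp
    then obtain i where i: "i < r" "\<eta> i \<otimes> b \<noteq> \<zero>" using sep IK[OF bI] by blast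
    then have "i \<in> T" using etaI bI by (auto simp: T_def)
    have "\<eta> i \<otimes> b = (\<eta> i \<ominus> \<eta> i \<otimes> e) \<otimes> a"
      unfolding b_def using i a IK by (simp add: a_minus_def r_distr r_minus m_assoc[symmetric])
    also have "\<dots> = \<zero>" using \<eta>e[OF \<open>i \<in> T\<close>] i a IK by (simp add: r_neg a_minus_def)
    finally show False using i by simp
  qed
  have fix_e: "\<sigma> e = e"
  proof -
    have sI: "s i a \<in> I" if "a \<in> I" for a i using that by (induction i) (auto intro: stable)
    have "s 1 e \<otimes> s 1 (s (n - 1) e) = s 1 (s (n - 1) e)"
      using id[OF sI[OF eI, of "n - 1"]] by (metis K.m_closed eK s_closed s_mult)
    moreover have "s 1 (s (n - 1) e) = e" using n_pos by (simp only: s_s) (simp add: period)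
    ultimately have "s 1 e \<otimes> e = e" by simp
    moreover have "e \<otimes> s 1 e = s 1 e" using sI[OF eI] by (rule id)
    ultimately have "s 1 e = e" using m_comm[OF eK s_closed[OF eK, of 1]] by simp
    then show ?thesis by simp
  qed
  then have "e \<in> scalars F K" using fixed eK by blast
  then obtain c where c: "c \<in> carrier F" "e = c \<odot> \<one>" by (auto simp: scalars_def)
  have "e \<noteq> \<zero>" using id[OF \<open>x \<in> I\<close>] \<open>x \<noteq> \<zero>\<close> IK[OF \<open>x \<in> I\<close>] by auto
  then have "c \<noteq> \<zero>\<^bsub>F\<^esub>" using c by auto
  then have cu: "c \<in> Units F" using c F.field_Units by auto
  have "(inv\<^bsub>F\<^esub> c \<odot> \<one>) \<otimes> e = (inv\<^bsub>F\<^esub> c \<otimes>\<^bsub>F\<^esub> c) \<odot> \<one>"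
    using c cu by (simp add: smult_one_mult KA.smult_assoc1 del: F.Units_l_inv)
  also have "\<dots> = \<one>" using cu by simp
  finally show ?thesis using mult[of "inv\<^bsub>F\<^esub> c \<odot> \<one>" e] eI cu by simp
qed

text \<open>
  The sequences \<open>i \<mapsto> \<Sum>\<^sub>k x\<^sub>k \<sigma>\<^sup>i(y\<^sub>k)\<close> with \<open>x\<^sub>k, y\<^sub>k\<close> in \<open>K\<close>.  They form a ring under pointwise
  operations, the image of the tensor square of \<open>K\<close> under \<open>x \<otimes> y \<mapsto> (x \<sigma>\<^sup>i(y))\<^sub>i\<close>.
\<close>

inductive_set conv :: "(nat \<Rightarrow> 'b) set" where
  pure: "\<lbrakk>x \<in> carrier K; y \<in> carrier K\<rbrakk> \<Longrightarrow> (\<lambda>i. x \<otimes> s i y) \<in> conv"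
| sum: "\<lbrakk>u \<in> conv; v \<in> conv\<rbrakk> \<Longrightarrow> (\<lambda>i. u i \<oplus> v i) \<in> conv"

lemma conv_closed: "u \<in> conv \<Longrightarrow> u i \<in> carrier K"
  by (induction rule: conv.induct) auto

lemma conv_mult: "\<lbrakk>u \<in> conv; v \<in> conv\<rbrakk> \<Longrightarrow> (\<lambda>i. u i \<otimes> v i) \<in> conv"
proof (induction u rule: conv.induct)
  case (pure x y)
  show ?case using pure(3)
  proof (induction v rule: conv.induct)
    case (pure x' y')
    have "(\<lambda>i. x \<otimes> s i y \<otimes> (x' \<otimes> s i y')) = (\<lambda>i. (x \<otimes> x') \<otimes> s i (y \<otimes> y'))"
      using pure \<open>x \<in> carrier K\<close> \<open>y \<in> carrier K\<close> by (simp add: m_ac)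
    then show ?case using pure \<open>x \<in> carrier K\<close> \<open>y \<in> carrier K\<close> conv.pure[of "x \<otimes> x'" "y \<otimes> y'"] by simp
  next
    case (sum u v)
    have "(\<lambda>i. x \<otimes> s i y \<otimes> (u i \<oplus> v i)) = (\<lambda>i. x \<otimes> s i y \<otimes> u i \<oplus> x \<otimes> s i y \<otimes> v i)"
      using sum \<open>x \<in> carrier K\<close> \<open>y \<in> carrier K\<close> by (simp add: r_distr conv_closed)
    then show ?case using conv.sum[OF sum(3,4)] by simp
  qed
next
  case (sum u u')
  have "(\<lambda>i. (u i \<oplus> u' i) \<otimes> v i) = (\<lambda>i. u i \<otimes> v i \<oplus> u' i \<otimes> v i)"
    using sum by (simp add: l_distr conv_closed)
  then show ?case using conv.sum[OF sum(3)[OF sum(5)] sum(4)[OF sum(5)]] by simp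
qed

lemma conv_scale: "\<lbrakk>c \<in> carrier K; u \<in> conv\<rbrakk> \<Longrightarrow> (\<lambda>i. c \<otimes> u i) \<in> conv"
  using conv_mult[OF conv.pure[of c \<one>]] by simp

lemma conv_sigma: "u \<in> conv \<Longrightarrow> (\<lambda>i. \<sigma> (u i)) \<in> conv"
proof (induction rule: conv.induct)
  case (pure x y)
  have "\<sigma> (x \<otimes> s i y) = \<sigma> x \<otimes> s i (\<sigma> y)" for i
    using pure s_mult[of x "s i y" 1] by (simp add: funpow_swap1)
  then show ?case using pure s_closed[of x 1] s_closed[of y 1] conv.pure[of "\<sigma> x" "\<sigma> y"] by simp
next
  case (sum u v)
  have "\<sigma> (u i \<oplus> v i) = \<sigma> (u i) \<oplus> \<sigma> (v i)" for i
    using sum s_add[of "u i" "v i" 1] by (simp add: conv_closed)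
  then show ?case using conv.sum[OF sum(3,4)] by simp
qed

text \<open>
  The values at \<open>0\<close> of the sequences in \<open>conv\<close> that vanish at \<open>i\<close> form an ideal stable under \<open>\<sigma>\<close>.  It
  contains \<open>b - \<sigma>\<^sup>i(b)\<close> for every \<open>b\<close>, so it is nonzero and contains \<open>1\<close>.
\<close>

lemma conv_separates:
  assumes i: "0 < i" "i < n"
  obtains u where "u \<in> conv" "u 0 = \<one>" "u i = \<zero>"
proof -
  define I where "I = {u 0 |u. u \<in> conv \<and> u i = \<zero>}"
  have I_I: "w 0 \<in> I" if "w \<in> conv" "w i = \<zero>" for w using that by (auto simp: I_def)
  obtain b where b: "b \<in> carrier K" "s i b \<noteq> b" using order i by blast
  have "\<one> \<in> I"
  proof (rule sigma_simple)
    show "I \<subseteq> carrier K" by (auto simp: I_def conv_closed)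
    have "(\<lambda>j. \<one> \<otimes> s j b \<oplus> (\<ominus> s i b) \<otimes> s j \<one>) \<in> conv" using b by (intro conv.intros) auto
    moreover have "\<one> \<otimes> s i b \<oplus> (\<ominus> s i b) \<otimes> s i \<one> = \<zero>" using b by (simp add: r_neg)
    ultimately have "\<one> \<otimes> s 0 b \<oplus> (\<ominus> s i b) \<otimes> s 0 \<one> \<in> I"
      by (rule I_I)
    then show "b \<ominus> s i b \<in> I" using b by (simp add: a_minus_def)
    show "b \<ominus> s i b \<noteq> \<zero>" using b by simp
  next
    fix x y assume "x \<in> I" "y \<in> I"
    then obtain u v where uv: "u \<in> conv" "u i = \<zero>" "x = u 0" "v \<in> conv" "v i = \<zero>" "y = v 0"
      by (auto simp: I_def)
    then have "(\<lambda>i. u i \<oplus> v i) \<in> conv" "u i \<oplus> v i = \<zero>" by (auto intro: conv.sum)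
    then show "x \<oplus> y \<in> I" using uv I_I[of "\<lambda>i. u i \<oplus> v i"] by simp
  next
    fix x y assume "x \<in> carrier K" "y \<in> I"
    then obtain u where u: "u \<in> conv" "u i = \<zero>" "y = u 0" by (auto simp: I_def)
    then have "(\<lambda>i. x \<otimes> u i) \<in> conv" "x \<otimes> u i = \<zero>" using \<open>x \<in> carrier K\<close> by (auto intro: conv_scale)
    then show "x \<otimes> y \<in> I" using u I_I[of "\<lambda>i. x \<otimes> u i"] by simp
  next
    fix x assume "x \<in> I"
    then obtain u where u: "u \<in> conv" "u i = \<zero>" "x = u 0" by (auto simp: I_def)
    then have "(\<lambda>i. \<sigma> (u i)) \<in> conv" "\<sigma> (u i) = \<zero>" using s_zero[of 1] by (auto intro: conv_sigma)
    then show "\<sigma> x \<in> I" using u I_I[of "\<lambda>i. \<sigma> (u i)"] by simp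
  qed
  then show thesis using that by (auto simp: I_def)
qed

lemma conv_delta:
  obtains u where "u \<in> conv" "u 0 = \<one>" "\<And>i. \<lbrakk>0 < i; i < n\<rbrakk> \<Longrightarrow> u i = \<zero>"
proof -
  have "\<exists>u\<in>conv. u 0 = \<one> \<and> (\<forall>i. 0 < i \<and> i < m \<longrightarrow> u i = \<zero>)" if "m \<le> n" for m
    using that
  proof (induction m)
    case 0
    show ?case using conv.pure[of \<one> \<one>] by (intro bexI[of _ "\<lambda>i. \<one> \<otimes> s i \<one>"]) auto
  next
    case (Suc m)
    then obtain u where u: "u \<in> conv" "u 0 = \<one>" "\<And>i. \<lbrakk>0 < i; i < m\<rbrakk> \<Longrightarrow> u i = \<zero>" by auto
    show ?case
    proof (cases "m = 0")
      case True then show ?thesis using u by auto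
    next
      case False
      then obtain v where v: "v \<in> conv" "v 0 = \<one>" "v m = \<zero>" using conv_separates[of m] Suc by auto
      have "u i \<otimes> v i = \<zero>" if "0 < i" "i < Suc m" for i
        using that u v conv_closed[OF v(1), of i] conv_closed[OF u(1), of i] by (cases "i = m") auto
      then show ?thesis using u v by (intro bexI[of _ "\<lambda>i. u i \<otimes> v i"] conv_mult) auto
    qed
  qed
  then show thesis using that by blast
qed

lemma conv_sum:
  assumes "w \<in> conv"
  shows "\<exists>N u v. (\<forall>k. u k \<in> carrier K \<and> v k \<in> carrier K) \<and>
    (\<forall>i. w i = (\<Oplus>k\<in>{..<N::nat}. u k \<otimes> s i (v k)))"
  using assms
proof (induction rule: conv.induct)
    case (pure x y)
    then show ?case by (intro exI[of _ 1] exI[of _ "\<lambda>k. x"] exI[of _ "\<lambda>k. y"]) (auto simp: lessThan_Suc)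
  next
    case (sum w w')
    obtain N u v where 1: "\<And>k. u k \<in> carrier K" "\<And>k. v k \<in> carrier K" "\<And>i. w i = (\<Oplus>k\<in>{..<N::nat}. u k \<otimes> s i (v k))"
      using sum(3) by blast
    obtain M u' v' where 2: "\<And>k. u' k \<in> carrier K" "\<And>k. v' k \<in> carrier K" "\<And>i. w' i = (\<Oplus>k\<in>{..<M::nat}. u' k \<otimes> s i (v' k))"
      using sum(4) by blast
    define u'' where "u'' = (\<lambda>k. if k < N then u k else u' (k - N))"
    define v'' where "v'' = (\<lambda>k. if k < N then v k else v' (k - N))"
    have "w i \<oplus> w' i = (\<Oplus>k\<in>{..<N + M}. u'' k \<otimes> s i (v'' k))" for i
    proof -
      have "w' i = (\<Oplus>k\<in>{N..<N + M}. u' (k - N) \<otimes> s i (v' (k - N)))"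
      proof -
        have "bij_betw (\<lambda>k. k - N) {N..<N + M} {..<M}"
          by (rule bij_betw_byWitness[of _ "\<lambda>k. k + N"]) auto
        then show ?thesis unfolding 2(3) using 1 2 by (intro finsum_bij[symmetric]) auto
      qed
      also have "\<dots> = (\<Oplus>k\<in>{N..<N + M}. u'' k \<otimes> s i (v'' k))"
        using 1 2 by (intro finsum_eqI) (auto simp: u''_def v''_def)
      finally have a: "w' i = (\<Oplus>k\<in>{N..<N + M}. u'' k \<otimes> s i (v'' k))" .
      have b: "w i = (\<Oplus>k\<in>{..<N}. u'' k \<otimes> s i (v'' k))"
        unfolding 1(3) using 1 2 by (intro finsum_eqI) (auto simp: u''_def v''_def)
      have "{..<N + M} = {..<N} \<union> {N..<N + M}" by auto
      then show ?thesis unfolding a b using 1 2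
        by (simp only:) (intro finsum_Un_disjoint[symmetric]; auto simp: u''_def v''_def)
    qed
    moreover have "u'' k \<in> carrier K" "v'' k \<in> carrier K" for k using 1 2 by (auto simp: u''_def v''_def)
    ultimately show ?case by blast
qed

text \<open>The Galois property in the form in which it is used throughout.\<close>

lemma dual_families:
  obtains N u v where "\<And>k. u k \<in> carrier K" "\<And>k. v k \<in> carrier K"
    "\<And>i. i < n \<Longrightarrow> (\<Oplus>k\<in>{..<N::nat}. u k \<otimes> s i (v k)) = (if i = 0 then \<one> else \<zero>)"
proof -
  obtain w where w: "w \<in> conv" "w 0 = \<one>" "\<And>i. \<lbrakk>0 < i; i < n\<rbrakk> \<Longrightarrow> w i = \<zero>"
    using conv_delta by blast
  from conv_sum[OF w(1)] obtain N u v where "\<forall>k. u k \<in> carrier K \<and> v k \<in> carrier K"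
    "\<forall>i. w i = (\<Oplus>k\<in>{..<N::nat}. u k \<otimes> s i (v k))" by (elim exE conjE)
  then have uv: "\<And>k. u k \<in> carrier K" "\<And>k. v k \<in> carrier K"
    "\<And>i. w i = (\<Oplus>k\<in>{..<N}. u k \<otimes> s i (v k))" by auto
  show thesis
  proof (rule that[of u v N])
    fix i assume "i < n"
    then show "(\<Oplus>k\<in>{..<N}. u k \<otimes> s i (v k)) = (if i = 0 then \<one> else \<zero>)"
      using w unfolding uv(3)[symmetric] by (cases "i = 0") auto
  qed (use uv in auto)
qed

end

text \<open>A Galois \<open>C\<^sub>n\<close>-algebra with a choice of dual families \<open>u\<^sub>k, v\<^sub>k\<close>.\<close>

locale galois_dual = galois K \<sigma> n F
  for K :: "('a, 'b, 'p) module_scheme" (structure) and \<sigma> n and F :: "('a, 'm) ring_scheme" +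
  fixes N :: nat and u v :: "nat \<Rightarrow> 'b"
  assumes u_closed [simp]: "u k \<in> carrier K" and v_closed [simp]: "v k \<in> carrier K"
    and dual: "i < n \<Longrightarrow> (\<Oplus>k\<in>{..<N}. u k \<otimes> s i (v k)) = (if i = 0 then \<one> else \<zero>)"
begin

lemma dual_shift:
  assumes "i < n" "j < n"
  shows "(\<Oplus>k\<in>{..<N}. s i (u k) \<otimes> s j (v k)) = (if i = j then \<one> else \<zero>)"
proof -
  have e: "s j x = s i (s ((j + n - i) mod n) x)" if "x \<in> carrier K" for x
    using that assms add_mod[of i j] by (metis s_s s_mod)
  have "(\<Oplus>k\<in>{..<N}. s i (u k) \<otimes> s j (v k)) = (\<Oplus>k\<in>{..<N}. s i (u k \<otimes> s ((j + n - i) mod n) (v k)))"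
    by (intro finsum_eqI) (auto simp: e[of "v _"])
  also have "\<dots> = s i (\<Oplus>k\<in>{..<N}. u k \<otimes> s ((j + n - i) mod n) (v k))"
    by (intro s_sum[symmetric]) auto
  also have "\<dots> = s i (if (j + n - i) mod n = 0 then \<one> else \<zero>)"
    using n_pos by (simp add: dual)
  also have "(j + n - i) mod n = 0 \<longleftrightarrow> i = j"
  proof (cases "i \<le> j")
    case True then show ?thesis using assms by (auto simp: sub_mod)
  qed (use assms in auto)
  finally show ?thesis by auto
qed

text \<open>A substitute for the independence of automorphisms that is valid in the presence of zero divisors.\<close>

lemma annihilates:
  assumes i: "0 < i" "i < n" and c: "c \<in> carrier K"
    and eq: "\<And>a. a \<in> carrier K \<Longrightarrow> c \<otimes> s i a = c \<otimes> a"
  shows "c = \<zero>"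
proof -
  have "c = c \<otimes> (\<Oplus>k\<in>{..<N}. u k \<otimes> s 0 (v k))"
    using c n_pos by (simp only: dual) simp
  also have "\<dots> = (\<Oplus>k\<in>{..<N}. c \<otimes> (u k \<otimes> s 0 (v k)))"
    using c by (intro finsum_rdistr) auto
  also have "\<dots> = (\<Oplus>k\<in>{..<N}. c \<otimes> (u k \<otimes> s i (v k)))"
    using c eq by (intro finsum_eqI) (auto simp: m_lcomm[of c "u _"])
  also have "\<dots> = c \<otimes> (\<Oplus>k\<in>{..<N}. u k \<otimes> s i (v k))"
    using c by (intro finsum_rdistr[symmetric]) auto
  also have "\<dots> = \<zero>" using c i by (simp add: dual)
  finally show ?thesis .
qed

text \<open>The trace of \<open>K\<close> over \<open>F\<close>, first with values in \<open>K\<close>, and below with values in \<open>F\<close>.\<close>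

definition tr :: "'b \<Rightarrow> 'b" where "tr a = (\<Oplus>i\<in>{..<n}. s i a)"

lemma tr_fixed: assumes a: "a \<in> carrier K" shows "\<sigma> (tr a) = tr a"
proof -
  have "\<sigma> (tr a) = s 1 (tr a)" by simp
  also have "\<dots> = (\<Oplus>i\<in>{..<n}. s 1 (s i a))" unfolding tr_def using a by (intro s_sum) auto
  also have "\<dots> = (\<Oplus>i\<in>{..<n}. s ((i + 1) mod n) a)"
    using a by (intro finsum_eqI) (auto simp: s_s s_mod simp del: funpow.simps)
  also have "\<dots> = (\<Oplus>i\<in>{..<n}. s i a)"
  proof (rule finsum_bij)
    show "bij_betw (\<lambda>i. (i + 1) mod n) {..<n} {..<n}"
    proof (rule bij_betw_byWitness[of _ "\<lambda>i. (i + n - 1) mod n"])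
      show "\<forall>i\<in>{..<n}. ((i + 1) mod n + n - 1) mod n = i"
      proof
        fix i assume "i \<in> {..<n}"
        then show "((i + 1) mod n + n - 1) mod n = i" by (cases "i + 1 = n") auto
      qed
      show "\<forall>i\<in>{..<n}. ((i + n - 1) mod n + 1) mod n = i"
      proof
        fix i assume "i \<in> {..<n}"
        then show "((i + n - 1) mod n + 1) mod n = i" using n_pos by (cases i) (auto simp: mod_Suc)
      qed
    qed (use n_pos in auto)
  qed (use a in auto)
  finally show ?thesis by (simp add: tr_def)
qed

text \<open>The trace is fixed by \<open>\<sigma>\<close>, so it is \<open>c \<odot> 1\<close> for a unique scalar \<open>c\<close>.\<close>

definition trF :: "'b \<Rightarrow> 'a" where "trF a = (SOME c. c \<in> carrier F \<and> c \<odot> \<one> = tr a)"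

lemma trF:
  assumes a: "a \<in> carrier K"
  shows trF_closed [simp]: "trF a \<in> carrier F" and trF_one: "trF a \<odot> \<one> = tr a"
proof -
  have "tr a \<in> carrier K" unfolding tr_def using a by (auto intro!: finsum_in)
  then have "tr a \<in> scalars F K" using tr_fixed[OF a] fixed by auto
  then have "\<exists>c. c \<in> carrier F \<and> c \<odot> \<one> = tr a" by (auto simp: scalars_def)
  from someI_ex[OF this] show "trF a \<in> carrier F" "trF a \<odot> \<one> = tr a" by (auto simp: trF_def)
qed

lemma tr_closed [simp]: "a \<in> carrier K \<Longrightarrow> tr a \<in> carrier K"
  unfolding tr_def by (auto intro!: finsum_in)

lemma trF_smult: "\<lbrakk>a \<in> carrier K; x \<in> carrier K\<rbrakk> \<Longrightarrow> trF a \<odot> x = tr a \<otimes> x"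
  by (metis smult_one_mult trF)

lemma tr_add: "\<lbrakk>a \<in> carrier K; b \<in> carrier K\<rbrakk> \<Longrightarrow> tr (a \<oplus> b) = tr a \<oplus> tr b"
  unfolding tr_def by (subst finsum_add[symmetric]) (auto intro!: finsum_eqI simp del: add.finprod_multf)

lemma trF_add: "\<lbrakk>a \<in> carrier K; b \<in> carrier K\<rbrakk> \<Longrightarrow> trF (a \<oplus> b) = trF a \<oplus>\<^bsub>F\<^esub> trF b"
  by (rule scalar_inj) (auto simp: trF_one tr_add KA.smult_l_distr)

lemma tr_smult: "\<lbrakk>c \<in> carrier F; a \<in> carrier K\<rbrakk> \<Longrightarrow> tr (c \<odot> a) = c \<odot> tr a"
  unfolding tr_def by (subst KA.finsum_smult) (auto intro!: finsum_eqI)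

lemma trF_lin: "\<lbrakk>c \<in> carrier F; a \<in> carrier K\<rbrakk> \<Longrightarrow> trF (c \<odot> a) = c \<otimes>\<^bsub>F\<^esub> trF a"
  by (rule scalar_inj) (auto simp: trF_one tr_smult KA.smult_assoc1)

text \<open>With respect to the trace form, the families \<open>u\<close> and \<open>v\<close> behave like dual bases.\<close>

lemma dual_expansion:
  assumes a: "a \<in> carrier K"
  shows "a = (\<Oplus>k\<in>{..<N}. trF (v k \<otimes> a) \<odot> u k)"
proof -
  have "(\<Oplus>k\<in>{..<N}. trF (v k \<otimes> a) \<odot> u k) = (\<Oplus>k\<in>{..<N}. \<Oplus>i\<in>{..<n}. s i a \<otimes> (u k \<otimes> s i (v k)))"
  proof (rule finsum_eqI)
    fix k
    have "trF (v k \<otimes> a) \<odot> u k = (\<Oplus>i\<in>{..<n}. s i (v k \<otimes> a) \<otimes> u k)"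
      using a by (simp add: trF_smult tr_def finsum_ldistr Pi_def)
    also have "\<dots> = (\<Oplus>i\<in>{..<n}. s i a \<otimes> (u k \<otimes> s i (v k)))"
      using a by (intro finsum_eqI) (auto simp: m_ac)
    finally show "trF (v k \<otimes> a) \<odot> u k = (\<Oplus>i\<in>{..<n}. s i a \<otimes> (u k \<otimes> s i (v k)))" .
  qed (use a in \<open>auto intro!: finsum_in\<close>)
  also have "\<dots> = (\<Oplus>i\<in>{..<n}. \<Oplus>k\<in>{..<N}. s i a \<otimes> (u k \<otimes> s i (v k)))"
    using a by (intro finsum_swap) auto
  also have "\<dots> = (\<Oplus>i\<in>{..<n}. if i = 0 then a else \<zero>)"
  proof (rule finsum_eqI)
    fix i assume i: "i \<in> {..<n}"
    have "(\<Oplus>k\<in>{..<N}. s i a \<otimes> (u k \<otimes> s i (v k))) = s i a \<otimes> (\<Oplus>k\<in>{..<N}. u k \<otimes> s i (v k))"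
      using a by (intro finsum_rdistr[symmetric]) auto
    then show "(\<Oplus>k\<in>{..<N}. s i a \<otimes> (u k \<otimes> s i (v k))) = (if i = 0 then a else \<zero>)"
      using i a by (simp add: dual)
  qed (use a in auto)
  also have "\<dots> = a" using a n_pos by (subst finsum_single[of 0]) auto
  finally show ?thesis by simp
qed

lemma K_fin_dim: "vectorspace.fin_dim F K"
proof -
  interpret V: vectorspace F K by (rule K_vectorspace)
  have "a \<in> KA.span (u ` {..<N})" if a: "a \<in> carrier K" for a
  proof -
    have sub: "submodule F (KA.span (u ` {..<N})) K" by (rule KA.span_is_submodule) auto
    then interpret W: submodule F "KA.span (u ` {..<N})" K .
    have uk: "u k \<in> KA.span (u ` {..<N})" if "k < N" for k
    proof -
      have "u ` {..<N} \<subseteq> KA.span (u ` {..<N})" by (rule KA.in_own_span) auto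
      then show ?thesis using that by auto
    qed
    have "(\<Oplus>k\<in>T. trF (v k \<otimes> a) \<odot> u k) \<in> KA.span (u ` {..<N})" if "finite T" "T \<subseteq> {..<N}" for T
      using that
    proof (induction T rule: finite_induct)
      case (insert k T)
      then show ?case using a uk by (subst finsum_insert) auto
    qed auto
    from this[of "{..<N}"] show ?thesis using dual_expansion[OF a] by simp
  qed
  moreover have "KA.span (u ` {..<N}) \<subseteq> carrier K" by (rule KA.span_is_subset2) auto
  ultimately have "KA.gen_set (u ` {..<N})" by blast
  then show ?thesis
    unfolding V.fin_dim_def by (intro exI[of _ "u ` {..<N}"] conjI finite_imageI finite_lessThan image_subsetI u_closed)
qed

end

section \<open>Tensor products\<close>

context abelian_group
begin

lemma int_multiple_closed [simp]: "b \<in> carrier G \<Longrightarrow> [(k::int)] \<cdot> b \<in> carrier G"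
  by (rule add.int_pow_closed)

text \<open>The homomorphism from a free abelian group, given by its values \<open>\<beta>\<close> on the generators.\<close>

definition frag_sum :: "('c \<Rightarrow> 'a) \<Rightarrow> ('c \<Rightarrow>\<^sub>0 int) \<Rightarrow> 'a" where
  "frag_sum \<beta> x = (\<Oplus>p\<in>Poly_Mapping.keys x. [Poly_Mapping.lookup x p] \<cdot> \<beta> p)"

lemma frag_sum_superset:
  assumes "finite X" "Poly_Mapping.keys x \<subseteq> X" "\<And>p. p \<in> X \<Longrightarrow> \<beta> p \<in> carrier G"
  shows "frag_sum \<beta> x = (\<Oplus>p\<in>X. [Poly_Mapping.lookup x p] \<cdot> \<beta> p)"
proof -
  have z: "[(0::int)] \<cdot> b = \<zero>" for b by (simp add: add_pow_def)
  show ?thesis unfolding frag_sum_def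
    by (rule add.finprod_mono_neutral_cong_left) (use assms in \<open>auto simp: in_keys_iff z\<close>)
qed

lemma frag_sum_closed:
  assumes "\<And>p. p \<in> Poly_Mapping.keys x \<Longrightarrow> \<beta> p \<in> carrier G"
  shows "frag_sum \<beta> x \<in> carrier G"
  unfolding frag_sum_def using assms by (intro finsum_in) auto

lemma frag_sum_diff:
  assumes "\<And>p. p \<in> Poly_Mapping.keys x \<Longrightarrow> \<beta> p \<in> carrier G" "\<And>p. p \<in> Poly_Mapping.keys y \<Longrightarrow> \<beta> p \<in> carrier G"
  shows "frag_sum \<beta> (x - y) = frag_sum \<beta> x \<ominus> frag_sum \<beta> y"
proof -
  let ?X = "Poly_Mapping.keys x \<union> Poly_Mapping.keys y"
  have c: "[k] \<cdot> \<beta> p \<in> carrier G" if "p \<in> ?X" for k :: int and p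
    using that assms by auto
  have "frag_sum \<beta> (x - y) = (\<Oplus>p\<in>?X. [Poly_Mapping.lookup (x - y) p] \<cdot> \<beta> p)"
    using assms keys_diff[of x y] by (intro frag_sum_superset) auto
  also have "\<dots> = (\<Oplus>p\<in>?X. [Poly_Mapping.lookup x p] \<cdot> \<beta> p \<oplus> (\<ominus> ([Poly_Mapping.lookup y p] \<cdot> \<beta> p)))"
  proof (rule finsum_eqI)
    fix p assume p: "p \<in> ?X"
    then have b: "\<beta> p \<in> carrier G" using assms by auto
    show "[Poly_Mapping.lookup (x - y) p] \<cdot> \<beta> p =
        [Poly_Mapping.lookup x p] \<cdot> \<beta> p \<oplus> (\<ominus> ([Poly_Mapping.lookup y p] \<cdot> \<beta> p))"
      using add.int_pow_mult[OF b, of "Poly_Mapping.lookup x p" "- Poly_Mapping.lookup y p"]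
        add.int_pow_neg[OF b, of "Poly_Mapping.lookup y p"]
      by (simp add: lookup_minus add_pow_def a_inv_def)
  qed (use c in auto)
  also have "\<dots> = (\<Oplus>p\<in>?X. [Poly_Mapping.lookup x p] \<cdot> \<beta> p) \<oplus> (\<Oplus>p\<in>?X. \<ominus> ([Poly_Mapping.lookup y p] \<cdot> \<beta> p))"
    using c by (intro finsum_add) auto
  also have "(\<Oplus>p\<in>?X. \<ominus> ([Poly_Mapping.lookup y p] \<cdot> \<beta> p)) = \<ominus> (\<Oplus>p\<in>?X. [Poly_Mapping.lookup y p] \<cdot> \<beta> p)"
    using c by (intro finsum_uminus[symmetric]) auto
  also have "(\<Oplus>p\<in>?X. [Poly_Mapping.lookup x p] \<cdot> \<beta> p) = frag_sum \<beta> x"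
    using assms by (intro frag_sum_superset[symmetric]) auto
  also have "(\<Oplus>p\<in>?X. [Poly_Mapping.lookup y p] \<cdot> \<beta> p) = frag_sum \<beta> y"
    using assms by (intro frag_sum_superset[symmetric]) auto
  finally show ?thesis by (simp add: a_minus_def)
qed

lemma frag_sum_zero [simp]: "frag_sum \<beta> 0 = \<zero>"
  by (simp add: frag_sum_def)

lemma frag_sum_of [simp]: "\<beta> p \<in> carrier G \<Longrightarrow> frag_sum \<beta> (frag_of p) = \<beta> p"
  unfolding frag_sum_def by (subst finsum_single[of p]) (auto simp: add.int_pow_1)

lemma frag_sum_add:
  assumes "\<And>p. p \<in> Poly_Mapping.keys x \<Longrightarrow> \<beta> p \<in> carrier G" "\<And>p. p \<in> Poly_Mapping.keys y \<Longrightarrow> \<beta> p \<in> carrier G"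
  shows "frag_sum \<beta> (x + y) = frag_sum \<beta> x \<oplus> frag_sum \<beta> y"
proof -
  have m: "\<beta> p \<in> carrier G" if "p \<in> Poly_Mapping.keys (- y)" for p using that assms by simp
  have "frag_sum \<beta> (0 - y) = \<ominus> frag_sum \<beta> y"
    using assms by (subst frag_sum_diff) (auto simp: a_minus_def frag_sum_closed)
  moreover have "frag_sum \<beta> (x - (0 - y)) = frag_sum \<beta> x \<ominus> frag_sum \<beta> (0 - y)"
    using assms m by (intro frag_sum_diff) auto
  ultimately show ?thesis using assms by (simp add: a_minus_def frag_sum_closed)
qed

lemma frag_sum_unique:
  assumes x: "Poly_Mapping.keys x \<subseteq> S"
    and "\<And>p. p \<in> S \<Longrightarrow> \<beta> p \<in> carrier G"
    and "h 0 = \<zero>" "\<And>p. p \<in> S \<Longrightarrow> h (frag_of p) = \<beta> p"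
    and "\<And>x y. \<lbrakk>Poly_Mapping.keys x \<subseteq> S; Poly_Mapping.keys y \<subseteq> S\<rbrakk> \<Longrightarrow> h (x - y) = h x \<ominus> h y"
  shows "h x = frag_sum \<beta> x"
  using x
proof (induction x rule: free_Abelian_group_induct[consumes 1, case_names zero diff gen])
  case (diff x y)
  then show ?case using assms(2) by (subst frag_sum_diff) (auto simp: assms(5) subset_iff)
qed (use assms in auto)

end

text \<open>
  Two modules over \<open>F\<close>.  An element of their tensor product is the class \<open>cls x\<close>, modulo the subgroup \<open>ker\<close>
  of relations, of an element \<open>x\<close> of the free abelian group \<open>FG\<close> on the set \<open>S\<close> of pairs.  That \<open>x\<close> lies in
  this group is expressed by \<open>Poly_Mapping.keys x \<subseteq> S\<close>.
\<close>

locale tensor_modules = M: module F M + N: module F N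
  for F :: "('a, 'm) ring_scheme" and M :: "('a, 'b, 'p) module_scheme" and N :: "('a, 'c, 'q) module_scheme"
begin

abbreviation S where "S \<equiv> carrier M \<times> carrier N"
abbreviation FG where "FG \<equiv> free_Abelian_group S"
abbreviation ker where "ker \<equiv> tensor_kernel F M N"
abbreviation cls where "cls \<equiv> tensor_class F M N"

lemma relations_carrier: "tensor_relations F M N \<subseteq> carrier FG"
proof -
  have d: "x - y \<in> carrier FG" if "x \<in> carrier FG" "y \<in> carrier FG" for x y
    using that keys_diff[of x y] by auto
  have f: "frag_of (x, y) \<in> carrier FG" if "x \<in> carrier M" "y \<in> carrier N" for x y using that by simp
  show ?thesis unfolding tensor_relations_def by (auto simp del: carrier_free_Abelian_group_iff intro!: d f)
qed

lemma ker_subgroup: "subgroup ker FG"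
  unfolding tensor_kernel_def using relations_carrier by (intro group.generate_is_subgroup) auto

lemma ker_zero [simp]: "0 \<in> ker" using subgroup.one_closed[OF ker_subgroup] by simp
lemma ker_carrier: "x \<in> ker \<Longrightarrow> Poly_Mapping.keys x \<subseteq> S"
  using subgroup.subset[OF ker_subgroup] by (auto simp del: carrier_free_Abelian_group_iff simp flip: carrier_free_Abelian_group_iff)
lemma ker_add: "\<lbrakk>x \<in> ker; y \<in> ker\<rbrakk> \<Longrightarrow> x + y \<in> ker"
  using subgroup.m_closed[OF ker_subgroup] by simp
lemma ker_uminus: "x \<in> ker \<Longrightarrow> - x \<in> ker"
  using subgroup.m_inv_closed[OF ker_subgroup] ker_carrier by (metis inv_free_Abelian_group)
lemma ker_diff: "\<lbrakk>x \<in> ker; y \<in> ker\<rbrakk> \<Longrightarrow> x - y \<in> ker"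
  using ker_add[of x "- y"] ker_uminus by simp

lemma ker_rel: "x \<in> tensor_relations F M N \<Longrightarrow> x \<in> ker"
  unfolding tensor_kernel_def by (rule generate.incl)

lemma ker_induct [consumes 1, case_names rel diff zero]:
  assumes "x \<in> ker" "\<And>x. x \<in> tensor_relations F M N \<Longrightarrow> Q x"
    "\<And>x y. \<lbrakk>x \<in> ker; y \<in> ker; Q x; Q y\<rbrakk> \<Longrightarrow> Q (x - y)" "Q 0"
  shows "Q x"
  using assms(1) unfolding tensor_kernel_def
proof (induction x rule: generate.induct)
  case (inv h)
  then have "inv\<^bsub>FG\<^esub> h = 0 - h" using relations_carrier by (auto simp del: carrier_free_Abelian_group_iff simp flip: carrier_free_Abelian_group_iff)
  then show ?case using inv assms(2-4) ker_rel ker_zero by metis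
next
  case (eng x y)
  then have k: "x \<in> ker" "y \<in> ker" by (auto simp: tensor_kernel_def)
  have "Q (0 - y)" using k eng assms(3,4) ker_zero by blast
  then have "Q (x - (0 - y))" using k eng assms(3) ker_diff ker_zero by blast
  then show ?case by simp
qed (use assms in auto)

lemma mem_cls: "y \<in> cls x \<longleftrightarrow> y - x \<in> ker"
proof -
  have "y \<in> cls x \<longleftrightarrow> (\<exists>k\<in>ker. y = k + x)" by (auto simp: tensor_class_def r_coset_def)
  also have "\<dots> \<longleftrightarrow> y - x \<in> ker" by (metis add_diff_cancel_right' diff_add_cancel)
  finally show ?thesis .
qed

lemma cls_eq: "cls x = cls y \<longleftrightarrow> x - y \<in> ker"
proof
  assume "cls x = cls y"
  moreover have "x \<in> cls x" by (simp add: mem_cls)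
  ultimately show "x - y \<in> ker" by (simp add: mem_cls)
next
  assume k: "x - y \<in> ker"
  have "z - x \<in> ker \<longleftrightarrow> z - y \<in> ker" for z
    using ker_add[OF _ k, of "z - x"] ker_diff[OF _ k, of "z - y"] by (auto simp: algebra_simps)
  then show "cls x = cls y" by (auto simp: mem_cls)
qed

lemma carrier_tensor: "X \<in> carrier (tensor_group F M N) \<longleftrightarrow> (\<exists>x. Poly_Mapping.keys x \<subseteq> S \<and> X = cls x)"
proof -
  have "carrier (tensor_group F M N) = (\<Union>x\<in>carrier FG. {cls x})"
    by (simp add: tensor_group_def FactGroup_def RCOSETS_def tensor_class_def)
  then have "X \<in> carrier (tensor_group F M N) \<longleftrightarrow> (\<exists>x\<in>carrier FG. X = cls x)"
    by (simp only: UN_iff singleton_iff)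
  also have "\<dots> \<longleftrightarrow> (\<exists>x. Poly_Mapping.keys x \<subseteq> S \<and> X = cls x)"
    by (simp only: Bex_def carrier_free_Abelian_group_iff)
  finally show ?thesis .
qed

lemma one_tensor: "\<one>\<^bsub>tensor_group F M N\<^esub> = cls 0"
  by (auto simp: tensor_group_def FactGroup_def mem_cls)

lemma mult_tensor: "cls x \<otimes>\<^bsub>tensor_group F M N\<^esub> cls y = cls (x + y)"
proof -
  have "z \<in> cls x <#>\<^bsub>FG\<^esub> cls y \<longleftrightarrow> z \<in> cls (x + y)" for z
  proof
    assume "z \<in> cls x <#>\<^bsub>FG\<^esub> cls y"
    then obtain a b where "z = a + b" "a - x \<in> ker" "b - y \<in> ker" by (auto simp: set_mult_def mem_cls)
    then show "z \<in> cls (x + y)" using ker_add[of "a - x" "b - y"] by (simp add: mem_cls algebra_simps)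
  next
    assume "z \<in> cls (x + y)"
    then have "z - y \<in> cls x" by (simp add: mem_cls algebra_simps)
    moreover have "y \<in> cls y" by (simp add: mem_cls)
    moreover have "z = (z - y) + y" by simp
    ultimately have "\<exists>a\<in>cls x. \<exists>b\<in>cls y. z = a + b" by blast
    then show "z \<in> cls x <#>\<^bsub>FG\<^esub> cls y" unfolding set_mult_def by auto
  qed
  then show ?thesis by (auto simp: tensor_group_def FactGroup_def)
qed

text \<open>One half of the universal property: balanced biadditive maps factor through the tensor product.\<close>

lemma ker_frag_sum:
  assumes H: "abelian_group H"
    and c: "\<And>x y. \<lbrakk>x \<in> carrier M; y \<in> carrier N\<rbrakk> \<Longrightarrow> \<beta> (x, y) \<in> carrier H"
    and l: "\<And>x x' y. \<lbrakk>x \<in> carrier M; x' \<in> carrier M; y \<in> carrier N\<rbrakk> \<Longrightarrow> \<beta> (x \<oplus>\<^bsub>M\<^esub> x', y) = \<beta> (x, y) \<oplus>\<^bsub>H\<^esub> \<beta> (x', y)"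
    and r: "\<And>x y y'. \<lbrakk>x \<in> carrier M; y \<in> carrier N; y' \<in> carrier N\<rbrakk> \<Longrightarrow> \<beta> (x, y \<oplus>\<^bsub>N\<^esub> y') = \<beta> (x, y) \<oplus>\<^bsub>H\<^esub> \<beta> (x, y')"
    and b: "\<And>a x y. \<lbrakk>a \<in> carrier F; x \<in> carrier M; y \<in> carrier N\<rbrakk> \<Longrightarrow> \<beta> (a \<odot>\<^bsub>M\<^esub> x, y) = \<beta> (x, a \<odot>\<^bsub>N\<^esub> y)"
    and x: "x \<in> ker"
  shows "abelian_group.frag_sum H \<beta> x = \<zero>\<^bsub>H\<^esub>"
proof -
  interpret H: abelian_group H by fact
  have kc: "\<beta> p \<in> carrier H" if "p \<in> Poly_Mapping.keys x" "Poly_Mapping.keys x \<subseteq> S" for p and x :: "'b \<times> 'c \<Rightarrow>\<^sub>0 int"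
    using that c by auto
  have d: "H.frag_sum \<beta> (x - y) = H.frag_sum \<beta> x \<ominus>\<^bsub>H\<^esub> H.frag_sum \<beta> y"
    if "Poly_Mapping.keys x \<subseteq> S" "Poly_Mapping.keys y \<subseteq> S" for x y :: "'b \<times> 'c \<Rightarrow>\<^sub>0 int"
    using that kc by (intro H.frag_sum_diff) blast+
  have dk: "Poly_Mapping.keys (x - y) \<subseteq> S"
    if "Poly_Mapping.keys x \<subseteq> S" "Poly_Mapping.keys y \<subseteq> S" for x y :: "'b \<times> 'c \<Rightarrow>\<^sub>0 int"
    using that keys_diff[of x y] by auto
  have three: "H.frag_sum \<beta> (frag_of p - frag_of q - frag_of q') = \<beta> p \<ominus>\<^bsub>H\<^esub> \<beta> q \<ominus>\<^bsub>H\<^esub> \<beta> q'"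
    if "p \<in> S" "q \<in> S" "q' \<in> S" for p q q'
  proof -
    have 1: "Poly_Mapping.keys (frag_of p) \<subseteq> S" "Poly_Mapping.keys (frag_of q) \<subseteq> S" "Poly_Mapping.keys (frag_of q') \<subseteq> S"
      using that by auto
    show ?thesis using that c unfolding d[OF dk[OF 1(1,2)] 1(3)] d[OF 1(1,2)] by (cases p; cases q; cases q') auto
  qed
  have two: "H.frag_sum \<beta> (frag_of p - frag_of q) = \<beta> p \<ominus>\<^bsub>H\<^esub> \<beta> q" if "p \<in> S" "q \<in> S" for p q
  proof -
    have 1: "Poly_Mapping.keys (frag_of p) \<subseteq> S" "Poly_Mapping.keys (frag_of q) \<subseteq> S" using that by auto
    show ?thesis using that c unfolding d[OF 1] by (cases p; cases q) auto
  qed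
  show ?thesis
    using x
  proof (induction x rule: ker_induct)
    case (rel x)
    then consider
      (1) m m' n where "x = frag_of (m \<oplus>\<^bsub>M\<^esub> m', n) - frag_of (m, n) - frag_of (m', n)" "m \<in> carrier M" "m' \<in> carrier M" "n \<in> carrier N"
    | (2) m n n' where "x = frag_of (m, n \<oplus>\<^bsub>N\<^esub> n') - frag_of (m, n) - frag_of (m, n')" "m \<in> carrier M" "n \<in> carrier N" "n' \<in> carrier N"
    | (3) a m n where "x = frag_of (a \<odot>\<^bsub>M\<^esub> m, n) - frag_of (m, a \<odot>\<^bsub>N\<^esub> n)" "a \<in> carrier F" "m \<in> carrier M" "n \<in> carrier N"
      unfolding tensor_relations_def by blast
    then show ?case
    proof cases
      case 1
      then show ?thesis using c l by (simp add: three) (simp add: a_minus_def H.a_ac H.r_neg H.r_neg1)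
    next
      case 2
      then show ?thesis using c r by (simp add: three) (simp add: a_minus_def H.a_ac H.r_neg H.r_neg1)
    next
      case 3
      then show ?thesis using c b by (simp add: two)
    qed
  next
    case (diff x y)
    then show ?case using ker_carrier by (subst d) (auto simp: a_minus_def)
  qed simp
qed

text \<open>
  A coordinate criterion for an element of the tensor product to vanish.  Suppose that \<open>M\<close> is generated by
  \<open>e\<^sub>k\<close>, with coordinate functions \<open>f\<^sub>k\<close> (of which nothing but the expansion of every \<open>m\<close> is required).
  Modulo the relations, \<open>x\<close> equals \<open>\<Sum>\<^sub>k e\<^sub>k \<otimes> g\<^sub>k(x)\<close>, where \<open>g\<^sub>k\<close> is given by \<open>m \<otimes> n \<mapsto> f\<^sub>k(m) n\<close>.  So if all
  \<open>g\<^sub>k(x)\<close> are zero, then so is the class of \<open>x\<close>.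
\<close>

lemma ker_criterion:
  assumes e: "finite Q" "\<And>k. k \<in> Q \<Longrightarrow> e k \<in> carrier M" and f: "\<And>k m. \<lbrakk>k \<in> Q; m \<in> carrier M\<rbrakk> \<Longrightarrow> f k m \<in> carrier F"
    and expansion: "\<And>m. m \<in> carrier M \<Longrightarrow> m = (\<Oplus>\<^bsub>M\<^esub>k\<in>Q. f k m \<odot>\<^bsub>M\<^esub> e k)"
    and x: "Poly_Mapping.keys x \<subseteq> S"
    and zero: "\<And>k. k \<in> Q \<Longrightarrow> N.frag_sum (\<lambda>(m, n). f k m \<odot>\<^bsub>N\<^esub> n) x = \<zero>\<^bsub>N\<^esub>"
  shows "x \<in> ker"
proof -
  let ?g = "\<lambda>k. N.frag_sum (\<lambda>(m, n). f k m \<odot>\<^bsub>N\<^esub> n)"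
  have addr: "frag_of (m, n \<oplus>\<^bsub>N\<^esub> n') - frag_of (m, n) - frag_of (m, n') \<in> ker"
    if "m \<in> carrier M" "n \<in> carrier N" "n' \<in> carrier N" for m n n'
    using that by (intro ker_rel) (auto simp: tensor_relations_def)
  have addl: "frag_of (m \<oplus>\<^bsub>M\<^esub> m', n) - frag_of (m, n) - frag_of (m', n) \<in> ker"
    if "m \<in> carrier M" "m' \<in> carrier M" "n \<in> carrier N" for m m' n
    using that by (intro ker_rel) (auto simp: tensor_relations_def)
  have bal: "frag_of (a \<odot>\<^bsub>M\<^esub> m, n) - frag_of (m, a \<odot>\<^bsub>N\<^esub> n) \<in> ker"
    if "a \<in> carrier F" "m \<in> carrier M" "n \<in> carrier N" for a m n
    using that by (intro ker_rel) (auto simp: tensor_relations_def)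
  have zr: "frag_of (m, \<zero>\<^bsub>N\<^esub>) \<in> ker" if "m \<in> carrier M" for m
    using ker_uminus[OF addr[of m "\<zero>\<^bsub>N\<^esub>" "\<zero>\<^bsub>N\<^esub>"]] that by simp
  have zl: "frag_of (\<zero>\<^bsub>M\<^esub>, n) \<in> ker" if "n \<in> carrier N" for n
    using ker_uminus[OF addl[of "\<zero>\<^bsub>M\<^esub>" "\<zero>\<^bsub>M\<^esub>" n]] that by simp
  have diffr: "frag_of (m, n \<ominus>\<^bsub>N\<^esub> n') - (frag_of (m, n) - frag_of (m, n')) \<in> ker"
    if "m \<in> carrier M" "n \<in> carrier N" "n' \<in> carrier N" for m n n'
  proof -
    have "n \<ominus>\<^bsub>N\<^esub> n' \<oplus>\<^bsub>N\<^esub> n' = n" using that by (simp add: a_minus_def N.a_assoc N.l_neg)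
    then show ?thesis using ker_uminus[OF addr[of m "n \<ominus>\<^bsub>N\<^esub> n'" n']] that by (simp add: algebra_simps)
  qed
  have gc: "?g k x \<in> carrier N" if "k \<in> Q" "Poly_Mapping.keys x \<subseteq> S" for k and x :: "'b \<times> 'c \<Rightarrow>\<^sub>0 int"
    using that f by (intro N.frag_sum_closed) auto
  have sum_ker: "(\<Sum>k\<in>T. y k) \<in> ker" if "\<And>k. k \<in> T \<Longrightarrow> y k \<in> ker" "finite T" for T and y
    using that(2,1) by (induction T rule: finite_induct) (auto intro: ker_add)
  have "x - (\<Sum>k\<in>Q. frag_of (e k, ?g k x)) \<in> ker"
    using x
  proof (induction x rule: free_Abelian_group_induct[consumes 1, case_names zero diff gen])
    case zero
    show ?case using e zr by (simp, intro ker_uminus sum_ker) auto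
  next
    case (diff x y)
    have gd: "?g k (x - y) = ?g k x \<ominus>\<^bsub>N\<^esub> ?g k y" if "k \<in> Q" for k
      using that diff f by (intro N.frag_sum_diff) auto
    have "(\<Sum>k\<in>Q. frag_of (e k, ?g k (x - y)) - (frag_of (e k, ?g k x) - frag_of (e k, ?g k y))) \<in> ker"
      using diff e by (intro sum_ker) (auto simp: gd gc intro!: diffr)
    from ker_diff[OF ker_diff[OF diff(3,4)] this] show ?case
      by (simp add: sum_subtractf sum.distrib algebra_simps)
  next
    case (gen p)
    then obtain m n where p: "p = (m, n)" "m \<in> carrier M" "n \<in> carrier N" by auto
    have g: "?g k (frag_of p) = f k m \<odot>\<^bsub>N\<^esub> n" if "k \<in> Q" for k
      using p f that by simp
    have sumM: "frag_of (\<Oplus>\<^bsub>M\<^esub>k\<in>T. f k m \<odot>\<^bsub>M\<^esub> e k, n) - (\<Sum>k\<in>T. frag_of (f k m \<odot>\<^bsub>M\<^esub> e k, n)) \<in> ker"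
      if "finite T" "T \<subseteq> Q" for T
      using that
    proof (induction T rule: finite_induct)
      case empty
      then show ?case using zl p by simp
    next
      case (insert k T)
      let ?m = "\<Oplus>\<^bsub>M\<^esub>k\<in>T. f k m \<odot>\<^bsub>M\<^esub> e k"
      have mc: "?m \<in> carrier M" using insert e f p by (intro M.finsum_in) auto
      have "frag_of (f k m \<odot>\<^bsub>M\<^esub> e k \<oplus>\<^bsub>M\<^esub> ?m, n) - frag_of (f k m \<odot>\<^bsub>M\<^esub> e k, n) - frag_of (?m, n) \<in> ker"
        using insert e f p mc by (intro addl) auto
      moreover have "frag_of (?m, n) - (\<Sum>k\<in>T. frag_of (f k m \<odot>\<^bsub>M\<^esub> e k, n)) \<in> ker" using insert by auto
      moreover have "(\<Oplus>\<^bsub>M\<^esub>k\<in>insert k T. f k m \<odot>\<^bsub>M\<^esub> e k) = f k m \<odot>\<^bsub>M\<^esub> e k \<oplus>\<^bsub>M\<^esub> ?m"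
        using insert e f p by (intro M.finsum_insert) auto
      ultimately show ?case using insert(1,2)
        ker_add[of "frag_of (f k m \<odot>\<^bsub>M\<^esub> e k \<oplus>\<^bsub>M\<^esub> ?m, n) - frag_of (f k m \<odot>\<^bsub>M\<^esub> e k, n) - frag_of (?m, n)"
          "frag_of (?m, n) - (\<Sum>k\<in>T. frag_of (f k m \<odot>\<^bsub>M\<^esub> e k, n))"]
        by (simp add: algebra_simps)
    qed
    have 1: "frag_of (m, n) - (\<Sum>k\<in>Q. frag_of (f k m \<odot>\<^bsub>M\<^esub> e k, n)) \<in> ker"
      using sumM[of Q] e(1) expansion[OF p(2)] by simp
    have "(\<Sum>k\<in>Q. frag_of (f k m \<odot>\<^bsub>M\<^esub> e k, n) - frag_of (e k, f k m \<odot>\<^bsub>N\<^esub> n)) \<in> ker"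
      using e f p by (intro sum_ker bal) auto
    from ker_add[OF 1 this] have "frag_of (m, n) - (\<Sum>k\<in>Q. frag_of (e k, f k m \<odot>\<^bsub>N\<^esub> n)) \<in> ker"
      by (simp add: sum_subtractf)
    moreover have "(\<Sum>k\<in>Q. frag_of (e k, ?g k (frag_of p))) = (\<Sum>k\<in>Q. frag_of (e k, f k m \<odot>\<^bsub>N\<^esub> n))"
      using g by (intro sum.cong) auto
    ultimately show ?case by (simp only: p(1))
  qed
  moreover have "(\<Sum>k\<in>Q. frag_of (e k, ?g k x)) \<in> ker"
    using zero e zr by (intro sum_ker) auto
  ultimately show ?thesis using ker_add by fastforce
qed

end

lemma (in abelian_group) frag_sum_sum:
  assumes "finite I" "\<And>i. i \<in> I \<Longrightarrow> Poly_Mapping.keys (f i) \<subseteq> S" "\<And>p. p \<in> S \<Longrightarrow> \<beta> p \<in> carrier G"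
  shows "frag_sum \<beta> (sum f I) = (\<Oplus>i\<in>I. frag_sum \<beta> (f i))"
proof -
  have c: "frag_sum \<beta> (f i) \<in> carrier G" if "i \<in> I" for i
    using that assms(2,3) by (intro frag_sum_closed) blast
  have "Poly_Mapping.keys (sum f I) \<subseteq> S \<and> frag_sum \<beta> (sum f I) = (\<Oplus>i\<in>I. frag_sum \<beta> (f i))"
    using assms(1,2) c
  proof (induction I rule: finite_induct)
    case (insert i I)
    then have IH: "Poly_Mapping.keys (sum f I) \<subseteq> S" "frag_sum \<beta> (sum f I) = (\<Oplus>i\<in>I. frag_sum \<beta> (f i))" by auto
    have "frag_sum \<beta> (f i + sum f I) = frag_sum \<beta> (f i) \<oplus> frag_sum \<beta> (sum f I)"
      using IH(1) insert(4) assms(3) by (intro frag_sum_add) blast+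
    moreover have "Poly_Mapping.keys (f i + sum f I) \<subseteq> S" using IH(1) insert(4) keys_add[of "f i" "sum f I"] by auto
    ultimately show ?case using insert IH(2) by (simp add: Pi_def)
  qed simp
  then show ?thesis by simp
qed

section \<open>Dimension of sequence spaces\<close>

text \<open>
  The sequences in \<open>V\<close> of length \<open>m\<close> have dimension \<open>m \<cdot> dim V\<close>.  The induction step applies rank-nullity
  to the last coordinate, whose kernel consists of the sequences of length \<open>m\<close>.  The statement is for every
  module record \<open>X\<close> with these operations, because the multiplication of the record plays no role.
\<close>

lemma seq_space_dim:
  fixes R :: "('a, 'm) ring_scheme" and V :: "('a, 'b, 'p) module_scheme" and X :: "('a, nat \<Rightarrow> 'b, 'q) module_scheme"
  assumes V: "vectorspace R V" "vectorspace.fin_dim R V"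
    and X: "carrier X = skew_polys_below V m" "\<zero>\<^bsub>X\<^esub> = (\<lambda>i. \<zero>\<^bsub>V\<^esub>)"
      "\<And>g h. g \<oplus>\<^bsub>X\<^esub> h = (\<lambda>i. g i \<oplus>\<^bsub>V\<^esub> h i)" "\<And>a g. a \<odot>\<^bsub>X\<^esub> g = (\<lambda>i. a \<odot>\<^bsub>V\<^esub> g i)"
  shows "vectorspace R X \<and> vectorspace.fin_dim R X \<and> vectorspace.dim R X = m * vectorspace.dim R V"
  using X
proof (induction m arbitrary: X)
  interpret V: vectorspace R V by fact
  have mem: "g \<in> skew_polys_below V m \<longleftrightarrow> (\<forall>i. g i \<in> carrier V) \<and> (\<forall>i\<ge>m. g i = \<zero>\<^bsub>V\<^esub>)" for g m
    unfolding skew_polys_below_def up_def bound_def by (auto intro: less_imp_le)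
  have vs: "vectorspace R X" if X: "carrier X = skew_polys_below V m" "\<zero>\<^bsub>X\<^esub> = (\<lambda>i. \<zero>\<^bsub>V\<^esub>)"
      "\<And>g h. g \<oplus>\<^bsub>X\<^esub> h = (\<lambda>i. g i \<oplus>\<^bsub>V\<^esub> h i)" "\<And>a g. a \<odot>\<^bsub>X\<^esub> g = (\<lambda>i. a \<odot>\<^bsub>V\<^esub> g i)"
    for X :: "('a, nat \<Rightarrow> 'b, 'q) module_scheme" and m
  proof (intro vectorspace.intro moduleI)
    show "abelian_group X"
    proof (rule abelian_groupI)
      fix x assume "x \<in> carrier X"
      then show "\<exists>y\<in>carrier X. y \<oplus>\<^bsub>X\<^esub> x = \<zero>\<^bsub>X\<^esub>"
        by (intro bexI[of _ "\<lambda>i. \<ominus>\<^bsub>V\<^esub> x i"]) (auto simp: X mem V.module.M.l_neg)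
    qed (auto simp: X mem V.module.M.a_ac)
  qed (auto simp: X mem V.smult_l_distr V.smult_r_distr V.smult_assoc1 V.R.is_cring V.field_axioms)
  {
    case 0
    interpret X: vectorspace R X by (rule vs[OF 0])
    have X0: "carrier X = {\<zero>\<^bsub>X\<^esub>}" using 0 by (auto simp: mem)
    have g: "X.gen_set {\<zero>\<^bsub>X\<^esub>}"
      using X.in_own_span[of "{\<zero>\<^bsub>X\<^esub>}"] X.span_is_subset2[of "{\<zero>\<^bsub>X\<^esub>}"] X0 by auto
    then have "X.fin_dim" unfolding X.fin_dim_def by (intro exI[of _ "{\<zero>\<^bsub>X\<^esub>}"]) auto
    then show ?case using X.dim0I[OF g] X.vectorspace_axioms by simp
  next
    case (Suc m)
    define Y where "Y = X\<lparr>carrier := skew_polys_below V m\<rparr>"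
    have Y: "carrier Y = skew_polys_below V m" "\<zero>\<^bsub>Y\<^esub> = (\<lambda>i. \<zero>\<^bsub>V\<^esub>)"
      "\<And>g h. g \<oplus>\<^bsub>Y\<^esub> h = (\<lambda>i. g i \<oplus>\<^bsub>V\<^esub> h i)" "\<And>a g. a \<odot>\<^bsub>Y\<^esub> g = (\<lambda>i. a \<odot>\<^bsub>V\<^esub> g i)"
      by (simp_all add: Y_def Suc)
    have IH: "vectorspace R Y" "vectorspace.fin_dim R Y" "vectorspace.dim R Y = m * vectorspace.dim R V"
      using Suc.IH[OF Y] by auto
    interpret X: vectorspace R X by (rule vs[OF Suc.prems])
    interpret Y: vectorspace R Y by (rule IH(1))
    have sub: "submodule R (skew_polys_below V m) X"
      by (intro submodule.intro X.module_axioms) (auto simp: Suc.prems mem)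
    have mon: "skew_monom V a m \<in> carrier X" if "a \<in> carrier V" for a
      using that by (auto simp: Suc.prems mem skew_monom_def)
    obtain GY where GY: "finite GY" "GY \<subseteq> carrier Y" "Y.gen_set GY" using IH(2) unfolding Y.fin_dim_def by auto
    obtain GV where GV: "finite GV" "GV \<subseteq> carrier V" "V.gen_set GV" using V(2) unfolding V.fin_dim_def by auto
    define G where "G = GY \<union> (\<lambda>a. skew_monom V a m) ` GV"
    have G: "finite G" "G \<subseteq> carrier X"
      using GY GV mon by (auto simp: G_def Y Suc.prems mem)
    define W where "W = X.span G"
    interpret W: submodule R W X unfolding W_def using G by (intro X.span_is_submodule)
    have GW: "G \<subseteq> W" unfolding W_def using G by (intro X.in_own_span)
    have "X.span GY = skew_polys_below V m"
      using X.span_li_not_depend(1)[OF _ sub, of GY] GY by (simp add: Y_def)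
    then have YW: "skew_polys_below V m \<subseteq> W"
      using X.span_is_monotone[of GY G] by (auto simp: W_def G_def)
    have "submodule R {a \<in> carrier V. skew_monom V a m \<in> W} V"
    proof (intro submodule.intro V.module_axioms)
      fix a b assume ab: "a \<in> {a \<in> carrier V. skew_monom V a m \<in> W}" "b \<in> {a \<in> carrier V. skew_monom V a m \<in> W}"
      have "skew_monom V (a \<oplus>\<^bsub>V\<^esub> b) m = skew_monom V a m \<oplus>\<^bsub>X\<^esub> skew_monom V b m"
        by (auto simp: Suc.prems skew_monom_def fun_eq_iff)
      then show "a \<oplus>\<^bsub>V\<^esub> b \<in> {a \<in> carrier V. skew_monom V a m \<in> W}" using ab by simp
    next
      have "skew_monom V \<zero>\<^bsub>V\<^esub> m = \<zero>\<^bsub>X\<^esub>" by (auto simp: Suc.prems skew_monom_def)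
      then show "\<zero>\<^bsub>V\<^esub> \<in> {a \<in> carrier V. skew_monom V a m \<in> W}" by simp
    next
      fix c a assume ca: "c \<in> carrier R" "a \<in> {a \<in> carrier V. skew_monom V a m \<in> W}"
      have "skew_monom V (c \<odot>\<^bsub>V\<^esub> a) m = c \<odot>\<^bsub>X\<^esub> skew_monom V a m"
        using ca by (auto simp: Suc.prems skew_monom_def fun_eq_iff)
      then show "c \<odot>\<^bsub>V\<^esub> a \<in> {a \<in> carrier V. skew_monom V a m \<in> W}" using ca by simp
    qed auto
    then have "V.span GV \<subseteq> {a \<in> carrier V. skew_monom V a m \<in> W}"
      using GV GW by (intro V.span_is_subset) (auto simp: G_def)
    then have monW: "skew_monom V a m \<in> W" if "a \<in> carrier V" for a using GV that by auto
    have "x \<in> W" if x: "x \<in> carrier X" for x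
    proof -
      have "(\<lambda>i. if i < m then x i else \<zero>\<^bsub>V\<^esub>) \<in> W" using YW x by (auto simp: mem Suc.prems)
      moreover have "skew_monom V (x m) m \<in> W" using x monW by (auto simp: mem Suc.prems)
      moreover have "x = (\<lambda>i. if i < m then x i else \<zero>\<^bsub>V\<^esub>) \<oplus>\<^bsub>X\<^esub> skew_monom V (x m) m"
        using x by (auto simp: mem Suc.prems skew_monom_def fun_eq_iff)
      ultimately show ?thesis by (metis W.m_closed)
    qed
    then have "X.span G = carrier X" using W.subset by (auto simp: W_def)
    then have fd: "X.fin_dim" unfolding X.fin_dim_def using G by auto
    interpret T: linear_map R X V "\<lambda>g. g m"
      by (intro linear_map.intro X.vectorspace_axioms V.vectorspace_axioms mod_hom.intro mod_hom_axioms.intro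
          X.module_axioms V.module_axioms) (auto simp: module_hom_def Suc.prems mem)
    have ker: "T.kerT = skew_polys_below V m"
      unfolding T.ker_def by (auto simp: Suc.prems mem) (metis Suc_leI le_neq_implies_less)
    have "a \<in> T.imT" if "a \<in> carrier V" for a
      unfolding T.im_def using mon[OF that] by (intro image_eqI[of _ _ "skew_monom V a m"]) (auto simp: skew_monom_def)
    then have im: "T.imT = carrier V" unfolding T.im_def by auto
    show ?case
      using T.rank_nullity[OF fd] IH(3) fd X.vectorspace_axioms by (simp add: ker im Y_def[symmetric])
  }
qed

section \<open>Transport of structure\<close>

lemma algebra_transport:
  assumes K: "algebra F K" and bij: "bij_betw h (carrier K) (carrier B)"
    and hom: "\<And>x y. \<lbrakk>x \<in> carrier K; y \<in> carrier K\<rbrakk> \<Longrightarrow> h (x \<otimes>\<^bsub>K\<^esub> y) = h x \<otimes>\<^bsub>B\<^esub> h y"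
      "\<And>x y. \<lbrakk>x \<in> carrier K; y \<in> carrier K\<rbrakk> \<Longrightarrow> h (x \<oplus>\<^bsub>K\<^esub> y) = h x \<oplus>\<^bsub>B\<^esub> h y"
      "h \<one>\<^bsub>K\<^esub> = \<one>\<^bsub>B\<^esub>" "h \<zero>\<^bsub>K\<^esub> = \<zero>\<^bsub>B\<^esub>"
      "\<And>a x. \<lbrakk>a \<in> carrier F; x \<in> carrier K\<rbrakk> \<Longrightarrow> h (a \<odot>\<^bsub>K\<^esub> x) = a \<odot>\<^bsub>B\<^esub> h x"
  shows "algebra F B"
proof -
  interpret K: algebra F K by fact
  have c: "h x \<in> carrier B" if "x \<in> carrier K" for x using bij that by (auto simp: bij_betw_def)
  have s: "\<exists>x\<in>carrier K. y = h x" if "y \<in> carrier B" for y using bij that by (auto simp: bij_betw_def)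
  note hs = hom(1,2,5)[symmetric] hom(3,4)[symmetric]
  show ?thesis
  proof (rule algebraI)
    show "cring B"
    proof (rule cringI)
      show "abelian_group B"
      proof (rule abelian_groupI)
        fix y assume "y \<in> carrier B"
        then obtain x where "x \<in> carrier K" "y = h x" using s by auto
        then show "\<exists>z\<in>carrier B. z \<oplus>\<^bsub>B\<^esub> y = \<zero>\<^bsub>B\<^esub>"
          using c by (intro bexI[of _ "h (\<ominus>\<^bsub>K\<^esub> x)"]) (auto simp: hs K.l_neg)
      qed (use c in \<open>auto dest!: s simp: hs K.M.a_ac\<close>)
      show "Group.comm_monoid B"
        by (rule comm_monoidI) (use c in \<open>auto dest!: s simp: hs K.m_ac\<close>)
    qed (use c in \<open>auto dest!: s simp: hs K.l_distr\<close>)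
  qed (use c in \<open>auto dest!: s simp: hs K.smult_l_distr K.smult_r_distr K.smult_assoc1 K.smult_assoc2 K.R_cring\<close>)
qed

lemma finite_separable_transport:
  assumes L: "finite_separable_field_extension F K" and F: "field F"
    and bij: "bij_betw h (carrier K) (carrier B)"
    and hom: "\<And>x y. \<lbrakk>x \<in> carrier K; y \<in> carrier K\<rbrakk> \<Longrightarrow> h (x \<otimes>\<^bsub>K\<^esub> y) = h x \<otimes>\<^bsub>B\<^esub> h y"
      "\<And>x y. \<lbrakk>x \<in> carrier K; y \<in> carrier K\<rbrakk> \<Longrightarrow> h (x \<oplus>\<^bsub>K\<^esub> y) = h x \<oplus>\<^bsub>B\<^esub> h y"
      "h \<one>\<^bsub>K\<^esub> = \<one>\<^bsub>B\<^esub>" "h \<zero>\<^bsub>K\<^esub> = \<zero>\<^bsub>B\<^esub>"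
      "\<And>a x. \<lbrakk>a \<in> carrier F; x \<in> carrier K\<rbrakk> \<Longrightarrow> h (a \<odot>\<^bsub>K\<^esub> x) = a \<odot>\<^bsub>B\<^esub> h x"
  shows "finite_separable_field_extension F B"
proof -
  interpret F: field F by fact
  interpret K: algebra F K using L by (simp add: finite_separable_field_extension_def)
  interpret KF: field K using L by (simp add: finite_separable_field_extension_def)
  interpret B: algebra F B by (rule algebra_transport[OF K.algebra_axioms bij hom])
  have c [simp]: "h x \<in> carrier B" if "x \<in> carrier K" for x using bij that by (auto simp: bij_betw_def)
  have s: "\<exists>x\<in>carrier K. y = h x" if "y \<in> carrier B" for y using bij that by (auto simp: bij_betw_def)
  have inj: "x = y" if "x \<in> carrier K" "y \<in> carrier K" "h x = h y" for x y
    using bij that by (auto simp: bij_betw_def inj_on_def)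
  have field: "field B"
  proof (rule B.cring_fieldI2)
    show "\<zero>\<^bsub>B\<^esub> \<noteq> \<one>\<^bsub>B\<^esub>" using inj[of "\<zero>\<^bsub>K\<^esub>" "\<one>\<^bsub>K\<^esub>"] hom(3,4) by auto
  next
    fix y assume y: "y \<in> carrier B" "y \<noteq> \<zero>\<^bsub>B\<^esub>"
    then obtain x where x: "x \<in> carrier K" "y = h x" using s by auto
    then have "x \<in> Units K" using y hom(4) KF.field_Units by auto
    then have "y \<otimes>\<^bsub>B\<^esub> h (inv\<^bsub>K\<^esub> x) = \<one>\<^bsub>B\<^esub>" using x hom(1)[of x "inv\<^bsub>K\<^esub> x"] hom(3) by simp
    then show "\<exists>b\<in>carrier B. y \<otimes>\<^bsub>B\<^esub> b = \<one>\<^bsub>B\<^esub>" using \<open>x \<in> Units K\<close> by auto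
  qed
  have lin: "linear_map F K B h"
    using hom F.field_axioms K.module B.module
    by (intro linear_map.intro vectorspace.intro mod_hom.intro mod_hom_axioms.intro) (auto simp: module_hom_def)
  have fin: "vectorspace.fin_dim F B"
    using linear_map.surj_fin_dim[OF lin] L bij by (auto simp: finite_separable_field_extension_def bij_betw_def)
  have pow: "h (x [^]\<^bsub>K\<^esub> i) = h x [^]\<^bsub>B\<^esub> i" if "x \<in> carrier K" for x and i :: nat
    using that by (induction i) (auto simp: hom)
  have sep: "separable_element F B y" if y: "y \<in> carrier B" for y
  proof -
    obtain x where x: "x \<in> carrier K" "y = h x" using s y by auto
    then obtain p where p: "p \<in> carrier (UP F)" "Divisibility.irreducible (UP F) p" "p (deg F p) = \<one>\<^bsub>F\<^esub>"
      "UnivPoly.eval F K (\<lambda>a. a \<odot>\<^bsub>K\<^esub> \<one>\<^bsub>K\<^esub>) x p = \<zero>\<^bsub>K\<^esub>" "separable_poly F p"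
      using L by (auto simp: finite_separable_field_extension_def separable_element_def)
    have pc: "p i \<in> carrier F" for i using p(1) by (auto simp: UP_def up_def)
    have cf: "coeff (UP F) p i = p i" for i using p(1) by (simp add: UP_def)
    have "UnivPoly.eval F B (\<lambda>a. a \<odot>\<^bsub>B\<^esub> \<one>\<^bsub>B\<^esub>) y p = (\<Oplus>\<^bsub>B\<^esub>i\<in>{..deg F p}. (p i \<odot>\<^bsub>B\<^esub> \<one>\<^bsub>B\<^esub>) \<otimes>\<^bsub>B\<^esub> y [^]\<^bsub>B\<^esub> i)"
      using p(1) by (simp add: UnivPoly.eval_def cf)
    also have "\<dots> = (\<Oplus>\<^bsub>B\<^esub>i\<in>{..deg F p}. h ((p i \<odot>\<^bsub>K\<^esub> \<one>\<^bsub>K\<^esub>) \<otimes>\<^bsub>K\<^esub> x [^]\<^bsub>K\<^esub> i))"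
      using x pc by (intro B.finsum_eqI) (auto simp: hom pow)
    also have "\<dots> = h (\<Oplus>\<^bsub>K\<^esub>i\<in>{..deg F p}. (p i \<odot>\<^bsub>K\<^esub> \<one>\<^bsub>K\<^esub>) \<otimes>\<^bsub>K\<^esub> x [^]\<^bsub>K\<^esub> i)"
      using x pc by (intro K.finsum_map[symmetric]) (auto simp: hom B.abelian_monoid_axioms)
    also have "(\<Oplus>\<^bsub>K\<^esub>i\<in>{..deg F p}. (p i \<odot>\<^bsub>K\<^esub> \<one>\<^bsub>K\<^esub>) \<otimes>\<^bsub>K\<^esub> x [^]\<^bsub>K\<^esub> i) = \<zero>\<^bsub>K\<^esub>"
      using p(1,4) by (simp add: UnivPoly.eval_def cf)
    finally have "UnivPoly.eval F B (\<lambda>a. a \<odot>\<^bsub>B\<^esub> \<one>\<^bsub>B\<^esub>) y p = \<zero>\<^bsub>B\<^esub>" using hom(4) by simp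
    then show ?thesis using p unfolding separable_element_def by blast
  qed
  show ?thesis
    unfolding finite_separable_field_extension_def using B.algebra_axioms field fin sep by blast
qed

text \<open>The algebra structure transported along an injection \<open>\<iota>\<close> of element types.\<close>

definition image_algebra :: "('b \<Rightarrow> 'c) \<Rightarrow> ('a, 'b) module \<Rightarrow> ('a, 'c) module" where
  "image_algebra \<iota> L =
    \<lparr>carrier = \<iota> ` carrier L, monoid.mult = (\<lambda>x y. \<iota> (inv_into UNIV \<iota> x \<otimes>\<^bsub>L\<^esub> inv_into UNIV \<iota> y)), one = \<iota> \<one>\<^bsub>L\<^esub>,
     ring.zero = \<iota> \<zero>\<^bsub>L\<^esub>, add = (\<lambda>x y. \<iota> (inv_into UNIV \<iota> x \<oplus>\<^bsub>L\<^esub> inv_into UNIV \<iota> y)), smult = (\<lambda>a x. \<iota> (a \<odot>\<^bsub>L\<^esub> inv_into UNIV \<iota> x))\<rparr>"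

text \<open>
  The field factors of an etale algebra live on its own element type, so an isomorphism \<open>h\<close> to an algebra \<open>B\<close>
  on another type needs, besides, an injection \<open>\<iota>\<close> to move the factors along.
\<close>

lemma etale_transport:
  fixes F :: "('a, 'm) ring_scheme" and K :: "('a, 'b, 'p) module_scheme" and B :: "('a, 'c, 'q) module_scheme"
    and \<iota> :: "'b \<Rightarrow> 'c"
  assumes K: "etale_algebra F K" and F: "field F" and \<iota>: "inj \<iota>"
    and bij: "bij_betw h (carrier K) (carrier B)"
    and hom: "\<And>x y. \<lbrakk>x \<in> carrier K; y \<in> carrier K\<rbrakk> \<Longrightarrow> h (x \<otimes>\<^bsub>K\<^esub> y) = h x \<otimes>\<^bsub>B\<^esub> h y"
      "\<And>x y. \<lbrakk>x \<in> carrier K; y \<in> carrier K\<rbrakk> \<Longrightarrow> h (x \<oplus>\<^bsub>K\<^esub> y) = h x \<oplus>\<^bsub>B\<^esub> h y"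
      "h \<one>\<^bsub>K\<^esub> = \<one>\<^bsub>B\<^esub>" "h \<zero>\<^bsub>K\<^esub> = \<zero>\<^bsub>B\<^esub>"
      "\<And>a x. \<lbrakk>a \<in> carrier F; x \<in> carrier K\<rbrakk> \<Longrightarrow> h (a \<odot>\<^bsub>K\<^esub> x) = a \<odot>\<^bsub>B\<^esub> h x"
  shows "etale_algebra F B"
proof -
  interpret K: algebra F K using K by (simp add: etale_algebra_def)
  interpret B: algebra F B by (rule algebra_transport[OF K.algebra_axioms bij hom])
  obtain r and L :: "nat \<Rightarrow> ('a, 'b) module" where L: "\<And>i. i < r \<Longrightarrow> finite_separable_field_extension F (L i)"
    and "alg_isomorphic F K (prod_algebra r L)"
    using K by (auto simp: etale_algebra_def)
  then obtain k where k: "k \<in> alg_iso F K (prod_algebra r L)" by (auto simp: alg_isomorphic_def)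
  define L' where "L' = (\<lambda>i. image_algebra \<iota> (L i))"
  have inv\<iota> [simp]: "inv_into UNIV \<iota> (\<iota> x) = x" for x using \<iota> by simp
  have L'_simps: "carrier (L' i) = \<iota> ` carrier (L i)" "\<iota> x \<otimes>\<^bsub>L' i\<^esub> \<iota> y = \<iota> (x \<otimes>\<^bsub>L i\<^esub> y)" "\<one>\<^bsub>L' i\<^esub> = \<iota> \<one>\<^bsub>L i\<^esub>"
    "\<zero>\<^bsub>L' i\<^esub> = \<iota> \<zero>\<^bsub>L i\<^esub>" "\<iota> x \<oplus>\<^bsub>L' i\<^esub> \<iota> y = \<iota> (x \<oplus>\<^bsub>L i\<^esub> y)" "a \<odot>\<^bsub>L' i\<^esub> \<iota> x = \<iota> (a \<odot>\<^bsub>L i\<^esub> x)" for i x y a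
    by (simp_all add: L'_def image_algebra_def)
  have L': "finite_separable_field_extension F (L' i)" if "i < r" for i
  proof (rule finite_separable_transport[OF L[OF that] F])
    show "bij_betw \<iota> (carrier (L i)) (carrier (L' i))"
      using \<iota> by (auto simp: L'_simps bij_betw_def intro: inj_on_subset)
  qed (simp_all add: L'_simps)
  have kb: "bij_betw k (carrier K) (carrier (prod_algebra r L))" and kh: "k \<in> ring_hom K (prod_algebra r L)"
    and ks: "\<And>a x. \<lbrakk>a \<in> carrier F; x \<in> carrier K\<rbrakk> \<Longrightarrow> k (a \<odot>\<^bsub>K\<^esub> x) = a \<odot>\<^bsub>prod_algebra r L\<^esub> k x"
    using k by (auto simp: alg_iso_def ring_iso_def)
  have kc: "k x i \<in> carrier (L i)" if "x \<in> carrier K" "i < r" for x i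
    using ring_hom_closed[OF kh that(1)] that(2) by (auto simp: prod_algebra_def)
  define g where "g = inv_into (carrier K) h"
  have gh: "g (h x) = x" if "x \<in> carrier K" for x
    unfolding g_def using bij that by (simp add: bij_betw_def inv_into_f_f)
  have gb: "bij_betw g (carrier B) (carrier K)" unfolding g_def by (rule bij_betw_inv_into[OF bij])
  have s: "\<exists>x\<in>carrier K. y = h x" if "y \<in> carrier B" for y using bij that by (auto simp: bij_betw_def)
  define k' where "k' = (\<lambda>y. \<lambda>i\<in>{..<r}. \<iota> (k (g y) i))"
  have hc: "h x \<in> carrier B" if "x \<in> carrier K" for x using bij that by (auto simp: bij_betw_def)
  have "k' \<in> alg_iso F B (prod_algebra r L')"
    unfolding alg_iso_def ring_iso_def
  proof (intro CollectI conjI ballI)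
    show "k' \<in> ring_hom B (prod_algebra r L')"
    proof (rule ring_hom_memI)
      fix y assume "y \<in> carrier B"
      then obtain x where "x \<in> carrier K" "y = h x" using s by auto
      then show "k' y \<in> carrier (prod_algebra r L')" by (auto simp: k'_def prod_algebra_def gh kc L'_simps)
    next
      fix y z assume "y \<in> carrier B" "z \<in> carrier B"
      then obtain x w where xw: "x \<in> carrier K" "y = h x" "w \<in> carrier K" "z = h w" using s by metis
      show "k' (y \<otimes>\<^bsub>B\<^esub> z) = k' y \<otimes>\<^bsub>prod_algebra r L'\<^esub> k' z"
        using xw ring_hom_mult[OF kh, of x w]
        by (simp add: hom(1)[symmetric] gh k'_def, simp add: prod_algebra_def L'_simps cong: restrict_cong)
      show "k' (y \<oplus>\<^bsub>B\<^esub> z) = k' y \<oplus>\<^bsub>prod_algebra r L'\<^esub> k' z"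
        using xw ring_hom_add[OF kh, of x w]
        by (simp add: hom(2)[symmetric] gh k'_def, simp add: prod_algebra_def L'_simps cong: restrict_cong)
    next
      show "k' \<one>\<^bsub>B\<^esub> = \<one>\<^bsub>prod_algebra r L'\<^esub>"
        using ring_hom_one[OF kh]
        by (simp add: hom(3)[symmetric] gh k'_def, simp add: prod_algebra_def L'_simps cong: restrict_cong)
    qed
    show "bij_betw k' (carrier B) (carrier (prod_algebra r L'))"
      unfolding bij_betw_def
    proof
      show "inj_on k' (carrier B)"
      proof (rule inj_onI)
        fix y z assume yz: "y \<in> carrier B" "z \<in> carrier B" "k' y = k' z"
        then obtain x w where xw: "x \<in> carrier K" "y = h x" "w \<in> carrier K" "z = h w" using s by metis
        have "k x i = k w i" if "i < r" for i
          using fun_cong[OF yz(3), of i] that xw \<iota> by (simp add: k'_def gh inj_eq)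
        moreover have "k x \<in> carrier (prod_algebra r L)" "k w \<in> carrier (prod_algebra r L)"
          using ring_hom_closed[OF kh] xw by auto
        ultimately have "k x = k w"
          by (intro PiE_ext[of "k x" "{..<r}" "\<lambda>i. carrier (L i)"]) (auto simp: prod_algebra_def)
        then show "y = z" using kb xw by (auto simp: bij_betw_def inj_on_def)
      qed
      show "k' ` carrier B = carrier (prod_algebra r L')"
      proof (intro equalityI subsetI)
        fix w assume "w \<in> k' ` carrier B"
        then obtain x where "x \<in> carrier K" "w = k' (h x)" using s by auto
        then show "w \<in> carrier (prod_algebra r L')" by (auto simp: k'_def prod_algebra_def gh kc L'_simps)
      next
        fix w assume w: "w \<in> carrier (prod_algebra r L')"
        then have wi: "\<exists>x\<in>carrier (L i). w i = \<iota> x" if "i < r" for i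
          using that by (auto simp: prod_algebra_def L'_simps PiE_def Pi_def)
        have "(\<lambda>i\<in>{..<r}. inv_into UNIV \<iota> (w i)) \<in> carrier (prod_algebra r L)"
          using wi by (auto simp: prod_algebra_def) (metis inv\<iota>)
        then obtain x where x: "x \<in> carrier K" "k x = (\<lambda>i\<in>{..<r}. inv_into UNIV \<iota> (w i))"
          using kb unfolding bij_betw_def by (metis imageE)
        have "k' (h x) = (\<lambda>i\<in>{..<r}. w i)"
          unfolding k'_def using x wi by (intro restrict_ext) (auto simp: gh, metis inv\<iota>)
        also have "\<dots> = w" using w by (auto simp: prod_algebra_def PiE_def extensional_restrict)
        finally show "w \<in> k' ` carrier B" using hc[OF x(1)] by blast
      qed
    qed
    fix a y assume a: "a \<in> carrier F" and "y \<in> carrier B"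
    then obtain x where x: "x \<in> carrier K" "y = h x" using s by auto
    show "k' (a \<odot>\<^bsub>B\<^esub> y) = a \<odot>\<^bsub>prod_algebra r L'\<^esub> k' y"
      using x a ks[OF a x(1)]
      by (simp add: hom(5)[symmetric] gh k'_def, simp add: prod_algebra_def L'_simps cong: restrict_cong)
  qed
  then have "alg_isomorphic F B (prod_algebra r L')" by (auto simp: alg_isomorphic_def)
  then show ?thesis using L' B.algebra_axioms unfolding etale_algebra_def by blast
qed

lemma (in abelian_group) eq_minusI:
  assumes "a \<in> carrier G" "b \<in> carrier G" "a \<oplus> b = c"
  shows "a = c \<ominus> b"
  using assms by (auto simp: a_minus_def a_assoc r_neg)

section \<open>Nonassociative cyclic algebras are semiassociative\<close>

context cyclic_setup
begin

text \<open>The constant polynomials.\<close>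

abbreviation const :: "'b \<Rightarrow> nat \<Rightarrow> 'b" where "const a \<equiv> skew_monom K a 0"

lemma const_apply: "const a i = (if i = 0 then a else \<zero>)"
  by (simp add: skew_monom_def)

lemma scale_in: "\<lbrakk>a \<in> carrier K; g \<in> P\<rbrakk> \<Longrightarrow> (\<lambda>m. a \<otimes> g m) \<in> P" "\<lbrakk>a \<in> carrier K; g \<in> P\<rbrakk> \<Longrightarrow> (\<lambda>m. g m \<otimes> s m a) \<in> P"
  by (auto simp: mem_below)

lemma A_const_left: "\<lbrakk>d \<in> carrier K; a \<in> carrier K; g \<in> P\<rbrakk> \<Longrightarrow> const a \<otimes>\<^bsub>A d\<^esub> g = (\<lambda>m. a \<otimes> g m)"
  by (simp add: A_mult cmul_const_left)

lemma A_const_right: "\<lbrakk>d \<in> carrier K; a \<in> carrier K; g \<in> P\<rbrakk> \<Longrightarrow> g \<otimes>\<^bsub>A d\<^esub> const a = (\<lambda>m. g m \<otimes> s m a)"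
  by (simp add: A_mult cmul_const_right)

text \<open>
  From the left, a constant \<open>a\<close> multiplies the coefficients by \<open>a\<close>; from the right, it multiplies the
  coefficient of \<open>t\<^sup>m\<close> by \<open>\<sigma>\<^sup>m(a)\<close>.  The formula for the product is compatible with both.
\<close>

lemma const_nucleus:
  assumes d: "d \<in> carrier K" and a: "a \<in> carrier K"
  shows "const a \<in> nucleus (A d)"
proof -
  interpret AA: nonassoc_algebra F "A d" by (rule A_nonassoc_algebra[OF d])
  show ?thesis
    unfolding AA.mem_nucleus
  proof (intro conjI ballI)
    show "const a \<in> carrier (A d)" using a by simp
  next
    fix g h assume "g \<in> carrier (A d)" "h \<in> carrier (A d)"
    then have gh: "g \<in> P" "h \<in> P" by auto
    note c = gh scale_in(1)[OF a gh(1)] scale_in(1)[OF a gh(2)] scale_in(2)[OF a gh(1)] scale_in(2)[OF a gh(2)]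
    show "(const a \<otimes>\<^bsub>A d\<^esub> g) \<otimes>\<^bsub>A d\<^esub> h = const a \<otimes>\<^bsub>A d\<^esub> (g \<otimes>\<^bsub>A d\<^esub> h)"
      using c d a by (simp add: A_const_left A_mult cmul_scale_left cmul_const_left)
    show "(g \<otimes>\<^bsub>A d\<^esub> const a) \<otimes>\<^bsub>A d\<^esub> h = g \<otimes>\<^bsub>A d\<^esub> (const a \<otimes>\<^bsub>A d\<^esub> h)"
      using c d a by (simp add: A_const_left A_const_right) (simp add: A_mult cmul_scale_mid)
    show "(g \<otimes>\<^bsub>A d\<^esub> h) \<otimes>\<^bsub>A d\<^esub> const a = g \<otimes>\<^bsub>A d\<^esub> (h \<otimes>\<^bsub>A d\<^esub> const a)"
      using c d a by (simp add: A_const_right A_mult cmul_scale_right cmul_const_right)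
  qed
qed

lemma const_mult: "\<lbrakk>d \<in> carrier K; a \<in> carrier K; b \<in> carrier K\<rbrakk> \<Longrightarrow> const (a \<otimes> b) = const a \<otimes>\<^bsub>A d\<^esub> const b"
  by (simp add: A_const_left) (auto simp: fun_eq_iff skew_monom_def)

lemma const_add: "\<lbrakk>a \<in> carrier K; b \<in> carrier K\<rbrakk> \<Longrightarrow> const (a \<oplus> b) = const a \<oplus>\<^bsub>A d\<^esub> const b"
  by (auto simp: fun_eq_iff skew_monom_def)

lemma const_smult: "\<lbrakk>c \<in> carrier F; a \<in> carrier K\<rbrakk> \<Longrightarrow> const (c \<odot> a) = c \<odot>\<^bsub>A d\<^esub> const a"
  by (auto simp: fun_eq_iff skew_monom_def)

lemma const_inj: "const a = const b \<Longrightarrow> a = b"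
  by (drule fun_cong[of _ _ 0]) (simp add: const_apply)

text \<open>The copy of \<open>K\<close> inside the algebra.\<close>

abbreviation B where "B d \<equiv> (A d)\<lparr>carrier := const_embed K ` carrier K\<rparr>"

lemma B_simps [simp]:
  "carrier (B d) = const ` carrier K" "\<zero>\<^bsub>B d\<^esub> = (\<lambda>i. \<zero>)" "\<one>\<^bsub>B d\<^esub> = const \<one>"
  "g \<oplus>\<^bsub>B d\<^esub> h = (\<lambda>i. g i \<oplus> h i)" "a \<odot>\<^bsub>B d\<^esub> g = (\<lambda>i. a \<odot> g i)" "g \<otimes>\<^bsub>B d\<^esub> h = g \<otimes>\<^bsub>A d\<^esub> h"
  using A_simps[of d] by (simp_all add: const_embed_def image_image)

lemma const_bij: "bij_betw const (carrier K) (carrier (B d))"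
  by (auto simp: bij_betw_def inj_on_def intro: const_inj)

lemma const_hom:
  "\<lbrakk>d \<in> carrier K; a \<in> carrier K; b \<in> carrier K\<rbrakk> \<Longrightarrow> const (a \<otimes> b) = const a \<otimes>\<^bsub>B d\<^esub> const b"
  "\<lbrakk>a \<in> carrier K; b \<in> carrier K\<rbrakk> \<Longrightarrow> const (a \<oplus> b) = const a \<oplus>\<^bsub>B d\<^esub> const b"
  "const \<one> = \<one>\<^bsub>B d\<^esub>" "const \<zero> = \<zero>\<^bsub>B d\<^esub>"
  "\<lbrakk>c \<in> carrier F; a \<in> carrier K\<rbrakk> \<Longrightarrow> const (c \<odot> a) = c \<odot>\<^bsub>B d\<^esub> const a"
  using const_mult[of d a b] by (simp_all add: fun_eq_iff const_apply)

lemma B_algebra: assumes "d \<in> carrier K" shows "algebra F (B d)"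
  by (rule algebra_transport[OF alg const_bij const_hom(1)[OF assms] const_hom(2-5)])

lemma B_etale: assumes "d \<in> carrier K" "etale_algebra F K" shows "etale_algebra F (B d)"
  by (rule etale_transport[OF assms(2) field_F _ const_bij const_hom(1)[OF assms(1)] const_hom(2-5), of "\<lambda>a i. a"])
     (auto simp: inj_def fun_eq_iff)

end

context galois
begin

lemma A_dim: "vectorspace.fin_dim F K \<Longrightarrow> vectorspace F (A d) \<and> vectorspace.fin_dim F (A d) \<and> vectorspace.dim F (A d) = n * n"
  using seq_space_dim[OF K_vectorspace, of "A d" n] dim by simp

end

context galois_dual
begin

text \<open>
  Commuting with \<open>K\<close> forces the coefficients in positive degree to vanish, and commuting with \<open>t\<close> forces the
  constant coefficient to be fixed by \<open>\<sigma>\<close>.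
\<close>

lemma A_center:
  assumes d: "d \<in> carrier K"
  shows "center (A d) = scalars F (A d)"
proof
  interpret AA: nonassoc_algebra F "A d" by (rule A_nonassoc_algebra[OF d])
  show "scalars F (A d) \<subseteq> center (A d)" by (rule AA.scalars_subset_center)
  show "center (A d) \<subseteq> scalars F (A d)"
  proof
    fix x assume x: "x \<in> center (A d)"
    then have xP: "x \<in> P" using AA.nucleus_closed by (auto simp: center_def)
    have comm: "x \<otimes>\<^bsub>A d\<^esub> y = y \<otimes>\<^bsub>A d\<^esub> x" if "y \<in> P" for y using x that by (auto simp: center_def)
    have "x m = \<zero>" if m: "0 < m" "m < n" for m
    proof (rule annihilates[OF m])
      fix a assume a: "a \<in> carrier K"
      show "x m \<otimes> s m a = x m \<otimes> a"
        using fun_cong[OF comm[of "const a"], of m] a xP d by (simp add: A_const_left A_const_right m_comm)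
    qed (use xP in simp)
    moreover have x0: "x 0 \<in> carrier K" using xP by simp
    ultimately have x_eq: "x = const (x 0)"
      using xP by (intro below_ext) (auto simp: const_apply)
    have "\<sigma> (x 0) = x 0"
    proof (cases "n = 1")
      case True then show ?thesis using period[OF x0] by simp
    next
      case False
      then have n1: "1 < n" using n_pos by simp
      have t: "skew_monom K \<one> 1 \<in> P" using n1 by simp
      have "skew_monom K \<one> 1 \<otimes>\<^bsub>A d\<^esub> const (x 0) = const (x 0) \<otimes>\<^bsub>A d\<^esub> skew_monom K \<one> 1"
        using comm[OF t] x_eq by simp
      from fun_cong[OF this, of 1] have "skew_monom K \<one> 1 1 \<otimes> s 1 (x 0) = x 0 \<otimes> skew_monom K \<one> 1 1"
        using x0 d t by (simp only: A_const_left A_const_right)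
      then show ?thesis using x0 s_closed[OF x0, of 1] by (simp add: skew_monom_def)
    qed
    then obtain c where c: "c \<in> carrier F" "x 0 = c \<odot> \<one>" using fixed x0 by (auto simp: scalars_def)
    then have "x = c \<odot>\<^bsub>A d\<^esub> \<one>\<^bsub>A d\<^esub>" using x_eq by (auto simp: fun_eq_iff skew_monom_def)
    then show "x \<in> scalars F (A d)" using c by (auto simp: scalars_def)
  qed
qed

text \<open>
  The map \<open>x \<otimes> y \<mapsto> x \<sigma>\<^sup>m(y)\<close> on the tensor square of \<open>K\<close>, on representatives in the free abelian group on
  pairs of constant polynomials.
\<close>

definition phi :: "nat \<Rightarrow> ((nat \<Rightarrow> 'b) \<times> (nat \<Rightarrow> 'b) \<Rightarrow>\<^sub>0 int) \<Rightarrow> 'b" where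
  "phi m = K.frag_sum (\<lambda>p. fst p 0 \<otimes> s m (snd p 0))"

text \<open>
  A tensor \<open>x\<close> acts on the coefficient of \<open>t\<^sup>m\<close> as multiplication by \<open>phi m x\<close>.  Both requirements
  on the module therefore follow once \<open>x \<mapsto> (phi m x)\<^sub>m\<close>, \<open>m < n\<close>, is known to be a bijection from the tensor square of \<open>K\<close>
  to \<open>K\<^sup>n\<close>.  The dual families provide its inverse: a sequence \<open>w\<close> comes from \<open>\<Sum>\<^sub>i\<^sub>,\<^sub>k w\<^sub>i \<sigma>\<^sup>i(u\<^sub>k) \<otimes> v\<^sub>k\<close>, and the
  coordinates of a tensor with respect to the \<open>u\<^sub>k\<close> can be computed from its images under all \<open>phi m\<close>.
\<close>

lemma A_E_semiassociative:
  assumes d: "d \<in> carrier K"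
  shows "E_semiassociative F (A d) (const_embed K ` carrier K)"
proof -
  interpret AA: nonassoc_algebra F "A d" by (rule A_nonassoc_algebra[OF d])
  interpret BA: algebra F "B d" by (rule B_algebra[OF d])
  interpret T: tensor_modules F "B d" "B d" by (intro tensor_modules.intro BA.module)
  let ?act = "\<lambda>x a. frag_action (A d) x a"
  have fa: "?act x a = AA.frag_sum (\<lambda>p. (fst p \<otimes>\<^bsub>A d\<^esub> a) \<otimes>\<^bsub>A d\<^esub> snd p) x" for x a
    by (simp add: frag_action_def AA.frag_sum_def del: A_simps)
  have BP: "g \<in> P" if "g \<in> carrier (B d)" for g using that by auto
  have S: "fst p \<in> carrier (B d)" "snd p \<in> carrier (B d)" if "p \<in> T.S" for p using that by auto
  have tm_c: "(fst p \<otimes>\<^bsub>A d\<^esub> a) \<otimes>\<^bsub>A d\<^esub> snd p \<in> carrier (A d)" if "p \<in> T.S" "a \<in> P" for p a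
    using that BP[OF S(1)[OF that(1)]] BP[OF S(2)[OF that(1)]] by (intro AA.mult_closed) auto
  have tm: "((fst p \<otimes>\<^bsub>A d\<^esub> a) \<otimes>\<^bsub>A d\<^esub> snd p) m = (fst p 0 \<otimes> s m (snd p 0)) \<otimes> a m"
    if "p \<in> T.S" "a \<in> P" for p a m
  proof -
    obtain b c where bc: "p = (const b, const c)" "b \<in> carrier K" "c \<in> carrier K" using \<open>p \<in> T.S\<close> by auto
    then show ?thesis using that d scale_in[OF bc(2) that(2)]
      by (simp add: A_const_left A_const_right) (simp add: const_apply m_ac)
  qed
  have phi_c: "fst p 0 \<otimes> s m (snd p 0) \<in> carrier K" if "p \<in> T.S" for p m
    using BP[OF S(1)[OF that]] BP[OF S(2)[OF that]] by simp
  have phi_closed: "phi m x \<in> carrier K" if "Poly_Mapping.keys x \<subseteq> T.S" for m x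
    unfolding phi_def using that phi_c by (intro K.frag_sum_closed) blast
  have phi_diff: "phi m (x - y) = phi m x \<ominus> phi m y"
    if "Poly_Mapping.keys x \<subseteq> T.S" "Poly_Mapping.keys y \<subseteq> T.S" for m x y
    unfolding phi_def using that phi_c by (intro K.frag_sum_diff) blast+
  have phi_of: "phi m (frag_of p) = fst p 0 \<otimes> s m (snd p 0)" if "p \<in> T.S" for m p
    unfolding phi_def using phi_c[OF that] by (simp only: K.frag_sum_of)
  have phi_zero: "phi m 0 = \<zero>" for m by (simp add: phi_def)
  have act_closed: "?act x a \<in> P" if "Poly_Mapping.keys x \<subseteq> T.S" "a \<in> P" for x a
  proof -
    have "?act x a \<in> carrier (A d)"
      unfolding fa by (rule AA.frag_sum_closed) (rule tm_c; use that in blast)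
    then show ?thesis by simp
  qed
  have act: "?act x a m = phi m x \<otimes> a m" if x: "Poly_Mapping.keys x \<subseteq> T.S" and a: "a \<in> P" for x a m
  proof -
    let ?\<beta> = "\<lambda>p. (fst p 0 \<otimes> s m (snd p 0)) \<otimes> a m"
    have \<beta>: "?\<beta> p \<in> carrier K" if "p \<in> T.S" for p using phi_c[OF that] a by simp
    have minus: "(g \<ominus>\<^bsub>A d\<^esub> h) m = g m \<ominus> h m" if "g \<in> P" "h \<in> P" for g h
    proof -
      have "g \<ominus>\<^bsub>A d\<^esub> h \<oplus>\<^bsub>A d\<^esub> h = g"
        using that AA.M.a_assoc[of g "\<ominus>\<^bsub>A d\<^esub> h" h] AA.M.l_neg[of h] AA.M.a_inv_closed[of h] AA.M.r_zero[of g]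
        by (simp add: a_minus_def del: A_simps add: A_simps(1))
      then have "(g \<ominus>\<^bsub>A d\<^esub> h) m \<oplus> h m = g m" by (simp add: fun_eq_iff)
      moreover have "(g \<ominus>\<^bsub>A d\<^esub> h) m \<in> carrier K"
        using AA.M.minus_closed[of g h] that by simp
      ultimately show ?thesis using that
        by (metis K.add.inv_solve_right' K.minus_eq coeff_closed)
    qed
    have "?act x a m = K.frag_sum ?\<beta> x"
    proof (rule K.frag_sum_unique[OF x \<beta>, where h = "\<lambda>x. ?act x a m"])
      show "?act 0 a m = \<zero>" by (simp add: fa)
      show "?act (frag_of p) a m = ?\<beta> p" if "p \<in> T.S" for p
        unfolding fa using that tm_c[OF that a] tm[OF that a] by (simp only: AA.frag_sum_of)
      show "?act (x - y) a m = ?act x a m \<ominus> ?act y a m"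
        if "Poly_Mapping.keys x \<subseteq> T.S" "Poly_Mapping.keys y \<subseteq> T.S" for x y
      proof -
        have "?act (x - y) a = ?act x a \<ominus>\<^bsub>A d\<^esub> ?act y a"
          unfolding fa by (rule AA.frag_sum_diff) (rule tm_c; use that a in blast)+
        then show ?thesis using minus act_closed that a by simp
      qed
    qed
    moreover have "phi m x \<otimes> a m = K.frag_sum ?\<beta> x"
    proof (rule K.frag_sum_unique[OF x \<beta>, where h = "\<lambda>x. phi m x \<otimes> a m"])
      show "phi m (x - y) \<otimes> a m = phi m x \<otimes> a m \<ominus> phi m y \<otimes> a m"
        if "Poly_Mapping.keys x \<subseteq> T.S" "Poly_Mapping.keys y \<subseteq> T.S" for x y
        using phi_diff[OF that] phi_closed that a by (simp add: a_minus_def l_distr l_minus)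
    qed (use a phi_of in \<open>auto simp: phi_zero\<close>)
    ultimately show ?thesis by simp
  qed
  have phi_ker: "phi m x = \<zero>" if "x \<in> T.ker" for m x
    unfolding phi_def
  proof (rule T.ker_frag_sum[OF K.abelian_group_axioms _ _ _ _ that])
    fix x x' y assume "x \<in> carrier (B d)" "x' \<in> carrier (B d)" "y \<in> carrier (B d)"
    then have c: "x 0 \<in> carrier K" "x' 0 \<in> carrier K" "y 0 \<in> carrier K" by auto
    show "fst (x \<oplus>\<^bsub>B d\<^esub> x', y) 0 \<otimes> s m (snd (x \<oplus>\<^bsub>B d\<^esub> x', y) 0) =
        fst (x, y) 0 \<otimes> s m (snd (x, y) 0) \<oplus> fst (x', y) 0 \<otimes> s m (snd (x', y) 0)"
      using c by (simp add: l_distr)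
    show "fst (y, x \<oplus>\<^bsub>B d\<^esub> x') 0 \<otimes> s m (snd (y, x \<oplus>\<^bsub>B d\<^esub> x') 0) =
        fst (y, x) 0 \<otimes> s m (snd (y, x) 0) \<oplus> fst (y, x') 0 \<otimes> s m (snd (y, x') 0)"
      using c by (simp add: r_distr)
  next
    fix a x y assume "a \<in> carrier F" "x \<in> carrier (B d)" "y \<in> carrier (B d)"
    then have c: "a \<in> carrier F" "x 0 \<in> carrier K" "y 0 \<in> carrier K" by auto
    show "fst (a \<odot>\<^bsub>B d\<^esub> x, y) 0 \<otimes> s m (snd (a \<odot>\<^bsub>B d\<^esub> x, y) 0) =
        fst (x, a \<odot>\<^bsub>B d\<^esub> y) 0 \<otimes> s m (snd (x, a \<odot>\<^bsub>B d\<^esub> y) 0)"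
      using c by (simp add: KA.smult_assoc2 smult_mult_right)
  qed (auto simp: const_apply)
  have tact: "tensor_action (A d) (T.cls x) a = ?act x a" if x: "Poly_Mapping.keys x \<subseteq> T.S" and a: "a \<in> P" for x a
  proof -
    have const_act: "?act y a = ?act x a" if "y \<in> T.cls x" for y
    proof -
      have k: "y - x \<in> T.ker" using that by (simp add: T.mem_cls)
      have yS: "Poly_Mapping.keys y \<subseteq> T.S" using T.ker_carrier[OF k] x keys_add[of "y - x" x] by auto
      have "phi m y \<ominus> phi m x = \<zero>" for m using phi_ker[OF k] phi_diff[OF yS x] by simp
      then have "phi m y = phi m x" for m using phi_closed[OF yS] phi_closed[OF x] by simp
      then show ?thesis using act[OF yS a] act[OF x a] by (simp add: fun_eq_iff)
    qed
    have "x \<in> T.cls x" by (simp add: T.mem_cls)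
    have "(\<lambda>y. ?act y a) ` T.cls x = (\<lambda>y. ?act x a) ` T.cls x"
      by (rule image_cong[OF refl const_act])
    also have "\<dots> = {?act x a}" by (rule image_constant[OF \<open>x \<in> T.cls x\<close>])
    finally show ?thesis by (simp add: tensor_action_def)
  qed
  \<comment> \<open>the generator \<open>1 + t + \<dots> + t\<^sup>n\<^sup>-\<^sup>1\<close>\<close>
  define ones where "ones = (\<lambda>i. if i < n then \<one> else \<zero>)"
  have onesP: "ones \<in> P" by (auto simp: ones_def mem_below)
  have gen: "\<exists>x. Poly_Mapping.keys x \<subseteq> T.S \<and> ?act x ones = w" if w: "w \<in> P" for w
  proof -
    have p: "(const (w i \<otimes> s i (u k)), const (v k)) \<in> T.S" for i k using w by auto
    let ?f = "\<lambda>i k. frag_of (const (w i \<otimes> s i (u k)), const (v k))"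
    have ks: "Poly_Mapping.keys (\<Sum>k\<in>J. ?f i k) \<subseteq> T.S" if "finite J" for i and J :: "nat set"
      using that
    proof (induction J rule: finite_induct)
      case (insert k J)
      then show ?case using keys_add[of "?f i k" "\<Sum>k\<in>J. ?f i k"] p by auto
    qed simp
    have kss: "Poly_Mapping.keys (\<Sum>i\<in>I. \<Sum>k<N. ?f i k) \<subseteq> T.S" if "finite I" for I :: "nat set"
      using that
    proof (induction I rule: finite_induct)
      case (insert i I)
      then show ?case using keys_add[of "\<Sum>k<N. ?f i k" "\<Sum>i\<in>I. \<Sum>k<N. ?f i k"] ks[of "{..<N}" i] by auto
    qed simp
    define x where "x = (\<Sum>i<n. \<Sum>k<N. ?f i k)"
    have xS: "Poly_Mapping.keys x \<subseteq> T.S" unfolding x_def by (rule kss) simp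
    have "phi m x = w m" if m: "m < n" for m
    proof -
      have "phi m x = (\<Oplus>i\<in>{..<n}. phi m (\<Sum>k<N. ?f i k))"
        unfolding phi_def x_def
      proof (rule K.frag_sum_sum[where S = T.S])
        show "Poly_Mapping.keys (\<Sum>k<N. ?f i k) \<subseteq> T.S" for i by (rule ks) simp
      qed (use phi_c in simp_all)
      also have "\<dots> = (\<Oplus>i\<in>{..<n}. if i = m then w m else \<zero>)"
      proof (rule K.finsum_eqI)
        fix i assume i: "i \<in> {..<n}"
        have "phi m (\<Sum>k<N. ?f i k) = (\<Oplus>k\<in>{..<N}. phi m (?f i k))"
          unfolding phi_def
        proof (rule K.frag_sum_sum[where S = T.S])
          show "Poly_Mapping.keys (?f i k) \<subseteq> T.S" for k using p[of i k] by (simp del: B_simps)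
        qed (use phi_c in simp_all)
        also have "\<dots> = (\<Oplus>k\<in>{..<N}. w i \<otimes> (s i (u k) \<otimes> s m (v k)))"
          using w by (intro K.finsum_eqI) (auto simp: phi_of[OF p] const_apply m_assoc)
        also have "\<dots> = w i \<otimes> (\<Oplus>k\<in>{..<N}. s i (u k) \<otimes> s m (v k))"
          using w by (intro K.finsum_rdistr[symmetric]) auto
        also have "\<dots> = (if i = m then w m else \<zero>)"
          using i m w by (simp add: dual_shift)
        finally show "phi m (\<Sum>k<N. ?f i k) = (if i = m then w m else \<zero>)" .
      qed (use w in auto)
      also have "\<dots> = w m" using m w by (subst K.finsum_single[of m]) auto
      finally show ?thesis .
    qed
    then have "?act x ones = w"
      using act_closed[OF xS onesP] w act[OF xS onesP] by (intro below_ext) (auto simp: ones_def)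
    then show ?thesis using xS by blast
  qed
  have faithful: "x \<in> T.ker" if xS: "Poly_Mapping.keys x \<subseteq> T.S" and zero: "\<And>m. m < n \<Longrightarrow> phi m x = \<zero>" for x
  proof (rule T.ker_criterion[of "{..<N}" "\<lambda>k. const (u k)" "\<lambda>k g. trF (v k \<otimes> g 0)"])
    fix g assume g: "g \<in> carrier (B d)"
    then obtain a where a: "a \<in> carrier K" "g = const a" by auto
    have "const (\<Oplus>k\<in>{..<N}. trF (v k \<otimes> a) \<odot> u k) = (\<Oplus>\<^bsub>B d\<^esub>k\<in>{..<N}. const (trF (v k \<otimes> a) \<odot> u k))"
      using a by (intro K.finsum_map BA.abelian_monoid_axioms) (auto simp: skew_monom_def fun_eq_iff)
    also have "\<dots> = (\<Oplus>\<^bsub>B d\<^esub>k\<in>{..<N}. trF (v k \<otimes> g 0) \<odot>\<^bsub>B d\<^esub> const (u k))"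
      using a by (intro BA.finsum_eqI) (auto simp: const_apply skew_monom_def fun_eq_iff intro!: image_eqI[of _ _ "trF _ \<odot> u _"])
    finally show "g = (\<Oplus>\<^bsub>B d\<^esub>k\<in>{..<N}. trF (v k \<otimes> g 0) \<odot>\<^bsub>B d\<^esub> const (u k))"
      using a dual_expansion[OF a(1)] by simp
  next
    fix k
    let ?\<beta> = "\<lambda>(g, h). trF (v k \<otimes> g 0) \<odot>\<^bsub>B d\<^esub> h"
    \<comment> \<open>\<open>tr(v\<^sub>k a) b\<close> is the sum of the \<open>\<sigma>\<^sup>p(v\<^sub>k a \<sigma>\<^sup>n\<^sup>-\<^sup>p(b))\<close>, and \<open>a \<sigma>\<^sup>n\<^sup>-\<^sup>p(b)\<close> is the value of \<open>phi (n - p)\<close> at \<open>a \<otimes> b\<close>\<close>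
    let ?h = "\<lambda>x. const (\<Oplus>p\<in>{..<n}. s p (v k \<otimes> phi (n - p) x))"
    have phi_n: "phi (n - p) x = \<zero>" if "p < n" for p
    proof (cases "p = 0")
      case True
      have "K.frag_sum (\<lambda>p. fst p 0 \<otimes> s n (snd p 0)) x = K.frag_sum (\<lambda>p. fst p 0 \<otimes> s 0 (snd p 0)) x"
        unfolding K.frag_sum_def
      proof (rule K.finsum_eqI)
        fix p assume "p \<in> Poly_Mapping.keys x"
        then have p: "p \<in> T.S" using xS by blast
        show "[Poly_Mapping.lookup x p] \<cdot> (fst p 0 \<otimes> s n (snd p 0)) = [Poly_Mapping.lookup x p] \<cdot> (fst p 0 \<otimes> s 0 (snd p 0))"
          using BP[OF S(2)[OF p]] by (simp add: period)
        show "[Poly_Mapping.lookup x p] \<cdot> (fst p 0 \<otimes> s 0 (snd p 0)) \<in> carrier K"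
          by (rule K.int_multiple_closed[OF phi_c[OF p]])
      qed
      then show ?thesis using True zero[of 0] n_pos by (simp add: phi_def)
    next
      case False
      then show ?thesis using n_pos by (intro zero) simp
    qed
    have "?h x = BA.frag_sum ?\<beta> x"
    proof (rule BA.frag_sum_unique[OF xS])
      show "?h 0 = \<zero>\<^bsub>B d\<^esub>" by (simp add: phi_zero finsum_zero) (simp add: skew_monom_def)
    next
      fix p assume "p \<in> T.S"
      then obtain a b where p: "p = (const a, const b)" "a \<in> carrier K" "b \<in> carrier K" by auto
      show "?\<beta> p \<in> carrier (B d)"
        using p by (auto simp: const_apply fun_eq_iff skew_monom_def intro!: image_eqI[of _ _ "trF (v k \<otimes> a) \<odot> b"])
      have "trF (v k \<otimes> a) \<odot> b = (\<Oplus>p\<in>{..<n}. s p (v k \<otimes> a) \<otimes> b)"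
        using p by (simp add: trF_smult tr_def finsum_ldistr Pi_def)
      also have "\<dots> = (\<Oplus>q\<in>{..<n}. s q (v k \<otimes> phi (n - q) (frag_of p)))"
      proof (rule K.finsum_eqI)
        fix q assume q: "q \<in> {..<n}"
        have "phi (n - q) (frag_of p) = a \<otimes> s (n - q) b" using phi_of[OF \<open>p \<in> T.S\<close>] p by (simp add: const_apply)
        moreover have "s q (s (n - q) b) = b" using q p by (simp add: s_s period)
        ultimately show "s q (v k \<otimes> a) \<otimes> b = s q (v k \<otimes> phi (n - q) (frag_of p))"
          using p by (simp add: m_assoc)
        show "s q (v k \<otimes> phi (n - q) (frag_of p)) \<in> carrier K"
          using phi_closed[of "frag_of p" "n - q"] \<open>p \<in> T.S\<close> by (simp del: B_simps)
      qed
      finally show "?h (frag_of p) = ?\<beta> p" using p by (auto simp: const_apply fun_eq_iff skew_monom_def)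
    next
      fix x y :: "(nat \<Rightarrow> 'b) \<times> (nat \<Rightarrow> 'b) \<Rightarrow>\<^sub>0 int" assume xy: "Poly_Mapping.keys x \<subseteq> T.S" "Poly_Mapping.keys y \<subseteq> T.S"
      let ?g = "\<lambda>x. \<Oplus>p\<in>{..<n}. s p (v k \<otimes> phi (n - p) x)"
      have gc: "?g z \<in> carrier K" if "Poly_Mapping.keys z \<subseteq> T.S" for z
        using phi_closed[OF that] by (intro finsum_in) auto
      have "?g (x - y) \<oplus> ?g y = (\<Oplus>p\<in>{..<n}. s p (v k \<otimes> phi (n - p) (x - y)) \<oplus> s p (v k \<otimes> phi (n - p) y))"
        using phi_closed[OF xy(1)] phi_closed[OF xy(2)] phi_diff[OF xy] by (intro finsum_add[symmetric]) auto
      also have "\<dots> = ?g x"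
      proof (rule finsum_eqI)
        fix p
        have "phi (n - p) (x - y) \<oplus> phi (n - p) y = phi (n - p) x"
          using phi_closed[OF xy(1)] phi_closed[OF xy(2)] phi_diff[OF xy] by (simp add: a_minus_def a_assoc l_neg)
        then have "v k \<otimes> phi (n - p) (x - y) \<oplus> v k \<otimes> phi (n - p) y = v k \<otimes> phi (n - p) x"
          using phi_closed[OF xy(1)] phi_closed[OF xy(2)] phi_diff[OF xy] by (simp add: r_distr[symmetric])
        then show "s p (v k \<otimes> phi (n - p) (x - y)) \<oplus> s p (v k \<otimes> phi (n - p) y) = s p (v k \<otimes> phi (n - p) x)"
          using phi_closed[OF xy(1)] phi_closed[OF xy(2)] phi_diff[OF xy] by (simp del: s_mult flip: s_add)
      qed (use phi_closed[OF xy(1)] in auto)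
      finally have g: "?g (x - y) \<oplus> ?g y = ?g x" .
      have dk: "Poly_Mapping.keys (x - y) \<subseteq> T.S" using xy keys_diff[of x y] by blast
      have "?h (x - y) \<oplus>\<^bsub>B d\<^esub> ?h y = ?h x"
        using const_add[OF gc[OF dk] gc[OF xy(2)]] g by simp
      moreover have "?h z \<in> carrier (B d)" if "Poly_Mapping.keys z \<subseteq> T.S" for z using gc[OF that] by simp
      ultimately show "?h (x - y) = ?h x \<ominus>\<^bsub>B d\<^esub> ?h y"
        using dk xy by (intro BA.eq_minusI) blast+
    qed
    moreover have "?h x = \<zero>\<^bsub>B d\<^esub>" using phi_n by (simp add: finsum_zero cong: K.finsum_cong) (simp add: skew_monom_def)
    ultimately show "BA.frag_sum ?\<beta> x = \<zero>\<^bsub>B d\<^esub>" by simp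
  qed (use xS in auto)
  show ?thesis
    unfolding E_semiassociative_def Let_def
  proof (intro conjI ballI impI)
    show "field F" by (rule field_F)
    show "nonassoc_algebra F (A d)" by (rule AA.nonassoc_algebra_axioms)
    show "vectorspace.fin_dim F (A d)" using A_dim K_fin_dim by blast
    show "central F (A d)"
      unfolding central_def using A_center[OF d] one_neq_zero by (auto dest: fun_cong[of _ _ 0] simp: const_apply)
    show "const_embed K ` carrier K \<subseteq> nucleus (A d)" using const_nucleus[OF d] by (auto simp: const_embed_def)
    show "etale_algebra F (B d)" by (rule B_etale[OF d etale])
    show "\<exists>a\<in>carrier (A d). carrier (A d) = {tensor_action (A d) X a |X. X \<in> carrier (tensor_group F (B d) (B d))}"
    proof (intro bexI[of _ ones] equalityI subsetI)
      fix w assume "w \<in> carrier (A d)"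
      then obtain x where x: "Poly_Mapping.keys x \<subseteq> T.S" "?act x ones = w" using gen[of w] by auto
      have "T.cls x \<in> carrier (tensor_group F (B d) (B d))"
        using x(1) by (intro T.carrier_tensor[THEN iffD2] exI[of _ x] conjI refl)
      moreover have "w = tensor_action (A d) (T.cls x) ones" using tact[OF x(1) onesP] x(2) by simp
      ultimately show "w \<in> {tensor_action (A d) X ones |X. X \<in> carrier (tensor_group F (B d) (B d))}" by blast
    next
      fix w assume "w \<in> {tensor_action (A d) X ones |X. X \<in> carrier (tensor_group F (B d) (B d))}"
      then obtain X where "w = tensor_action (A d) X ones" "X \<in> carrier (tensor_group F (B d) (B d))" by blast
      then obtain x where "Poly_Mapping.keys x \<subseteq> T.S" "w = tensor_action (A d) (T.cls x) ones"
        by (elim T.carrier_tensor[THEN iffD1, elim_format] exE conjE) simp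
      then show "w \<in> carrier (A d)" using tact[OF _ onesP] act_closed[OF _ onesP] by simp
    qed (use onesP in simp)
  next
    fix X assume "X \<in> carrier (tensor_group F (B d) (B d))"
      and z: "\<forall>a\<in>carrier (A d). tensor_action (A d) X a = \<zero>\<^bsub>A d\<^esub>"
    then obtain x where x: "Poly_Mapping.keys x \<subseteq> T.S" "X = T.cls x"
      by (elim T.carrier_tensor[THEN iffD1, elim_format] exE conjE)
    have "?act x ones = \<zero>\<^bsub>A d\<^esub>" using z onesP tact[OF x(1) onesP] x(2) by simp
    then have "phi m x = \<zero>" if "m < n" for m
      using fun_cong[of "?act x ones" "\<zero>\<^bsub>A d\<^esub>" m] act[OF x(1) onesP, of m] that phi_closed[OF x(1), of m] by (simp add: ones_def)
    then have "x \<in> T.ker" by (rule faithful[OF x(1)])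
    then show "X = \<one>\<^bsub>tensor_group F (B d) (B d)\<^esub>"
      using x(2) T.cls_eq[of x 0] by (simp add: T.one_tensor)
  qed
qed

lemma A_degree: "algebra_degree F (A d) = n"
proof -
  have "vectorspace.dim F (A d) = n\<^sup>2" using A_dim[OF K_fin_dim] by (simp add: power2_eq_square)
  then show ?thesis unfolding algebra_degree_def by (intro the_equality) auto
qed

end

section \<open>Skew matrix algebras\<close>

lemma skew_matrix_simps [simp]:
  "carrier (skew_matrix_algebra R n c) = ({..<n} \<times> {..<n}) \<rightarrow>\<^sub>E carrier R"
  "\<one>\<^bsub>skew_matrix_algebra R n c\<^esub> = (\<lambda>(i, j)\<in>{..<n} \<times> {..<n}. if i = j then \<one>\<^bsub>R\<^esub> else \<zero>\<^bsub>R\<^esub>)"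
  "\<zero>\<^bsub>skew_matrix_algebra R n c\<^esub> = (\<lambda>p\<in>{..<n} \<times> {..<n}. \<zero>\<^bsub>R\<^esub>)"
  "x \<oplus>\<^bsub>skew_matrix_algebra R n c\<^esub> y = (\<lambda>p\<in>{..<n} \<times> {..<n}. x p \<oplus>\<^bsub>R\<^esub> y p)"
  "a \<odot>\<^bsub>skew_matrix_algebra R n c\<^esub> x = (\<lambda>p\<in>{..<n} \<times> {..<n}. a \<otimes>\<^bsub>R\<^esub> x p)"
  by (simp_all add: skew_matrix_algebra_def)

lemma skew_matrix_mult:
  "i < n \<Longrightarrow> l < n \<Longrightarrow> (x \<otimes>\<^bsub>skew_matrix_algebra R n c\<^esub> y) (i, l) =
    (\<Oplus>\<^bsub>R\<^esub>j\<in>{..<n}. c i j l \<otimes>\<^bsub>R\<^esub> (x (i, j) \<otimes>\<^bsub>R\<^esub> y (j, l)))"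
  by (simp add: skew_matrix_algebra_def)

lemma skew_matrix_mult_ext:
  "x \<otimes>\<^bsub>skew_matrix_algebra R n c\<^esub> y \<in> extensional ({..<n} \<times> {..<n})"
  by (simp add: skew_matrix_algebra_def)

lemma matrix_ext:
  assumes "x \<in> extensional ({..<n} \<times> {..<n})" "y \<in> extensional ({..<n} \<times> {..<n})"
    "\<And>i j. \<lbrakk>i < n; j < n\<rbrakk> \<Longrightarrow> x (i, j) = y (i, j)"
  shows "x = y"
  using assms by (intro extensionalityI[of x "{..<n} \<times> {..<n}" y]) auto

lemma skew_matrix_nonassoc_algebra:
  fixes R :: "('a, 'm) ring_scheme" (structure)
  assumes R: "cring R" and c: "reduced_skew_set R n c"
  shows "nonassoc_algebra R (skew_matrix_algebra R n c)"
proof -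
  interpret R: cring R by fact
  let ?M = "skew_matrix_algebra R n c"
  have cc [simp]: "c i j k \<in> carrier R" if "i < n" "j < n" "k < n" for i j k
    using c that by (auto simp: reduced_skew_set_def)
  have c1: "c i i j = \<one>" "c j i i = \<one>" if "i < n" "j < n" for i j
    using c that by (auto simp: reduced_skew_set_def)
  have e [simp]: "x (i, j) \<in> carrier R" if "x \<in> carrier ?M" "i < n" "j < n" for x i j
    using that by auto
  have ext: "x \<in> extensional ({..<n} \<times> {..<n})" if "x \<in> carrier ?M" for x
    using that by (auto simp: PiE_def)
  have mult_closed: "x \<otimes>\<^bsub>?M\<^esub> y \<in> carrier ?M" if "x \<in> carrier ?M" "y \<in> carrier ?M" for x y
    using that by (auto simp: PiE_def skew_matrix_mult_ext skew_matrix_mult simp del: skew_matrix_simps(4,5)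
        intro!: R.finsum_in)
  have ab: "abelian_group ?M"
  proof (rule abelian_groupI)
    fix x assume x: "x \<in> carrier ?M"
    show "\<exists>y\<in>carrier ?M. y \<oplus>\<^bsub>?M\<^esub> x = \<zero>\<^bsub>?M\<^esub>"
    proof (rule bexI[of _ "\<lambda>p\<in>{..<n} \<times> {..<n}. \<ominus> x p"])
      show "(\<lambda>p\<in>{..<n} \<times> {..<n}. \<ominus> x p) \<oplus>\<^bsub>?M\<^esub> x = \<zero>\<^bsub>?M\<^esub>"
        by (rule matrix_ext[of _ n]) (use e[OF x] in \<open>auto simp: R.l_neg\<close>)
    qed (use x in auto)
    show "\<zero>\<^bsub>?M\<^esub> \<oplus>\<^bsub>?M\<^esub> x = x"
      by (rule matrix_ext[of _ n]) (use e[OF x] ext[OF x] in auto)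
  next
    fix x y assume xy: "x \<in> carrier ?M" "y \<in> carrier ?M"
    show "x \<oplus>\<^bsub>?M\<^esub> y \<in> carrier ?M" using xy by auto
    show "x \<oplus>\<^bsub>?M\<^esub> y = y \<oplus>\<^bsub>?M\<^esub> x"
      by (rule matrix_ext[of _ n]) (use e[OF xy(1)] e[OF xy(2)] in \<open>auto simp: R.a_comm\<close>)
  next
    fix x y z assume xyz: "x \<in> carrier ?M" "y \<in> carrier ?M" "z \<in> carrier ?M"
    show "x \<oplus>\<^bsub>?M\<^esub> y \<oplus>\<^bsub>?M\<^esub> z = x \<oplus>\<^bsub>?M\<^esub> (y \<oplus>\<^bsub>?M\<^esub> z)"
      by (rule matrix_ext[of _ n]) (use e[OF xyz(1)] e[OF xyz(2)] e[OF xyz(3)] in \<open>auto simp: R.a_assoc\<close>)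
  qed auto
  have mod: "module R ?M"
  proof (rule moduleI)
    fix a b x assume *: "a \<in> carrier R" "b \<in> carrier R" "x \<in> carrier ?M"
    show "(a \<oplus> b) \<odot>\<^bsub>?M\<^esub> x = a \<odot>\<^bsub>?M\<^esub> x \<oplus>\<^bsub>?M\<^esub> b \<odot>\<^bsub>?M\<^esub> x"
      by (rule matrix_ext[of _ n]) (use * e[OF *(3)] in \<open>auto simp: R.l_distr\<close>)
    show "a \<otimes> b \<odot>\<^bsub>?M\<^esub> x = a \<odot>\<^bsub>?M\<^esub> (b \<odot>\<^bsub>?M\<^esub> x)"
      by (rule matrix_ext[of _ n]) (use * e[OF *(3)] in \<open>auto simp: R.m_assoc\<close>)
  next
    fix a x y assume *: "a \<in> carrier R" "x \<in> carrier ?M" "y \<in> carrier ?M"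
    show "a \<odot>\<^bsub>?M\<^esub> (x \<oplus>\<^bsub>?M\<^esub> y) = a \<odot>\<^bsub>?M\<^esub> x \<oplus>\<^bsub>?M\<^esub> a \<odot>\<^bsub>?M\<^esub> y"
      by (rule matrix_ext[of _ n]) (use * e[OF *(2)] e[OF *(3)] in \<open>auto simp: R.r_distr\<close>)
  next
    fix x assume x: "x \<in> carrier ?M"
    show "\<one> \<odot>\<^bsub>?M\<^esub> x = x"
      by (rule matrix_ext[of _ n]) (use e[OF x] ext[OF x] in auto)
  qed (use R ab in auto)
  show ?thesis
  proof (intro nonassoc_algebra.intro nonassoc_algebra_axioms.intro mod)
    show "\<one>\<^bsub>?M\<^esub> \<in> carrier ?M" by auto
  next
    fix x assume x: "x \<in> carrier ?M"
    note xe = e[OF x]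
    show "\<one>\<^bsub>?M\<^esub> \<otimes>\<^bsub>?M\<^esub> x = x"
    proof (rule matrix_ext[OF skew_matrix_mult_ext ext[OF x]])
      fix i l assume il: "i < n" "l < n"
      show "(\<one>\<^bsub>?M\<^esub> \<otimes>\<^bsub>?M\<^esub> x) (i, l) = x (i, l)"
        unfolding skew_matrix_mult[OF il] using il xe c1 by (subst R.finsum_single[of i]) auto
    qed
    show "x \<otimes>\<^bsub>?M\<^esub> \<one>\<^bsub>?M\<^esub> = x"
    proof (rule matrix_ext[OF skew_matrix_mult_ext ext[OF x]])
      fix i l assume il: "i < n" "l < n"
      show "(x \<otimes>\<^bsub>?M\<^esub> \<one>\<^bsub>?M\<^esub>) (i, l) = x (i, l)"
        unfolding skew_matrix_mult[OF il] using il xe c1 by (subst R.finsum_single[of l]) auto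
    qed
  next
    fix x y z assume xyz: "x \<in> carrier ?M" "y \<in> carrier ?M" "z \<in> carrier ?M"
    note xe = e[OF xyz(1)] e[OF xyz(2)] e[OF xyz(3)]
    show "(x \<oplus>\<^bsub>?M\<^esub> y) \<otimes>\<^bsub>?M\<^esub> z = x \<otimes>\<^bsub>?M\<^esub> z \<oplus>\<^bsub>?M\<^esub> y \<otimes>\<^bsub>?M\<^esub> z"
    proof (rule matrix_ext[OF skew_matrix_mult_ext])
      fix i l assume il: "i < n" "l < n"
      have "((x \<oplus>\<^bsub>?M\<^esub> y) \<otimes>\<^bsub>?M\<^esub> z) (i, l) =
          (\<Oplus>j\<in>{..<n}. c i j l \<otimes> (x (i, j) \<otimes> z (j, l)) \<oplus> c i j l \<otimes> (y (i, j) \<otimes> z (j, l)))"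
        unfolding skew_matrix_mult[OF il] using il xe
        by (intro R.finsum_eqI) (auto simp: R.l_distr R.r_distr)
      also have "\<dots> = (x \<otimes>\<^bsub>?M\<^esub> z) (i, l) \<oplus> (y \<otimes>\<^bsub>?M\<^esub> z) (i, l)"
        unfolding skew_matrix_mult[OF il] using il xe by (intro R.finsum_add) auto
      finally show "((x \<oplus>\<^bsub>?M\<^esub> y) \<otimes>\<^bsub>?M\<^esub> z) (i, l) = (x \<otimes>\<^bsub>?M\<^esub> z \<oplus>\<^bsub>?M\<^esub> y \<otimes>\<^bsub>?M\<^esub> z) (i, l)"
        using il by simp
    qed auto
    show "z \<otimes>\<^bsub>?M\<^esub> (x \<oplus>\<^bsub>?M\<^esub> y) = z \<otimes>\<^bsub>?M\<^esub> x \<oplus>\<^bsub>?M\<^esub> z \<otimes>\<^bsub>?M\<^esub> y"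
    proof (rule matrix_ext[OF skew_matrix_mult_ext])
      fix i l assume il: "i < n" "l < n"
      have "(z \<otimes>\<^bsub>?M\<^esub> (x \<oplus>\<^bsub>?M\<^esub> y)) (i, l) =
          (\<Oplus>j\<in>{..<n}. c i j l \<otimes> (z (i, j) \<otimes> x (j, l)) \<oplus> c i j l \<otimes> (z (i, j) \<otimes> y (j, l)))"
        unfolding skew_matrix_mult[OF il] using il xe
        by (intro R.finsum_eqI) (auto simp: R.l_distr R.r_distr)
      also have "\<dots> = (z \<otimes>\<^bsub>?M\<^esub> x) (i, l) \<oplus> (z \<otimes>\<^bsub>?M\<^esub> y) (i, l)"
        unfolding skew_matrix_mult[OF il] using il xe by (intro R.finsum_add) auto
      finally show "(z \<otimes>\<^bsub>?M\<^esub> (x \<oplus>\<^bsub>?M\<^esub> y)) (i, l) = (z \<otimes>\<^bsub>?M\<^esub> x \<oplus>\<^bsub>?M\<^esub> z \<otimes>\<^bsub>?M\<^esub> y) (i, l)"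
        using il by simp
    qed auto
  next
    fix a x y assume *: "a \<in> carrier R" "x \<in> carrier ?M" "y \<in> carrier ?M"
    note xe = e[OF *(2)] e[OF *(3)]
    show "(a \<odot>\<^bsub>?M\<^esub> x) \<otimes>\<^bsub>?M\<^esub> y = a \<odot>\<^bsub>?M\<^esub> (x \<otimes>\<^bsub>?M\<^esub> y)"
    proof (rule matrix_ext[OF skew_matrix_mult_ext])
      fix i l assume il: "i < n" "l < n"
      have "((a \<odot>\<^bsub>?M\<^esub> x) \<otimes>\<^bsub>?M\<^esub> y) (i, l) = (\<Oplus>j\<in>{..<n}. a \<otimes> (c i j l \<otimes> (x (i, j) \<otimes> y (j, l))))"
        unfolding skew_matrix_mult[OF il] using il xe *(1)
        by (intro R.finsum_eqI) (auto simp: R.m_assoc R.m_lcomm[of a "c i _ l"])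
      also have "\<dots> = a \<otimes> (x \<otimes>\<^bsub>?M\<^esub> y) (i, l)"
        unfolding skew_matrix_mult[OF il] using il xe *(1) by (intro R.finsum_rdistr[symmetric]) auto
      finally show "((a \<odot>\<^bsub>?M\<^esub> x) \<otimes>\<^bsub>?M\<^esub> y) (i, l) = (a \<odot>\<^bsub>?M\<^esub> (x \<otimes>\<^bsub>?M\<^esub> y)) (i, l)" using il by simp
    qed auto
    show "x \<otimes>\<^bsub>?M\<^esub> (a \<odot>\<^bsub>?M\<^esub> y) = a \<odot>\<^bsub>?M\<^esub> (x \<otimes>\<^bsub>?M\<^esub> y)"
    proof (rule matrix_ext[OF skew_matrix_mult_ext])
      fix i l assume il: "i < n" "l < n"
      have "(x \<otimes>\<^bsub>?M\<^esub> (a \<odot>\<^bsub>?M\<^esub> y)) (i, l) = (\<Oplus>j\<in>{..<n}. a \<otimes> (c i j l \<otimes> (x (i, j) \<otimes> y (j, l))))"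
        unfolding skew_matrix_mult[OF il] using il xe *(1)
        by (intro R.finsum_eqI) (auto simp: R.m_lcomm[of a])
      also have "\<dots> = a \<otimes> (x \<otimes>\<^bsub>?M\<^esub> y) (i, l)"
        unfolding skew_matrix_mult[OF il] using il xe *(1) by (intro R.finsum_rdistr[symmetric]) auto
      finally show "(x \<otimes>\<^bsub>?M\<^esub> (a \<odot>\<^bsub>?M\<^esub> y)) (i, l) = (a \<odot>\<^bsub>?M\<^esub> (x \<otimes>\<^bsub>?M\<^esub> y)) (i, l)" using il by simp
    qed auto
  qed (use mult_closed in auto)
qed

section \<open>The homomorphism to a skew matrix algebra given by a character\<close>

text \<open>The difference \<open>i - j\<close> modulo \<open>n\<close>, for \<open>j \<le> n\<close>.\<close>

definition dif :: "nat \<Rightarrow> nat \<Rightarrow> nat \<Rightarrow> nat" where "dif n i j = (i + n - j) mod n"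

lemma dif_eq: "\<lbrakk>i < n; j < n\<rbrakk> \<Longrightarrow> dif n i j = (if j \<le> i then i - j else i + n - j)"
proof -
  assume ij: "i < n" "j < n"
  show ?thesis
  proof (cases "j \<le> i")
    case True
    then have "(i + n - j) mod n = i - j"
      using ij by (metis Nat.add_diff_assoc2 less_imp_diff_less mod_add_self2 mod_less)
    then show ?thesis using True by (simp add: dif_def)
  qed (use ij in \<open>auto simp: dif_def\<close>)
qed

lemma dif_less [simp]: "0 < n \<Longrightarrow> dif n i j < n"
  by (simp add: dif_def)

lemma dif_self [simp]: "i < n \<Longrightarrow> dif n i i = 0" by (simp add: dif_eq)

lemma dif_dif: "\<lbrakk>i < n; p < n; l < n\<rbrakk> \<Longrightarrow> dif n (dif n i l) (dif n i p) = dif n p l"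
  using dif_less[of n i l] dif_less[of n i p] by (simp add: dif_eq split: if_splits) auto

lemma dif_inv: "\<lbrakk>i < n; p < n\<rbrakk> \<Longrightarrow> dif n i (dif n i p) = p"
  using dif_less[of n i p] by (simp add: dif_eq split: if_splits)

lemma dif_bij: "i < n \<Longrightarrow> bij_betw (dif n i) {..<n} {..<n}"
  by (rule bij_betw_byWitness[of _ "dif n i"]) (auto simp: dif_inv)

lemma dif_shift: "\<lbrakk>i < n; p < n\<rbrakk> \<Longrightarrow> (n - i + dif n i p) mod n = (n - p) mod n"
  by (simp add: dif_eq split: if_splits) (auto simp: le_mod_geq)

context twisted
begin

text \<open>
  For a ring homomorphism \<open>\<pi>\<close> from \<open>K\<close>, sending \<open>g\<close> to the matrix with entries
  \<open>\<pi>(\<sigma>\<^sup>-\<^sup>i(g\<^sub>i\<^sub>-\<^sub>j))\<close>, indices modulo \<open>n\<close>, turns the product of the cyclic algebra into that of the skew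
  matrix algebra whose structure constants are the images of the weights \<open>wt\<close>.
\<close>

definition cset :: "('b \<Rightarrow> 'r) \<Rightarrow> 'b \<Rightarrow> nat \<Rightarrow> nat \<Rightarrow> nat \<Rightarrow> 'r" where
  "cset \<pi> d i p j = \<pi> (s (n - i) (wt d (dif n i p) (dif n i j)))"

text \<open>The matrix attached to a polynomial of degree below \<open>n\<close>; here \<open>s (n - i)\<close> is \<open>\<sigma>\<^sup>-\<^sup>i\<close>.\<close>

definition Phi :: "('b \<Rightarrow> 'r) \<Rightarrow> (nat \<Rightarrow> 'b) \<Rightarrow> nat \<times> nat \<Rightarrow> 'r" where
  "Phi \<pi> g = (\<lambda>(i, j)\<in>{..<n} \<times> {..<n}. \<pi> (s (n - i) (g (dif n i j))))"

lemma Phi_apply: "\<lbrakk>i < n; j < n\<rbrakk> \<Longrightarrow> Phi \<pi> g (i, j) = \<pi> (s (n - i) (g (dif n i j)))"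
  by (simp add: Phi_def)

lemma cset_reduced:
  assumes \<pi>: "\<pi> \<in> ring_hom K R" and d: "d \<in> carrier K"
  shows "reduced_skew_set R n (cset \<pi> d)"
  using d ring_hom_one[OF \<pi>] ring_hom_closed[OF \<pi> K.one_closed] by (auto simp: reduced_skew_set_def cset_def wt_def intro: ring_hom_closed[OF \<pi>])

lemma Phi_closed:
  assumes \<pi>: "\<pi> \<in> ring_hom K R" and g: "g \<in> P"
  shows "Phi \<pi> g \<in> carrier (skew_matrix_algebra R n c)"
  using g by (auto simp: Phi_def intro: ring_hom_closed[OF \<pi>])

lemma Phi_mult:
  assumes R: "cring R" and \<pi>: "\<pi> \<in> ring_hom K R" and d: "d \<in> carrier K" and g: "g \<in> P" and h: "h \<in> P"
  shows "Phi \<pi> (cmul d g h) = Phi \<pi> g \<otimes>\<^bsub>skew_matrix_algebra R n (cset \<pi> d)\<^esub> Phi \<pi> h"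
proof (rule matrix_ext[OF _ skew_matrix_mult_ext])
  show "Phi \<pi> (cmul d g h) \<in> extensional ({..<n} \<times> {..<n})" by (simp add: Phi_def)
  interpret R: cring R by fact
  note \<pi>c [simp] = ring_hom_closed[OF \<pi>]
  have \<pi>0: "\<pi> \<zero> = \<zero>\<^bsub>R\<^esub>" by (rule ring_hom_zero[OF \<pi> K.ring_axioms R.ring_axioms])
  fix i l assume il: "i < n" "l < n"
  let ?m = "dif n i l"
  let ?t = "\<lambda>k. g k \<otimes> s k (h (dif n ?m k)) \<otimes> wt d k ?m"
  have tc: "?t k \<in> carrier K" for k using g h d by simp
  have "Phi \<pi> (cmul d g h) (i, l) = \<pi> (s (n - i) (\<Oplus>k\<in>{..<n}. ?t k))"
    using il n_pos by (simp add: Phi_apply cmul_def dif_def[of n "dif n i l"])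
  also have "\<dots> = (\<Oplus>\<^bsub>R\<^esub>k\<in>{..<n}. \<pi> (s (n - i) (?t k)))"
    using tc by (subst s_sum, simp, simp, intro K.finsum_map)
      (auto simp: \<pi>0 ring_hom_add[OF \<pi>] R.abelian_monoid_axioms)
  also have "\<dots> = (\<Oplus>\<^bsub>R\<^esub>p\<in>{..<n}. \<pi> (s (n - i) (?t (dif n i p))))"
    using tc il by (intro R.finsum_bij[OF dif_bij, symmetric]) auto
  also have "\<dots> = (\<Oplus>\<^bsub>R\<^esub>p\<in>{..<n}. cset \<pi> d i p l \<otimes>\<^bsub>R\<^esub> (Phi \<pi> g (i, p) \<otimes>\<^bsub>R\<^esub> Phi \<pi> h (p, l)))"
  proof (rule R.finsum_eqI)
    fix p assume "p \<in> {..<n}"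
    then have p: "p < n" by simp
    have "s (n - i) (s (dif n i p) x) = s (n - p) x" if "x \<in> carrier K" for x
      unfolding s_s using that dif_shift[OF il(1) p] by (rule s_cong)
    then have "\<pi> (s (n - i) (?t (dif n i p))) =
        \<pi> (s (n - i) (g (dif n i p))) \<otimes>\<^bsub>R\<^esub> \<pi> (s (n - p) (h (dif n p l))) \<otimes>\<^bsub>R\<^esub> cset \<pi> d i p l"
      using g h d il p by (simp add: ring_hom_mult[OF \<pi>] dif_dif cset_def)
    then show "\<pi> (s (n - i) (?t (dif n i p))) = cset \<pi> d i p l \<otimes>\<^bsub>R\<^esub> (Phi \<pi> g (i, p) \<otimes>\<^bsub>R\<^esub> Phi \<pi> h (p, l))"
      using g h d il p by (simp add: Phi_apply cset_def R.m_comm)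
    show "cset \<pi> d i p l \<otimes>\<^bsub>R\<^esub> (Phi \<pi> g (i, p) \<otimes>\<^bsub>R\<^esub> Phi \<pi> h (p, l)) \<in> carrier R"
      using g h d il p by (simp add: Phi_apply cset_def)
  qed
  also have "\<dots> = (Phi \<pi> g \<otimes>\<^bsub>skew_matrix_algebra R n (cset \<pi> d)\<^esub> Phi \<pi> h) (i, l)"
    by (rule skew_matrix_mult[OF il, symmetric])
  finally show "Phi \<pi> (cmul d g h) (i, l) = (Phi \<pi> g \<otimes>\<^bsub>skew_matrix_algebra R n (cset \<pi> d)\<^esub> Phi \<pi> h) (i, l)" .
qed

lemma Phi_one:
  assumes \<pi>: "\<pi> \<in> ring_hom K R" "cring R"
  shows "Phi \<pi> (skew_monom K \<one> 0) = \<one>\<^bsub>skew_matrix_algebra R n c\<^esub>"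
proof (rule matrix_ext[of _ n])
  interpret R: cring R by fact
  fix i j assume ij: "i < n" "j < n"
  have "dif n i j = 0 \<longleftrightarrow> i = j" using ij by (auto simp: dif_eq split: if_splits)
  then show "Phi \<pi> (skew_monom K \<one> 0) (i, j) = \<one>\<^bsub>skew_matrix_algebra R n c\<^esub> (i, j)"
    using ij ring_hom_one[OF \<pi>(1)] ring_hom_zero[OF \<pi>(1) K.ring_axioms R.ring_axioms]
    by (simp add: Phi_apply skew_monom_def)
qed (auto simp: Phi_def)

lemma Phi_add:
  assumes \<pi>: "\<pi> \<in> ring_hom K R" and "g \<in> P" "h \<in> P"
  shows "Phi \<pi> (\<lambda>i. g i \<oplus> h i) = Phi \<pi> g \<oplus>\<^bsub>skew_matrix_algebra R n c\<^esub> Phi \<pi> h"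
  by (rule matrix_ext[of _ n]) (use assms in \<open>auto simp: Phi_def ring_hom_add[OF \<pi>]\<close>)

end

context galois_dual
begin

text \<open>
  An \<open>F\<close>-algebra homomorphism \<open>\<pi>\<close> from \<open>K\<close> to \<open>F\<close>, composed with the powers of \<open>\<sigma>\<close>, gives \<open>n\<close> coordinates
  on \<open>K\<close>.  Applying \<open>\<pi>\<close> to the relations of the dual families shows that \<open>\<Sum>\<^sub>k \<pi>(u\<^sub>k) v\<^sub>k\<close> has a single
  nonzero coordinate.
\<close>

lemma character_delta:
  assumes \<pi>: "\<pi> \<in> ring_hom K F" and lin: "\<And>c x. \<lbrakk>c \<in> carrier F; x \<in> carrier K\<rbrakk> \<Longrightarrow> \<pi> (c \<odot> x) = c \<otimes>\<^bsub>F\<^esub> \<pi> x"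
  obtains a where "a \<in> carrier K"
    "\<And>i. \<pi> (s i a) = (if i mod n = 0 then \<one>\<^bsub>F\<^esub> else \<zero>\<^bsub>F\<^esub>)"
proof
  note \<pi>c [simp] = ring_hom_closed[OF \<pi>]
  have \<pi>0: "\<pi> \<zero> = \<zero>\<^bsub>F\<^esub>" by (rule ring_hom_zero[OF \<pi> K.ring_axioms F.ring_axioms])
  have \<pi>sum: "\<pi> (\<Oplus>k\<in>X. f k) = (\<Oplus>\<^bsub>F\<^esub>k\<in>X. \<pi> (f k))" if "finite X" "\<And>k. k \<in> X \<Longrightarrow> f k \<in> carrier K" for f and X :: "nat set"
    using that by (intro K.finsum_map) (auto simp: \<pi>0 ring_hom_add[OF \<pi>] F.abelian_monoid_axioms)
  let ?a = "\<Oplus>k\<in>{..<N}. \<pi> (u k) \<odot> v k"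
  show ac: "?a \<in> carrier K" by (intro K.finsum_in) auto
  fix i
  have "s i ?a = (\<Oplus>k\<in>{..<N}. s i (\<pi> (u k) \<odot> v k))" by (intro s_sum) auto
  then have "\<pi> (s i ?a) = (\<Oplus>\<^bsub>F\<^esub>k\<in>{..<N}. \<pi> (s i (\<pi> (u k) \<odot> v k)))" by (simp only: \<pi>sum) (intro \<pi>sum; auto)
  also have "\<dots> = (\<Oplus>\<^bsub>F\<^esub>k\<in>{..<N}. \<pi> (u k \<otimes> s (i mod n) (v k)))"
    by (intro F.finsum_eqI) (auto simp: lin ring_hom_mult[OF \<pi>] s_mod)
  also have "\<dots> = \<pi> (\<Oplus>k\<in>{..<N}. u k \<otimes> s (i mod n) (v k))" by (intro \<pi>sum[symmetric]) auto
  finally show "\<pi> (s i ?a) = (if i mod n = 0 then \<one>\<^bsub>F\<^esub> else \<zero>\<^bsub>F\<^esub>)"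
    using n_pos by (simp add: dual \<pi>0 ring_hom_one[OF \<pi>])
qed

text \<open>The elements all of whose coordinates vanish form a \<open>\<sigma>\<close>-stable ideal without \<open>1\<close>.\<close>

lemma character_inj:
  assumes \<pi>: "\<pi> \<in> ring_hom K F" and a: "a \<in> carrier K" and b: "b \<in> carrier K"
    and eq: "\<And>i. i < n \<Longrightarrow> \<pi> (s (n - i) a) = \<pi> (s (n - i) b)"
  shows "a = b"
proof -
  note \<pi>c [simp] = ring_hom_closed[OF \<pi>]
  have \<pi>0: "\<pi> \<zero> = \<zero>\<^bsub>F\<^esub>" by (rule ring_hom_zero[OF \<pi> K.ring_axioms F.ring_axioms])
  have \<pi>m: "\<pi> (\<ominus> x) = \<ominus>\<^bsub>F\<^esub> \<pi> x" if "x \<in> carrier K" for x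
    using that ring_hom_add[OF \<pi>, of "\<ominus> x" x] by (intro F.minus_equality[symmetric]) (auto simp: \<pi>0 K.l_neg)
  define I where "I = {x \<in> carrier K. \<forall>i. \<pi> (s i x) = \<zero>\<^bsub>F\<^esub>}"
  have eq': "\<pi> (s i a) = \<pi> (s i b)" for i
  proof (cases "i mod n = 0")
    case True
    then show ?thesis using eq[of 0] n_pos a b s_mod[of a i] s_mod[of b i] by (simp add: period)
  next
    case False
    then have "n - (n - i mod n) = i mod n" "n - i mod n < n" using n_pos by (auto simp: less_imp_le)
    then show ?thesis using eq[of "n - i mod n"] a b s_mod[of a i] s_mod[of b i] by simp
  qed
  have "a \<ominus> b \<in> I"
    using a b eq' by (auto simp: I_def a_minus_def ring_hom_add[OF \<pi>] \<pi>m F.r_neg)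
  show ?thesis
  proof (rule ccontr)
    assume "a \<noteq> b"
    then have "a \<ominus> b \<noteq> \<zero>" using a b by simp
    have "\<one> \<in> I"
    proof (rule sigma_simple[OF _ \<open>a \<ominus> b \<in> I\<close> \<open>a \<ominus> b \<noteq> \<zero>\<close>])
      show "\<sigma> x \<in> I" if "x \<in> I" for x
      proof -
        have "\<sigma> x = s 1 x" by simp
        then show ?thesis using that s_closed[of x 1] by (auto simp only: I_def s_s mem_Collect_eq)
      qed
    qed (auto simp: I_def ring_hom_add[OF \<pi>] ring_hom_mult[OF \<pi>])
    then show False using ring_hom_one[OF \<pi>] by (auto simp: I_def)
  qed
qed

lemma character_surj:
  assumes \<pi>: "\<pi> \<in> ring_hom K F" and lin: "\<And>c x. \<lbrakk>c \<in> carrier F; x \<in> carrier K\<rbrakk> \<Longrightarrow> \<pi> (c \<odot> x) = c \<otimes>\<^bsub>F\<^esub> \<pi> x"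
    and w: "\<And>i. i < n \<Longrightarrow> w i \<in> carrier F"
  shows "\<exists>a\<in>carrier K. \<forall>i<n. \<pi> (s (n - i) a) = w i"
proof -
  note \<pi>c [simp] = ring_hom_closed[OF \<pi>]
  have \<pi>0: "\<pi> \<zero> = \<zero>\<^bsub>F\<^esub>" by (rule ring_hom_zero[OF \<pi> K.ring_axioms F.ring_axioms])
  obtain a where a: "a \<in> carrier K" "\<And>i. \<pi> (s i a) = (if i mod n = 0 then \<one>\<^bsub>F\<^esub> else \<zero>\<^bsub>F\<^esub>)"
    using character_delta[OF \<pi> lin] by blast
  let ?b = "\<Oplus>j\<in>{..<n}. w j \<odot> s j a"
  have b: "?b \<in> carrier K" using a w by (intro K.finsum_in) auto
  have "\<pi> (s (n - i) ?b) = w i" if i: "i < n" for i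
  proof -
    have "\<pi> (s (n - i) ?b) = \<pi> (\<Oplus>j\<in>{..<n}. s (n - i) (w j \<odot> s j a))"
      using a w by (subst s_sum) auto
    also have "\<dots> = (\<Oplus>\<^bsub>F\<^esub>j\<in>{..<n}. \<pi> (s (n - i) (w j \<odot> s j a)))"
      using a w by (intro K.finsum_map) (auto simp: \<pi>0 ring_hom_add[OF \<pi>] F.abelian_monoid_axioms)
    also have "\<dots> = (\<Oplus>\<^bsub>F\<^esub>j\<in>{..<n}. if j = i then w i else \<zero>\<^bsub>F\<^esub>)"
    proof (rule F.finsum_eqI)
      fix j assume "j \<in> {..<n}"
      then have j: "j < n" by simp
      have "(n - i + j) mod n = 0 \<longleftrightarrow> j = i"
      proof (cases "i \<le> j")
        case True
        have "n - i + j = j + n - i" using i by simp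
        then have "(n - i + j) mod n = j - i" using True j by (simp only: sub_mod)
        then show ?thesis using True by auto
      qed (use i j in auto)
      then show "\<pi> (s (n - i) (w j \<odot> s j a)) = (if j = i then w i else \<zero>\<^bsub>F\<^esub>)"
        using a w j by (simp add: lin s_s)
    qed (use w i in auto)
    also have "\<dots> = w i" using w i by (subst F.finsum_single[of i]) auto
    finally show ?thesis .
  qed
  then show ?thesis using b by blast
qed

lemma character_split:
  assumes \<pi>: "\<pi> \<in> ring_hom K F" and lin: "\<And>c x. \<lbrakk>c \<in> carrier F; x \<in> carrier K\<rbrakk> \<Longrightarrow> \<pi> (c \<odot> x) = c \<otimes>\<^bsub>F\<^esub> \<pi> x"
  shows "alg_isomorphic F K (prod_algebra n (\<lambda>_. self_algebra F))"
proof -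
  let ?h = "\<lambda>a. \<lambda>i\<in>{..<n}. \<pi> (s (n - i) a)"
  have "?h \<in> alg_iso F K (prod_algebra n (\<lambda>_. self_algebra F))"
    unfolding alg_iso_def ring_iso_def
  proof (intro CollectI conjI ballI)
    show "?h \<in> ring_hom K (prod_algebra n (\<lambda>_. self_algebra F))"
      by (rule ring_hom_memI) (auto simp: prod_algebra_def self_algebra_def ring_hom_mult[OF \<pi>] ring_hom_add[OF \<pi>]
          ring_hom_one[OF \<pi>] intro: ring_hom_closed[OF \<pi>] cong: restrict_cong)
    show "bij_betw ?h (carrier K) (carrier (prod_algebra n (\<lambda>_. self_algebra F)))"
      unfolding bij_betw_def
    proof
      show "inj_on ?h (carrier K)"
      proof (rule inj_onI)
        fix a b assume ab: "a \<in> carrier K" "b \<in> carrier K" "?h a = ?h b"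
        have "\<pi> (s (n - i) a) = \<pi> (s (n - i) b)" if "i < n" for i
          using fun_cong[OF ab(3), of i] that by simp
        then show "a = b" by (rule character_inj[OF \<pi> ab(1,2)])
      qed
      show "?h ` carrier K = carrier (prod_algebra n (\<lambda>_. self_algebra F))"
      proof (intro equalityI subsetI)
        fix w assume "w \<in> carrier (prod_algebra n (\<lambda>_. self_algebra F))"
        then have w: "w \<in> {..<n} \<rightarrow>\<^sub>E carrier F" by (simp add: prod_algebra_def self_algebra_def)
        then obtain a where a: "a \<in> carrier K" "\<forall>i<n. \<pi> (s (n - i) a) = w i"
          using character_surj[OF \<pi> lin, of w] by auto
        then have "?h a = (\<lambda>i\<in>{..<n}. w i)" by (intro restrict_ext) auto
        also have "\<dots> = w" using w by (auto simp: PiE_def extensional_restrict)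
        finally show "w \<in> ?h ` carrier K" using a(1) by blast
      next
        fix w assume "w \<in> ?h ` carrier K"
        then obtain a where "a \<in> carrier K" "w = ?h a" by blast
        then show "w \<in> carrier (prod_algebra n (\<lambda>_. self_algebra F))"
          using ring_hom_closed[OF \<pi>] by (simp add: prod_algebra_def self_algebra_def)
      qed
    qed
  qed (auto simp: prod_algebra_def self_algebra_def lin cong: restrict_cong)
  then show ?thesis by (auto simp: alg_isomorphic_def)
qed

lemma character_A_split:
  assumes \<pi>: "\<pi> \<in> ring_hom K F" and lin: "\<And>c x. \<lbrakk>c \<in> carrier F; x \<in> carrier K\<rbrakk> \<Longrightarrow> \<pi> (c \<odot> x) = c \<otimes>\<^bsub>F\<^esub> \<pi> x"
    and d: "d \<in> carrier K"
  shows "split_algebra F (A d)"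
proof -
  let ?M = "skew_matrix_algebra F n (cset \<pi> d)"
  have "Phi \<pi> \<in> alg_iso F (A d) ?M"
    unfolding alg_iso_def ring_iso_def
  proof (intro CollectI conjI ballI)
    show "Phi \<pi> \<in> ring_hom (A d) ?M"
    proof (rule ring_hom_memI)
      fix x y assume "x \<in> carrier (A d)" "y \<in> carrier (A d)"
      then show "Phi \<pi> (x \<otimes>\<^bsub>A d\<^esub> y) = Phi \<pi> x \<otimes>\<^bsub>?M\<^esub> Phi \<pi> y" "Phi \<pi> (x \<oplus>\<^bsub>A d\<^esub> y) = Phi \<pi> x \<oplus>\<^bsub>?M\<^esub> Phi \<pi> y"
        using Phi_mult[OF F.is_cring \<pi> d] Phi_add[OF \<pi>] d by (simp_all only: A_simps A_mult)
    qed (use Phi_closed[OF \<pi>] Phi_one[OF \<pi> F.is_cring] in \<open>simp_all del: skew_matrix_simps\<close>)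
    show "bij_betw (Phi \<pi>) (carrier (A d)) (carrier ?M)"
      unfolding bij_betw_def
    proof
      show "inj_on (Phi \<pi>) (carrier (A d))"
      proof (rule inj_onI)
        fix g h assume "g \<in> carrier (A d)" "h \<in> carrier (A d)" and eq: "Phi \<pi> g = Phi \<pi> h"
        then have gh: "g \<in> P" "h \<in> P" by auto
        show "g = h"
        proof (rule below_ext[OF gh])
          fix m assume m: "m < n"
          show "g m = h m"
          proof (rule character_inj[OF \<pi>])
            fix i assume i: "i < n"
            show "\<pi> (s (n - i) (g m)) = \<pi> (s (n - i) (h m))"
              using fun_cong[OF eq, of "(i, dif n i m)"] i m n_pos by (simp add: Phi_apply dif_inv)
          qed (use gh in auto)
        qed
      qed
      show "Phi \<pi> ` carrier (A d) = carrier ?M"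
      proof (intro equalityI subsetI)
        fix W assume W: "W \<in> carrier ?M"
        then have Wc: "W (i, j) \<in> carrier F" if "i < n" "j < n" for i j using that by auto
        have "\<exists>a\<in>carrier K. \<forall>i<n. \<pi> (s (n - i) a) = W (i, dif n i m)" for m
          using n_pos by (intro character_surj[OF \<pi> lin] Wc) auto
        then obtain g where g: "\<And>m. g m \<in> carrier K" "\<And>m i. i < n \<Longrightarrow> \<pi> (s (n - i) (g m)) = W (i, dif n i m)"
          by metis
        let ?g = "\<lambda>m. if m < n then g m else \<zero>"
        have "?g \<in> P" using g by (auto simp: mem_below)
        moreover have "Phi \<pi> ?g = W"
          by (rule matrix_ext[of _ n]) (use W n_pos in \<open>auto simp: Phi_apply g dif_inv PiE_def, auto simp: Phi_def\<close>)
        ultimately show "W \<in> Phi \<pi> ` carrier (A d)" by auto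
      qed (use Phi_closed[OF \<pi>] in \<open>auto simp del: skew_matrix_simps\<close>)
    qed
  next
    fix a x assume a: "a \<in> carrier F" and x: "x \<in> carrier (A d)"
    show "Phi \<pi> (a \<odot>\<^bsub>A d\<^esub> x) = a \<odot>\<^bsub>?M\<^esub> Phi \<pi> x"
      by (rule matrix_ext[of _ n]) (use a x lin in \<open>auto simp: Phi_apply, auto simp: Phi_def\<close>)
  qed
  then show ?thesis
    unfolding split_algebra_def alg_isomorphic_def using n_pos cset_reduced[OF \<pi> d] by blast
qed

lemma split_if_K_split:
  assumes K: "alg_isomorphic F K (prod_algebra n (\<lambda>_. self_algebra F))" and d: "d \<in> carrier K"
  shows "split_algebra F (A d)"
proof -
  obtain h where h: "h \<in> alg_iso F K (prod_algebra n (\<lambda>_. self_algebra F))" using K by (auto simp: alg_isomorphic_def)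
  then have hom: "h \<in> ring_hom K (prod_algebra n (\<lambda>_. self_algebra F))" by (auto simp: alg_iso_def ring_iso_def)
  have "(\<lambda>a. h a 0) \<in> ring_hom K F"
  proof (rule ring_hom_memI)
    fix x y assume xy: "x \<in> carrier K" "y \<in> carrier K"
    show "h (x \<otimes> y) 0 = h x 0 \<otimes>\<^bsub>F\<^esub> h y 0" "h (x \<oplus> y) 0 = h x 0 \<oplus>\<^bsub>F\<^esub> h y 0"
      using ring_hom_mult[OF hom xy] ring_hom_add[OF hom xy] n_pos by (simp_all add: prod_algebra_def self_algebra_def)
  next
    fix x assume "x \<in> carrier K"
    from ring_hom_closed[OF hom this] show "h x 0 \<in> carrier F"
      using n_pos by (auto simp: prod_algebra_def self_algebra_def)
  next
    show "h \<one> 0 = \<one>\<^bsub>F\<^esub>" using ring_hom_one[OF hom] n_pos by (simp add: prod_algebra_def self_algebra_def)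
  qed
  then show ?thesis
    by (rule character_A_split) (use h n_pos d in \<open>auto simp: alg_iso_def prod_algebra_def self_algebra_def\<close>)
qed

end

section \<open>Splitting by the base change to K\<close>

context galois_dual
begin

lemma tr_rev: assumes a: "a \<in> carrier K" shows "tr a = (\<Oplus>p\<in>{..<n}. s (n - p) a)"
proof -
  have "bij_betw (dif n 0) {..<n} {..<n}" using n_pos by (rule dif_bij)
  then have "(\<Oplus>p\<in>{..<n}. s (dif n 0 p) a) = tr a"
    unfolding tr_def using a by (intro finsum_bij) auto
  moreover have "s (dif n 0 p) a = s (n - p) a" for p using a by (simp add: dif_def s_mod)
  ultimately show ?thesis by simp
qed

text \<open>
  The map \<open>g \<otimes> l \<mapsto> l \<cdot> Phi id g\<close> is an isomorphism of \<open>K\<close>-algebras.  It is denoted \<open>Psi\<close> on representatives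
  and \<open>H\<close> on classes.  The coordinates of a tensor with respect to the generators \<open>u\<^sub>k t\<^sup>i\<close> of \<open>A\<close> over \<open>F\<close>
  are obtained from the entries of its matrix by the trace, which gives injectivity; surjectivity is
  the duality of \<open>u\<close> and \<open>v\<close>.
\<close>

lemma base_change_split:
  assumes d: "d \<in> carrier K"
  shows "split_algebra K (base_change F (A d) K)"
proof -
  \<comment> \<open>the identity of \<open>K\<close> as a character with values in \<open>K\<close>\<close>
  define \<pi> :: "'b \<Rightarrow> 'b" where "\<pi> = id"
  have pi_apply: "\<pi> x = x" for x by (simp add: \<pi>_def)
  let ?c = "cset \<pi> d"
  let ?M = "skew_matrix_algebra K n ?c"
  have pi_hom: "\<pi> \<in> ring_hom K K" by (auto simp: ring_hom_def pi_apply)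
  have red: "reduced_skew_set K n ?c" by (rule cset_reduced[OF pi_hom d])
  interpret AA: nonassoc_algebra F "A d" by (rule A_nonassoc_algebra[OF d])
  interpret M: nonassoc_algebra K ?M by (rule skew_matrix_nonassoc_algebra[OF K.is_cring red])
  interpret T: tensor_modules F "A d" K by (intro tensor_modules.intro AA.module_axioms KA.module)
  have Phi_M: "Phi \<pi> g \<in> carrier ?M" if "g \<in> P" for g by (rule Phi_closed[OF pi_hom that])
  have M_entry: "W (i, j) \<in> carrier K" if "W \<in> carrier ?M" "i < n" "j < n" for W i j
    using that by auto
  let ?\<beta> = "\<lambda>(g, l). l \<odot>\<^bsub>?M\<^esub> Phi \<pi> g"
  have \<beta>c: "?\<beta> p \<in> carrier ?M" if "p \<in> T.S" for p
  proof -
    obtain g l where p: "p = (g, l)" "g \<in> P" "l \<in> carrier K" using \<open>p \<in> T.S\<close> by auto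
    then show ?thesis using M.smult_closed[OF p(3) Phi_M[OF p(2)]] by simp
  qed
  define Psi where "Psi = M.frag_sum ?\<beta>"
  have Psi_closed: "Psi x \<in> carrier ?M" if "Poly_Mapping.keys x \<subseteq> T.S" for x
    unfolding Psi_def by (rule M.frag_sum_closed) (rule \<beta>c; use that in blast)
  have Psi_diff: "Psi (x - y) = Psi x \<ominus>\<^bsub>?M\<^esub> Psi y" if "Poly_Mapping.keys x \<subseteq> T.S" "Poly_Mapping.keys y \<subseteq> T.S" for x y
    unfolding Psi_def by (rule M.frag_sum_diff) (rule \<beta>c; use that in blast)+
  have Psi_add: "Psi (x + y) = Psi x \<oplus>\<^bsub>?M\<^esub> Psi y" if "Poly_Mapping.keys x \<subseteq> T.S" "Poly_Mapping.keys y \<subseteq> T.S" for x y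
    unfolding Psi_def by (rule M.frag_sum_add) (rule \<beta>c; use that in blast)+
  have Psi_of: "Psi (frag_of (g, l)) = l \<odot>\<^bsub>?M\<^esub> Phi \<pi> g" if "g \<in> P" "l \<in> carrier K" for g l
  proof -
    have "?\<beta> (g, l) \<in> carrier ?M" using that by (intro \<beta>c) simp
    then have "M.frag_sum ?\<beta> (frag_of (g, l)) = ?\<beta> (g, l)" by (rule M.frag_sum_of)
    then show ?thesis by (simp only: Psi_def prod.case)
  qed
  have Psi_zero: "Psi 0 = \<zero>\<^bsub>?M\<^esub>" unfolding Psi_def by (rule M.frag_sum_zero)
  have ker: "Psi x = \<zero>\<^bsub>?M\<^esub>" if "x \<in> T.ker" for x
    unfolding Psi_def
  proof (rule T.ker_frag_sum[OF M.M.abelian_group_axioms _ _ _ _ that])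
    fix g g' l assume "g \<in> carrier (A d)" "g' \<in> carrier (A d)" and l: "l \<in> carrier K"
    then have gg: "g \<in> P" "g' \<in> P" by auto
    show "?\<beta> (g \<oplus>\<^bsub>A d\<^esub> g', l) = ?\<beta> (g, l) \<oplus>\<^bsub>?M\<^esub> ?\<beta> (g', l)"
      unfolding A_simps prod.case Phi_add[OF pi_hom gg, where c = "?c"]
      by (rule M.smult_r_distr[OF l Phi_M[OF gg(1)] Phi_M[OF gg(2)]])
  next
    fix g l l' assume "g \<in> carrier (A d)" and l: "l \<in> carrier K" "l' \<in> carrier K"
    then have g: "g \<in> P" by auto
    show "?\<beta> (g, l \<oplus> l') = ?\<beta> (g, l) \<oplus>\<^bsub>?M\<^esub> ?\<beta> (g, l')"
      using M.smult_l_distr[OF l Phi_M[OF g]] by (simp only: prod.case)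
  next
    fix a g l assume a: "a \<in> carrier F" and "g \<in> carrier (A d)" and l: "l \<in> carrier K"
    then have g: "g \<in> P" by auto
    show "?\<beta> (a \<odot>\<^bsub>A d\<^esub> g, l) = ?\<beta> (g, a \<odot> l)"
      using a l g by (auto simp: Phi_def pi_apply fun_eq_iff smult_mult_right KA.smult_assoc2)
  next
    fix g l assume "g \<in> carrier (A d)" "l \<in> carrier K"
    then show "?\<beta> (g, l) \<in> carrier ?M" by (intro \<beta>c) simp
  qed
  let ?\<chi> = "\<lambda>p j (g, l). l \<otimes> s (n - p) (g (dif n p j))"
  have Psi_entry: "Psi x (p, j) = K.frag_sum (?\<chi> p j) x" if x: "Poly_Mapping.keys x \<subseteq> T.S" and pj: "p < n" "j < n" for x p j
  proof (rule K.frag_sum_unique[OF x, where h = "\<lambda>x. Psi x (p, j)"])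
    fix q assume q: "q \<in> T.S"
    then obtain g l where gl: "q = (g, l)" "g \<in> P" "l \<in> carrier K" by auto
    show "?\<chi> p j q \<in> carrier K" using gl by simp
    show "Psi (frag_of q) (p, j) = ?\<chi> p j q" using gl pj by (simp add: Psi_of Phi_apply pi_apply)
  next
    fix x y :: "(nat \<Rightarrow> 'b) \<times> 'b \<Rightarrow>\<^sub>0 int" assume xy: "Poly_Mapping.keys x \<subseteq> T.S" "Poly_Mapping.keys y \<subseteq> T.S"
    have k: "Poly_Mapping.keys (x - y) \<subseteq> T.S" using xy keys_diff[of x y] by blast
    have c: "Psi z (p, j) \<in> carrier K" if "Poly_Mapping.keys z \<subseteq> T.S" for z
      by (rule M_entry[OF Psi_closed[OF that] pj])
    have "Psi (x - y) \<oplus>\<^bsub>?M\<^esub> Psi y = Psi x"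
      using Psi_add[OF k xy(2)] by simp
    then have "Psi (x - y) (p, j) \<oplus> Psi y (p, j) = Psi x (p, j)" using pj by (auto dest: fun_cong[of _ _ "(p, j)"])
    then show "Psi (x - y) (p, j) = Psi x (p, j) \<ominus> Psi y (p, j)"
      by (rule K.eq_minusI[OF c[OF k] c[OF xy(2)]])
  qed (use pj in \<open>simp add: Psi_zero\<close>)
  have inj: "x \<in> T.ker" if x: "Poly_Mapping.keys x \<subseteq> T.S" and zero: "Psi x = \<zero>\<^bsub>?M\<^esub>" for x
  proof (rule T.ker_criterion[of "{..<N} \<times> {..<n}" "\<lambda>(k, i). skew_monom K (u k) i" "\<lambda>(k, i) g. trF (v k \<otimes> g i)"])
    fix g assume "g \<in> carrier (A d)"
    then have g: "g \<in> P" by simp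
    let ?t = "\<lambda>k i. (\<lambda>m. trF (v k \<otimes> g i) \<odot> skew_monom K (u k) i m)"
    have tP: "?t k i \<in> P" if "i < n" for k i
      using g that by (auto simp: mem_below skew_monom_def)
    have "(\<Oplus>\<^bsub>A d\<^esub>q\<in>{..<N} \<times> {..<n}. ?t (fst q) (snd q)) = g"
    proof (rule below_ext)
      show "(\<Oplus>\<^bsub>A d\<^esub>q\<in>{..<N} \<times> {..<n}. ?t (fst q) (snd q)) \<in> P"
        using AA.M.finsum_in[of "{..<N} \<times> {..<n}" "\<lambda>q. ?t (fst q) (snd q)"] tP by auto
      fix m assume m: "m < n"
      have "(\<Oplus>\<^bsub>A d\<^esub>q\<in>{..<N} \<times> {..<n}. ?t (fst q) (snd q)) m = (\<Oplus>q\<in>{..<N} \<times> {..<n}. ?t (fst q) (snd q) m)"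
        by (subst A_finsum) (use tP in auto)
      also have "\<dots> = (\<Oplus>q\<in>{..<N} \<times> {m}. ?t (fst q) (snd q) m)"
        using m g by (intro K.add.finprod_mono_neutral_cong_right) (auto simp: skew_monom_def)
      also have "\<dots> = (\<Oplus>k\<in>{..<N}. ?t k m m)"
      proof -
        have "bij_betw (\<lambda>k. (k, m)) {..<N} ({..<N} \<times> {m})" by (auto simp: bij_betw_def inj_on_def)
        from K.finsum_bij[OF this, of "\<lambda>q. ?t (fst q) (snd q) m"] show ?thesis using g by simp
      qed
      also have "\<dots> = g m" using dual_expansion[of "g m"] g by (simp add: skew_monom_def)
      finally show "(\<Oplus>\<^bsub>A d\<^esub>q\<in>{..<N} \<times> {..<n}. ?t (fst q) (snd q)) m = g m" .
    qed (rule g)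
    then show "g = (\<Oplus>\<^bsub>A d\<^esub>q\<in>{..<N} \<times> {..<n}. (case q of (k, i) \<Rightarrow> \<lambda>g. trF (v k \<otimes> g i)) g \<odot>\<^bsub>A d\<^esub> (case q of (k, i) \<Rightarrow> skew_monom K (u k) i))"
      by (simp add: case_prod_unfold)
  next
    fix q assume "q \<in> {..<N} \<times> {..<n}"
    then obtain k i where q: "q = (k, i)" "k < N" "i < n" by auto
    let ?\<gamma> = "\<lambda>(g, l). trF (v k \<otimes> g i) \<odot> l"
    let ?h = "\<lambda>x. \<Oplus>p\<in>{..<n}. s (n - p) (v k) \<otimes> Psi x (p, dif n p i)"
    have c: "Psi z (p, dif n p i) \<in> carrier K" if "Poly_Mapping.keys z \<subseteq> T.S" "p < n" for z p
      by (rule M_entry[OF Psi_closed[OF that(1)] that(2) dif_less[OF n_pos]])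
    have "?h x = K.frag_sum ?\<gamma> x"
    proof (rule K.frag_sum_unique[OF x])
      fix r assume r: "r \<in> T.S"
      then obtain g l where gl: "r = (g, l)" "g \<in> P" "l \<in> carrier K" by auto
      show "?\<gamma> r \<in> carrier K" using gl by simp
      have "trF (v k \<otimes> g i) \<odot> l = (\<Oplus>p\<in>{..<n}. s (n - p) (v k \<otimes> g i) \<otimes> l)"
        using gl by (simp add: trF_smult tr_rev finsum_ldistr Pi_def)
      also have "\<dots> = (\<Oplus>p\<in>{..<n}. s (n - p) (v k) \<otimes> Psi (frag_of r) (p, dif n p i))"
        using gl q n_pos by (intro K.finsum_eqI) (auto simp: Psi_of Phi_apply pi_apply dif_inv m_ac)
      finally show "?h (frag_of r) = ?\<gamma> r" using gl by simp
    next
      fix x y :: "(nat \<Rightarrow> 'b) \<times> 'b \<Rightarrow>\<^sub>0 int" assume xy: "Poly_Mapping.keys x \<subseteq> T.S" "Poly_Mapping.keys y \<subseteq> T.S"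
      have k: "Poly_Mapping.keys (x - y) \<subseteq> T.S" using xy keys_diff[of x y] by blast
      have hc: "?h z \<in> carrier K" if "Poly_Mapping.keys z \<subseteq> T.S" for z using c[OF that] by (intro K.finsum_in) auto
      have "Psi (x - y) \<oplus>\<^bsub>?M\<^esub> Psi y = Psi x" using Psi_add[OF k xy(2)] by simp
      then have e: "Psi (x - y) (p, j) \<oplus> Psi y (p, j) = Psi x (p, j)" if "p < n" "j < n" for p j
        using that by (auto dest: fun_cong[of _ _ "(p, j)"])
      have "?h (x - y) \<oplus> ?h y = (\<Oplus>p\<in>{..<n}. s (n - p) (v k) \<otimes> Psi (x - y) (p, dif n p i) \<oplus> s (n - p) (v k) \<otimes> Psi y (p, dif n p i))"
        using c[OF k] c[OF xy(2)] by (intro K.finsum_add[symmetric]) auto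
      also have "\<dots> = ?h x"
        using c[OF k] c[OF xy(2)] c[OF xy(1)] n_pos by (intro K.finsum_eqI) (auto simp: r_distr[symmetric] e)
      finally show "?h (x - y) = ?h x \<ominus> ?h y" by (rule K.eq_minusI[OF hc[OF k] hc[OF xy(2)]])
    qed (use n_pos in \<open>auto simp: Psi_zero intro!: K.add.finprod_one_eqI\<close>)
    moreover have "?h x = \<zero>" using zero n_pos by (auto intro!: K.add.finprod_one_eqI)
    ultimately have "K.frag_sum ?\<gamma> x = \<zero>" by simp
    then show "K.frag_sum (\<lambda>(g, l). (case q of (k, i) \<Rightarrow> \<lambda>g. trF (v k \<otimes> g i)) g \<odot> l) x = \<zero>"
      using q by simp
  next
    show "finite ({..<N} \<times> {..<n})" by simp
  qed (use x in \<open>auto\<close>)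
  have surj: "\<exists>x. Poly_Mapping.keys x \<subseteq> T.S \<and> Psi x = W" if W: "W \<in> carrier ?M" for W
  proof -
    have Wc [simp]: "W (i, j) \<in> carrier K" if "i < n" "j < n" for i j using W that by auto
    \<comment> \<open>the tensor \<open>\<Sum>\<^sub>k v\<^sub>k t\<^sup>p\<^sup>-\<^sup>j \<otimes> W\<^sub>p\<^sub>j \<sigma>\<^sup>-\<^sup>p(u\<^sub>k)\<close> is mapped to the matrix with the single entry \<open>W\<^sub>p\<^sub>j\<close>\<close>
    let ?f = "\<lambda>p j k. frag_of (skew_monom K (v k) (dif n p j), W (p, j) \<otimes> s (n - p) (u k))"
    let ?X = "\<lambda>q. \<Sum>k<N. ?f (fst q) (snd q) k"
    have fS: "?f (fst q) (snd q) k \<in> carrier T.FG" if "q \<in> {..<n} \<times> {..<n}" for q k using that n_pos by auto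
    have XS: "?X q \<in> carrier T.FG" if "q \<in> {..<n} \<times> {..<n}" for q
      using fS[OF that] by (intro sum_closed_free_Abelian_group)
    define x where "x = sum ?X ({..<n} \<times> {..<n})"
    have "x \<in> carrier T.FG" unfolding x_def by (rule sum_closed_free_Abelian_group) (rule XS)
    then have xS: "Poly_Mapping.keys x \<subseteq> T.S" by simp
    have "Psi x (i, l) = W (i, l)" if il: "i < n" "l < n" for i l
    proof -
      have \<chi>c: "?\<chi> i l q \<in> carrier K" if "q \<in> T.S" for q using that by auto
      have "Psi x (i, l) = K.frag_sum (?\<chi> i l) x" by (rule Psi_entry[OF xS il])
      also have "\<dots> = (\<Oplus>q\<in>{..<n} \<times> {..<n}. K.frag_sum (?\<chi> i l) (?X q))"
        unfolding x_def
      proof (rule K.frag_sum_sum[where S = T.S])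
        show "Poly_Mapping.keys (?X q) \<subseteq> T.S" if "q \<in> {..<n} \<times> {..<n}" for q
          using XS[OF that] by (simp only: carrier_free_Abelian_group_iff)
      qed (use \<chi>c in auto)
      also have "\<dots> = (\<Oplus>q\<in>{..<n} \<times> {..<n}. if q = (i, l) then W (i, l) else \<zero>)"
      proof (rule K.finsum_eqI)
        fix q assume qI: "q \<in> {..<n} \<times> {..<n}"
        then obtain p j where q: "q = (p, j)" "p < n" "j < n" by auto
        have "K.frag_sum (?\<chi> i l) (?X q) = (\<Oplus>k\<in>{..<N}. K.frag_sum (?\<chi> i l) (?f p j k))"
          unfolding q(1) fst_conv snd_conv
        proof (rule K.frag_sum_sum[where S = T.S])
          show "Poly_Mapping.keys (?f p j k) \<subseteq> T.S" for k
            using fS[OF qI, of k] q(1) by (simp only: carrier_free_Abelian_group_iff fst_conv snd_conv)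
        qed (use \<chi>c in auto)
        also have "\<dots> = (\<Oplus>k\<in>{..<N}. (W (p, j) \<otimes> s (n - p) (u k)) \<otimes> s (n - i) (skew_monom K (v k) (dif n p j) (dif n i l)))"
          using q by (intro K.finsum_eqI) auto
        also have "\<dots> = (if q = (i, l) then W (i, l) else \<zero>)"
        proof (cases "dif n p j = dif n i l")
          case False
          then have "q \<noteq> (i, l)" using q by auto
          then show ?thesis using False q by (auto simp: skew_monom_def intro!: K.add.finprod_one_eqI)
        next
          case True
          have "(\<Oplus>k\<in>{..<N}. (W (p, j) \<otimes> s (n - p) (u k)) \<otimes> s (n - i) (skew_monom K (v k) (dif n p j) (dif n i l))) =
              (\<Oplus>k\<in>{..<N}. W (p, j) \<otimes> (s (dif n 0 p) (u k) \<otimes> s (dif n 0 i) (v k)))"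
            using q True by (intro K.finsum_eqI) (auto simp: skew_monom_def m_assoc dif_def s_mod)
          also have "\<dots> = W (p, j) \<otimes> (\<Oplus>k\<in>{..<N}. s (dif n 0 p) (u k) \<otimes> s (dif n 0 i) (v k))"
            using q by (intro K.finsum_rdistr[symmetric]) auto
          also have "\<dots> = (if p = i then W (p, j) else \<zero>)"
            using n_pos q il dif_inv[OF n_pos il(1)] dif_inv[OF n_pos q(2)] by (auto simp: dual_shift)
          also have "\<dots> = (if q = (i, l) then W (i, l) else \<zero>)"
            using q True dif_inv[OF il] dif_inv[OF q(2,3)] by auto
          finally show ?thesis .
        qed
        finally show "K.frag_sum (?\<chi> i l) (?X q) = (if q = (i, l) then W (i, l) else \<zero>)" .
      qed (use il in auto)
      also have "\<dots> = W (i, l)" using il by (subst K.finsum_single[of "(i, l)"]) auto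
      finally show ?thesis .
    qed
    then have "Psi x = W"
      using Psi_closed[OF xS] W by (intro matrix_ext[of _ n]) (auto simp: PiE_def)
    then show ?thesis using xS by blast
  qed
  have eq_iff: "T.cls x = T.cls y \<longleftrightarrow> Psi x = Psi y"
    if xy: "Poly_Mapping.keys x \<subseteq> T.S" "Poly_Mapping.keys y \<subseteq> T.S" for x y
  proof -
    have k: "Poly_Mapping.keys (x - y) \<subseteq> T.S" using xy keys_diff[of x y] by blast
    have "x - y \<in> T.ker \<longleftrightarrow> Psi (x - y) = \<zero>\<^bsub>?M\<^esub>" using ker inj[OF k] by blast
    also have "\<dots> \<longleftrightarrow> Psi x = Psi y"
      unfolding Psi_diff[OF xy] by (rule M.M.minus_other_side[OF Psi_closed[OF xy(1)] Psi_closed[OF xy(2)]])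
    finally show ?thesis by (simp only: T.cls_eq)
  qed
  have cls_keys: "Poly_Mapping.keys y \<subseteq> T.S" if "y \<in> T.cls x" "Poly_Mapping.keys x \<subseteq> T.S" for x y
  proof -
    have "y - x \<in> T.ker" using that by (simp add: T.mem_cls)
    from T.ker_carrier[OF this] have "Poly_Mapping.keys (y - x) \<subseteq> T.S" .
    then show ?thesis using that(2) keys_add[of "y - x" x] by auto
  qed
  have cls_Psi: "Psi y = Psi x" if y: "y \<in> T.cls x" and x: "Poly_Mapping.keys x \<subseteq> T.S" for x y
    using y eq_iff[OF cls_keys[OF y x] x] by (simp add: T.mem_cls T.cls_eq)
  have self_cls: "x \<in> T.cls x" for x by (simp add: T.mem_cls)
  have UN_cls: "(\<Union>y\<in>T.cls x. T.cls (f y)) = T.cls (f x)"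
    if x: "Poly_Mapping.keys x \<subseteq> T.S" and f: "\<And>y. Poly_Mapping.keys y \<subseteq> T.S \<Longrightarrow> Poly_Mapping.keys (f y) \<subseteq> T.S"
      and Psi_f: "\<And>y. \<lbrakk>Poly_Mapping.keys y \<subseteq> T.S; Psi y = Psi x\<rbrakk> \<Longrightarrow> Psi (f y) = Psi (f x)" for x f
  proof -
    have "T.cls (f y) = T.cls (f x)" if "y \<in> T.cls x" for y
      using eq_iff[OF f[OF cls_keys[OF that x]] f[OF x]] Psi_f[OF cls_keys[OF that x] cls_Psi[OF that x]] by simp
    then have "(\<Union>y\<in>T.cls x. T.cls (f y)) = (\<Union>y\<in>T.cls x. T.cls (f x))" by (intro SUP_cong refl)
    also have "\<dots> = T.cls (f x)" using self_cls[of x] by (intro UN_constant_eq) auto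
    finally show ?thesis .
  qed
  \<comment> \<open>the product and the scalar multiplication of the base change on representatives\<close>
  define pr where "pr = (\<lambda>x y. frag_extend (\<lambda>(a, k). frag_extend (\<lambda>(b, l). frag_of (a \<otimes>\<^bsub>A d\<^esub> b, k \<otimes> l)) y) x)"
  define sc where "sc = (\<lambda>l. frag_extend (\<lambda>(a :: nat \<Rightarrow> 'b, k). frag_of (a, l \<otimes> k)))"
  have diff_keys: "Poly_Mapping.keys (x - y) \<subseteq> T.S" if "Poly_Mapping.keys x \<subseteq> T.S" "Poly_Mapping.keys y \<subseteq> T.S" for x y :: "(nat \<Rightarrow> 'b) \<times> 'b \<Rightarrow>\<^sub>0 int"
    using that keys_diff[of x y] by blast
  have pr: "Poly_Mapping.keys (pr x y) \<subseteq> T.S \<and> Psi (pr x y) = Psi x \<otimes>\<^bsub>?M\<^esub> Psi y"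
    if x: "Poly_Mapping.keys x \<subseteq> T.S" and y: "Poly_Mapping.keys y \<subseteq> T.S" for x y
    using x
  proof (induction x rule: free_Abelian_group_induct[consumes 1, case_names zero diff gen])
    case zero
    show ?case using Psi_closed[OF y] M.mult_zero_left by (simp add: pr_def Psi_zero del: skew_matrix_simps)
  next
    case (diff x x')
    have "pr (x - x') y = pr x y - pr x' y" by (simp add: pr_def frag_extend_diff)
    then show ?case using diff Psi_diff[of "pr x y" "pr x' y"] diff_keys Psi_diff[of x x'] Psi_closed y
      by (simp add: a_minus_def M.distrib_right M.mult_minus_left M.mult_closed del: skew_matrix_simps)
  next
    case (gen p)
    then obtain g k where p: "p = (g, k)" "g \<in> P" "k \<in> carrier K" by auto
    show ?case
      using y
    proof (induction y rule: free_Abelian_group_induct[consumes 1, case_names zero diff gen])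
      case zero
      show ?case using Psi_closed[of "frag_of p"] gen M.mult_zero_right by (simp add: pr_def p(1) Psi_zero del: skew_matrix_simps)
    next
      case (diff y y')
      have "pr (frag_of p) (y - y') = pr (frag_of p) y - pr (frag_of p) y'" by (simp add: pr_def p(1) frag_extend_diff)
      then show ?case using diff Psi_diff[of "pr (frag_of p) y" "pr (frag_of p) y'"] diff_keys Psi_diff[of y y'] Psi_closed gen
        by (simp add: a_minus_def M.distrib_left M.mult_minus_right M.mult_closed del: skew_matrix_simps)
    next
      case (gen q)
      then obtain h l where q: "q = (h, l)" "h \<in> P" "l \<in> carrier K" by auto
      have gh: "g \<otimes>\<^bsub>A d\<^esub> h \<in> P" using AA.mult_closed[of g h] p q by simp
      have e: "pr (frag_of p) (frag_of q) = frag_of (g \<otimes>\<^bsub>A d\<^esub> h, k \<otimes> l)" by (simp add: pr_def p(1) q(1))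
      have "Psi (frag_of p) \<otimes>\<^bsub>?M\<^esub> Psi (frag_of q) = k \<odot>\<^bsub>?M\<^esub> (l \<odot>\<^bsub>?M\<^esub> (Phi \<pi> g \<otimes>\<^bsub>?M\<^esub> Phi \<pi> h))"
        unfolding p(1) q(1) Psi_of[OF p(2,3)] Psi_of[OF q(2,3)]
        using p q Phi_M[OF p(2)] Phi_M[OF q(2)]
        by (subst M.smult_left) (simp_all add: M.smult_right M.mult_closed M.smult_closed del: skew_matrix_simps)
      also have "\<dots> = (k \<otimes> l) \<odot>\<^bsub>?M\<^esub> Phi \<pi> (g \<otimes>\<^bsub>A d\<^esub> h)"
        using p q Phi_M[OF p(2)] Phi_M[OF q(2)] Phi_mult[OF K.is_cring pi_hom d p(2) q(2)]
        by (simp add: A_mult d M.smult_assoc1 M.mult_closed del: skew_matrix_simps)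
      finally have m: "Psi (frag_of p) \<otimes>\<^bsub>?M\<^esub> Psi (frag_of q) = (k \<otimes> l) \<odot>\<^bsub>?M\<^esub> Phi \<pi> (g \<otimes>\<^bsub>A d\<^esub> h)" .
      have kl: "k \<otimes> l \<in> carrier K" using p q by simp
      show ?case unfolding e m Psi_of[OF gh kl] using gh kl by simp
    qed
  qed
  have sc: "Poly_Mapping.keys (sc l x) \<subseteq> T.S \<and> Psi (sc l x) = l \<odot>\<^bsub>?M\<^esub> Psi x"
    if x: "Poly_Mapping.keys x \<subseteq> T.S" and l: "l \<in> carrier K" for x l
    using x
  proof (induction x rule: free_Abelian_group_induct[consumes 1, case_names zero diff gen])
    case zero
    show ?case using M.smult_r_null[OF l] by (simp add: sc_def Psi_zero del: skew_matrix_simps)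
  next
    case (diff x x')
    have "sc l (x - x') = sc l x - sc l x'" by (simp add: sc_def frag_extend_diff)
    then show ?case using diff Psi_diff[of "sc l x" "sc l x'"] diff_keys Psi_diff[of x x'] Psi_closed l
      by (simp add: a_minus_def M.smult_r_distr M.smult_r_minus del: skew_matrix_simps)
  next
    case (gen p)
    then obtain g k where p: "p = (g, k)" "g \<in> P" "k \<in> carrier K" by auto
    then show ?case using l Phi_M[OF p(2)]
      by (simp add: sc_def Psi_of M.smult_assoc1 del: skew_matrix_simps)
  qed
  let ?C = "base_change F (A d) K"
  define H where "H = (\<lambda>X. the_elem (Psi ` X))"
  have H_cls: "H (T.cls x) = Psi x" if "Poly_Mapping.keys x \<subseteq> T.S" for x
  proof -
    have "Psi ` T.cls x = (\<lambda>y. Psi x) ` T.cls x" by (rule image_cong[OF refl cls_Psi[OF _ that]])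
    also have "\<dots> = {Psi x}" by (rule image_constant[OF self_cls])
    finally show ?thesis by (simp add: H_def)
  qed
  have C: "\<exists>x. Poly_Mapping.keys x \<subseteq> T.S \<and> X = T.cls x" if "X \<in> carrier ?C" for X
    using that by (intro T.carrier_tensor[THEN iffD1]) (simp add: base_change_def)
  have C': "T.cls x \<in> carrier ?C" if "Poly_Mapping.keys x \<subseteq> T.S" for x
    using T.carrier_tensor[THEN iffD2, OF exI[of _ x]] that by (simp add: base_change_def)
  have C_add: "T.cls x \<oplus>\<^bsub>?C\<^esub> T.cls y = T.cls (x + y)" for x y
    using T.mult_tensor[of x y] by (simp add: base_change_def)
  have C_one: "\<one>\<^bsub>?C\<^esub> = T.cls (frag_of (\<one>\<^bsub>A d\<^esub>, \<one>))"
    by (simp only: base_change_def monoid.simps)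
  have C_mult: "T.cls x \<otimes>\<^bsub>?C\<^esub> T.cls y = T.cls (pr x y)"
    if x: "Poly_Mapping.keys x \<subseteq> T.S" and y: "Poly_Mapping.keys y \<subseteq> T.S" for x y
  proof -
    have "T.cls x \<otimes>\<^bsub>?C\<^esub> T.cls y = (\<Union>a\<in>T.cls x. \<Union>b\<in>T.cls y. T.cls (pr a b))"
      by (simp only: base_change_def monoid.simps pr_def)
    also have "\<dots> = (\<Union>a\<in>T.cls x. T.cls (pr a y))"
      by (intro SUP_cong refl UN_cls[OF y]) (use pr cls_keys[OF _ x] y in auto)
    also have "\<dots> = T.cls (pr x y)"
      by (intro UN_cls[OF x]) (use pr x y in auto)
    finally show ?thesis .
  qed
  have C_smult: "l \<odot>\<^bsub>?C\<^esub> T.cls x = T.cls (sc l x)" if x: "Poly_Mapping.keys x \<subseteq> T.S" and l: "l \<in> carrier K" for l x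
  proof -
    have "l \<odot>\<^bsub>?C\<^esub> T.cls x = (\<Union>y\<in>T.cls x. T.cls (sc l y))"
      by (simp only: base_change_def module.simps sc_def)
    also have "\<dots> = T.cls (sc l x)" by (intro UN_cls[OF x]) (use sc x l in auto)
    finally show ?thesis .
  qed
  have "H \<in> alg_iso K ?C ?M"
    unfolding alg_iso_def ring_iso_def
  proof (intro CollectI conjI ballI)
    show "H \<in> ring_hom ?C ?M"
    proof (rule ring_hom_memI)
      fix X assume "X \<in> carrier ?C"
      then obtain x where "Poly_Mapping.keys x \<subseteq> T.S" "X = T.cls x" using C by metis
      then show "H X \<in> carrier ?M" using Psi_closed by (simp add: H_cls del: skew_matrix_simps)
    next
      fix X Y assume "X \<in> carrier ?C" "Y \<in> carrier ?C"
      then obtain x y where xy: "Poly_Mapping.keys x \<subseteq> T.S" "X = T.cls x" "Poly_Mapping.keys y \<subseteq> T.S" "Y = T.cls y"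
        using C by metis
      show "H (X \<otimes>\<^bsub>?C\<^esub> Y) = H X \<otimes>\<^bsub>?M\<^esub> H Y"
        using xy pr[OF xy(1,3)] by (simp add: C_mult H_cls del: skew_matrix_simps)
      have "Poly_Mapping.keys (x + y) \<subseteq> T.S" using xy keys_add[of x y] by blast
      then show "H (X \<oplus>\<^bsub>?C\<^esub> Y) = H X \<oplus>\<^bsub>?M\<^esub> H Y"
        using xy by (simp add: C_add H_cls Psi_add del: skew_matrix_simps)
    next
      have "\<one>\<^bsub>A d\<^esub> \<in> P" by simp
      then have k: "Poly_Mapping.keys (frag_of (\<one>\<^bsub>A d\<^esub>, \<one>)) \<subseteq> T.S" by simp
      have "H \<one>\<^bsub>?C\<^esub> = \<one> \<odot>\<^bsub>?M\<^esub> Phi \<pi> (\<one>\<^bsub>A d\<^esub>)"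
        unfolding C_one H_cls[OF k] using \<open>\<one>\<^bsub>A d\<^esub> \<in> P\<close> by (intro Psi_of) auto
      also have "\<dots> = \<one>\<^bsub>?M\<^esub>"
        using M.smult_one[OF M.unit_closed] Phi_one[OF pi_hom K.is_cring] by (simp only: A_simps)
      finally show "H \<one>\<^bsub>?C\<^esub> = \<one>\<^bsub>?M\<^esub>" .
    qed
    show "bij_betw H (carrier ?C) (carrier ?M)"
      unfolding bij_betw_def
    proof
      show "inj_on H (carrier ?C)"
      proof (rule inj_onI)
        fix X Y assume XY: "X \<in> carrier ?C" "Y \<in> carrier ?C" "H X = H Y"
        then obtain x y where xy: "Poly_Mapping.keys x \<subseteq> T.S" "X = T.cls x" "Poly_Mapping.keys y \<subseteq> T.S" "Y = T.cls y"
          using C by metis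
        then show "X = Y" using XY(3) eq_iff[OF xy(1,3)] by (simp add: H_cls)
      qed
      show "H ` carrier ?C = carrier ?M"
      proof (intro equalityI subsetI)
        fix W assume "W \<in> H ` carrier ?C"
        then obtain X where X: "X \<in> carrier ?C" "W = H X" by blast
        then obtain x where "Poly_Mapping.keys x \<subseteq> T.S" "X = T.cls x" using C by metis
        then show "W \<in> carrier ?M" using Psi_closed X by (simp add: H_cls del: skew_matrix_simps)
      next
        fix W assume "W \<in> carrier ?M"
        then obtain x where x: "Poly_Mapping.keys x \<subseteq> T.S" "Psi x = W" using surj by metis
        then have "W = H (T.cls x)" by (simp add: H_cls)
        then show "W \<in> H ` carrier ?C" using C'[OF x(1)] by blast
      qed
    qed
  next
    fix l X assume l: "l \<in> carrier K" and "X \<in> carrier ?C"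
    then obtain x where "Poly_Mapping.keys x \<subseteq> T.S" "X = T.cls x" using C by metis
    then show "H (l \<odot>\<^bsub>?C\<^esub> X) = l \<odot>\<^bsub>?M\<^esub> H X" using sc l by (simp add: C_smult H_cls del: skew_matrix_simps)
  qed
  then show ?thesis unfolding split_algebra_def alg_isomorphic_def using red n_pos by blast
qed

end

section \<open>Idempotents with one-dimensional corners\<close>

context ring
begin

text \<open>
  Let \<open>y\<close> generate a two-sided ideal that is killed by all corners \<open>x \<mapsto> e\<^sub>p x e\<^sub>p\<close>.  If \<open>y f y = y\<close> for the
  sum \<open>f\<close> of the \<open>e\<^sub>p\<close>, then \<open>y = 0\<close>.  In the induction, passing from \<open>y\<close> to \<open>y + y e\<^sub>m y\<close> makes \<open>e\<^sub>m\<close>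
  superfluous in the sum.
\<close>

lemma offdiagonal_zero:
  fixes e :: "nat \<Rightarrow> 'a"
  assumes e [simp]: "\<And>p. p < m \<Longrightarrow> e p \<in> carrier R"
    and y: "y \<in> carrier R"
    and ideal: "\<And>a b p. \<lbrakk>a \<in> carrier R; b \<in> carrier R; p < m\<rbrakk> \<Longrightarrow> e p \<otimes> (a \<otimes> y \<otimes> b) \<otimes> e p = \<zero>"
    and eq: "y \<otimes> (\<Oplus>p\<in>{..<m}. e p) \<otimes> y = y"
  shows "y = \<zero>"
  using assms
proof (induction m arbitrary: y)
  case 0
  then show ?case by simp
next
  case (Suc m)
  note [simp] = Suc.prems(1,2)
  let ?f = "\<Oplus>p\<in>{..<m}. e p" and ?e = "e m"
  have f [simp]: "?f \<in> carrier R" by (intro finsum_in) simp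
  have em [simp]: "?e \<in> carrier R" by simp
  have sum: "(\<Oplus>p\<in>{..<Suc m}. e p) = ?e \<oplus> ?f"
    by (simp add: lessThan_Suc Pi_def)
  define v where "v = y \<otimes> ?e \<otimes> y"
  have v [simp]: "v \<in> carrier R" by (simp add: v_def)
  have eye: "?e \<otimes> y \<otimes> ?e = \<zero>" using Suc.prems(3)[of \<one> \<one> m] by simp
  have eyfye: "?e \<otimes> (y \<otimes> ?f \<otimes> y) \<otimes> ?e = \<zero>" using Suc.prems(3)[of "y \<otimes> ?f" \<one> m] by simp
  have "v \<oplus> y \<otimes> ?f \<otimes> y = y"
    using Suc.prems(4) unfolding sum by (simp add: v_def r_distr l_distr)
  then have yfy: "y \<otimes> ?f \<otimes> y = y \<ominus> v"
    using eq_minusI[of "y \<otimes> ?f \<otimes> y" v y] by (simp add: a_comm)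
  have vey: "v \<otimes> ?e \<otimes> y = \<zero>" "y \<otimes> ?e \<otimes> v = \<zero>"
  proof -
    have "v \<otimes> ?e \<otimes> y = y \<otimes> (?e \<otimes> y \<otimes> ?e) \<otimes> y" by (simp add: v_def m_assoc)
    then show "v \<otimes> ?e \<otimes> y = \<zero>" by (simp add: eye)
    have "y \<otimes> ?e \<otimes> v = y \<otimes> (?e \<otimes> y \<otimes> ?e) \<otimes> y" by (simp add: v_def m_assoc)
    then show "y \<otimes> ?e \<otimes> v = \<zero>" by (simp add: eye)
  qed
  have yfv: "y \<otimes> ?f \<otimes> v = v"
  proof -
    have "y \<otimes> ?f \<otimes> v = (y \<otimes> ?f \<otimes> y) \<otimes> ?e \<otimes> y" by (simp add: v_def m_assoc)
    also have "\<dots> = y \<otimes> ?e \<otimes> y \<ominus> v \<otimes> ?e \<otimes> y" unfolding yfy by (simp add: a_minus_def l_distr l_minus)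
    finally show ?thesis by (simp add: vey v_def[symmetric] a_minus_def)
  qed
  have vfy: "v \<otimes> ?f \<otimes> y = v"
  proof -
    have "v \<otimes> ?f \<otimes> y = y \<otimes> ?e \<otimes> (y \<otimes> ?f \<otimes> y)" by (simp add: v_def m_assoc)
    also have "\<dots> = y \<otimes> ?e \<otimes> y \<ominus> y \<otimes> ?e \<otimes> v" unfolding yfy by (simp add: a_minus_def r_distr r_minus)
    finally show ?thesis by (simp add: vey v_def[symmetric] a_minus_def)
  qed
  have vfv: "v \<otimes> ?f \<otimes> v = \<zero>"
  proof -
    have "v \<otimes> ?f \<otimes> v = y \<otimes> (?e \<otimes> (y \<otimes> ?f \<otimes> y) \<otimes> ?e) \<otimes> y" by (simp add: v_def m_assoc)
    then show ?thesis by (simp add: eyfye)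
  qed
  define w where "w = y \<oplus> v"
  have w [simp]: "w \<in> carrier R" by (simp add: w_def)
  have "w = \<zero>"
  proof (rule Suc.IH)
    have "w \<otimes> ?f \<otimes> w = (y \<otimes> ?f \<otimes> y \<oplus> y \<otimes> ?f \<otimes> v) \<oplus> (v \<otimes> ?f \<otimes> y \<oplus> v \<otimes> ?f \<otimes> v)"
      by (simp add: w_def l_distr r_distr a_ac)
    also have "\<dots> = w" unfolding yfy yfv vfy vfv by (simp add: w_def a_minus_def a_assoc l_neg)
    finally show "w \<otimes> ?f \<otimes> w = w" .
  next
    fix a b p assume ab: "a \<in> carrier R" "b \<in> carrier R" and p: "p < m"
    have "e p \<otimes> (a \<otimes> w \<otimes> b) \<otimes> e p = e p \<otimes> (a \<otimes> y \<otimes> b) \<otimes> e p \<oplus> e p \<otimes> (a \<otimes> y \<otimes> (?e \<otimes> y \<otimes> b)) \<otimes> e p"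
      using ab p by (simp add: w_def v_def l_distr r_distr m_assoc)
    then show "e p \<otimes> (a \<otimes> w \<otimes> b) \<otimes> e p = \<zero>"
      using Suc.prems(3)[of a b p] Suc.prems(3)[of a "?e \<otimes> y \<otimes> b" p] ab p by simp
  qed simp_all
  then have y_v: "y = \<ominus> v" unfolding w_def by (simp add: minus_equality[symmetric])
  then have "y \<otimes> ?f \<otimes> y = v \<otimes> ?f \<otimes> v" by (simp add: l_minus r_minus)
  then have "y \<ominus> v = \<zero>" by (simp add: yfy vfv)
  then have yv: "y = v" by simp
  have "v = y \<otimes> ?e \<otimes> v" using yv by (simp add: v_def)
  then show ?case using vey(2) yv by simp
qed

text \<open>
  Suppose that \<open>1\<close> is a sum of idempotents \<open>e\<^sub>p\<close> whose corners \<open>e\<^sub>p R e\<^sub>p\<close> consist of the multiples of \<open>e\<^sub>p\<close> by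
  elements of a set \<open>C\<close> of central elements with inverses.  Let \<open>\<epsilon>\<close> be a nonzero idempotent and \<open>z\<close> a central
  element of the corner \<open>\<epsilon> R \<epsilon>\<close>.  Then \<open>z\<close> acts on some nonzero \<open>g\<close> in \<open>\<epsilon> R\<close> as an element of \<open>C\<close>.  By the
  preceding lemma some \<open>e\<^sub>p a \<epsilon> b e\<^sub>p\<close> is nonzero, so \<open>e\<^sub>p\<close> is equivalent to an idempotent \<open>g\<close> below \<open>\<epsilon>\<close>, and
  \<open>z g = g z g\<close> lies in the corner of \<open>g\<close>.
\<close>

lemma corner_center:
  fixes e :: "nat \<Rightarrow> 'a"
  assumes e [simp]: "\<And>p. p < m \<Longrightarrow> e p \<in> carrier R"
    and e_idem: "\<And>p. p < m \<Longrightarrow> e p \<otimes> e p = e p"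
    and e_sum: "(\<Oplus>p\<in>{..<m}. e p) = \<one>"
    and C: "C \<subseteq> carrier R" "\<And>c x. \<lbrakk>c \<in> C; x \<in> carrier R\<rbrakk> \<Longrightarrow> c \<otimes> x = x \<otimes> c"
      "\<And>c. \<lbrakk>c \<in> C; c \<noteq> \<zero>\<rbrakk> \<Longrightarrow> \<exists>c'\<in>C. c' \<otimes> c = \<one>"
    and corner: "\<And>p x. \<lbrakk>p < m; x \<in> carrier R\<rbrakk> \<Longrightarrow> \<exists>c\<in>C. e p \<otimes> x \<otimes> e p = c \<otimes> e p"
    and \<epsilon> [simp]: "\<epsilon> \<in> carrier R" and \<epsilon>_idem: "\<epsilon> \<otimes> \<epsilon> = \<epsilon>" and \<epsilon>_nz: "\<epsilon> \<noteq> \<zero>"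
    and z [simp]: "z \<in> carrier R" and z\<epsilon>: "z \<otimes> \<epsilon> = z" "\<epsilon> \<otimes> z = z"
    and comm: "\<And>x. x \<in> carrier R \<Longrightarrow> z \<otimes> (\<epsilon> \<otimes> x \<otimes> \<epsilon>) = (\<epsilon> \<otimes> x \<otimes> \<epsilon>) \<otimes> z"
  shows "\<exists>c\<in>C. \<exists>g\<in>carrier R. g \<noteq> \<zero> \<and> \<epsilon> \<otimes> g = g \<and> z \<otimes> g = c \<otimes> g"
proof -
  have "\<exists>a\<in>carrier R. \<exists>b\<in>carrier R. \<exists>p<m. e p \<otimes> (a \<otimes> \<epsilon> \<otimes> b) \<otimes> e p \<noteq> \<zero>"
  proof (rule ccontr)
    assume "\<not> ?thesis"
    then have "\<epsilon> = \<zero>"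
      by (intro offdiagonal_zero[of m e \<epsilon>]) (auto simp: e_sum \<epsilon>_idem)
    then show False using \<epsilon>_nz by simp
  qed
  then obtain a b p where ab [simp]: "a \<in> carrier R" "b \<in> carrier R" and p: "p < m"
    and nz: "e p \<otimes> (a \<otimes> \<epsilon> \<otimes> b) \<otimes> e p \<noteq> \<zero>" by blast
  have ep [simp]: "e p \<in> carrier R" using p by simp
  note epi = e_idem[OF p]
  obtain c0 where c0: "c0 \<in> C" "e p \<otimes> (a \<otimes> \<epsilon> \<otimes> b) \<otimes> e p = c0 \<otimes> e p"
    using corner[OF p, of "a \<otimes> \<epsilon> \<otimes> b"] by auto
  then have "c0 \<noteq> \<zero>" "e p \<noteq> \<zero>" using nz C(1) by auto
  then obtain c1 where c1: "c1 \<in> C" "c1 \<otimes> c0 = \<one>" using C(3) c0 by blast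
  have [simp]: "c0 \<in> carrier R" "c1 \<in> carrier R" using c0 c1 C(1) by auto
  define u where "u = e p \<otimes> a \<otimes> \<epsilon>"
  define w where "w = c1 \<otimes> (\<epsilon> \<otimes> b \<otimes> e p)"
  have [simp]: "u \<in> carrier R" "w \<in> carrier R" by (simp_all add: u_def w_def)
  have uw: "u \<otimes> w = e p"
  proof -
    have "u \<otimes> w = c1 \<otimes> (u \<otimes> (\<epsilon> \<otimes> b \<otimes> e p))"
      using C(2)[OF c1(1), of u] by (simp add: w_def m_assoc[symmetric])
    also have "u \<otimes> (\<epsilon> \<otimes> b \<otimes> e p) = e p \<otimes> a \<otimes> (\<epsilon> \<otimes> \<epsilon>) \<otimes> b \<otimes> e p" by (simp add: u_def m_assoc)
    also have "\<dots> = c0 \<otimes> e p" using c0(2) by (simp add: \<epsilon>_idem m_assoc)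
    also have "c1 \<otimes> (c0 \<otimes> e p) = e p" using c1(2) by (simp add: m_assoc[symmetric])
    finally show ?thesis .
  qed
  have eu: "e p \<otimes> u = u" by (simp add: u_def m_assoc[symmetric] epi)
  have we: "w \<otimes> e p = w" by (simp add: w_def m_assoc epi)
  have \<epsilon>w: "\<epsilon> \<otimes> w = w"
  proof -
    have "\<epsilon> \<otimes> w = (\<epsilon> \<otimes> c1) \<otimes> (\<epsilon> \<otimes> b \<otimes> e p)" by (simp add: w_def m_assoc)
    also have "\<epsilon> \<otimes> c1 = c1 \<otimes> \<epsilon>" using C(2)[OF c1(1), of \<epsilon>] by simp
    also have "(c1 \<otimes> \<epsilon>) \<otimes> (\<epsilon> \<otimes> b \<otimes> e p) = c1 \<otimes> (\<epsilon> \<otimes> \<epsilon> \<otimes> b \<otimes> e p)" by (simp add: m_assoc)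
    finally have "\<epsilon> \<otimes> w = c1 \<otimes> (\<epsilon> \<otimes> \<epsilon> \<otimes> b \<otimes> e p)" .
    then show ?thesis by (simp add: \<epsilon>_idem w_def)
  qed
  have u\<epsilon>: "u \<otimes> \<epsilon> = u" by (simp add: u_def m_assoc \<epsilon>_idem)
  define g where "g = w \<otimes> u"
  have [simp]: "g \<in> carrier R" by (simp add: g_def)
  have gg: "g \<otimes> g = g"
  proof -
    have "g \<otimes> g = w \<otimes> (u \<otimes> w) \<otimes> u" by (simp add: g_def m_assoc)
    then show ?thesis by (simp add: uw we g_def)
  qed
  have \<epsilon>g: "\<epsilon> \<otimes> g = g" by (simp add: g_def m_assoc[symmetric] \<epsilon>w)
  have g\<epsilon>: "g \<otimes> \<epsilon> = g" by (simp add: g_def m_assoc u\<epsilon>)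
  have "u \<otimes> g \<otimes> w = (u \<otimes> w) \<otimes> (u \<otimes> w)" by (simp add: g_def m_assoc)
  then have "g \<noteq> \<zero>" using \<open>e p \<noteq> \<zero>\<close> by (auto simp: uw epi)
  have "u \<otimes> z \<otimes> w = e p \<otimes> (u \<otimes> z \<otimes> w) \<otimes> e p"
    using eu we by (simp add: m_assoc[symmetric]) (simp add: m_assoc)
  then obtain c where c: "c \<in> C" "u \<otimes> z \<otimes> w = c \<otimes> e p" using corner[OF p, of "u \<otimes> z \<otimes> w"] by auto
  have [simp]: "c \<in> carrier R" using c C(1) by auto
  have "z \<otimes> g = g \<otimes> z" using comm[of g] by (simp add: \<epsilon>g g\<epsilon>)
  then have "z \<otimes> g = g \<otimes> z \<otimes> g" using gg by (metis \<open>g \<in> carrier R\<close> m_assoc z)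
  also have "\<dots> = w \<otimes> (u \<otimes> z \<otimes> w) \<otimes> u" by (simp add: g_def m_assoc)
  also have "\<dots> = (w \<otimes> c) \<otimes> (e p \<otimes> u)" unfolding c(2) by (simp add: m_assoc)
  also have "w \<otimes> c = c \<otimes> w" using C(2)[OF c(1), of w] by simp
  also have "(c \<otimes> w) \<otimes> (e p \<otimes> u) = c \<otimes> g" unfolding eu by (simp add: m_assoc g_def)
  finally show ?thesis using c(1) \<open>g \<noteq> \<zero>\<close> \<epsilon>g by (intro bexI[of _ c] bexI[of _ g]) auto
qed

end

section \<open>Diagonal idempotents of a skew matrix algebra\<close>

text \<open>Since \<open>c\<close> is reduced, multiplication by \<open>e\<^sub>p\<^sub>p\<close> selects a row or a column, as for ordinary matrices.\<close>

lemma skew_matrix_diagonal: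
  fixes R :: "('a, 'm) ring_scheme" (structure)
  assumes R: "cring R" and c: "reduced_skew_set R n c" and p: "p < n"
  defines "M \<equiv> skew_matrix_algebra R n c"
  defines "E \<equiv> (\<lambda>q\<in>{..<n} \<times> {..<n}. if q = (p, p) then \<one> else \<zero>)"
  shows "E \<in> nucleus M" "Y \<in> carrier M \<Longrightarrow> (E \<otimes>\<^bsub>M\<^esub> Y) \<otimes>\<^bsub>M\<^esub> E = Y (p, p) \<odot>\<^bsub>M\<^esub> E"
proof -
  interpret R: cring R by fact
  interpret M: nonassoc_algebra R M unfolding M_def by (rule skew_matrix_nonassoc_algebra[OF R c])
  have cc [simp]: "c i j k \<in> carrier R" if "i < n" "j < n" "k < n" for i j k
    using c that by (auto simp: reduced_skew_set_def)
  have c1: "c i i j = \<one>" "c j i i = \<one>" if "i < n" "j < n" for i j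
    using c that by (auto simp: reduced_skew_set_def)
  have entry: "x (i, j) \<in> carrier R" if "x \<in> carrier M" "i < n" "j < n" for x i j
    using that by (auto simp: M_def)
  have ext: "x \<in> extensional ({..<n} \<times> {..<n})" if "x \<in> carrier M" for x
    using that by (auto simp: M_def PiE_def)
  have EM: "E \<in> carrier M" by (auto simp: E_def M_def)
  note mult = skew_matrix_mult[where n = n and R = R and c = c, folded M_def]
  have left: "(E \<otimes>\<^bsub>M\<^esub> y) (i, l) = (if i = p then y (i, l) else \<zero>)" if "y \<in> carrier M" "i < n" "l < n" for y i l
  proof -
    note ye = entry[OF that(1)]
    have "(E \<otimes>\<^bsub>M\<^esub> y) (i, l) = (\<Oplus>j\<in>{..<n}. if j = p then (if i = p then y (i, l) else \<zero>) else \<zero>)"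
      unfolding mult[OF that(2,3)] using that p ye c1 by (intro R.finsum_eqI) (auto simp: E_def)
    also have "\<dots> = (if i = p then y (i, l) else \<zero>)"
      using that p ye by (subst R.finsum_single[of p]) auto
    finally show ?thesis .
  qed
  have right: "(y \<otimes>\<^bsub>M\<^esub> E) (i, l) = (if l = p then y (i, l) else \<zero>)" if "y \<in> carrier M" "i < n" "l < n" for y i l
  proof -
    note ye = entry[OF that(1)]
    have "(y \<otimes>\<^bsub>M\<^esub> E) (i, l) = (\<Oplus>j\<in>{..<n}. if j = p then (if l = p then y (i, l) else \<zero>) else \<zero>)"
      unfolding mult[OF that(2,3)] using that p ye c1 by (intro R.finsum_eqI) (auto simp: E_def)
    also have "\<dots> = (if l = p then y (i, l) else \<zero>)"
      using that p ye by (subst R.finsum_single[of p]) auto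
    finally show ?thesis .
  qed
  have eqI: "x = y" if "x \<in> carrier M" "y \<in> carrier M" "\<And>i l. \<lbrakk>i < n; l < n\<rbrakk> \<Longrightarrow> x (i, l) = y (i, l)" for x y
    using matrix_ext[OF ext[OF that(1)] ext[OF that(2)] that(3)] .
  show "E \<in> nucleus M"
    unfolding M.mem_nucleus
  proof (intro conjI ballI EM)
    fix y z assume yz: "y \<in> carrier M" "z \<in> carrier M"
    note mc = M.mult_closed[OF EM yz(1)] M.mult_closed[OF yz(1) EM] M.mult_closed[OF EM yz(2)] M.mult_closed[OF yz(2) EM]
      M.mult_closed[OF yz]
    note en = entry[OF yz(1)] entry[OF yz(2)]
    show "(E \<otimes>\<^bsub>M\<^esub> y) \<otimes>\<^bsub>M\<^esub> z = E \<otimes>\<^bsub>M\<^esub> (y \<otimes>\<^bsub>M\<^esub> z)"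
    proof (rule eqI)
      fix i l assume il: "i < n" "l < n"
      show "((E \<otimes>\<^bsub>M\<^esub> y) \<otimes>\<^bsub>M\<^esub> z) (i, l) = (E \<otimes>\<^bsub>M\<^esub> (y \<otimes>\<^bsub>M\<^esub> z)) (i, l)"
        unfolding left[OF mc(5) il] unfolding mult[OF il] using yz il en
        by (cases "i = p") (auto simp: left intro!: R.finsum_eqI R.add.finprod_one_eqI)
    qed (use mc yz EM M.mult_closed in auto)
    show "(y \<otimes>\<^bsub>M\<^esub> E) \<otimes>\<^bsub>M\<^esub> z = y \<otimes>\<^bsub>M\<^esub> (E \<otimes>\<^bsub>M\<^esub> z)"
    proof (rule eqI)
      fix i l assume il: "i < n" "l < n"
      show "((y \<otimes>\<^bsub>M\<^esub> E) \<otimes>\<^bsub>M\<^esub> z) (i, l) = (y \<otimes>\<^bsub>M\<^esub> (E \<otimes>\<^bsub>M\<^esub> z)) (i, l)"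
        unfolding mult[OF il] using yz il en by (intro R.finsum_eqI) (auto simp: left right)
    qed (use mc yz EM M.mult_closed in auto)
    show "(y \<otimes>\<^bsub>M\<^esub> z) \<otimes>\<^bsub>M\<^esub> E = y \<otimes>\<^bsub>M\<^esub> (z \<otimes>\<^bsub>M\<^esub> E)"
    proof (rule eqI)
      fix i l assume il: "i < n" "l < n"
      show "((y \<otimes>\<^bsub>M\<^esub> z) \<otimes>\<^bsub>M\<^esub> E) (i, l) = (y \<otimes>\<^bsub>M\<^esub> (z \<otimes>\<^bsub>M\<^esub> E)) (i, l)"
        unfolding right[OF mc(5) il] unfolding mult[OF il] using yz il en
        by (cases "l = p") (auto simp: right intro!: R.finsum_eqI R.add.finprod_one_eqI[symmetric])
    qed (use mc yz EM M.mult_closed in auto)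
  qed
  assume Y: "Y \<in> carrier M"
  have EY: "E \<otimes>\<^bsub>M\<^esub> Y \<in> carrier M" by (rule M.mult_closed[OF EM Y])
  show "(E \<otimes>\<^bsub>M\<^esub> Y) \<otimes>\<^bsub>M\<^esub> E = Y (p, p) \<odot>\<^bsub>M\<^esub> E"
  proof (rule eqI)
    fix i l assume il: "i < n" "l < n"
    show "((E \<otimes>\<^bsub>M\<^esub> Y) \<otimes>\<^bsub>M\<^esub> E) (i, l) = (Y (p, p) \<odot>\<^bsub>M\<^esub> E) (i, l)"
      unfolding right[OF EY il] left[OF Y il] using il p entry[OF Y] by (auto simp: M_def E_def)
  next
    show "E \<otimes>\<^bsub>M\<^esub> Y \<otimes>\<^bsub>M\<^esub> E \<in> carrier M" by (rule M.mult_closed[OF EY EM])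
    show "Y (p, p) \<odot>\<^bsub>M\<^esub> E \<in> carrier M" by (rule M.smult_closed[OF entry[OF Y p p] EM])
  qed
qed

section \<open>The nucleus of a nonassociative cyclic algebra\<close>

context cyclic_setup
begin

lemma dif_iff: "\<lbrakk>m < n; i < n; j < n\<rbrakk> \<Longrightarrow> dif n m i = j \<longleftrightarrow> i = dif n m j"
  using dif_inv[of m n i] dif_inv[of m n j] by auto

lemma cmul_mon_right:
  assumes "d \<in> carrier K" "b \<in> carrier K" "j < n" "g \<in> P" "m < n"
  shows "cmul d g (skew_monom K b j) m = g (dif n m j) \<otimes> s (dif n m j) b \<otimes> wt d (dif n m j) m"
proof -
  have "cmul d g (skew_monom K b j) m = (\<Oplus>i\<in>{..<n}. g i \<otimes> s i (skew_monom K b j (dif n m i)) \<otimes> wt d i m)"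
    using assms by (simp add: cmul_def dif_def)
  also have "\<dots> = g (dif n m j) \<otimes> s (dif n m j) (skew_monom K b j (dif n m (dif n m j))) \<otimes> wt d (dif n m j) m"
    using assms n_pos dif_iff[OF assms(5)] by (intro finsum_single) (auto simp: skew_monom_def)
  finally show ?thesis using assms by (simp add: dif_inv skew_monom_def)
qed

text \<open>Compare the coefficients of \<open>t\<^sup>i\<close> in \<open>(x t\<^sup>n\<^sup>-\<^sup>1) t = x (t\<^sup>n\<^sup>-\<^sup>1 t) = x d\<close>.\<close>

lemma nucleus_coeff:
  assumes d: "d \<in> carrier K" and x: "x \<in> nucleus (A d)" and i: "0 < i" "i < n"
  shows "x i \<otimes> s (i - 1) (\<sigma> d \<ominus> d) = \<zero>"
proof -
  interpret AA: nonassoc_algebra F "A d" by (rule A_nonassoc_algebra[OF d])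
  have xP: "x \<in> P" using AA.nucleus_closed[OF x] by simp
  have n1: "1 < n" using i by simp
  let ?t = "skew_monom K \<one> 1" and ?t' = "skew_monom K \<one> (n - 1)"
  have t: "?t \<in> P" "?t' \<in> P" using n1 by auto
  have "?t' \<otimes>\<^bsub>A d\<^esub> ?t = const d"
    using n1 d t by (simp add: A_mult cmul_mon_mon wt_def)
  moreover have "(x \<otimes>\<^bsub>A d\<^esub> ?t') \<otimes>\<^bsub>A d\<^esub> ?t = x \<otimes>\<^bsub>A d\<^esub> (?t' \<otimes>\<^bsub>A d\<^esub> ?t)"
    using AA.nucleus_assoc[of x ?t' ?t] xP t x by simp
  ultimately have "cmul d (cmul d x ?t') ?t i = x i \<otimes> s i d"
    using xP t d by (simp add: A_mult cmul_const_right)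
  moreover have "cmul d (cmul d x ?t') ?t i = cmul d x ?t' (i - 1)"
  proof -
    have "dif n i 1 = i - 1" using i by (simp add: dif_eq)
    moreover have "cmul d x ?t' (i - 1) \<in> carrier K" using cmul_closed[OF d xP t(2)] by simp
    ultimately show ?thesis using i n1 xP t d by (subst cmul_mon_right) (auto simp: wt_def)
  qed
  moreover have "cmul d x ?t' (i - 1) = x i \<otimes> s (i - 1) d"
  proof -
    have "dif n (i - 1) (n - 1) = i" using i by (auto simp: dif_eq)
    then show ?thesis using i n1 xP d by (subst cmul_mon_right) (auto simp: wt_def)
  qed
  ultimately have "x i \<otimes> s i d = x i \<otimes> s (i - 1) d" by simp
  moreover have "s i d = s (i - 1) (\<sigma> d)" using i by (cases i) (simp_all add: funpow_swap1)
  moreover have "\<sigma> d \<in> carrier K" using s_closed[OF d, of 1] by simp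
  ultimately show ?thesis using xP d by (simp add: a_minus_def r_distr r_minus r_neg)
qed

end

lemma smult_eq_zero:
  assumes "field F" "module F M" "a \<in> carrier F" "x \<in> carrier M" "a \<odot>\<^bsub>M\<^esub> x = \<zero>\<^bsub>M\<^esub>" "x \<noteq> \<zero>\<^bsub>M\<^esub>"
  shows "a = \<zero>\<^bsub>F\<^esub>"
proof (rule ccontr)
  interpret F: field F by fact
  interpret M: module F M by fact
  assume "a \<noteq> \<zero>\<^bsub>F\<^esub>"
  then have u: "a \<in> Units F" using assms F.field_Units by auto
  have "x = (inv\<^bsub>F\<^esub> a \<otimes>\<^bsub>F\<^esub> a) \<odot>\<^bsub>M\<^esub> x" using u assms by simp
  also have "\<dots> = \<zero>\<^bsub>M\<^esub>" using u assms M.smult_assoc1[of "inv\<^bsub>F\<^esub> a" a x] by simp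
  finally show False using assms by simp
qed

context galois_dual
begin

text \<open>The nucleus is graded: for \<open>x\<close> in the nucleus, \<open>\<Sum>\<^sub>k \<sigma>\<^sup>i(u\<^sub>k) x v\<^sub>k = x\<^sub>i t\<^sup>i\<close> is again in it.\<close>

lemma nucleus_component:
  assumes d: "d \<in> carrier K" and x: "x \<in> nucleus (A d)" and i: "i < n"
  shows "skew_monom K (x i) i \<in> nucleus (A d)"
proof -
  interpret AA: nonassoc_algebra F "A d" by (rule A_nonassoc_algebra[OF d])
  have xP: "x \<in> P" using AA.nucleus_closed[OF x] by simp
  let ?y = "\<lambda>k. (const (s i (u k)) \<otimes>\<^bsub>A d\<^esub> x) \<otimes>\<^bsub>A d\<^esub> const (v k)"
  have yN: "?y k \<in> nucleus (A d)" for k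
    using d x by (intro AA.nucleus_mult const_nucleus) auto
  have y: "?y k = (\<lambda>m. (s i (u k) \<otimes> x m) \<otimes> s m (v k))" for k
    using xP d scale_in(1)[OF _ xP] by (simp add: A_const_left A_const_right)
  have sumN: "finsum (A d) ?y X \<in> nucleus (A d)" if "finite X" for X
    using that
  proof (induction X rule: finite_induct)
    case (insert k X)
    have "finsum (A d) ?y (insert k X) = ?y k \<oplus>\<^bsub>A d\<^esub> finsum (A d) ?y X"
      using insert(1,2) AA.nucleus_closed[OF yN] by (intro AA.M.finsum_insert) auto
    then show ?case using AA.nucleus_add[OF yN insert(3)] by (simp only:)
  next
    case empty
    show ?case by (simp only: AA.M.finsum_empty AA.nucleus_zero)
  qed
  have "finsum (A d) ?y {..<N} = skew_monom K (x i) i"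
  proof
    fix m
    have "finsum (A d) ?y {..<N} m = (\<Oplus>k\<in>{..<N}. ?y k m)"
      by (subst A_finsum) (use AA.nucleus_closed[OF yN] in auto)
    also have "\<dots> = (\<Oplus>k\<in>{..<N}. x m \<otimes> (s i (u k) \<otimes> s m (v k)))"
      using xP unfolding y by (intro finsum_eqI) (auto simp: m_ac)
    also have "\<dots> = x m \<otimes> (\<Oplus>k\<in>{..<N}. s i (u k) \<otimes> s m (v k))"
      using xP by (intro finsum_rdistr[symmetric]) auto
    also have "\<dots> = skew_monom K (x i) i m"
    proof (cases "m < n")
      case True
      then show ?thesis using i xP by (auto simp: dual_shift skew_monom_def)
    next
      case False
      then show ?thesis using i coeff_zero[OF xP, of m] by (auto simp: skew_monom_def intro!: l_null finsum_in)
    qed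
    finally show "finsum (A d) ?y {..<N} m = skew_monom K (x i) i m" .
  qed
  then show ?thesis using sumN[of "{..<N}"] by simp
qed

text \<open>The idempotents are the preimages of the diagonal matrix units.\<close>

lemma split_diagonal:
  assumes d: "d \<in> carrier K" and split: "split_algebra F (A d)"
  obtains m :: nat and e where "\<And>p. p < m \<Longrightarrow> e p \<in> nucleus (A d)"
    "\<And>p. p < m \<Longrightarrow> e p \<otimes>\<^bsub>A d\<^esub> e p = e p" "(\<Oplus>\<^bsub>A d\<^esub>p\<in>{..<m}. e p) = \<one>\<^bsub>A d\<^esub>"
    "\<And>p x. \<lbrakk>p < m; x \<in> P\<rbrakk> \<Longrightarrow> \<exists>c\<in>carrier F. (e p \<otimes>\<^bsub>A d\<^esub> x) \<otimes>\<^bsub>A d\<^esub> e p = c \<odot>\<^bsub>A d\<^esub> e p"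
proof -
  obtain m c h where m: "0 < m" and red: "reduced_skew_set F m c"
    and h: "h \<in> alg_iso F (A d) (skew_matrix_algebra F m c)"
    using split by (auto simp: split_algebra_def alg_isomorphic_def)
  let ?M = "skew_matrix_algebra F m c"
  interpret AA: nonassoc_algebra F "A d" by (rule A_nonassoc_algebra[OF d])
  interpret M: nonassoc_algebra F ?M by (rule skew_matrix_nonassoc_algebra[OF F.is_cring red])
  have hom: "h \<in> ring_hom (A d) ?M" and bij: "bij_betw h (carrier (A d)) (carrier ?M)"
    and hs: "\<And>a x. \<lbrakk>a \<in> carrier F; x \<in> carrier (A d)\<rbrakk> \<Longrightarrow> h (a \<odot>\<^bsub>A d\<^esub> x) = a \<odot>\<^bsub>?M\<^esub> h x"
    using h unfolding alg_iso_def ring_iso_def by blast+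
  note hc = ring_hom_closed[OF hom] and hm = ring_hom_mult[OF hom] and ha = ring_hom_add[OF hom]
  have inj: "x = y" if "x \<in> carrier (A d)" "y \<in> carrier (A d)" "h x = h y" for x y
    using bij that unfolding bij_betw_def inj_on_def by blast
  let ?E = "\<lambda>p. \<lambda>q\<in>{..<m} \<times> {..<m}. if q = (p, p) then \<one>\<^bsub>F\<^esub> else \<zero>\<^bsub>F\<^esub>"
  note EN = skew_matrix_diagonal(1)[OF F.is_cring red]
  note EYE = skew_matrix_diagonal(2)[OF F.is_cring red]
  have EM: "?E p \<in> carrier ?M" if "p < m" for p by (rule M.nucleus_closed[OF EN[OF that]])
  define e where "e = (\<lambda>p. inv_into (carrier (A d)) h (?E p))"
  have e: "e p \<in> carrier (A d)" "h (e p) = ?E p" if "p < m" for p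
  proof -
    have im: "?E p \<in> h ` carrier (A d)" using bij EM[OF that] unfolding bij_betw_def by blast
    show "e p \<in> carrier (A d)" unfolding e_def by (rule inv_into_into[OF im])
    show "h (e p) = ?E p" unfolding e_def by (rule f_inv_into_f[OF im])
  qed
  show thesis
  proof (rule that[of m e])
    fix p assume p: "p < m"
    note ep = e(1)[OF p]
    have a: "(h (e p) \<otimes>\<^bsub>?M\<^esub> y) \<otimes>\<^bsub>?M\<^esub> z = h (e p) \<otimes>\<^bsub>?M\<^esub> (y \<otimes>\<^bsub>?M\<^esub> z)"
        "(y \<otimes>\<^bsub>?M\<^esub> h (e p)) \<otimes>\<^bsub>?M\<^esub> z = y \<otimes>\<^bsub>?M\<^esub> (h (e p) \<otimes>\<^bsub>?M\<^esub> z)"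
        "(y \<otimes>\<^bsub>?M\<^esub> z) \<otimes>\<^bsub>?M\<^esub> h (e p) = y \<otimes>\<^bsub>?M\<^esub> (z \<otimes>\<^bsub>?M\<^esub> h (e p))"
      if "y \<in> carrier ?M" "z \<in> carrier ?M" for y z
      using EN[OF p] that unfolding e(2)[OF p] M.mem_nucleus by blast+
    show "e p \<in> nucleus (A d)"
      unfolding AA.mem_nucleus
    proof (intro conjI ballI ep)
      fix y z assume yz: "y \<in> carrier (A d)" "z \<in> carrier (A d)"
      note mc = AA.mult_closed
      show "(e p \<otimes>\<^bsub>A d\<^esub> y) \<otimes>\<^bsub>A d\<^esub> z = e p \<otimes>\<^bsub>A d\<^esub> (y \<otimes>\<^bsub>A d\<^esub> z)"
        by (rule inj) (use a(1)[OF hc[OF yz(1)] hc[OF yz(2)]] ep yz in \<open>simp_all only: hm mc\<close>)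
      show "(y \<otimes>\<^bsub>A d\<^esub> e p) \<otimes>\<^bsub>A d\<^esub> z = y \<otimes>\<^bsub>A d\<^esub> (e p \<otimes>\<^bsub>A d\<^esub> z)"
        by (rule inj) (use a(2)[OF hc[OF yz(1)] hc[OF yz(2)]] ep yz in \<open>simp_all only: hm mc\<close>)
      show "(y \<otimes>\<^bsub>A d\<^esub> z) \<otimes>\<^bsub>A d\<^esub> e p = y \<otimes>\<^bsub>A d\<^esub> (z \<otimes>\<^bsub>A d\<^esub> e p)"
        by (rule inj) (use a(3)[OF hc[OF yz(1)] hc[OF yz(2)]] ep yz in \<open>simp_all only: hm mc\<close>)
    qed
    have "(?E p \<otimes>\<^bsub>?M\<^esub> \<one>\<^bsub>?M\<^esub>) \<otimes>\<^bsub>?M\<^esub> ?E p = \<one>\<^bsub>?M\<^esub> (p, p) \<odot>\<^bsub>?M\<^esub> ?E p"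
      by (rule EYE[OF p M.unit_closed])
    then have "?E p \<otimes>\<^bsub>?M\<^esub> ?E p = ?E p"
      using M.unit_right[OF EM[OF p]] p M.smult_one[OF EM[OF p]] by (simp only: skew_matrix_simps(2)) simp
    then show "e p \<otimes>\<^bsub>A d\<^esub> e p = e p"
      by (intro inj) (use ep e(2)[OF p] in \<open>simp_all only: hm AA.mult_closed\<close>)
    fix x assume "x \<in> P"
    then have x: "x \<in> carrier (A d)" by simp
    have c: "h x (p, p) \<in> carrier F" using hc[OF x] p by auto
    have "(e p \<otimes>\<^bsub>A d\<^esub> x) \<otimes>\<^bsub>A d\<^esub> e p = h x (p, p) \<odot>\<^bsub>A d\<^esub> e p"
      by (rule inj) (use EYE[OF p hc[OF x]] ep x c e(2)[OF p] in \<open>simp_all only: hm hs AA.mult_closed AA.smult_closed\<close>)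
    then show "\<exists>c\<in>carrier F. (e p \<otimes>\<^bsub>A d\<^esub> x) \<otimes>\<^bsub>A d\<^esub> e p = c \<odot>\<^bsub>A d\<^esub> e p" using c by blast
  next
    have z: "h \<zero>\<^bsub>A d\<^esub> = \<zero>\<^bsub>?M\<^esub>"
    proof -
      have "h \<zero>\<^bsub>A d\<^esub> \<oplus>\<^bsub>?M\<^esub> h \<zero>\<^bsub>A d\<^esub> = h \<zero>\<^bsub>A d\<^esub>"
        using ha[OF AA.M.zero_closed AA.M.zero_closed] AA.M.l_zero[OF AA.M.zero_closed] by (simp only:)
      then show ?thesis using hc[OF AA.M.zero_closed] by (metis M.M.add.l_cancel_one')
    qed
    have "h (\<Oplus>\<^bsub>A d\<^esub>p\<in>{..<m}. e p) = (\<Oplus>\<^bsub>?M\<^esub>p\<in>{..<m}. h (e p))"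
      by (rule AA.M.finsum_map[OF M.M.abelian_monoid_axioms]) (use e z hc ha in auto)
    also have "\<dots> = (\<Oplus>\<^bsub>?M\<^esub>p\<in>{..<m}. ?E p)"
      using EM by (intro M.M.finsum_eqI) (auto simp: e(2) simp del: skew_matrix_simps)
    also have "\<dots> = \<one>\<^bsub>?M\<^esub>"
    proof (rule matrix_ext[of _ m])
      have "(\<Oplus>\<^bsub>?M\<^esub>p\<in>{..<m}. ?E p) \<in> carrier ?M" using EM by (intro M.M.finsum_in) blast
      then show "(\<Oplus>\<^bsub>?M\<^esub>p\<in>{..<m}. ?E p) \<in> extensional ({..<m} \<times> {..<m})" by (simp add: PiE_def)
    next
      fix i j assume ij: "i < m" "j < m"
      have "(\<Oplus>\<^bsub>?M\<^esub>p\<in>{..<m}. ?E p) (i, j) = (\<Oplus>\<^bsub>F\<^esub>p\<in>{..<m}. ?E p (i, j))"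
        by (rule M.M.finsum_map[OF F.abelian_monoid_axioms, where \<phi> = "\<lambda>Y. Y (i, j)"])
           (use ij EM in \<open>auto simp del: restrict_apply' simp: restrict_def\<close>)
      also have "\<dots> = (\<Oplus>\<^bsub>F\<^esub>p\<in>{..<m}. if p = i then (if i = j then \<one>\<^bsub>F\<^esub> else \<zero>\<^bsub>F\<^esub>) else \<zero>\<^bsub>F\<^esub>)"
        using ij by (intro F.finsum_eqI) auto
      also have "\<dots> = \<one>\<^bsub>?M\<^esub> (i, j)" using ij by (subst F.finsum_single[of i]) auto
      finally show "(\<Oplus>\<^bsub>?M\<^esub>p\<in>{..<m}. ?E p) (i, j) = \<one>\<^bsub>?M\<^esub> (i, j)" .
    qed auto
    also have "\<dots> = h \<one>\<^bsub>A d\<^esub>" by (rule ring_hom_one[OF hom, symmetric])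
    finally show "(\<Oplus>\<^bsub>A d\<^esub>p\<in>{..<m}. e p) = \<one>\<^bsub>A d\<^esub>"
      by (rule inj[rotated 2]) (use e AA.M.finsum_in AA.unit_closed in \<open>auto simp del: A_simps\<close>)
  qed
qed

text \<open>
  Let \<open>N\<close> be the nucleus of \<open>A\<close> and \<open>\<epsilon>\<close> a primitive idempotent of \<open>K\<close> that does not annihilate
  \<open>\<delta> = d - \<sigma>\<^sup>-\<^sup>1(d)\<close>.  The point is that no \<open>\<sigma>\<^sup>i\<close> with \<open>0 < i < n\<close> fixes \<open>\<epsilon>\<close>.  The exponents \<open>k\<close> for which \<open>\<sigma>\<^sup>k\<close>
  fixes \<open>\<epsilon>\<close> and \<open>\<epsilon> t\<^sup>k\<close> is in \<open>N\<close> form a subgroup \<open>T\<close> of the integers modulo \<open>n\<close>, and \<open>\<epsilon> N \<epsilon>\<close> is the sum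
  of the \<open>K \<epsilon> t\<^sup>k\<close> with \<open>k \<in> T\<close>.  So the partial trace \<open>z(y) = \<Sum>\<^sub>k\<^sub>\<in>\<^sub>T \<sigma>\<^sup>k(\<epsilon> y)\<close> is central in \<open>\<epsilon> N \<epsilon>\<close>.  As \<open>A\<close> is split,
  \<open>N\<close> contains idempotents with one-dimensional corners and sum \<open>1\<close>, and it follows that \<open>z(y)\<close> is in \<open>F \<epsilon>\<close>.
  If \<open>\<sigma>\<^sup>i\<close> fixes \<open>\<epsilon>\<close>, then it fixes every \<open>z(y)\<close>, which forces \<open>i \<in> T\<close>.  But \<open>\<epsilon> t\<^sup>i\<close> cannot be in \<open>N\<close>, since
  \<open>\<epsilon>\<close> does not annihilate \<open>\<delta>\<close>.

  Consequently the \<open>\<sigma>\<^sup>i(\<epsilon>)\<close>, \<open>i < n\<close>, are orthogonal, hence \<open>\<epsilon> tr(\<epsilon> a) = \<epsilon> a\<close>, and \<open>a \<mapsto> tr(\<epsilon> a)\<close> is a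
  homomorphism to \<open>F\<close>.
\<close>

lemma split_imp_character:
  assumes d: "d \<in> Units K" and dF: "d \<notin> scalars F K" and split: "split_algebra F (A d)"
  obtains \<pi> where "\<pi> \<in> ring_hom K F" "\<And>c x. \<lbrakk>c \<in> carrier F; x \<in> carrier K\<rbrakk> \<Longrightarrow> \<pi> (c \<odot> x) = c \<otimes>\<^bsub>F\<^esub> \<pi> x"
proof -
  have dK [simp]: "d \<in> carrier K" using d by (rule K.Units_closed)
  interpret AA: nonassoc_algebra F "A d" by (rule A_nonassoc_algebra[OF dK])
  let ?N = "nucleus_algebra (A d)"
  interpret N: ring ?N by (rule AA.nucleus_ring)
  have sd: "\<sigma> d \<in> carrier K" using s_closed[OF dK, of 1] by simp
  define \<delta> where "\<delta> = s (n - 1) (\<sigma> d \<ominus> d)"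
  have \<delta> [simp]: "\<delta> \<in> carrier K" using sd by (simp add: \<delta>_def)
  have "\<sigma> d \<noteq> d" using dF fixed dK by blast
  then have \<delta>_nz: "\<delta> \<noteq> \<zero>" using sd by (simp add: \<delta>_def)
  obtain r :: nat and \<eta> where \<eta>: "\<And>i. i < r \<Longrightarrow> \<eta> i \<in> carrier K"
    and orth: "\<And>i j. \<lbrakk>i < r; j < r\<rbrakk> \<Longrightarrow> \<eta> i \<otimes> \<eta> j = (if i = j then \<eta> i else \<zero>)"
    and sep: "\<And>x. \<lbrakk>x \<in> carrier K; x \<noteq> \<zero>\<rbrakk> \<Longrightarrow> \<exists>i<r. \<eta> i \<otimes> x \<noteq> \<zero>"
    and inv: "\<And>i x. \<lbrakk>i < r; x \<in> carrier K; \<eta> i \<otimes> x \<noteq> \<zero>\<rbrakk> \<Longrightarrow> \<exists>y\<in>carrier K. x \<otimes> y = \<eta> i"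
    using etale_idempotents[OF etale] by blast
  obtain j where j: "j < r" "\<eta> j \<otimes> \<delta> \<noteq> \<zero>" using sep[OF \<delta> \<delta>_nz] by blast
  define \<epsilon> where "\<epsilon> = \<eta> j"
  have \<epsilon> [simp]: "\<epsilon> \<in> carrier K" and \<epsilon>_idem: "\<epsilon> \<otimes> \<epsilon> = \<epsilon>" and \<epsilon>\<delta>: "\<epsilon> \<otimes> \<delta> \<noteq> \<zero>"
    and \<epsilon>_inv: "\<And>x. \<lbrakk>x \<in> carrier K; \<epsilon> \<otimes> x \<noteq> \<zero>\<rbrakk> \<Longrightarrow> \<exists>y\<in>carrier K. x \<otimes> y = \<epsilon>"
    using j \<eta> orth inv by (auto simp: \<epsilon>_def)
  have \<epsilon>_nz: "\<epsilon> \<noteq> \<zero>" using \<epsilon>\<delta> by auto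
  \<comment> \<open>conjugates of \<open>\<epsilon>\<close> are equal or orthogonal\<close>
  have prim: "s i \<epsilon> = \<epsilon>" if ne: "\<epsilon> \<otimes> s i \<epsilon> \<noteq> \<zero>" for i
  proof -
    obtain y where y: "y \<in> carrier K" "s i \<epsilon> \<otimes> y = \<epsilon>" using \<epsilon>_inv[OF _ ne] by auto
    have "s i \<epsilon> \<otimes> \<epsilon> = (s i \<epsilon> \<otimes> s i \<epsilon>) \<otimes> y" using y by (simp add: m_assoc)
    also have "\<dots> = \<epsilon>" using y \<epsilon>_idem by (simp flip: s_mult)
    finally have 1: "\<epsilon> \<otimes> s i \<epsilon> = \<epsilon>" by (simp add: m_comm)
    have 2: "\<epsilon> \<otimes> s (i * k) \<epsilon> = \<epsilon>" for k
    proof (induction k)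
      case 0 then show ?case by (simp add: \<epsilon>_idem)
    next
      case (Suc k)
      have "s (i * k) \<epsilon> \<otimes> s (i * Suc k) \<epsilon> = s (i * k) (\<epsilon> \<otimes> s i \<epsilon>)"
        by (simp add: s_s add.commute)
      then have e: "s (i * k) \<epsilon> \<otimes> s (i * Suc k) \<epsilon> = s (i * k) \<epsilon>" by (simp only: 1)
      have "\<epsilon> \<otimes> s (i * Suc k) \<epsilon> = (\<epsilon> \<otimes> s (i * k) \<epsilon>) \<otimes> s (i * Suc k) \<epsilon>" by (simp only: Suc.IH)
      also have "\<dots> = \<epsilon> \<otimes> (s (i * k) \<epsilon> \<otimes> s (i * Suc k) \<epsilon>)" by (rule m_assoc) auto
      also have "\<dots> = \<epsilon>" by (simp only: e Suc.IH)
      finally show ?case .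
    qed
    have "i + i * (n - 1) = n * i" using n_pos by (cases n) auto
    then have "s i (s (i * (n - 1)) \<epsilon>) = \<epsilon>" by (simp only: s_s) (simp add: s_period)
    then have "s i \<epsilon> \<otimes> \<epsilon> = s i (\<epsilon> \<otimes> s (i * (n - 1)) \<epsilon>)" by simp
    then have "s i \<epsilon> \<otimes> \<epsilon> = s i \<epsilon>" by (simp only: 2)
    then show ?thesis using 1 m_comm[of \<epsilon> "s i \<epsilon>"] by simp
  qed
  have no_stabilizer: "s i \<epsilon> \<noteq> \<epsilon>" if i: "0 < i" "i < n" for i
  proof
    assume fix_i: "s i \<epsilon> = \<epsilon>"
    define T where "T = {k. k < n \<and> s k \<epsilon> = \<epsilon> \<and> skew_monom K \<epsilon> k \<in> nucleus (A d)}"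
    have T_fin: "finite T" unfolding T_def by simp
    have T0: "0 \<in> T" using n_pos const_nucleus[OF dK \<epsilon>] by (simp add: T_def)
    have T_unit: "skew_monom K \<epsilon> k \<in> nucleus (A d)"
      if y: "y \<in> carrier K" "y \<otimes> a = \<epsilon>" and a: "a \<in> carrier K" and k: "k < n" and N: "skew_monom K a k \<in> nucleus (A d)" for y a k
    proof -
      have "const y \<otimes>\<^bsub>A d\<^esub> skew_monom K a k = skew_monom K (y \<otimes> a) k"
        using y(1) a k by (simp add: A_const_left) (auto simp: skew_monom_def fun_eq_iff)
      then show ?thesis using AA.nucleus_mult[OF const_nucleus[OF dK y(1)] N] y(2) by simp
    qed
    have T_add: "(k + l) mod n \<in> T" if "k \<in> T" "l \<in> T" for k l
    proof -
      have kl: "k < n" "l < n" "s k \<epsilon> = \<epsilon>" "s l \<epsilon> = \<epsilon>" using that by (auto simp: T_def)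
      let ?w = "wt d k ((k + l) mod n)"
      have w: "?w \<in> Units K" using d s_Units[OF d] by (simp add: wt_def)
      have "skew_monom K \<epsilon> k \<otimes>\<^bsub>A d\<^esub> skew_monom K \<epsilon> l = skew_monom K (\<epsilon> \<otimes> ?w) ((k + l) mod n)"
        using kl by (simp add: A_mult cmul_mon_mon \<epsilon>_idem)
      then have "skew_monom K (\<epsilon> \<otimes> ?w) ((k + l) mod n) \<in> nucleus (A d)"
        using AA.nucleus_mult[of "skew_monom K \<epsilon> k" "skew_monom K \<epsilon> l"] that by (simp add: T_def)
      moreover have "inv ?w \<otimes> (\<epsilon> \<otimes> ?w) = \<epsilon>"
        using w K.Units_closed[OF w] K.Units_inv_closed[OF w] by (simp add: m_lcomm[of "inv ?w" \<epsilon>])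
      ultimately have "skew_monom K \<epsilon> ((k + l) mod n) \<in> nucleus (A d)"
        using w K.Units_closed[OF w] K.Units_inv_closed[OF w] n_pos by (intro T_unit[of "inv ?w" "\<epsilon> \<otimes> ?w"]) auto
      moreover have "s ((k + l) mod n) \<epsilon> = \<epsilon>" using kl by (simp add: s_mod) (simp flip: s_s)
      ultimately show ?thesis using n_pos by (simp add: T_def)
    qed
    \<comment> \<open>a finite submonoid of a group is a subgroup, so translation by an element of \<open>T\<close> permutes \<open>T\<close>\<close>
    have T_bij: "bij_betw (\<lambda>k. (k + l) mod n) T T" if l: "l \<in> T" for l
    proof -
      have "inj_on (\<lambda>k. (k + l) mod n) T"
      proof (rule inj_onI)
        fix k k' assume k: "k \<in> T" "k' \<in> T" "(k + l) mod n = (k' + l) mod n"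
        moreover have "k < n" "k' < n" "l < n" using k l by (auto simp: T_def)
        ultimately show "k = k'" by (auto simp: mod_if split: if_splits)
      qed
      moreover from this have "(\<lambda>k. (k + l) mod n) ` T = T"
        using T_add l by (intro endo_inj_surj[OF T_fin]) auto
      ultimately show ?thesis by (simp add: bij_betw_def)
    qed
    define z where "z = (\<lambda>y. \<Oplus>k\<in>T. s k (\<epsilon> \<otimes> y))"
    have z_closed: "z y \<in> carrier K" if "y \<in> carrier K" for y unfolding z_def using that by (intro finsum_in) auto
    have z_scalar: "\<exists>c\<in>carrier F. z y = c \<odot> \<epsilon>" if y: "y \<in> carrier K" for y
    proof -
      note zc = z_closed[OF y]
      have \<epsilon>z: "\<epsilon> \<otimes> z y = z y"
      proof -
        have "\<epsilon> \<otimes> s k (\<epsilon> \<otimes> y) = s k (\<epsilon> \<otimes> y)" if "k \<in> T" for k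
          using that y \<epsilon>_idem by (simp add: T_def m_assoc[symmetric])
        then show ?thesis unfolding z_def using y T_fin
          by (subst finsum_rdistr) (auto intro!: finsum_eqI)
      qed
      have z_inv: "s l (z y) = z y" if l: "l \<in> T" for l
      proof -
        have "s l (z y) = (\<Oplus>k\<in>T. s l (s k (\<epsilon> \<otimes> y)))" unfolding z_def using y T_fin by (intro s_sum) auto
        also have "\<dots> = (\<Oplus>k\<in>T. s ((k + l) mod n) (\<epsilon> \<otimes> y))"
          using y by (intro finsum_eqI) (auto simp: s_s s_mod add.commute simp del: s_mult)
        also have "\<dots> = z y" unfolding z_def using y by (intro finsum_bij[OF T_bij[OF l]]) auto
        finally show ?thesis .
      qed
      obtain m :: nat and e where e: "\<And>p. p < m \<Longrightarrow> e p \<in> nucleus (A d)"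
        "\<And>p. p < m \<Longrightarrow> e p \<otimes>\<^bsub>A d\<^esub> e p = e p" "(\<Oplus>\<^bsub>A d\<^esub>p\<in>{..<m}. e p) = \<one>\<^bsub>A d\<^esub>"
        "\<And>p x. \<lbrakk>p < m; x \<in> P\<rbrakk> \<Longrightarrow> \<exists>c\<in>carrier F. (e p \<otimes>\<^bsub>A d\<^esub> x) \<otimes>\<^bsub>A d\<^esub> e p = c \<odot>\<^bsub>A d\<^esub> e p"
        using split_diagonal[OF dK split] by blast
      have comm: "const (z y) \<otimes>\<^bsub>A d\<^esub> ((const \<epsilon> \<otimes>\<^bsub>A d\<^esub> x) \<otimes>\<^bsub>A d\<^esub> const \<epsilon>) = ((const \<epsilon> \<otimes>\<^bsub>A d\<^esub> x) \<otimes>\<^bsub>A d\<^esub> const \<epsilon>) \<otimes>\<^bsub>A d\<^esub> const (z y)"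
        if x: "x \<in> nucleus (A d)" for x
      proof -
        have xP: "x \<in> P" using AA.nucleus_closed[OF x] by simp
        let ?x = "\<lambda>m. (\<epsilon> \<otimes> x m) \<otimes> s m \<epsilon>"
        have xP': "(\<lambda>m. \<epsilon> \<otimes> x m) \<in> P" "?x \<in> P" using scale_in xP by auto
        have exe: "(const \<epsilon> \<otimes>\<^bsub>A d\<^esub> x) \<otimes>\<^bsub>A d\<^esub> const \<epsilon> = ?x"
          using xP xP' by (simp add: A_const_left A_const_right)
        \<comment> \<open>either \<open>m\<close> is in \<open>T\<close> and \<open>\<sigma>\<^sup>m\<close> fixes \<open>z(y)\<close>, or the coefficient of \<open>\<epsilon> x \<epsilon>\<close> in degree \<open>m\<close> is zero\<close>
        have "z y \<otimes> ?x m = ?x m \<otimes> s m (z y)" for m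
        proof (cases "m < n \<and> \<epsilon> \<otimes> x m \<noteq> \<zero> \<and> \<epsilon> \<otimes> s m \<epsilon> \<noteq> \<zero>")
          case True
          then obtain y' where y': "y' \<in> carrier K" "x m \<otimes> y' = \<epsilon>" using \<epsilon>_inv[of "x m"] xP by auto
          have "skew_monom K \<epsilon> m \<in> nucleus (A d)"
            using T_unit[of y' "x m" m] y' True xP nucleus_component[OF dK x] by (simp add: m_comm)
          then have "m \<in> T" using True prim by (simp add: T_def)
          then show ?thesis using z_inv[of m] xP zc by (simp add: m_comm)
        next
          case False
          have "?x m = \<zero>"
          proof (cases "m < n")
            case True
            have e: "?x m = x m \<otimes> (\<epsilon> \<otimes> s m \<epsilon>)" using xP by (simp add: m_ac)
            show ?thesis
            proof (cases "\<epsilon> \<otimes> x m = \<zero>")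
              case False
              then show ?thesis unfolding e using \<open>\<not> (m < n \<and> _ \<and> _)\<close> \<open>m < n\<close> xP by simp
            qed simp
          qed (use coeff_zero[OF xP'(2), of m] in auto)
          then show ?thesis using zc by simp
        qed
        then show ?thesis unfolding exe using xP' zc by (simp add: A_const_left A_const_right)
      qed
      have "\<exists>c\<in>scalars F (A d). \<exists>g\<in>carrier ?N. g \<noteq> \<zero>\<^bsub>?N\<^esub> \<and> const \<epsilon> \<otimes>\<^bsub>?N\<^esub> g = g \<and> const (z y) \<otimes>\<^bsub>?N\<^esub> g = c \<otimes>\<^bsub>?N\<^esub> g"
      proof (rule N.corner_center[of m e])
        have "finsum ?N e {..<m} = finsum (A d) e {..<m}"
          by (rule N.finsum_map[where \<phi> = "\<lambda>x. x", OF AA.M.abelian_monoid_axioms])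
             (use e(1) AA.nucleus_closed in auto)
        then show "finsum ?N e {..<m} = \<one>\<^bsub>?N\<^esub>" using e(3) by (simp del: A_simps)
      next
        show "scalars F (A d) \<subseteq> carrier ?N"
          using AA.scalars_subset_center by (auto simp: center_def simp del: A_simps)
        show "c \<otimes>\<^bsub>?N\<^esub> x = x \<otimes>\<^bsub>?N\<^esub> c" if "c \<in> scalars F (A d)" "x \<in> carrier ?N" for c x
          using AA.scalars_subset_center AA.nucleus_closed that by (auto simp: center_def simp del: A_simps)
      next
        fix c assume c: "c \<in> scalars F (A d)" "c \<noteq> \<zero>\<^bsub>?N\<^esub>"
        then obtain a where a: "a \<in> carrier F" "c = a \<odot>\<^bsub>A d\<^esub> \<one>\<^bsub>A d\<^esub>" by (auto simp: scalars_def simp del: A_simps)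
        then have "a \<noteq> \<zero>\<^bsub>F\<^esub>" using c(2) AA.smult_l_null[OF AA.unit_closed] by (auto simp del: A_simps)
        then have u: "a \<in> Units F" using a F.field_Units by auto
        have "(inv\<^bsub>F\<^esub> a \<odot>\<^bsub>A d\<^esub> \<one>\<^bsub>A d\<^esub>) \<otimes>\<^bsub>A d\<^esub> c = (inv\<^bsub>F\<^esub> a \<otimes>\<^bsub>F\<^esub> a) \<odot>\<^bsub>A d\<^esub> \<one>\<^bsub>A d\<^esub>"
          unfolding a(2) using a(1) u AA.unit_closed AA.unit_left AA.smult_closed AA.smult_assoc1 AA.smult_left
          by (simp del: A_simps F.Units_l_inv)
        also have "\<dots> = \<one>\<^bsub>A d\<^esub>" using u AA.smult_one[OF AA.unit_closed] by (simp del: A_simps)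
        finally show "\<exists>c'\<in>scalars F (A d). c' \<otimes>\<^bsub>?N\<^esub> c = \<one>\<^bsub>?N\<^esub>"
          using u by (intro bexI[of _ "inv\<^bsub>F\<^esub> a \<odot>\<^bsub>A d\<^esub> \<one>\<^bsub>A d\<^esub>"]) (auto simp: scalars_def simp del: A_simps)
      next
        fix p x assume p: "p < m" and x: "x \<in> carrier ?N"
        then have ep: "e p \<in> carrier (A d)" and xA: "x \<in> carrier (A d)" using e(1)[OF p] AA.nucleus_closed by (auto simp del: A_simps)
        obtain a where a: "a \<in> carrier F" "(e p \<otimes>\<^bsub>A d\<^esub> x) \<otimes>\<^bsub>A d\<^esub> e p = a \<odot>\<^bsub>A d\<^esub> e p"
          using e(4)[OF p] xA A_simps(1) by blast
        have "(a \<odot>\<^bsub>A d\<^esub> \<one>\<^bsub>A d\<^esub>) \<otimes>\<^bsub>A d\<^esub> e p = a \<odot>\<^bsub>A d\<^esub> e p"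
          using a(1) ep AA.smult_left[OF a(1) AA.unit_closed ep] AA.unit_left[OF ep] by (simp only:)
        then show "\<exists>c\<in>scalars F (A d). e p \<otimes>\<^bsub>?N\<^esub> x \<otimes>\<^bsub>?N\<^esub> e p = c \<otimes>\<^bsub>?N\<^esub> e p"
          using a by (intro bexI[of _ "a \<odot>\<^bsub>A d\<^esub> \<one>\<^bsub>A d\<^esub>"]) (auto simp: scalars_def simp del: A_simps)
      next
        show "const \<epsilon> \<noteq> \<zero>\<^bsub>?N\<^esub>" using \<epsilon>_nz by (auto simp: fun_eq_iff const_apply)
        show "const \<epsilon> \<otimes>\<^bsub>?N\<^esub> const \<epsilon> = const \<epsilon>" using const_mult[OF dK \<epsilon> \<epsilon>] by (simp add: \<epsilon>_idem)
        show "const (z y) \<otimes>\<^bsub>?N\<^esub> const \<epsilon> = const (z y)" "const \<epsilon> \<otimes>\<^bsub>?N\<^esub> const (z y) = const (z y)"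
          using const_mult[OF dK \<epsilon> zc] const_mult[OF dK zc \<epsilon>] \<epsilon>z m_comm[OF \<epsilon> zc] by simp_all
      qed (use e(1,2) const_nucleus dK zc comm in \<open>simp_all del: A_simps\<close>)
      then obtain c g where c: "c \<in> scalars F (A d)" and g: "g \<in> nucleus (A d)" "g \<noteq> \<zero>\<^bsub>A d\<^esub>"
        "const \<epsilon> \<otimes>\<^bsub>A d\<^esub> g = g" "const (z y) \<otimes>\<^bsub>A d\<^esub> g = c \<otimes>\<^bsub>A d\<^esub> g" by (auto simp del: A_simps)
      obtain a where a: "a \<in> carrier F" "c = a \<odot>\<^bsub>A d\<^esub> \<one>\<^bsub>A d\<^esub>" using c by (auto simp: scalars_def simp del: A_simps)
      have gP: "g \<in> P" using AA.nucleus_closed[OF g(1)] by simp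
      have "c = const (a \<odot> \<one>)" unfolding a(2) using a(1) by (auto simp: skew_monom_def fun_eq_iff)
      then have zg: "z y \<otimes> g m = (a \<odot> \<one>) \<otimes> g m" for m
        using fun_cong[OF g(4), of m] gP zc a(1) by (simp add: A_const_left)
      have \<epsilon>g: "\<epsilon> \<otimes> g m = g m" for m using fun_cong[OF g(3), of m] gP by (simp add: A_const_left)
      obtain m where m: "g m \<noteq> \<zero>" using g(2) by (auto simp: fun_eq_iff)
      \<comment> \<open>\<open>\<epsilon> K\<close> is a field, and \<open>z(y) - a \<epsilon>\<close> annihilates a nonzero element of it\<close>
      let ?b = "z y \<ominus> a \<odot> \<epsilon>"
      have bc: "?b \<in> carrier K" using zc a(1) by simp
      have \<epsilon>b: "\<epsilon> \<otimes> ?b = ?b" using zc a(1) \<epsilon>z by (simp add: a_minus_def r_distr r_minus smult_mult_right \<epsilon>_idem)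
      have "?b \<otimes> g m = \<zero>"
        using zc a(1) gP zg[of m] \<epsilon>g[of m] by (simp add: a_minus_def l_distr l_minus KA.smult_assoc2 r_neg)
      have "?b = \<zero>"
      proof (rule ccontr)
        assume "?b \<noteq> \<zero>"
        then obtain y' where y': "y' \<in> carrier K" "?b \<otimes> y' = \<epsilon>" using \<epsilon>_inv[OF bc] \<epsilon>b by auto
        have "g m = (?b \<otimes> y') \<otimes> g m" using y'(2) \<epsilon>g by simp
        also have "\<dots> = y' \<otimes> (?b \<otimes> g m)" using y'(1) bc gP by (simp add: m_ac)
        also have "\<dots> = \<zero>" using \<open>?b \<otimes> g m = \<zero>\<close> y'(1) by simp
        finally show False using m by simp
      qed
      then have "z y = a \<odot> \<epsilon>" using zc a(1) by simp
      then show ?thesis using a(1) by blast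
    qed
    have z_fix: "s i (z y) = z y" if "y \<in> carrier K" for y
      using z_scalar[OF that] fix_i by auto
    have "i \<in> T"
    proof (rule ccontr)
      assume "i \<notin> T"
      have nz: "(i + k) mod n \<noteq> 0" if k: "k \<in> T" for k
      proof
        assume 0: "(i + k) mod n = 0"
        have kn: "k < n" using k by (simp add: T_def)
        have "0 \<in> (\<lambda>l. (l + k) mod n) ` T" using T0 bij_betw_imp_surj_on[OF T_bij[OF k]] by (simp only:)
        then obtain l where l: "l \<in> T" "(l + k) mod n = 0" by (elim imageE) simp
        have "l < n" using l by (simp add: T_def)
        have "l = i"
        proof -
          have "\<not> i + k < n" using 0 i by auto
          moreover have "(i + k) mod n = i + k - n" if "n \<le> i + k" using that i kn by (simp add: le_mod_geq)
          ultimately have "i + k = n" using 0 by simp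
          moreover from this have "k \<noteq> 0" using i by simp
          ultimately show ?thesis using l(2) \<open>l < n\<close> kn i
            by (cases "l + k < n") (simp_all add: le_mod_geq)
        qed
        then show False using l(1) \<open>i \<notin> T\<close> by simp
      qed
      \<comment> \<open>pairing \<open>z\<close> with the dual families extracts the term of the partial trace with \<open>k = -q\<close> modulo \<open>n\<close>\<close>
      have comb: "(\<Oplus>j\<in>{..<N}. u j \<otimes> s q (z (v j))) = (\<Oplus>k\<in>T. if (q + k) mod n = 0 then s (q + k) \<epsilon> else \<zero>)" for q
      proof -
        have "(\<Oplus>j\<in>{..<N}. u j \<otimes> s q (z (v j))) = (\<Oplus>j\<in>{..<N}. \<Oplus>k\<in>T. s (q + k) \<epsilon> \<otimes> (u j \<otimes> s (q + k) (v j)))"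
        proof (rule finsum_eqI)
          fix j
          have "s q (z (v j)) = (\<Oplus>k\<in>T. s q (s k (\<epsilon> \<otimes> v j)))" unfolding z_def using T_fin by (intro s_sum) auto
          then have "u j \<otimes> s q (z (v j)) = (\<Oplus>k\<in>T. u j \<otimes> s q (s k (\<epsilon> \<otimes> v j)))"
            using T_fin by (simp only:) (intro finsum_rdistr; auto)
          also have "\<dots> = (\<Oplus>k\<in>T. s (q + k) \<epsilon> \<otimes> (u j \<otimes> s (q + k) (v j)))"
            by (intro finsum_eqI) (auto simp: s_s m_ac)
          finally show "u j \<otimes> s q (z (v j)) = (\<Oplus>k\<in>T. s (q + k) \<epsilon> \<otimes> (u j \<otimes> s (q + k) (v j)))" .
        qed (auto intro!: finsum_in)
        also have "\<dots> = (\<Oplus>k\<in>T. \<Oplus>j\<in>{..<N}. s (q + k) \<epsilon> \<otimes> (u j \<otimes> s (q + k) (v j)))"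
          using T_fin by (intro finsum_swap) auto
        also have "\<dots> = (\<Oplus>k\<in>T. if (q + k) mod n = 0 then s (q + k) \<epsilon> else \<zero>)"
        proof (rule finsum_eqI)
          fix k
          have "(\<Oplus>j\<in>{..<N}. s (q + k) \<epsilon> \<otimes> (u j \<otimes> s (q + k) (v j))) = s (q + k) \<epsilon> \<otimes> (\<Oplus>j\<in>{..<N}. u j \<otimes> s (q + k) (v j))"
            by (intro finsum_rdistr[symmetric]) auto
          also have "(\<Oplus>j\<in>{..<N}. u j \<otimes> s (q + k) (v j)) = (\<Oplus>j\<in>{..<N}. u j \<otimes> s ((q + k) mod n) (v j))"
            by (intro finsum_eqI) (auto simp: s_mod)
          finally show "(\<Oplus>j\<in>{..<N}. s (q + k) \<epsilon> \<otimes> (u j \<otimes> s (q + k) (v j))) = (if (q + k) mod n = 0 then s (q + k) \<epsilon> else \<zero>)"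
            using n_pos by (simp add: dual)
        qed auto
        finally show ?thesis .
      qed
      have "(\<Oplus>j\<in>{..<N}. u j \<otimes> s i (z (v j))) = \<zero>"
        unfolding comb by (intro K.add.finprod_one_eqI) (simp only: nz if_False)
      moreover have "(\<Oplus>j\<in>{..<N}. u j \<otimes> s i (z (v j))) = (\<Oplus>j\<in>{..<N}. u j \<otimes> s 0 (z (v j)))"
        by (intro finsum_eqI) (auto simp: z_fix z_closed)
      moreover have "(\<Oplus>j\<in>{..<N}. u j \<otimes> s 0 (z (v j))) = s (0 + 0) \<epsilon>"
        unfolding comb using T0 T_fin by (subst finsum_single[of 0]) (auto simp: T_def)
      ultimately show False using \<epsilon>_nz by simp
    qed
    then have "skew_monom K \<epsilon> i \<in> nucleus (A d)" by (simp add: T_def)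
    from nucleus_coeff[OF dK this i] have "\<epsilon> \<otimes> s (i - 1) (\<sigma> d \<ominus> d) = \<zero>" by (simp add: skew_monom_def)
    then have "s (n - i) (\<epsilon> \<otimes> s (i - 1) (\<sigma> d \<ominus> d)) = \<zero>" by simp
    then have "s (n - i) \<epsilon> \<otimes> s (n - i) (s (i - 1) (\<sigma> d \<ominus> d)) = \<zero>" using sd by (simp only: s_mult \<epsilon> s_closed K.minus_closed dK)
    moreover have "s (n - i) (s (i - 1) (\<sigma> d \<ominus> d)) = \<delta>" unfolding s_s \<delta>_def using i by simp
    moreover have "s (n - i) \<epsilon> = \<epsilon>"
    proof -
      have "s (n - i) (s i \<epsilon>) = \<epsilon>" unfolding s_s using i by (simp add: period)
      then show ?thesis by (simp only: fix_i)
    qed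
    ultimately show False using \<epsilon>\<delta> by simp
  qed
  have tr_\<epsilon>: "\<epsilon> \<otimes> tr (\<epsilon> \<otimes> a) = \<epsilon> \<otimes> a" if a: "a \<in> carrier K" for a
  proof -
    have "\<epsilon> \<otimes> tr (\<epsilon> \<otimes> a) = (\<Oplus>i\<in>{..<n}. \<epsilon> \<otimes> s i (\<epsilon> \<otimes> a))"
      unfolding tr_def using a by (intro finsum_rdistr) auto
    also have "\<dots> = \<epsilon> \<otimes> s 0 (\<epsilon> \<otimes> a)"
    proof (rule finsum_single)
      fix i assume "i \<in> {..<n}" "i \<noteq> 0"
      then have "\<epsilon> \<otimes> s i \<epsilon> = \<zero>" using prim[of i] no_stabilizer[of i] by auto
      then show "\<epsilon> \<otimes> s i (\<epsilon> \<otimes> a) = \<zero>" using a by (simp add: m_assoc[symmetric])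
    qed (use a n_pos in auto)
    also have "\<dots> = \<epsilon> \<otimes> a" using a by (simp add: m_assoc[symmetric] \<epsilon>_idem)
    finally show ?thesis .
  qed
  define \<pi> where "\<pi> = (\<lambda>a. trF (\<epsilon> \<otimes> a))"
  have \<pi>c [simp]: "\<pi> a \<in> carrier F" if "a \<in> carrier K" for a using that by (simp add: \<pi>_def)
  have \<pi>\<epsilon>: "\<pi> a \<odot> \<epsilon> = \<epsilon> \<otimes> a" if "a \<in> carrier K" for a
    using that tr_\<epsilon>[OF that] by (simp add: \<pi>_def trF_smult m_comm)
  have inj: "a = b" if ab: "a \<in> carrier F" "b \<in> carrier F" "a \<odot> \<epsilon> = b \<odot> \<epsilon>" for a b
  proof -
    have "(a \<ominus>\<^bsub>F\<^esub> b) \<odot> \<epsilon> = \<zero>"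
      using ab by (simp add: a_minus_def KA.smult_l_distr KA.smult_l_minus r_neg)
    then have "a \<ominus>\<^bsub>F\<^esub> b = \<zero>\<^bsub>F\<^esub>"
      using smult_eq_zero[OF field_F KA.module _ \<epsilon> _ \<epsilon>_nz] ab by blast
    then show ?thesis using ab by simp
  qed
  show thesis
  proof (rule that[of \<pi>])
    show "\<pi> \<in> ring_hom K F"
    proof (rule ring_hom_memI)
      fix x y assume xy: "x \<in> carrier K" "y \<in> carrier K"
      show "\<pi> (x \<oplus> y) = \<pi> x \<oplus>\<^bsub>F\<^esub> \<pi> y" using xy by (simp add: \<pi>_def r_distr trF_add)
      show "\<pi> (x \<otimes> y) = \<pi> x \<otimes>\<^bsub>F\<^esub> \<pi> y"
      proof (rule inj)
        have "(\<pi> x \<otimes>\<^bsub>F\<^esub> \<pi> y) \<odot> \<epsilon> = \<pi> x \<odot> (\<epsilon> \<otimes> y)" using xy by (simp add: KA.smult_assoc1 \<pi>\<epsilon>)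
        also have "\<dots> = (\<pi> x \<odot> \<epsilon>) \<otimes> y" using xy by (simp add: KA.smult_assoc2)
        also have "\<dots> = \<pi> (x \<otimes> y) \<odot> \<epsilon>" using xy by (simp add: \<pi>\<epsilon> m_assoc)
        finally show "\<pi> (x \<otimes> y) \<odot> \<epsilon> = (\<pi> x \<otimes>\<^bsub>F\<^esub> \<pi> y) \<odot> \<epsilon>" by simp
      qed (use xy in auto)
    next
      show "\<pi> \<one> = \<one>\<^bsub>F\<^esub>" by (rule inj) (simp_all add: \<pi>\<epsilon>)
    qed simp
  next
    fix c x assume "c \<in> carrier F" "x \<in> carrier K"
    then show "\<pi> (c \<odot> x) = c \<otimes>\<^bsub>F\<^esub> \<pi> x" by (simp add: \<pi>_def smult_mult_right trF_lin)
  qed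
qed

end

section \<open>Division algebras\<close>

lemma (in vectorspace) inj_imp_surj:
  assumes fd: "fin_dim" and lin: "linear_map K V V T" and inj: "inj_on T (carrier V)"
  shows "T ` carrier V = carrier V"
proof -
  interpret T: linear_map K V V T by (rule lin)
  obtain B where B: "finite B" "basis B" using finite_basis_exists[OF fd] by blast
  have Bc: "B \<subseteq> carrier V" using B(2) by (simp add: basis_def)
  have Bli: "lin_indpt B" using B(2) by (simp add: basis_def)
  have injB: "inj_on T B" using inj Bc by (rule inj_on_subset)
  have TBc: "T ` B \<subseteq> carrier V" using Bc by auto
  have li: "lin_indpt (T ` B)"
  proof (rule finite_lin_indpt2)
    show "finite (T ` B)" using B by simp
    show "T ` B \<subseteq> carrier V" by (rule TBc)
    fix a assume a: "a \<in> T ` B \<rightarrow> carrier K" and z: "lincomb a (T ` B) = \<zero>\<^bsub>V\<^esub>"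
    have "T (lincomb (a \<circ> T) B) = \<zero>\<^bsub>V\<^esub>" using T.lincomb_linear_image[OF inj Bc a B(1)] z by simp
    moreover have c: "a \<circ> T \<in> B \<rightarrow> carrier K" using a by auto
    ultimately have "lincomb (a \<circ> T) B = \<zero>\<^bsub>V\<^esub>"
      using inj_onD[OF inj, of "lincomb (a \<circ> T) B" "\<zero>\<^bsub>V\<^esub>"] lincomb_closed[OF Bc c] T.T0_is_0
      by (simp only: M.zero_closed)
    then have "(a \<circ> T) v = \<zero>\<^bsub>K\<^esub>" if "v \<in> B" for v
      using Bli c that B(1) lin_dep_crit[of B B "a \<circ> T" v] by blast
    then show "\<forall>v\<in>T ` B. a v = \<zero>\<^bsub>K\<^esub>" by auto
  qed
  have "card (T ` B) \<ge> dim" using card_image[OF injB] dim_basis[OF B] by simp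
  then have "basis (T ` B)" using fd B(1) TBc li by (intro dim_li_is_basis) auto
  then have "span (T ` B) = carrier V" by (simp add: basis_def)
  moreover have "span (T ` B) \<subseteq> T.imT"
    using TBc Bc by (intro span_is_subset T.im_is_submodule) (auto simp: T.im_def)
  ultimately show ?thesis unfolding T.im_def using T.T_im by blast
qed

lemma division_algebraI:
  assumes F: "field F" and A: "nonassoc_algebra F A" and fd: "vectorspace.fin_dim F A" and ne: "\<one>\<^bsub>A\<^esub> \<noteq> \<zero>\<^bsub>A\<^esub>"
    and nzd: "\<And>x y. \<lbrakk>x \<in> carrier A; y \<in> carrier A; x \<otimes>\<^bsub>A\<^esub> y = \<zero>\<^bsub>A\<^esub>\<rbrakk> \<Longrightarrow> x = \<zero>\<^bsub>A\<^esub> \<or> y = \<zero>\<^bsub>A\<^esub>"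
  shows "division_algebra A"
proof -
  interpret A: nonassoc_algebra F A by fact
  interpret F: field F by fact
  interpret V: vectorspace F A by (intro vectorspace.intro A.module_axioms F)
  have bij: "bij_betw T (carrier A) (carrier A)"
    if T: "\<And>x. x \<in> carrier A \<Longrightarrow> T x \<in> carrier A"
      "\<And>x y. \<lbrakk>x \<in> carrier A; y \<in> carrier A\<rbrakk> \<Longrightarrow> T (x \<oplus>\<^bsub>A\<^esub> y) = T x \<oplus>\<^bsub>A\<^esub> T y"
      "\<And>a x. \<lbrakk>a \<in> carrier F; x \<in> carrier A\<rbrakk> \<Longrightarrow> T (a \<odot>\<^bsub>A\<^esub> x) = a \<odot>\<^bsub>A\<^esub> T x"
      and z: "\<And>x. \<lbrakk>x \<in> carrier A; T x = \<zero>\<^bsub>A\<^esub>\<rbrakk> \<Longrightarrow> x = \<zero>\<^bsub>A\<^esub>" for T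
  proof -
    have lin: "linear_map F A A T"
      by (intro linear_map.intro V.vectorspace_axioms mod_hom.intro mod_hom_axioms.intro A.module_axioms)
         (auto simp: module_hom_def T)
    interpret T: linear_map F A A T by (rule lin)
    have "T.kerT = {\<zero>\<^bsub>A\<^esub>}" unfolding T.ker_def using z T.T0_is_0 A.M.zero_closed by blast
    then have "inj_on T (carrier A)" by (intro T.Ke0_imp_inj) simp
    then show ?thesis using V.inj_imp_surj[OF fd lin] by (simp add: bij_betw_def)
  qed
  show ?thesis
    unfolding division_algebra_def
  proof (intro conjI ballI)
    show "carrier A \<noteq> {\<zero>\<^bsub>A\<^esub>}" using ne A.unit_closed by auto
    fix a assume "a \<in> carrier A - {\<zero>\<^bsub>A\<^esub>}"
    then have a: "a \<in> carrier A" "a \<noteq> \<zero>\<^bsub>A\<^esub>" by auto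
    show "bij_betw (\<lambda>x. a \<otimes>\<^bsub>A\<^esub> x) (carrier A) (carrier A)"
    proof (rule bij)
      show "x = \<zero>\<^bsub>A\<^esub>" if "x \<in> carrier A" "a \<otimes>\<^bsub>A\<^esub> x = \<zero>\<^bsub>A\<^esub>" for x using nzd[OF a(1) that] a(2) by blast
    qed (use a(1) in \<open>simp_all add: A.mult_closed A.distrib_left A.smult_right\<close>)
    show "bij_betw (\<lambda>x. x \<otimes>\<^bsub>A\<^esub> a) (carrier A) (carrier A)"
    proof (rule bij)
      show "x = \<zero>\<^bsub>A\<^esub>" if "x \<in> carrier A" "x \<otimes>\<^bsub>A\<^esub> a = \<zero>\<^bsub>A\<^esub>" for x using nzd[OF that(1) a(1) that(2)] a(2) by blast
    qed (use a(1) in \<open>simp_all add: A.mult_closed A.distrib_right A.smult_left\<close>)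
  qed
qed

context galois_dual
begin

text \<open>
  The algebra as a left vector space over \<open>K\<close>.  Only the module structure matters; \<open>mult\<close> and \<open>one\<close> are
  placeholders.
\<close>

definition left_K :: "('b, nat \<Rightarrow> 'b) module" where
  "left_K = \<lparr>carrier = P, monoid.mult = (\<lambda>g h. g), one = (\<lambda>i. \<zero>), ring.zero = (\<lambda>i. \<zero>),
     add = (\<lambda>g h i. g i \<oplus> h i), smult = (\<lambda>a g i. a \<otimes> g i)\<rparr>"

lemma left_K_simps [simp]: "carrier left_K = P" "\<zero>\<^bsub>left_K\<^esub> = (\<lambda>i. \<zero>)" "g \<oplus>\<^bsub>left_K\<^esub> h = (\<lambda>i. g i \<oplus> h i)"
  "a \<odot>\<^bsub>left_K\<^esub> g = (\<lambda>i. a \<otimes> g i)"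
  by (simp_all add: left_K_def)

lemma left_K_dim:
  assumes "field K"
  shows "vectorspace K left_K" "vectorspace.dim K left_K = n"
proof -
  interpret KF: field K by fact
  let ?V = "self_algebra K"
  have m: "module K ?V"
  proof (rule moduleI)
    show "abelian_group ?V"
    proof (rule abelian_groupI)
      fix x assume "x \<in> carrier ?V"
      then show "\<exists>y\<in>carrier ?V. y \<oplus>\<^bsub>?V\<^esub> x = \<zero>\<^bsub>?V\<^esub>"
        by (intro bexI[of _ "\<ominus> x"]) (auto simp: self_algebra_def K.l_neg)
    qed (auto simp: self_algebra_def K.a_ac)
  qed (auto simp: self_algebra_def K.is_cring K.l_distr K.r_distr K.m_assoc)
  interpret V: vectorspace K ?V by (intro vectorspace.intro m assms)
  have gen: "V.gen_set {\<one>}"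
  proof -
    have "x \<in> V.span {\<one>}" if x: "x \<in> carrier ?V" for x
    proof -
      have "x = V.lincomb (\<lambda>_. x) {\<one>}"
        using x unfolding V.lincomb_def by (subst V.finsum_single[of \<one>]) (auto simp: self_algebra_def)
      then show ?thesis using x unfolding V.span_def by (intro CollectI exI[of _ "\<lambda>_. x"] exI[of _ "{\<one>}"]) (auto simp: self_algebra_def)
    qed
    moreover have "V.span {\<one>} \<subseteq> carrier ?V" by (rule V.span_is_subset2) (simp add: self_algebra_def)
    ultimately show ?thesis by blast
  qed
  have "V.fin_dim" unfolding V.fin_dim_def using gen by (intro exI[of _ "{\<one>}"] conjI) (simp_all add: self_algebra_def)
  moreover have "V.dim = 1" using V.dim1I[OF gen] one_neq_zero by (simp add: self_algebra_def)
  moreover have "skew_polys_below ?V n = P"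
  proof -
    have "carrier ?V = carrier K" "\<zero>\<^bsub>?V\<^esub> = \<zero>" by (simp_all add: self_algebra_def)
    then show ?thesis unfolding skew_polys_below_def up_def by (simp only:)
  qed
  ultimately show "vectorspace K left_K" "vectorspace.dim K left_K = n"
    using seq_space_dim[OF V.vectorspace_axioms, of left_K n] by (auto simp: self_algebra_def)
qed

text \<open>
  Left multiplication by \<open>t\<close>: it applies \<open>\<sigma>\<close> to the coefficients and replaces \<open>t\<^sup>n\<close> by \<open>d\<close>.  For \<open>n = 1\<close>,
  where \<open>t\<close> itself is not reduced, it is left multiplication by the remainder \<open>d\<close> of \<open>t\<close>.
\<close>

definition shift :: "'b \<Rightarrow> (nat \<Rightarrow> 'b) \<Rightarrow> nat \<Rightarrow> 'b" where
  "shift d g = (\<lambda>m. if m < n then (if m = 0 then \<sigma> (g (n - 1)) \<otimes> d else \<sigma> (g (m - 1))) else \<zero>)"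

lemma sigma_closed [simp]: "x \<in> carrier K \<Longrightarrow> \<sigma> x \<in> carrier K"
  using s_closed[of x 1] by simp

lemma shift_closed: "\<lbrakk>d \<in> carrier K; g \<in> P\<rbrakk> \<Longrightarrow> shift d g \<in> P"
  by (auto simp: mem_below shift_def)

lemma shift_pow_closed: "\<lbrakk>d \<in> carrier K; g \<in> P\<rbrakk> \<Longrightarrow> (shift d ^^ i) g \<in> P"
  by (induction i) (auto intro: shift_closed)

lemma shift_pow:
  assumes d: "d \<in> carrier K" and g: "g \<in> P" and i: "i < n" and m: "m < n"
  shows "(shift d ^^ i) g m = s i (g (dif n m i)) \<otimes> wt d i m"
  using i m
proof (induction i arbitrary: m)
  case 0
  then show ?case using g by (simp add: dif_eq wt_def)
next
  case (Suc i)
  have sw: "\<sigma> (x \<otimes> wt d i k) = s (Suc i) y \<otimes> \<sigma> (wt d i k)" if "x = s i y" "y \<in> carrier K" for x y k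
    using that d s_mult[of x "wt d i k" 1] by simp
  show ?case
  proof (cases "m = 0")
    case True
    have w1: "wt d i (n - 1) = \<one>"
    proof -
      have "i \<le> n - 1" using Suc.prems by linarith
      then show ?thesis by (simp add: wt_def)
    qed
    have "(shift d ^^ Suc i) g m = \<sigma> (s i (g (dif n (n - 1) i)) \<otimes> wt d i (n - 1)) \<otimes> d"
      using True n_pos Suc.prems Suc.IH[of "n - 1"] by (simp add: shift_def[of d "(shift d ^^ i) g"])
    also have "\<dots> = s (Suc i) (g (dif n (n - 1) i)) \<otimes> d"
      using sw[OF refl, of "g (dif n (n - 1) i)" "n - 1"] d g Suc.prems s_closed[of "g (dif n (n - 1) i)" "Suc i"]
        w1 s_one[of 1] by simp
    also have "dif n (n - 1) i = dif n m (Suc i)" using Suc.prems True by (simp add: dif_eq)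
    finally show ?thesis using True by (simp add: wt_def)
  next
    case False
    have "(shift d ^^ Suc i) g m = \<sigma> (s i (g (dif n (m - 1) i)) \<otimes> wt d i (m - 1))"
      using False Suc.prems Suc.IH[of "m - 1"] by (simp add: shift_def[of d "(shift d ^^ i) g"])
    also have "\<dots> = s (Suc i) (g (dif n (m - 1) i)) \<otimes> \<sigma> (wt d i (m - 1))"
      using sw[OF refl, of "g (dif n (m - 1) i)" "m - 1"] g by simp
    also have "dif n (m - 1) i = dif n m (Suc i)" using Suc.prems False by (auto simp: dif_eq)
    also have "\<sigma> (wt d i (m - 1)) = wt d (Suc i) m"
    proof -
      have "\<sigma> (s (m - 1) d) = s m d" using False by (cases m) auto
      then show ?thesis using False s_one[of 1] by (auto simp: wt_def)
    qed
    finally show ?thesis .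
  qed
qed

text \<open>
  As the algebra need not be associative, the \<open>n\<close>-th power of the left multiplication by \<open>t\<close> is in general not
  the left multiplication by \<open>d\<close>; it is the right one, and so scales the coefficient of \<open>t\<^sup>m\<close> by \<open>\<sigma>\<^sup>m(d)\<close>.
\<close>

lemma shift_n:
  assumes d: "d \<in> carrier K" and g: "g \<in> P"
  shows "(shift d ^^ n) g = (\<lambda>m. g m \<otimes> s m d)"
proof (rule below_ext)
  show "(shift d ^^ n) g \<in> P" by (rule shift_pow_closed[OF d g])
  show "(\<lambda>m. g m \<otimes> s m d) \<in> P" by (rule scale_in(2)[OF d g])
  fix m assume m: "m < n"
  have e: "(shift d ^^ n) g = shift d ((shift d ^^ (n - 1)) g)" using n_pos by (cases n) auto
  have n1: "n - 1 < n" using n_pos by simp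
  show "(shift d ^^ n) g m = g m \<otimes> s m d"
  proof (cases "m = 0")
    case True
    have "dif n (n - 1) (n - 1) = 0" using n_pos by simp
    then have "(shift d ^^ n) g m = \<sigma> (s (n - 1) (g 0)) \<otimes> d"
      unfolding e using True m shift_pow[OF d g n1 n1] g d by (simp add: shift_def wt_def)
    also have "\<sigma> (s (n - 1) (g 0)) = s (1 + (n - 1)) (g 0)" by (simp flip: s_s)
    also have "\<dots> = g 0" using g n_pos by (simp add: period)
    finally show ?thesis using True by simp
  next
    case False
    have m1: "m - 1 < n" using m by simp
    have "dif n (m - 1) (n - 1) = m" using False m by (auto simp: dif_eq)
    then have "(shift d ^^ n) g m = \<sigma> (s (n - 1) (g m) \<otimes> s (m - 1) d)"
      unfolding e using False m shift_pow[OF d g n1 m1] g d by (auto simp: shift_def wt_def)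
    also have "\<dots> = s 1 (s (n - 1) (g m)) \<otimes> s 1 (s (m - 1) d)"
      using g d s_mult[of "s (n - 1) (g m)" "s (m - 1) d" 1] by simp
    also have "\<dots> = g m \<otimes> s m d" unfolding s_s using False n_pos g by (simp add: period)
    finally show ?thesis .
  qed
qed

lemma mult_shift:
  assumes d: "d \<in> carrier K" and x: "x \<in> P" and a: "a \<in> P"
  shows "cmul d x a m = (\<Oplus>i\<in>{..<n}. x i \<otimes> (shift d ^^ i) a m)"
proof (cases "m < n")
  case True
  then show ?thesis using assms
    by (auto simp: cmul_def shift_pow dif_def m_assoc intro!: finsum_eqI)
next
  case False
  then have "x i \<otimes> (shift d ^^ i) a m = \<zero>" for i
    using coeff_zero[OF shift_pow_closed[OF d a], of m i] x by simp
  then show ?thesis using False by (simp add: cmul_def finsum_zero)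
qed

text \<open>
  The only nonzero subspace invariant under \<open>shift\<close> is the whole space.  The \<open>n\<close>-th power of
  \<open>shift\<close> is diagonal with distinct eigenvalues \<open>\<sigma>\<^sup>m(d)\<close>, so the subspace contains a monomial, and
  \<open>shift\<close> moves it to all degrees.
\<close>

lemma shift_simple:
  assumes K: "field K" and d: "d \<in> carrier K"
    and dist: "\<And>i. \<lbrakk>0 < i; i < n\<rbrakk> \<Longrightarrow> s i d \<noteq> d"
    and U: "submodule K U left_K" and stable: "\<And>g. g \<in> U \<Longrightarrow> shift d g \<in> U"
    and a: "a \<in> U" "a \<noteq> (\<lambda>i. \<zero>)"
  shows "U = P"
proof -
  interpret KF: field K by fact
  interpret U: submodule K U left_K by fact
  have UP: "g \<in> P" if "g \<in> U" for g using U.subset that by auto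
  have pow: "(shift d ^^ i) g \<in> U" if "g \<in> U" for g i using that by (induction i) (auto intro: stable)
  have diag: "(\<lambda>m. g m \<otimes> s m d) \<in> U" if "g \<in> U" for g
    using pow[OF that, of n] shift_n[OF d UP[OF that]] by simp
  have scale: "(\<lambda>m. c \<otimes> g m) \<in> U" if "c \<in> carrier K" "g \<in> U" for c g using U.smult_closed[OF that] by simp
  have plus: "(\<lambda>m. g m \<oplus> h m) \<in> U" if "g \<in> U" "h \<in> U" for g h using U.m_closed[OF that] by simp
  have eigen: "s i d \<noteq> s j d" if "i < j" "j < n" for i j
  proof
    assume "s i d = s j d"
    then have "s i d = s i (s (j - i) d)" using that by (simp add: s_s)
    then have "d = s (j - i) d" by (rule s_inj[rotated 2]) (use d in auto)
    moreover have "0 < j - i" "j - i < n" using that by linarith+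
    ultimately show False using dist[of "j - i"] by metis
  qed
  have ex_mon: "\<exists>j<n. \<exists>c\<in>carrier K. c \<noteq> \<zero> \<and> skew_monom K c j \<in> U"
    if "g \<in> U" "g \<noteq> (\<lambda>i. \<zero>)" for g
    using that
  proof (induction "card {i. g i \<noteq> \<zero>}" arbitrary: g rule: less_induct)
    case less
    have gP: "g \<in> P" by (rule UP[OF less.prems(1)])
    have fin: "finite {i. g i \<noteq> \<zero>}"
      by (rule finite_subset[of _ "{..<n}"]) (use coeff_zero[OF gP] in \<open>auto simp: not_less[symmetric]\<close>)
    obtain j where j: "g j \<noteq> \<zero>" using less.prems(2) by auto
    then have jn: "j < n" using coeff_zero[OF gP, of j] by (cases "j < n") auto
    show ?case
    proof (cases "\<exists>i. i \<noteq> j \<and> g i \<noteq> \<zero>")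
      case False
      then have "g = skew_monom K (g j) j" by (auto simp: skew_monom_def fun_eq_iff)
      then show ?thesis using j jn gP less.prems(1) by (metis coeff_closed)
    next
      case True
      then obtain i where i: "i \<noteq> j" "g i \<noteq> \<zero>" by auto
      then have "i < n" using coeff_zero[OF gP, of i] by (cases "i < n") auto
      \<comment> \<open>subtracting \<open>\<sigma>\<^sup>i(d) g\<close> removes the coefficient of \<open>t\<^sup>i\<close> and keeps that of \<open>t\<^sup>j\<close>\<close>
      let ?h = "\<lambda>m. g m \<otimes> s m d \<oplus> (\<ominus> s i d) \<otimes> g m"
      have h: "?h \<in> U" using d by (intro plus diag scale less.prems) auto
      have hm: "?h m = g m \<otimes> (s m d \<ominus> s i d)" for m
        using gP d by (simp add: a_minus_def r_distr r_minus l_minus m_comm)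
      have "?h j \<noteq> \<zero>"
      proof -
        have "s j d \<noteq> s i d" using eigen[of i j] eigen[of j i] i(1) jn \<open>i < n\<close> by (metis linorder_neqE_nat)
        then have "s j d \<ominus> s i d \<noteq> \<zero>" using d by simp
        then show ?thesis unfolding hm using j gP d by (simp add: KF.integral_iff)
      qed
      then have hnz: "?h \<noteq> (\<lambda>i. \<zero>)" by metis
      have "?h i = \<zero>" unfolding hm using gP d by (simp add: r_neg a_minus_def)
      moreover have "?h m = \<zero>" if "g m = \<zero>" for m unfolding hm using that d by simp
      ultimately have "{m. ?h m \<noteq> \<zero>} \<subset> {m. g m \<noteq> \<zero>}" using i(2) by auto
      then have "card {m. ?h m \<noteq> \<zero>} < card {m. g m \<noteq> \<zero>}" by (rule psubset_card_mono[OF fin])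
      from less.hyps[OF this h hnz] show ?thesis .
    qed
  qed
  obtain j c where j: "j < n" and c: "c \<in> carrier K" "c \<noteq> \<zero>" and cj: "skew_monom K c j \<in> U"
    using ex_mon[OF a] by blast
  have d_nz: "d \<noteq> \<zero> \<or> n = 1" using dist[of 1] n_pos s_zero[of 1] by (cases "n = 1") auto
  have up: "\<exists>c'\<in>carrier K. c' \<noteq> \<zero> \<and> skew_monom K c' (Suc m mod n) \<in> U"
    if "m < n" "c \<in> carrier K" "c \<noteq> \<zero>" "skew_monom K c m \<in> U" for m c
  proof (cases "n = 1")
    case True then show ?thesis using that by auto
  next
    case n1: False
    have \<sigma>c: "\<sigma> c \<noteq> \<zero>" "\<sigma> c \<in> carrier K" using that s_eq_zero[of c 1] by simp_all
    show ?thesis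
    proof (cases "Suc m = n")
      case True
      have "shift d (skew_monom K c m) = skew_monom K (\<sigma> c \<otimes> d) 0"
        using True n_pos s_zero[of 1] by (auto simp: shift_def skew_monom_def fun_eq_iff)
      then show ?thesis using stable[OF that(4)] True \<sigma>c d d_nz n1
        by (intro bexI[of _ "\<sigma> c \<otimes> d"]) (auto simp: KF.integral_iff)
    next
      case False
      have "shift d (skew_monom K c m) = skew_monom K (\<sigma> c) (Suc m)"
        using False that(1) d s_zero[of 1] by (auto simp: shift_def skew_monom_def fun_eq_iff)
      then show ?thesis using stable[OF that(4)] False that(1) \<sigma>c by (intro bexI[of _ "\<sigma> c"]) auto
    qed
  qed
  have all: "\<exists>c'\<in>carrier K. c' \<noteq> \<zero> \<and> skew_monom K c' ((j + q) mod n) \<in> U" for q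
  proof (induction q)
    case 0 then show ?case using j c cj by auto
  next
    case (Suc q)
    then obtain c' where "c' \<in> carrier K" "c' \<noteq> \<zero>" "skew_monom K c' ((j + q) mod n) \<in> U" by blast
    from up[OF _ this] n_pos show ?case by (simp add: mod_Suc_eq)
  qed
  have mon: "skew_monom K b m \<in> U" if m: "m < n" and b: "b \<in> carrier K" for b m
  proof -
    have "(j + (m + n - j)) mod n = m" using j m by simp
    then obtain c' where c': "c' \<in> carrier K" "c' \<noteq> \<zero>" "skew_monom K c' m \<in> U" using all[of "m + n - j"] by auto
    then have u: "c' \<in> Units K" using KF.field_Units by auto
    have "(\<lambda>i. (b \<otimes> inv c') \<otimes> skew_monom K c' m i) = skew_monom K b m"
      using u b c' by (auto simp: skew_monom_def fun_eq_iff m_assoc)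
    then show ?thesis using scale[of "b \<otimes> inv c'" "skew_monom K c' m"] c' u b by simp
  qed
  have trunc: "(\<lambda>i. if i < m then g i else \<zero>) \<in> U" if "g \<in> P" "m \<le> n" for g m
    using that(2)
  proof (induction m)
    case 0 then show ?case using U.zero_closed by simp
  next
    case (Suc m)
    have "(\<lambda>i. if i < Suc m then g i else \<zero>) = (\<lambda>i. (if i < m then g i else \<zero>) \<oplus> skew_monom K (g m) m i)"
      using that(1) by (auto simp: skew_monom_def fun_eq_iff less_Suc_eq)
    then show ?case using plus[OF Suc.IH mon[of m "g m"]] Suc.prems that(1) by simp
  qed
  have "g \<in> U" if g: "g \<in> P" for g
  proof -
    have "(\<lambda>i. if i < n then g i else \<zero>) = g" using coeff_zero[OF g] by auto
    then show ?thesis using trunc[OF g, of n] by simp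
  qed
  then show ?thesis using UP by blast
qed

text \<open>
  Suppose \<open>x a = 0\<close> with \<open>x\<close> of degree \<open>k < n\<close>.  Solving for the leading term shows that the \<open>k\<close> elements
  \<open>a, t a, t(t a), \<dots>\<close> span a subspace invariant under \<open>shift\<close>.  Its
  dimension is less than \<open>n\<close>, so it is zero, and \<open>a = 0\<close>.
\<close>

lemma no_zero_divisors:
  assumes K: "field K" and d: "d \<in> carrier K"
    and dist: "\<And>i. \<lbrakk>0 < i; i < n\<rbrakk> \<Longrightarrow> s i d \<noteq> d"
    and x: "x \<in> P" and a: "a \<in> P" and zero: "cmul d x a = (\<lambda>i. \<zero>)"
  shows "x = (\<lambda>i. \<zero>) \<or> a = (\<lambda>i. \<zero>)"
proof (rule ccontr)
  assume "\<not> ?thesis"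
  then have xnz: "x \<noteq> (\<lambda>i. \<zero>)" and anz: "a \<noteq> (\<lambda>i. \<zero>)" by auto
  interpret KF: field K by fact
  interpret V: vectorspace K left_K by (rule left_K_dim(1)[OF K])
  define k where "k = Max {i. x i \<noteq> \<zero>}"
  have fin: "finite {i. x i \<noteq> \<zero>}"
    by (rule finite_subset[of _ "{..<n}"]) (use coeff_zero[OF x] in \<open>auto simp: not_less[symmetric]\<close>)
  have ne: "{i. x i \<noteq> \<zero>} \<noteq> {}" using xnz by auto
  have k: "x k \<noteq> \<zero>" using Max_in[OF fin ne] by (simp add: k_def)
  have k_max: "x i = \<zero>" if "k < i" for i using Max_ge[OF fin, of i] that by (auto simp: k_def)
  have kn: "k < n" using k coeff_zero[OF x, of k] by (cases "k < n") auto
  let ?b = "\<lambda>i. (shift d ^^ i) a"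
  have bP: "?b i \<in> P" for i by (rule shift_pow_closed[OF d a])
  define G where "G = ?b ` {..<k}"
  have G: "finite G" "G \<subseteq> carrier left_K" "card G \<le> k"
    using bP card_image_le[of "{..<k}" ?b] by (auto simp: G_def)
  define U where "U = V.span G"
  have Usub: "submodule K U left_K" unfolding U_def by (rule V.span_is_submodule[OF G(2)])
  interpret U: submodule K U left_K by (rule Usub)
  have bU: "?b i \<in> U" if "i < k" for i
    using V.in_own_span[OF G(2)] that by (auto simp: U_def G_def)
  have scale: "(\<lambda>m. c \<otimes> g m) \<in> U" if "c \<in> carrier K" "g \<in> U" for c g using U.smult_closed[OF that] by simp
  have plus: "(\<lambda>m. g m \<oplus> h m) \<in> U" if "g \<in> U" "h \<in> U" for g h using U.m_closed[OF that] by simp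
  have sumU: "(\<lambda>m. \<Oplus>i\<in>X. x i \<otimes> ?b i m) \<in> U" if "finite X" "X \<subseteq> {..<k}" for X
    using that
  proof (induction X rule: finite_induct)
    case empty then show ?case using U.zero_closed by simp
  next
    case (insert i X)
    have "(\<lambda>m. \<Oplus>i\<in>insert i X. x i \<otimes> ?b i m) = (\<lambda>m. x i \<otimes> ?b i m \<oplus> (\<Oplus>i\<in>X. x i \<otimes> ?b i m))"
      using insert(1,2) x coeff_closed[OF bP] by (intro ext finsum_insert) auto
    then show ?case using plus[OF scale[of "x i" "?b i"] insert(3)] bU[of i] insert(4) x by simp
  qed
  have bk: "?b k \<in> U"
  proof -
    let ?r = "\<lambda>m. \<Oplus>i\<in>{..<k}. x i \<otimes> ?b i m"
    have rK: "?r m \<in> carrier K" for m using x coeff_closed[OF bP] by (intro finsum_in) auto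
    have "x k \<otimes> ?b k m \<oplus> ?r m = \<zero>" for m
    proof -
      have "\<zero> = (\<Oplus>i\<in>{..<n}. x i \<otimes> ?b i m)" using mult_shift[OF d x a, of m] zero by (simp add: fun_eq_iff)
      also have "\<dots> = (\<Oplus>i\<in>insert k {..<k}. x i \<otimes> ?b i m)"
        using kn k_max x coeff_closed[OF bP] by (intro add.finprod_mono_neutral_cong_right) auto
      also have "\<dots> = x k \<otimes> ?b k m \<oplus> ?r m" using x coeff_closed[OF bP] by (intro finsum_insert) auto
      finally show ?thesis by simp
    qed
    then have "x k \<otimes> ?b k m = \<ominus> ?r m" for m using rK x coeff_closed[OF bP] by (simp add: minus_equality[symmetric])
    moreover have xu: "x k \<in> Units K" using k x KF.field_Units by auto
    ultimately have "?b k m = (\<ominus> (inv (x k))) \<otimes> ?r m" for m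
      using rK x coeff_closed[OF bP, of k m] K.m_assoc[of "inv (x k)" "x k" "?b k m"] by (simp add: l_minus r_minus)
    then have "?b k = (\<lambda>m. (\<ominus> (inv (x k))) \<otimes> ?r m)" by auto
    then show ?thesis using scale[OF _ sumU[of "{..<k}"], of "\<ominus> (inv (x k))"] xu by simp
  qed
  have shift_add: "shift d (\<lambda>m. g m \<oplus> h m) = (\<lambda>m. shift d g m \<oplus> shift d h m)" if "g \<in> P" "h \<in> P" for g h
    using that d s_add[of "g _" "h _" 1] by (auto simp: shift_def fun_eq_iff l_distr)
  have shift_scale: "shift d (\<lambda>m. c \<otimes> g m) = (\<lambda>m. \<sigma> c \<otimes> shift d g m)" if "c \<in> carrier K" "g \<in> P" for c g
    using that d s_mult[of c "g _" 1] by (auto simp: shift_def fun_eq_iff m_assoc)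
  have "shift d g \<in> U" if "g \<in> U" for g
  proof -
    have "submodule K {g \<in> P. shift d g \<in> U} left_K"
    proof (intro submodule.intro V.module_axioms)
      show "\<zero>\<^bsub>left_K\<^esub> \<in> {g \<in> P. shift d g \<in> U}"
      proof -
        have "shift d (\<lambda>i. \<zero>) = (\<lambda>i. \<zero>)" using d s_zero[of 1] by (intro ext) (simp add: shift_def)
        then show ?thesis using U.zero_closed by (simp add: mem_below)
      qed
    next
      fix g h assume "g \<in> {g \<in> P. shift d g \<in> U}" "h \<in> {g \<in> P. shift d g \<in> U}"
      then show "g \<oplus>\<^bsub>left_K\<^esub> h \<in> {g \<in> P. shift d g \<in> U}"
        using plus by (auto simp: shift_add) (auto simp: mem_below)
    next
      fix c g assume "c \<in> carrier K" "g \<in> {g \<in> P. shift d g \<in> U}"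
      then show "c \<odot>\<^bsub>left_K\<^esub> g \<in> {g \<in> P. shift d g \<in> U}"
        using scale scale_in(1) by (auto simp: shift_scale)
    qed auto
    moreover have "G \<subseteq> {g \<in> P. shift d g \<in> U}"
    proof
      fix g assume "g \<in> G"
      then obtain i where i: "i < k" "g = ?b i" by (auto simp: G_def)
      have "?b (Suc i) \<in> U" using bU[of "Suc i"] bk i by (cases "Suc i = k") auto
      then show "g \<in> {g \<in> P. shift d g \<in> U}" using i bP by simp
    qed
    ultimately have "V.span G \<subseteq> {g \<in> P. shift d g \<in> U}" by (intro V.span_is_subset)
    then show ?thesis using that by (auto simp: U_def)
  qed
  moreover have "a \<in> U" using bU[of 0] bk by (cases "k = 0") auto
  ultimately have "U = P" using shift_simple[OF K d dist Usub] anz by blast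
  then have "V.gen_set G" by (simp add: U_def)
  then have "vectorspace.dim K left_K \<le> card G" using G by (intro V.gen_ge_dim) auto
  then show False using G(3) kn left_K_dim(2)[OF K] by simp
qed

lemma division:
  assumes K: "field K" and d: "d \<in> carrier K" and dist: "\<And>i. \<lbrakk>0 < i; i < n\<rbrakk> \<Longrightarrow> s i d \<noteq> d"
  shows "division_algebra (A d)"
proof (rule division_algebraI[OF field_F A_nonassoc_algebra[OF d]])
  show "vectorspace.fin_dim F (A d)" using A_dim K_fin_dim by blast
  show "\<one>\<^bsub>A d\<^esub> \<noteq> \<zero>\<^bsub>A d\<^esub>" using one_neq_zero by (auto dest: fun_cong[of _ _ 0] simp: const_apply)
  show "x = \<zero>\<^bsub>A d\<^esub> \<or> y = \<zero>\<^bsub>A d\<^esub>" if "x \<in> carrier (A d)" "y \<in> carrier (A d)" "x \<otimes>\<^bsub>A d\<^esub> y = \<zero>\<^bsub>A d\<^esub>" for x y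
    using no_zero_divisors[OF K d dist, of x y] that d by (simp add: A_mult)
qed

text \<open>The stabilizer of \<open>d\<close> in a group of prime order is trivial, as \<open>\<sigma>\<close> itself does not fix \<open>d\<close>.\<close>

lemma division_prime:
  assumes K: "field K" and d: "d \<in> carrier K" "d \<notin> scalars F K" and n: "Factorial_Ring.prime n"
  shows "division_algebra (A d)"
proof (rule division[OF K d(1)])
  fix i assume i: "0 < i" "i < n"
  show "s i d \<noteq> d"
  proof
    assume fix_i: "s i d = d"
    have "\<not> n dvd i" using i by (auto dest: dvd_imp_le)
    then have "coprime i n" using n prime_imp_coprime[of n i] by (simp add: coprime_commute)
    then obtain q y where q: "i * q = n * y + 1" using bezout_nat[of i n] i by auto
    have "s (i * q) d = d" for q
    proof (induction q)
      case (Suc q)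
      have "s (i * Suc q) d = s i (s (i * q) d)" by (simp add: s_s)
      then show ?case using Suc fix_i by simp
    qed simp
    moreover have "s (i * q) d = s 1 d"
    proof -
      have "(i * q) mod n = 1 mod n" unfolding q by (metis mod_mult_self4)
      then show ?thesis using d(1) by (intro s_cong) auto
    qed
    ultimately have "\<sigma> d = d" by simp
    then show False using fixed d by blast
  qed
qed

text \<open>If the powers of \<open>d\<close> form a basis of \<open>K\<close>, then a power of \<open>\<sigma>\<close> fixing \<open>d\<close> is the identity.\<close>

lemma division_independent:
  assumes K: "field K" and d: "d \<in> carrier K" and indep: "powers_independent F K d n"
  shows "division_algebra (A d)"
proof (rule division[OF K d])
  fix i assume i: "0 < i" "i < n"
  interpret V: vectorspace F K by (rule K_vectorspace)
  let ?p = "\<lambda>j. d [^] (j::nat)"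
  have pc [simp]: "?p j \<in> carrier K" for j using d by simp
  have ind: "c j = \<zero>\<^bsub>F\<^esub>" if "\<And>j. j < n \<Longrightarrow> c j \<in> carrier F" "(\<Oplus>j\<in>{..<n}. c j \<odot> ?p j) = \<zero>" "j < n" for c j
    using indep that unfolding powers_independent_def by blast
  have inj: "inj_on ?p {..<n}"
  proof (rule inj_onI, rule ccontr)
    fix j k assume jk: "j \<in> {..<n}" "k \<in> {..<n}" "?p j = ?p k" "j \<noteq> k"
    let ?c = "\<lambda>l. if l = j then \<one>\<^bsub>F\<^esub> else if l = k then \<ominus>\<^bsub>F\<^esub> \<one>\<^bsub>F\<^esub> else \<zero>\<^bsub>F\<^esub>"
    have "(\<Oplus>l\<in>{..<n}. ?c l \<odot> ?p l) = (\<Oplus>l\<in>{..<n}. (if l = j then ?p j else \<zero>) \<oplus> (if l = k then \<ominus> ?p k else \<zero>))"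
      using jk(4) by (intro finsum_eqI) (auto simp: KA.smult_l_minus)
    also have "\<dots> = (\<Oplus>l\<in>{..<n}. if l = j then ?p j else \<zero>) \<oplus> (\<Oplus>l\<in>{..<n}. if l = k then \<ominus> ?p k else \<zero>)"
      by (intro finsum_add) auto
    also have "\<dots> = ?p j \<oplus> (\<ominus> ?p k)"
      using jk(1,2) by (subst (1 2) finsum_single[of j] finsum_single[of k]) (auto simp: finsum_single[of k])
    also have "\<dots> = \<zero>" using jk(3) by (simp add: r_neg)
    finally have "?c j = \<zero>\<^bsub>F\<^esub>" using jk(1) by (intro ind[of ?c]) auto
    then show False by simp
  qed
  let ?B = "?p ` {..<n}"
  have "V.basis ?B"
  proof (rule V.dim_li_is_basis[OF K_fin_dim])
    show "\<not> KA.lin_dep ?B"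
    proof (rule KA.finite_lin_indpt2)
      fix a assume a: "a \<in> ?B \<rightarrow> carrier F" and z: "KA.lincomb a ?B = \<zero>"
      have "KA.lincomb a ?B = (\<Oplus>j\<in>{..<n}. a (?p j) \<odot> ?p j)"
        unfolding KA.lincomb_def by (intro finsum_reindex inj) (use funcset_mem[OF a] in auto)
      then show "\<forall>v\<in>?B. a v = \<zero>\<^bsub>F\<^esub>" using ind[of "\<lambda>j. a (?p j)"] a z by auto
    qed auto
    show "V.dim \<le> card ?B" using dim card_image[OF inj] by simp
  qed auto
  then have gen: "KA.span ?B = carrier K" by (simp add: V.basis_def)
  show "s i d \<noteq> d"
  proof
    assume fix_i: "s i d = d"
    have "submodule F {x \<in> carrier K. s i x = x} K"
      by (intro submodule.intro KA.module) auto
    moreover have "s i (?p j) = ?p j" for j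
      using d by (induction j) (auto simp: fix_i)
    ultimately have "KA.span ?B \<subseteq> {x \<in> carrier K. s i x = x}" by (intro KA.span_is_subset) auto
    then show False using gen order[OF i] by auto
  qed
qed

end

section \<open>Atoms\<close>

lemma (in field) jacobson_radical_field: "jacobson_radical R = {\<zero>}"
proof -
  have "maximal_left_ideal {\<zero>} R"
    unfolding maximal_left_ideal_def Let_def
  proof (intro conjI allI impI ballI)
    show "additive_subgroup {\<zero>} R" using zeroideal by (rule ideal.axioms(1))
    show "x \<otimes> a \<in> {\<zero>}" if "x \<in> carrier R" "a \<in> {\<zero>}" for x a using that by simp
    show "{\<zero>} \<noteq> carrier R" using one_not_zero one_closed by blast
    fix J assume J: "(additive_subgroup J R \<and> (\<forall>x\<in>carrier R. \<forall>a\<in>J. x \<otimes> a \<in> J)) \<and> {\<zero>} \<subseteq> J"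
    then have sub: "J \<subseteq> carrier R" using additive_subgroup.a_subset by blast
    have "ideal J R"
    proof (intro ideal.intro ideal_axioms.intro ring_axioms)
      show "additive_subgroup J R" using J by simp
      show "x \<otimes> a \<in> J" if "a \<in> J" "x \<in> carrier R" for a x using J that by blast
      then show "a \<otimes> x \<in> J" if "a \<in> J" "x \<in> carrier R" for a x using m_comm[of a x] that sub by auto
    qed
    then show "J = {\<zero>} \<or> J = carrier R" using all_ideals by blast
  qed
  moreover have zI: "\<zero> \<in> I" if "maximal_left_ideal I R" for I
  proof -
    have "additive_subgroup I R" using that unfolding maximal_left_ideal_def Let_def by (elim conjE)
    then show ?thesis by (rule additive_subgroup.zero_closed)
  qed
  ultimately show ?thesis unfolding jacobson_radical_def by auto
qed

text \<open>The identity element that is reassigned to a simple component is, for a field, the given one.\<close>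

lemma simple_component_field:
  fixes Q :: "('a, 'b) module"
  assumes "field Q"
  shows "Q \<in> simple_components Q"
proof -
  interpret Q: field Q by fact
  have "(THE e. e \<in> carrier Q \<and> (\<forall>x\<in>carrier Q. e \<otimes>\<^bsub>Q\<^esub> x = x \<and> x \<otimes>\<^bsub>Q\<^esub> e = x)) = \<one>\<^bsub>Q\<^esub>"
  proof (rule the_equality)
    fix e assume "e \<in> carrier Q \<and> (\<forall>x\<in>carrier Q. e \<otimes>\<^bsub>Q\<^esub> x = x \<and> x \<otimes>\<^bsub>Q\<^esub> e = x)"
    then have "e \<in> carrier Q" "e \<otimes>\<^bsub>Q\<^esub> \<one>\<^bsub>Q\<^esub> = \<one>\<^bsub>Q\<^esub>" using Q.one_closed by blast+
    then show "e = \<one>\<^bsub>Q\<^esub>" using Q.r_one[of e] by simp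
  qed simp
  then have "Q = Q\<lparr>carrier := carrier Q,
      one := (THE e. e \<in> carrier Q \<and> (\<forall>x\<in>carrier Q. e \<otimes>\<^bsub>Q\<^esub> x = x \<and> x \<otimes>\<^bsub>Q\<^esub> e = x))\<rparr>" by simp
  moreover have "ideal (carrier Q) Q" by (rule Q.oneideal)
  moreover have "carrier Q \<noteq> {\<zero>\<^bsub>Q\<^esub>}" using Q.one_not_zero Q.one_closed by blast
  moreover have "J = {\<zero>\<^bsub>Q\<^esub>} \<or> J = carrier Q" if "ideal J Q" for J using that Q.all_ideals by blast
  ultimately show ?thesis unfolding simple_components_def by (intro CollectI exI[of _ "carrier Q"]) simp
qed

lemma (in cring) center_eq_carrier: "center R = carrier R"
proof -
  have "associator R x y z = \<zero>" if "x \<in> carrier R" "y \<in> carrier R" "z \<in> carrier R" for x y z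
    using that by (simp add: associator_def m_assoc)
  then show ?thesis unfolding center_def nucleus_def by (auto intro: m_comm)
qed

context galois_dual
begin

text \<open>
  By the relation satisfied by the coefficients of an element of the nucleus, only
  constant polynomials can be in the nucleus, because \<open>\<sigma>(d) - d\<close> is invertible.
\<close>

lemma nucleus_field:
  assumes K: "field K" and d: "d \<in> carrier K" "d \<notin> scalars F K"
  shows "nucleus (A d) = const ` carrier K"
proof
  interpret KF: field K by fact
  interpret AA: nonassoc_algebra F "A d" by (rule A_nonassoc_algebra[OF d(1)])
  show "const ` carrier K \<subseteq> nucleus (A d)" using const_nucleus[OF d(1)] by blast
  have nz: "\<sigma> d \<ominus> d \<noteq> \<zero>"
  proof
    assume "\<sigma> d \<ominus> d = \<zero>"
    moreover have "(\<sigma> d \<ominus> d) \<oplus> d = \<sigma> d" using d(1) by (simp add: a_minus_def K.a_assoc K.l_neg)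
    ultimately have "\<sigma> d = d" using d(1) by simp
    then show False using d fixed by blast
  qed
  show "nucleus (A d) \<subseteq> const ` carrier K"
  proof
    fix x assume x: "x \<in> nucleus (A d)"
    then have xP: "x \<in> P" using AA.nucleus_closed by simp
    have "x i = \<zero>" if i: "0 < i" for i
    proof (cases "i < n")
      case True
      have c: "\<sigma> d \<ominus> d \<in> carrier K" using d(1) by simp
      have "s (i - 1) (\<sigma> d \<ominus> d) \<noteq> \<zero>" using s_inj[OF c K.zero_closed, of "i - 1"] nz by auto
      then show ?thesis
        using nucleus_coeff[OF d(1) x i True] KF.integral[of "x i"] coeff_closed[OF xP] s_closed[OF c] by blast
    qed (use coeff_zero[OF xP] in simp)
    then have "x = const (x 0)" by (auto simp: fun_eq_iff const_apply)
    then show "x \<in> const ` carrier K" using coeff_closed[OF xP] by blast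
  qed
qed

lemma nucleus_mod_radical_field:
  assumes K: "field K" and d: "d \<in> carrier K" "d \<notin> scalars F K"
  shows "jacobson_radical (nucleus_algebra (A d)) = {\<zero>\<^bsub>A d\<^esub>}"
    and "(\<lambda>a. jacobson_radical (nucleus_algebra (A d)) +>\<^bsub>nucleus_algebra (A d)\<^esub> const_embed K a)
      \<in> alg_iso F K (nucleus_mod_radical (A d))"
    and "field (nucleus_mod_radical (A d))"
proof -
  interpret KF: field K by fact
  interpret AA: nonassoc_algebra F "A d" by (rule A_nonassoc_algebra[OF d(1)])
  define N where "N = nucleus_algebra (A d)"
  have N: "carrier N = const ` carrier K" "monoid.mult N = monoid.mult (A d)" "\<one>\<^bsub>N\<^esub> = const \<one>"
    "\<zero>\<^bsub>N\<^esub> = (\<lambda>i. \<zero>)" "add N = add (A d)" "smult N = smult (A d)"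
    using nucleus_field[OF K d] by (simp_all add: N_def)
  have isoN: "const \<in> ring_iso K N"
    unfolding ring_iso_def
  proof (intro CollectI conjI ring_hom_memI)
    show "bij_betw const (carrier K) (carrier N)" using const_bij by (simp add: N)
  qed (use d(1) in \<open>simp_all add: N const_mult[of d] const_add[of _ _ d] del: A_simps\<close>)
  have "field (N\<lparr>zero := const \<zero>\<rparr>)" using KF.ring_iso_imp_img_field[OF isoN] .
  moreover have "const \<zero> = \<zero>\<^bsub>N\<^esub>" by (simp add: N fun_eq_iff const_apply)
  ultimately have fN: "field N" by simp
  interpret NF: field N by (rule fN)
  have J: "jacobson_radical N = {\<zero>\<^bsub>N\<^esub>}" by (rule NF.jacobson_radical_field)
  then show "jacobson_radical (nucleus_algebra (A d)) = {\<zero>\<^bsub>A d\<^esub>}" by (simp add: N_def)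
  have cos: "{\<zero>\<^bsub>N\<^esub>} +>\<^bsub>N\<^esub> x = {x}" if "x \<in> carrier N" for x
    using that by (simp add: a_r_coset_def')
  define Q where "Q = nucleus_mod_radical (A d)"
  have Q': "Q = quotient_algebra N {\<zero>\<^bsub>N\<^esub>}" by (simp add: Q_def nucleus_mod_radical_def N_def[symmetric] J)
  have Qc: "carrier Q = (\<lambda>a. {const a}) ` carrier K"
    by (auto simp: Q' quotient_algebra_def FactRing_def A_RCOSETS_def' a_r_coset_def'[symmetric] cos N(1))
  have c [simp]: "const a \<in> carrier N" if "a \<in> carrier K" for a using that by (simp add: N)
  have Q1: "\<one>\<^bsub>Q\<^esub> = {const \<one>}" "\<zero>\<^bsub>Q\<^esub> = {const \<zero>}"
    using cos[OF NF.one_closed] by (simp_all add: Q' quotient_algebra_def FactRing_def N \<open>const \<zero> = \<zero>\<^bsub>N\<^esub>\<close>)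
  have Qm: "{const a} \<otimes>\<^bsub>Q\<^esub> {const b} = {const (a \<otimes> b)}" if "a \<in> carrier K" "b \<in> carrier K" for a b
    using that cos[OF c, of "a \<otimes> b"] const_mult[OF d(1) that]
    by (simp add: Q' quotient_algebra_def FactRing_def rcoset_mult_def N(2) del: A_simps)
  have Qa: "{const a} \<oplus>\<^bsub>Q\<^esub> {const b} = {const (a \<oplus> b)}" if "a \<in> carrier K" "b \<in> carrier K" for a b
    using const_add[OF that, of d]
    by (simp add: Q' quotient_algebra_def FactRing_def set_add_def' N(5) del: A_simps)
  have Qs: "r \<odot>\<^bsub>Q\<^esub> {const a} = {const (r \<odot> a)}" if "r \<in> carrier F" "a \<in> carrier K" for r a
    using that cos[OF c, of "r \<odot> a"] const_smult[OF that, of d]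
    by (simp add: Q' quotient_algebra_def N(6) del: A_simps)
  have iso: "(\<lambda>a. {const a}) \<in> ring_iso K Q"
    unfolding ring_iso_def
  proof (intro CollectI conjI ring_hom_memI)
    show "bij_betw (\<lambda>a. {const a}) (carrier K) (carrier Q)"
      unfolding bij_betw_def Qc by (auto simp: inj_on_def dest: const_inj)
  qed (simp_all add: Qc Q1 Qm Qa)
  have h: "jacobson_radical N +>\<^bsub>N\<^esub> const_embed K a = {const a}" if "a \<in> carrier K" for a
    using that cos[OF c] by (simp add: J const_embed_def)
  have "(\<lambda>a. jacobson_radical N +>\<^bsub>N\<^esub> const_embed K a) \<in> alg_iso F K Q"
    unfolding alg_iso_def ring_iso_def
  proof (intro CollectI conjI ring_hom_memI ballI)
    show "bij_betw (\<lambda>a. jacobson_radical N +>\<^bsub>N\<^esub> const_embed K a) (carrier K) (carrier Q)"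
      using iso unfolding ring_iso_def by (simp add: h cong: bij_betw_cong)
  qed (simp_all add: h Qc Q1 Qm Qa Qs)
  then show "(\<lambda>a. jacobson_radical (nucleus_algebra (A d)) +>\<^bsub>nucleus_algebra (A d)\<^esub> const_embed K a)
      \<in> alg_iso F K (nucleus_mod_radical (A d))" by (simp only: N_def Q_def)
  have "field (Q\<lparr>zero := {const \<zero>}\<rparr>)" using KF.ring_iso_imp_img_field[OF iso] .
  then show "field (nucleus_mod_radical (A d))" by (simp add: Q1(2)[symmetric] flip: Q_def)
qed

text \<open>The only atom is a copy of \<open>K\<close>, whose center \<open>K\<close> contains \<open>d\<close> and so is larger than \<open>F\<close>.\<close>

lemma not_semicentral:
  assumes K: "field K" and d: "d \<in> carrier K" "d \<notin> scalars F K"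
  shows "\<not> semicentral F (A d)"
proof
  assume "semicentral F (A d)"
  define Q where "Q = nucleus_mod_radical (A d)"
  interpret Q: field Q unfolding Q_def by (rule nucleus_mod_radical_field[OF K d])
  obtain h where h: "h \<in> alg_iso F K Q" using nucleus_mod_radical_field(2)[OF K d] by (auto simp: Q_def)
  then have hr: "h \<in> ring_hom K Q" and inj: "inj_on h (carrier K)"
    and hs: "\<And>c x. \<lbrakk>c \<in> carrier F; x \<in> carrier K\<rbrakk> \<Longrightarrow> h (c \<odot> x) = c \<odot>\<^bsub>Q\<^esub> h x"
    by (auto simp: alg_iso_def ring_iso_def bij_betw_def)
  have "Q \<in> atoms (A d)" unfolding atoms_def Q_def[symmetric] by (rule simple_component_field[OF Q.field_axioms])
  then have "central F Q" using \<open>semicentral F (A d)\<close> by (auto simp: semicentral_def)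
  then have "carrier Q = scalars F Q" unfolding central_def Q.center_eq_carrier by simp
  then have "h d \<in> scalars F Q" using ring_hom_closed[OF hr d(1)] by simp
  then obtain c where c: "c \<in> carrier F" "h d = c \<odot>\<^bsub>Q\<^esub> \<one>\<^bsub>Q\<^esub>" by (auto simp: scalars_def)
  then have "h d = h (c \<odot> \<one>)" using hs[OF c(1) K.one_closed] ring_hom_one[OF hr] by simp
  then have "d = c \<odot> \<one>" using inj_onD[OF inj] d(1) c(1) by simp
  then show False using d(2) c(1) by (auto simp: scalars_def)
qed

end

section \<open>Properties of nonassociative cyclic algebras\<close>

lemma galois_cyclic_algebraD:
  fixes F :: "('a, 'm) ring_scheme" and K :: "('a, 'b, 'p) module_scheme"
  assumes F: "field F" and K: "galois_cyclic_algebra F K \<sigma> n"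
  shows "galois K \<sigma> n F"
proof -
  have et: "etale_algebra F K" and dim: "vectorspace.dim F K = n" and iso: "\<sigma> \<in> alg_iso F K K" and n: "0 < n"
    and per: "\<forall>x\<in>carrier K. (\<sigma> ^^ n) x = x"
    and ord: "\<forall>m. 0 < m \<and> m < n \<longrightarrow> (\<exists>x\<in>carrier K. (\<sigma> ^^ m) x \<noteq> x)"
    and fix': "{x \<in> carrier K. \<sigma> x = x} = scalars F K"
    using K unfolding galois_cyclic_algebra_def by blast+
  have alg: "algebra F K" using et unfolding etale_algebra_def by blast
  have "cring K" using alg by (rule algebra.axioms(2))
  show ?thesis
  proof (intro galois.intro cyclic_setup.intro twisted.intro twisted_axioms.intro cyclic_setup_axioms.intro
      galois_axioms.intro F alg et dim n fix' \<open>cring K\<close>)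
    show "\<sigma> \<in> ring_hom K K" using iso by (auto simp: alg_iso_def ring_iso_def)
  qed (use iso per ord in \<open>auto simp: alg_iso_def\<close>)
qed

theorem proposition3:
  fixes F :: "('a, 'm) ring_scheme"
    and K :: "('a, 'b, 'p) module_scheme"
    and \<sigma> :: "'b \<Rightarrow> 'b" and n :: nat
  assumes "field F"
    and "galois_cyclic_algebra F K \<sigma> n"
  shows
    "(\<forall>d\<in>Units K.
        E_semiassociative F (nonassoc_cyclic_algebra K \<sigma> n d) (const_embed K ` carrier K) \<and>
        semiassociative F (nonassoc_cyclic_algebra K \<sigma> n d) \<and>
        algebra_degree F (nonassoc_cyclic_algebra K \<sigma> n d) = n) \<and>
     (\<forall>d\<in>Units K - scalars F K.
        split_algebra F (nonassoc_cyclic_algebra K \<sigma> n d) \<longleftrightarrow>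
        alg_isomorphic F K (prod_algebra n (\<lambda>_. self_algebra F))) \<and>
     (\<forall>d\<in>Units K.
        split_algebra K (base_change F (nonassoc_cyclic_algebra K \<sigma> n d) K)) \<and>
     (field K \<longrightarrow>
        (\<forall>d\<in>carrier K - scalars F K. powers_independent F K d n \<longrightarrow>
           division_algebra (nonassoc_cyclic_algebra K \<sigma> n d)) \<and>
        (Factorial_Ring.prime n \<longrightarrow>
           (\<forall>d\<in>carrier K - scalars F K.
              division_algebra (nonassoc_cyclic_algebra K \<sigma> n d)))) \<and>
     (field K \<longrightarrow>
        (\<forall>d\<in>carrier K - scalars F K.
           \<not> semicentral F (nonassoc_cyclic_algebra K \<sigma> n d) \<and>
           (\<lambda>a. jacobson_radical (nucleus_algebra (nonassoc_cyclic_algebra K \<sigma> n d))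
                  +>\<^bsub>nucleus_algebra (nonassoc_cyclic_algebra K \<sigma> n d)\<^esub> const_embed K a)
             \<in> alg_iso F K (nucleus_mod_radical (nonassoc_cyclic_algebra K \<sigma> n d)) \<and>
           \<not> homogeneous F (nonassoc_cyclic_algebra K \<sigma> n d)))"
proof -
  interpret galois K \<sigma> n F by (rule galois_cyclic_algebraD[OF assms])
  obtain N u v where uv: "\<And>k. u k \<in> carrier K" "\<And>k. v k \<in> carrier K"
    "\<And>i. i < n \<Longrightarrow> (\<Oplus>\<^bsub>K\<^esub>k\<in>{..<N::nat}. u k \<otimes>\<^bsub>K\<^esub> (\<sigma> ^^ i) (v k)) = (if i = 0 then \<one>\<^bsub>K\<^esub> else \<zero>\<^bsub>K\<^esub>)"
    by (rule dual_families) (rule that)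
  interpret galois_dual K \<sigma> n F N u v
    by (intro galois_dual.intro galois_dual_axioms.intro galois_axioms uv)
  show ?thesis
  proof (intro conjI ballI impI)
    fix d assume "d \<in> Units K"
    then have d: "d \<in> carrier K" by (rule K.Units_closed)
    show E: "E_semiassociative F (nonassoc_cyclic_algebra K \<sigma> n d) (const_embed K ` carrier K)"
      by (rule A_E_semiassociative[OF d])
    then show "semiassociative F (nonassoc_cyclic_algebra K \<sigma> n d)" unfolding semiassociative_def by (rule exI)
    show "algebra_degree F (nonassoc_cyclic_algebra K \<sigma> n d) = n" by (rule A_degree)
    show "split_algebra K (base_change F (nonassoc_cyclic_algebra K \<sigma> n d) K)" by (rule base_change_split[OF d])
  next
    fix d assume "d \<in> Units K - scalars F K"
    then have d: "d \<in> Units K" "d \<notin> scalars F K" by auto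
    show "split_algebra F (nonassoc_cyclic_algebra K \<sigma> n d) \<longleftrightarrow>
        alg_isomorphic F K (prod_algebra n (\<lambda>_. self_algebra F))"
    proof
      assume "split_algebra F (nonassoc_cyclic_algebra K \<sigma> n d)"
      then obtain \<pi> where "\<pi> \<in> ring_hom K F"
        "\<And>c x. \<lbrakk>c \<in> carrier F; x \<in> carrier K\<rbrakk> \<Longrightarrow> \<pi> (c \<odot>\<^bsub>K\<^esub> x) = c \<otimes>\<^bsub>F\<^esub> \<pi> x"
        using split_imp_character[OF d] by blast
      then show "alg_isomorphic F K (prod_algebra n (\<lambda>_. self_algebra F))" by (rule character_split)
    next
      assume "alg_isomorphic F K (prod_algebra n (\<lambda>_. self_algebra F))"
      then show "split_algebra F (nonassoc_cyclic_algebra K \<sigma> n d)"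
        using K.Units_closed[OF d(1)] by (rule split_if_K_split)
    qed
  next
    fix d assume K: "field K" and "d \<in> carrier K - scalars F K"
    then have d: "d \<in> carrier K" "d \<notin> scalars F K" by auto
    show "division_algebra (nonassoc_cyclic_algebra K \<sigma> n d)" if "powers_independent F K d n"
      by (rule division_independent[OF K d(1) that])
    show "division_algebra (nonassoc_cyclic_algebra K \<sigma> n d)" if "Factorial_Ring.prime n"
      by (rule division_prime[OF K d that])
    show "\<not> semicentral F (nonassoc_cyclic_algebra K \<sigma> n d)" by (rule not_semicentral[OF K d])
    then show "\<not> homogeneous F (nonassoc_cyclic_algebra K \<sigma> n d)" unfolding homogeneous_def by blast
    show "(\<lambda>a. jacobson_radical (nucleus_algebra (nonassoc_cyclic_algebra K \<sigma> n d))
                  +>\<^bsub>nucleus_algebra (nonassoc_cyclic_algebra K \<sigma> n d)\<^esub> const_embed K a)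
             \<in> alg_iso F K (nucleus_mod_radical (nonassoc_cyclic_algebra K \<sigma> n d))"
      by (rule nucleus_mod_radical_field(2)[OF K d])
  qed
qed

end
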